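(* Assume the Generalized Riemann Hypothesis. Let $g\ge 3$ be an odd integer, let $\delta_g := 1-\frac{g}{\pi}\sin\frac{\pi}{g}$, and let $\epsilon>0$. Then there exist a constant $c=c(\epsilon,g)>0$ and an infinite family of Dirichlet characters $\chi \pmod q$ of order $g$ (with $q$ unbounded) such that $$\max_{t\le q}\Big|\sum_{n\le t}\chi(n)\Big| \geq c\,\sqrt{q}\,(\log\log q)^{1-\delta_g-\epsilon}.$$ *)

theory Defs
  imports "HOL-Complex_Analysis.Complex_Analysis"
begin

definition dirichlet_character :: "nat \<Rightarrow> (int \<Rightarrow> complex) \<Rightarrow> bool" where
  "dirichlet_character q \<psi> \<longleftrightarrow>
     q > 0 \<and>
     (\<forall>m n. \<psi> (m * n) = \<psi> m * \<psi> n) \<and>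
     (\<forall>n. \<psi> (n + int q) = \<psi> n) \<and>
     (\<forall>n. \<psi> n = 0 \<longleftrightarrow> \<not> coprime n (int q))"

definition principal_character :: "nat \<Rightarrow> int \<Rightarrow> complex" where
  "principal_character q n = (if coprime n (int q) then 1 else 0)"

definition character_order :: "nat \<Rightarrow> (int \<Rightarrow> complex) \<Rightarrow> nat" where
  "character_order q \<psi> = (LEAST k. k > 0 \<and> (\<lambda>n. \<psi> n ^ k) = principal_character q)"

text \<open>
  The analytic continuation of the Dirichlet series. It is entire for non-principal
  characters and has its only pole at 1 for principal ones (where the value of the function
  below is unspecified); by the identity theorem the choice is unique on that domain.
  The case \<open>q = 1\<close> is the Riemann zeta function.
\<close>

definition dirichlet_L :: "nat \<Rightarrow> (int \<Rightarrow> complex) \<Rightarrow> complex \<Rightarrow> complex" where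
  "dirichlet_L q \<psi> = (SOME f.
     f holomorphic_on (if \<psi> = principal_character q then - {1} else UNIV) \<and>
     (\<forall>s. Re s > 1 \<longrightarrow> f s = (\<Sum>n. \<psi> (int (Suc n)) / of_nat (Suc n) powr s)))"

text \<open>
  All moduli and all characters are covered. Restricting to the open critical strip excludes
  the trivial zeros, including those on the imaginary axis that come from the Euler factors
  missing in imprimitive characters.
\<close>

definition GRH :: bool where
  "GRH \<longleftrightarrow> (\<forall>q \<psi> s. dirichlet_character q \<psi> \<longrightarrow> 0 < Re s \<longrightarrow> Re s < 1 \<longrightarrow>
     dirichlet_L q \<psi> s = 0 \<longrightarrow> Re s = 1 / 2)"

definition max_character_sum :: "nat \<Rightarrow> (int \<Rightarrow> complex) \<Rightarrow> real" where
  "max_character_sum q \<psi> = Max ((\<lambda>t. cmod (\<Sum>n=1..t. \<psi> (int n))) ` {..q})"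

definition delta :: "nat \<Rightarrow> real" where
  "delta g = 1 - real g / pi * sin (pi / real g)"

end

theory Submission
  imports Defs "HOL-Number_Theory.Number_Theory" "HOL-Computational_Algebra.Squarefree"
    "HOL-Computational_Algebra.Fundamental_Theorem_Algebra" "HOL-Real_Asymp.Real_Asymp"
begin

text \<open>
  The argument is unconditional and elementary. Fix an odd character \<open>\<psi>\<close> of prime modulus \<open>m\<close> and
  order \<open>m - 1\<close>. By Mertens' theorem in arithmetic progressions, choosing for each prime \<open>p\<close> the
  \<open>g\<close>-th root of unity \<open>z p\<close> closest to \<open>\<psi> p\<close> makes the sum of \<open>Re (\<psi> p * cnj (z p)) / p\<close> over
  \<open>p \<le> y\<close> as large as \<open>(1 - delta g - \<epsilon>) * ln (ln y)\<close>. Hence the corresponding sum of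
  \<open>\<psi> n * cnj (z n) / n\<close> over \<open>y\<close>-smooth \<open>n < N\<close> has size \<open>ln y powr (1 - delta g - \<epsilon>)\<close>, already when
  \<open>ln N\<close> is about \<open>ln y * ln (ln y)\<close>, and averaging over the values at the primes between \<open>y\<close> and \<open>N\<close>
  removes the restriction to smooth numbers.

  A character \<open>\<eta>\<close> of order \<open>g\<close> with \<open>\<eta> p = z p\<close> for all \<open>p \<le> N\<close> is a product of power residue
  characters to prime moduli. Such moduli are found below a power of \<open>exp N\<close>, so that \<open>ln (ln q)\<close> is
  about \<open>ln N\<close>: if an integer \<open>n\<close> were an \<open>l\<close>-th power modulo all suitable primes \<open>r\<close>, then the integer
  norms of the forms \<open>c0 ^ l - n * c1 ^ l\<close> over a cyclotomic field would have too many prime factors.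
  Finally, since \<open>\<eta>\<close> is even and \<open>\<psi>\<close> is odd, the finite Fourier expansion of the partial sums of
  \<open>\<eta>\<close>, combined with a Fejer kernel, bounds their maximum from below by the sum of
  \<open>\<psi> n * cnj (\<eta> n) / n\<close>.
\<close>

hide_const (open) Module.smult UnivPoly.up_ring.monom UnivPoly.up_ring.coeff Coset.order

section \<open>Chebyshev and Mertens estimates\<close>

text \<open>Prescribing \<open>\<eta>\<close> at all primes up to \<open>N\<close> is a system of up
  to \<open>N\<close> conditions, and \<open>ln (ln q)\<close> may exceed \<open>ln N\<close> only
  by a constant factor, so moduli \<open>r\<close> with \<open>ln r\<close> polynomial in
  \<open>N\<close> must be found for every nonzero exponent vector modulo \<open>g\<close>. Counting
  does this: if \<open>n\<close> were an \<open>l\<close>-th power modulo all suitable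
  \<open>r\<close>, small arguments of the norm form would agree modulo \<open>r\<close> too often.
  The norm has degree \<open>l * D\<close> in \<open>2 * D\<close> variables, where \<open>D\<close>
  is the degree of the field. For variables below \<open>X\<close> its size allows a prime sum of
  about \<open>ln X\<close>, but the box has \<open>X ^ (2 * D)\<close> points, so primes up to that
  bound count, and in the progression they contribute \<open>2 * ln X\<close>. This factor 2 is the
  contradiction. The exponent is a mean value: the largest real part of \<open>w * cnj z\<close>
  over \<open>g\<close>-th roots of unity \<open>z\<close>, averaged over the unit circle, is
  \<open>g / pi * sin (pi / g)\<close>. The factor \<open>ln (ln y)\<close> in \<open>ln N\<close>,
  the power of \<open>N\<close> in \<open>ln q\<close> and all constants only cost part of
  \<open>\<epsilon>\<close>. The Fejer kernel serves because positivity bounds its mean absolute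
  value, where a sharp cutoff would lose a logarithm.\<close>

lemma sum_divisors_swap:
  fixes F :: "nat \<Rightarrow> nat \<Rightarrow> 'a :: comm_monoid_add"
  shows "(\<Sum>n=1..N. \<Sum>d | d dvd n. F d (n div d)) = (\<Sum>d=1..N. \<Sum>k=1..N div d. F d k)"
proof -
  have "(\<Sum>n=1..N. \<Sum>d | d dvd n. F d (n div d)) =
      (\<Sum>(n, d)\<in>(SIGMA n:{1..N}. {d. d dvd n}). F d (n div d))"
    by (subst sum.Sigma) auto
  also have "\<dots> = (\<Sum>(d, k)\<in>(SIGMA d:{1..N}. {1..N div d}). F d k)"
  proof (rule sum.reindex_bij_witness[where i = "\<lambda>(d, k). (d * k, d)" and j = "\<lambda>(n, d). (d, n div d)"])
    fix x assume "x \<in> (SIGMA n:{1..N}. {d. d dvd n})"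
    then obtain n d where x: "x = (n, d)" "1 \<le> n" "n \<le> N" "d dvd n" by auto
    hence "d \<le> n" "d > 0" by (auto intro: dvd_imp_le dvd_pos_nat)
    moreover have "n div d > 0" using x \<open>d > 0\<close> by (auto simp: div_greater_zero_iff dvd_imp_le)
    ultimately show "(case x of (n, d) \<Rightarrow> (d, n div d)) \<in> (SIGMA d:{1..N}. {1..N div d})"
      using x by (auto intro: div_le_mono)
  next
    fix x assume "x \<in> (SIGMA d:{1..N}. {1..N div d})"
    then obtain d k where x: "x = (d, k)" "1 \<le> d" "d \<le> N" "1 \<le> k" "k \<le> N div d" by auto
    have "d * k \<le> d * (N div d)" using x by simp
    also have "\<dots> \<le> N" by simp
    finally show "(case x of (d, k) \<Rightarrow> (d * k, d)) \<in> (SIGMA n:{1..N}. {d. d dvd n})"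
      using x by (auto simp: Suc_le_eq)
  qed (auto simp: split: prod.splits)
  also have "\<dots> = (\<Sum>d=1..N. \<Sum>k=1..N div d. F d k)"
    by (subst sum.Sigma) auto
  finally show ?thesis .
qed

lemma real_div_le: "real (N div d) \<le> real N / real d"
  and real_div_gt: "real N / real d < real (N div d) + 1"
  using floor_divide_of_nat_eq[of N d, where ?'a = real] by linarith+

lemma ln_fact_sum: "ln (fact N :: real) = (\<Sum>n=1..N. ln (real n))"
  by (induction N) (simp_all add: ln_mult)

abbreviation \<Lambda> :: "nat \<Rightarrow> real" where "\<Lambda> \<equiv> mangoldt"

definition psi :: "nat \<Rightarrow> real" where "psi N = (\<Sum>d=1..N. \<Lambda> d)"

lemma ln_fact_mangoldt:
  assumes "N \<le> M"
  shows "ln (fact N) = (\<Sum>d=1..M. \<Lambda> d * real (N div d))"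
proof -
  have "ln (fact N :: real) = (\<Sum>n=1..N. ln (real n))"
    by (rule ln_fact_sum)
  also have "\<dots> = (\<Sum>n=1..N. \<Sum>d | d dvd n. \<Lambda> d)"
    by (intro sum.cong refl) (simp add: mangoldt_sum)
  also have "\<dots> = (\<Sum>d=1..N. \<Sum>k=1..N div d. \<Lambda> d)"
    using sum_divisors_swap[where F = "\<lambda>d k. \<Lambda> d"] .
  also have "\<dots> = (\<Sum>d=1..N. \<Lambda> d * real (N div d))"
    by (simp add: mult.commute)
  also have "\<dots> = (\<Sum>d=1..M. \<Lambda> d * real (N div d))"
    using assms by (intro sum.mono_neutral_left) auto
  finally show ?thesis .
qed

text \<open>Chebyshev's argument: \<open>2 * n div d - 2 * (n div d)\<close> is never negative and
  is at least 1 for \<open>n < d \<le> 2 * n\<close>, so the increment of \<open>psi\<close> is at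
  most the logarithm of the central binomial coefficient.\<close>

lemma psi_double: "psi (2 * n) - psi n \<le> 2 * real n * ln 2"
proof -
  have "psi (2 * n) - psi n = (\<Sum>d=1..2*n. if n < d then \<Lambda> d else 0)"
  proof -
    have "psi n = (\<Sum>d=1..2*n. if n < d then 0 else \<Lambda> d)"
      unfolding psi_def by (intro sum.mono_neutral_cong_left) auto
    hence "psi (2 * n) - psi n = (\<Sum>d=1..2*n. \<Lambda> d - (if n < d then 0 else \<Lambda> d))"
      by (simp only: psi_def[of "2 * n"] sum_subtractf)
    thus ?thesis by (auto intro!: sum.cong)
  qed
  also have "\<dots> \<le> (\<Sum>d=1..2*n. \<Lambda> d * (real (2 * n div d) - 2 * real (n div d)))"
  proof (intro sum_mono)
    fix d assume d: "d \<in> {1..2*n}"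
    have "2 * (n div d) \<le> 2 * n div d"
      using d by (simp add: less_eq_div_iff_mult_less_eq algebra_simps)
    hence "real (2 * (n div d)) \<le> real (2 * n div d)" by (rule of_nat_mono)
    hence 1: "real (2 * n div d) - 2 * real (n div d) \<ge> 0" by simp
    moreover have "real (2 * n div d) - 2 * real (n div d) \<ge> 1" if "n < d"
    proof -
      have "2 * n div d \<ge> 1" using d by (simp add: Suc_le_eq div_greater_zero_iff)
      thus ?thesis using that by simp
    qed
    ultimately show "(if n < d then \<Lambda> d else 0) \<le> \<Lambda> d * (real (2 * n div d) - 2 * real (n div d))"
      using mangoldt_nonneg[of d] mult_left_mono[of 1 _ "\<Lambda> d"] by auto
  qed
  also have "\<dots> = ln (fact (2 * n)) - 2 * ln (fact n)"
    using ln_fact_mangoldt[of "2 * n" "2 * n"] ln_fact_mangoldt[of n "2 * n"]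
    by (simp add: algebra_simps sum_subtractf sum_distrib_left)
  also have "\<dots> = ln (fact (2 * n) / (fact n * fact n))"
    by (simp add: ln_div ln_mult)
  also have "fact (2 * n) / (fact n * fact n) = real (2 * n choose n)"
    by (simp add: binomial_fact)
  also have "ln (real (2 * n choose n)) \<le> ln (2 ^ (2 * n))"
  proof -
    have "2 * n choose n \<le> 2 ^ (2 * n)" by (rule binomial_le_pow2)
    hence "real (2 * n choose n) \<le> real (2 ^ (2 * n))" by (rule of_nat_mono)
    thus ?thesis by (subst ln_le_cancel_iff) auto
  qed
  also have "\<dots> = 2 * real n * ln 2" by (simp add: ln_realpow)
  finally show ?thesis .
qed

lemma psi_le: "psi N \<le> 4 * real N"
proof (cases "N = 0")
  case False
  have pow: "psi (2 ^ k) \<le> 2 * 2 ^ k * ln 2" for k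
  proof (induction k)
    case 0
    have "psi 1 = 0" by (simp add: psi_def)
    thus ?case by simp
  next
    case (Suc k)
    have "psi (2 ^ Suc k) \<le> psi (2 ^ k) + 2 * 2 ^ k * ln 2"
      using psi_double[of "2 ^ k"] by simp
    thus ?case using Suc by simp
  qed
  obtain k where k: "2 ^ k \<le> N" "N < 2 ^ Suc k"
    using ex_power_ivl1[of 2 N] False by auto
  have "psi N \<le> psi (2 ^ Suc k)"
    unfolding psi_def using k by (intro sum_mono2) (auto simp: mangoldt_nonneg)
  also have "\<dots> \<le> 2 * 2 ^ Suc k * ln 2" by (rule pow)
  also have "\<dots> = 4 * 2 ^ k * ln 2" by simp
  also have "\<dots> \<le> 4 * real N * 1"
  proof (rule mult_mono)
    have "real (2 ^ k) \<le> real N" using k by (simp only: of_nat_le_iff)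
    thus "4 * 2 ^ k \<le> 4 * real N" by simp
  qed (use ln_2_less_1 in auto)
  finally show ?thesis by simp
qed (simp add: psi_def)

lemma ln_fact_ge: "ln (fact N) \<ge> real N * ln (real N) - real N"
proof (induction N)
  case (Suc N)
  show ?case
  proof (cases "N = 0")
    case False
    have "ln (fact (Suc N)) = ln (real (Suc N)) + ln (fact N)"
      by (simp add: ln_mult)
    moreover have "real N * (ln (real (Suc N)) - ln (real N)) \<le> 1"
    proof -
      have "1 + 1 / real N = real (Suc N) / real N" using False by (simp add: field_simps)
      hence "ln (real (Suc N)) - ln (real N) = ln (1 + 1 / real N)"
        using False by (simp only: ln_div) simp
      also have "\<dots> \<le> 1 / real N" using False by (intro ln_add_one_self_le_self) auto
      finally show ?thesis using False by (simp add: field_simps)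
    qed
    ultimately show ?thesis using Suc by (simp add: algebra_simps)
  qed simp
qed simp

lemma ln_fact_le: "ln (fact N) \<le> real N * ln (real N)"
proof (cases "N = 0")
  case False
  have "ln (fact N) \<le> ln (real N ^ N)"
    using False fact_le_power[of N, where ?'a = real] by (subst ln_le_cancel_iff) auto
  thus ?thesis using False by (simp add: ln_realpow)
qed simp

lemma mertens_lower:
  assumes "N > 0" shows "(\<Sum>d=1..N. \<Lambda> d / real d) \<ge> ln (real N) - 1"
proof -
  have "real N * ln (real N) - real N \<le> (\<Sum>d=1..N. \<Lambda> d * real (N div d))"
    using ln_fact_ge[of N] ln_fact_mangoldt[of N N] by simp
  also have "\<dots> \<le> (\<Sum>d=1..N. real N * (\<Lambda> d / real d))"
  proof (intro sum_mono)
    fix d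
    show "\<Lambda> d * real (N div d) \<le> real N * (\<Lambda> d / real d)"
      using mult_left_mono[OF real_div_le[of N d] mangoldt_nonneg[of d]] by (simp add: mult_ac)
  qed
  also have "\<dots> = real N * (\<Sum>d=1..N. \<Lambda> d / real d)" by (rule sum_distrib_left[symmetric])
  finally have "real N * (ln (real N) - 1) \<le> real N * (\<Sum>d=1..N. \<Lambda> d / real d)"
    by (simp add: algebra_simps)
  thus ?thesis using assms by simp
qed

text \<open>Passing from \<open>N div d\<close> to \<open>N / d\<close> in the expansion of
  \<open>ln (fact N)\<close> costs at most \<open>\<Lambda> d\<close> for each \<open>d\<close>,
  hence \<open>psi N \<le> 4 * N\<close> altogether; this is the constant 4.\<close>

lemma mertens_upper:
  assumes "N > 0" shows "(\<Sum>d=1..N. \<Lambda> d / real d) \<le> ln (real N) + 4"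
proof -
  have "real N * (\<Sum>d=1..N. \<Lambda> d / real d) = (\<Sum>d=1..N. real N * (\<Lambda> d / real d))"
    by (rule sum_distrib_left)
  also have "\<dots> \<le> (\<Sum>d=1..N. \<Lambda> d * real (N div d) + \<Lambda> d)"
  proof (intro sum_mono)
    fix d assume "d \<in> {1..N}"
    hence "real N / real d \<le> real (N div d) + 1"
      using real_div_gt[of N d] by simp
    from mult_left_mono[OF this mangoldt_nonneg[of d]]
    show "real N * (\<Lambda> d / real d) \<le> \<Lambda> d * real (N div d) + \<Lambda> d" by (simp add: algebra_simps)
  qed
  also have "\<dots> = ln (fact N) + psi N"
    using ln_fact_mangoldt[of N N] by (simp add: sum.distrib psi_def)
  also have "\<dots> \<le> real N * (ln (real N) + 4)"
    using ln_fact_le[of N] psi_le[of N] by (simp add: algebra_simps)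
  finally show ?thesis using assms by simp
qed

lemma ln_le_sum_inverse: "d \<le> N \<Longrightarrow> d > 0 \<Longrightarrow> ln (real N / real d) \<le> (\<Sum>j=d..<N. 1 / real j)"
proof (induction rule: dec_induct)
  case (step m)
  have "ln (real (Suc m) / real d) = ln (real m / real d) + ln (1 + 1 / real m)"
  proof -
    have "real (Suc m) / real d = real m / real d * (1 + 1 / real m)"
      using step by (simp add: field_simps)
    moreover have "1 + 1 / real m > 0" by (simp add: add_pos_nonneg)
    ultimately show ?thesis using step by (simp only: ln_mult) auto
  qed
  also have "\<dots> \<le> (\<Sum>j=d..<m. 1 / real j) + 1 / real m"
    using step by (intro add_mono ln_add_one_self_le_self) auto
  finally show ?case using step by simp
qed simp

text \<open>Bounding the logarithm by a sum of \<open>1 / j\<close> and exchanging the sums leaves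
  the sum of \<open>psi j / j\<close>, where each term is at most 4. It controls the error of
  \<open>sum_H_approx\<close> for the von Mangoldt function.\<close>

lemma sum_mangoldt_ln_le: "(\<Sum>d=1..N. \<Lambda> d * ln (real N / real d)) \<le> 4 * real N"
proof -
  have "(\<Sum>d=1..N. \<Lambda> d * ln (real N / real d)) \<le> (\<Sum>d=1..N. \<Lambda> d * (\<Sum>j=d..<N. 1 / real j))"
    by (intro sum_mono mult_left_mono ln_le_sum_inverse mangoldt_nonneg) auto
  also have "\<dots> = (\<Sum>d=1..N. \<Sum>j=1..<N. if d \<le> j then \<Lambda> d / real j else 0)"
    unfolding sum_distrib_left by (intro sum.cong sum.mono_neutral_cong_left) auto
  also have "\<dots> = (\<Sum>j=1..<N. \<Sum>d=1..N. if d \<le> j then \<Lambda> d / real j else 0)"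
    by (rule sum.swap)
  also have "\<dots> = (\<Sum>j=1..<N. psi j / real j)"
    unfolding psi_def sum_divide_distrib by (intro sum.cong sum.mono_neutral_cong_right) auto
  also have "\<dots> \<le> (\<Sum>j=1..<N. 4)"
    using psi_le by (intro sum_mono) (auto simp: field_simps)
  also have "\<dots> \<le> 4 * real N" by simp
  finally show ?thesis .
qed

lemma sum_ln_div_le: "(\<Sum>d=1..N. ln (real N / real d)) \<le> real N"
proof -
  have "(\<Sum>d=1..N. ln (real N / real d)) = (\<Sum>d=1..N. ln (real N) - ln (real d))"
    by (intro sum.cong refl) (auto simp: ln_div)
  also have "\<dots> = real N * ln (real N) - ln (fact N)"
    by (simp add: sum_subtractf ln_fact_sum)
  finally show ?thesis using ln_fact_ge[of N] by linarith
qed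

lemma ln_le_two_sqrt: "x > 0 \<Longrightarrow> ln x \<le> 2 * sqrt x"
  using ln_bound[of "sqrt x"] by (simp add: ln_sqrt)

text \<open>The powers of \<open>p\<close> from the square on contribute at most
  \<open>ln p * 2 / p ^ 2\<close>, and \<open>ln p \<le> 2 * sqrt p\<close> turns this into the
  summable \<open>4 * p powr (-3/2)\<close>.\<close>

lemma prime_power_sum_bounded:
  "\<exists>C. \<forall>N. (\<Sum>d | d \<in> {1..N} \<and> \<not> prime d. \<Lambda> d / real d) \<le> C"
proof -
  have summ: "summable (\<lambda>n. 4 * real n powr (-3/2))"
    by (intro summable_mult) (simp add: summable_real_powr_iff)
  define C where "C = (\<Sum>n. 4 * real n powr (-3/2))"
  have "(\<Sum>d | d \<in> {1..N} \<and> \<not> prime d. \<Lambda> d / real d) \<le> C" for N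
  proof -
    define P where "P = {p. prime p \<and> p \<le> N}"
    define S where "S = {d. d \<in> {1..N} \<and> \<not> prime d \<and> primepow d}"
    have finP: "finite P" by (simp add: P_def)
    have "(\<Sum>d | d \<in> {1..N} \<and> \<not> prime d. \<Lambda> d / real d) = (\<Sum>d\<in>S. \<Lambda> d / real d)"
      by (rule sum.mono_neutral_right) (auto simp: S_def mangoldt_def)
    also have "\<dots> \<le> (\<Sum>d\<in>(\<lambda>(p, k). p ^ k) ` (P \<times> {2..N}). \<Lambda> d / real d)"
    proof (intro sum_mono2)
      show "S \<subseteq> (\<lambda>(p, k). p ^ k) ` (P \<times> {2..N})"
      proof
        fix d assume d: "d \<in> S"
        then obtain p k where pk: "prime p" "k > 0" "d = p ^ k"
          by (auto simp: S_def primepow_def)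
        have "k \<noteq> 1" using d pk by (auto simp: S_def)
        have "p \<le> d" using pk by (simp add: dvd_imp_le prime_gt_0_nat)
        moreover have "k < p ^ k" using pk prime_gt_1_nat by (intro power_gt_expt) auto
        ultimately show "d \<in> (\<lambda>(p, k). p ^ k) ` (P \<times> {2..N})"
          using d pk \<open>k \<noteq> 1\<close> by (intro image_eqI[of _ _ "(p, k)"]) (auto simp: S_def P_def)
      qed
    qed (auto simp: mangoldt_nonneg finP)
    also have "\<dots> \<le> (\<Sum>(p, k)\<in>P \<times> {2..N}. \<Lambda> (p ^ k) / real (p ^ k))"
      using finP by (intro order.trans[OF sum_image_le]) (auto simp: mangoldt_nonneg case_prod_unfold o_def)
    also have "\<dots> = (\<Sum>p\<in>P. \<Sum>k=2..N. ln (real p) / real p ^ k)"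
      unfolding sum.cartesian_product[symmetric] by (intro sum.cong refl) (auto simp: P_def)
    also have "\<dots> \<le> (\<Sum>p\<in>P. 4 * real p powr (-3/2))"
    proof (intro sum_mono)
      fix p assume "p \<in> P"
      hence p: "p \<ge> 2" by (auto simp: P_def prime_ge_2_nat)
      have "(\<Sum>k=2..N. ln (real p) / real p ^ k) = ln (real p) * (\<Sum>k=2..N. (1 / real p) ^ k)"
        by (simp add: sum_distrib_left power_divide)
      also have "\<dots> \<le> (2 * sqrt (real p)) * (2 / real p ^ 2)"
      proof (rule mult_mono)
        show "ln (real p) \<le> 2 * sqrt (real p)" using p by (intro ln_le_two_sqrt) auto
        show "(\<Sum>k=2..N. (1 / real p) ^ k) \<le> 2 / real p ^ 2"
        proof (cases "N \<ge> 2")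
          case True
          have "(\<Sum>k=2..N. (1 / real p) ^ k) = ((1 / real p) ^ 2 - (1 / real p) ^ Suc N) / (1 - 1 / real p)"
            using True p by (subst sum_gp) auto
          also have "\<dots> \<le> (1 / real p) ^ 2 / (1 / 2)"
            using p by (intro frac_le) (auto simp: field_simps)
          finally show ?thesis by (simp add: power_divide)
        qed simp
      qed (auto intro: sum_nonneg)
      also have "\<dots> = 4 * (real p powr (1/2) / real p powr 2)"
        using p by (simp add: powr_half_sqrt powr_numeral)
      also have "real p powr (1/2) / real p powr 2 = real p powr (-3/2)"
        unfolding powr_diff[symmetric] by simp
      finally show "(\<Sum>k=2..N. ln (real p) / real p ^ k) \<le> 4 * real p powr (-3/2)" .
    qed
    also have "\<dots> \<le> C" unfolding C_def by (intro sum_le_suminf summ finP) auto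
    finally show ?thesis .
  qed
  thus ?thesis by blast
qed

section \<open>Nonvanishing of L(1) and the twisted Mertens sum\<close>

lemma sum_by_parts:
  fixes a :: "nat \<Rightarrow> complex" and f :: "nat \<Rightarrow> real"
  defines "A \<equiv> \<lambda>k. \<Sum>n=1..k. a n"
  assumes "x \<le> y"
  shows "(\<Sum>n=Suc x..Suc y. a n * of_real (f n)) =
    A (Suc y) * of_real (f (Suc y)) - A x * of_real (f (Suc x)) +
    (\<Sum>n=Suc x..y. A n * of_real (f n - f (Suc n)))"
  using assms(2)
proof (induction y rule: dec_induct)
  case base
  have "A (Suc x) = A x + a (Suc x)" by (simp add: A_def)
  thus ?case by (simp add: algebra_simps)
next
  case (step y)
  have "A (Suc (Suc y)) = A (Suc y) + a (Suc (Suc y))" by (simp add: A_def)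
  thus ?case using step by (simp add: algebra_simps)
qed

lemma norm_sum_by_parts_le:
  fixes a :: "nat \<Rightarrow> complex" and f :: "nat \<Rightarrow> real"
  assumes A: "\<And>k. norm (\<Sum>n=1..k. a n) \<le> B"
    and f: "\<And>n. n > x \<Longrightarrow> f n \<ge> 0" "\<And>n. n > x \<Longrightarrow> f (Suc n) \<le> f n"
  shows "norm (\<Sum>n=Suc x..y. a n * of_real (f n)) \<le> 2 * B * f (Suc x)"
proof (cases "x < y")
  case True
  then obtain z where y: "y = Suc z" "x \<le> z" by (metis Suc_le_eq less_Suc_eq_le less_imp_Suc_add le_add1 add_Suc_right)
  define A' where "A' k = (\<Sum>n=1..k. a n)" for k
  have B0: "B \<ge> 0" using A[of 0] by simp
  have "norm (\<Sum>n=Suc x..y. a n * of_real (f n)) \<le>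
      norm (A' (Suc z) * of_real (f (Suc z))) + norm (A' x * of_real (f (Suc x))) +
      norm (\<Sum>n=Suc x..z. A' n * of_real (f n - f (Suc n)))"
    unfolding y(1) sum_by_parts[OF y(2), of a f, folded A'_def]
    by (intro order.trans[OF norm_triangle_ineq] add_right_mono norm_triangle_ineq4)
  also have "norm (\<Sum>n=Suc x..z. A' n * of_real (f n - f (Suc n))) \<le> (\<Sum>n=Suc x..z. B * (f n - f (Suc n)))"
    using A f(2) B0 by (intro sum_norm_le) (auto simp: norm_mult A'_def intro!: mult_mono simp flip: of_real_diff)
  also have "(\<Sum>n=Suc x..z. B * (f n - f (Suc n))) = B * (f (Suc x) - f (Suc z))"
    using y(2) by (induction z rule: dec_induct) (simp_all add: algebra_simps)
  also have "norm (A' (Suc z) * of_real (f (Suc z))) \<le> B * f (Suc z)"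
    using A[of "Suc z"] f(1)[of "Suc z"] y(2) by (simp add: norm_mult A'_def mult_right_mono)
  also have "norm (A' x * of_real (f (Suc x))) \<le> B * f (Suc x)"
    using A[of x] f(1)[of "Suc x"] by (simp add: norm_mult A'_def mult_right_mono)
  finally show ?thesis by (simp add: algebra_simps)
next
  case False
  have "B \<ge> 0" using A[of 0] by simp
  thus ?thesis using False f(1)[of "Suc x"] by simp
qed

text \<open>Dirichlet's test with a rate of convergence. Monotonicity is required only from
  \<open>m\<close> on because \<open>ln n / n\<close> and \<open>ln n ^ 2 / n\<close> increase at
  first; the instances take 1, 3 and 8 for \<open>m\<close>.\<close>

lemma bounded_partial_sums_limit:
  fixes a :: "nat \<Rightarrow> complex" and f :: "nat \<Rightarrow> real"
  assumes A: "\<And>k. norm (\<Sum>n=1..k. a n) \<le> B"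
    and f: "\<And>n. n \<ge> m \<Longrightarrow> f n \<ge> 0" "\<And>n. n \<ge> m \<Longrightarrow> f (Suc n) \<le> f n" "f \<longlonglongrightarrow> 0"
  shows "\<exists>L. \<forall>x. Suc x \<ge> m \<longrightarrow> norm ((\<Sum>n=1..x. a n * of_real (f n)) - L) \<le> 2 * B * f (Suc x)"
proof -
  define S where "S x = (\<Sum>n=1..x. a n * of_real (f n))" for x
  have B0: "B \<ge> 0" using A[of 0] by simp
  have diff: "norm (S y - S x) \<le> 2 * B * f (Suc x)" if "x \<le> y" "Suc x \<ge> m" for x y
  proof -
    have "S y = S x + (\<Sum>n=Suc x..y. a n * of_real (f n))"
      unfolding S_def using that(1) sum.ub_add_nat[of 1 x "\<lambda>n. a n * of_real (f n)" "y - x"] by simp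
    thus ?thesis using norm_sum_by_parts_le[OF A, of x f y] f that by simp
  qed
  have "(\<lambda>x. 2 * B * f (Suc x)) \<longlonglongrightarrow> 2 * B * 0"
    by (intro tendsto_intros LIMSEQ_Suc f)
  hence lim: "(\<lambda>x. 2 * B * f (Suc x)) \<longlonglongrightarrow> 0" by simp
  have "Cauchy S"
  proof (rule CauchyI')
    fix e :: real assume "e > 0"
    hence "eventually (\<lambda>x. 2 * B * f (Suc x) < e) sequentially"
      using lim by (rule order_tendstoD(2)[rotated])
    then obtain M where M: "\<And>x. x \<ge> M \<Longrightarrow> 2 * B * f (Suc x) < e" by (auto simp: eventually_at_top_linorder)
    show "\<exists>M. \<forall>x\<ge>M. \<forall>y>x. dist (S x) (S y) < e"
    proof (intro exI[of _ "max M m"] allI impI)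
      fix x y assume "max M m \<le> x" "x < y"
      thus "dist (S x) (S y) < e" using diff[of x y] M[of x] by (simp add: dist_norm norm_minus_commute)
    qed
  qed
  then obtain L where L: "S \<longlonglongrightarrow> L" by (auto simp: Cauchy_convergent_iff convergent_def)
  have "norm (S x - L) \<le> 2 * B * f (Suc x)" if "Suc x \<ge> m" for x
  proof (rule tendsto_upperbound)
    show "(\<lambda>y. norm (S y - S x)) \<longlonglongrightarrow> norm (S x - L)"
      using tendsto_norm[OF tendsto_diff[OF L tendsto_const[of "S x"]]] by (simp add: norm_minus_commute)
    show "eventually (\<lambda>y. norm (S y - S x) \<le> 2 * B * f (Suc x)) sequentially"
      using diff[OF _ that] by (auto simp: eventually_at_top_linorder)
  qed simp
  thus ?thesis by (auto simp: S_def)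
qed

lemma ln_div_antimono: "3 \<le> m \<Longrightarrow> m \<le> n \<Longrightarrow> ln (real n) / real n \<le> ln (real m) / real m"
proof -
  assume mn: "3 \<le> m" "m \<le> n"
  have "exp 1 \<le> real m" using mn exp_le by linarith
  hence lm: "1 \<le> ln (real m)" using ln_ge_iff[of "real m" 1] mn by simp
  have "ln (real n) = ln (real m) + ln (real n / real m)" using mn by (simp add: ln_div)
  also have "ln (real n / real m) \<le> real n / real m - 1" using mn by (intro ln_le_minus_one) auto
  also have "\<dots> \<le> ln (real m) * (real n / real m - 1)"
    using mn lm mult_right_mono[of 1 "ln (real m)" "real n / real m - 1"] by simp
  finally show ?thesis using mn by (simp add: field_simps)
qed

text \<open>\<open>ln x ^ 2 / x\<close> is four times the square of \<open>ln s / s\<close> at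
  \<open>s = sqrt x\<close>, and \<open>ln s / s\<close> decreases from \<open>exp 1\<close> on. The
  threshold 8 exceeds \<open>exp 1 ^ 2\<close>.\<close>

lemma ln_sq_div_antimono: "8 \<le> m \<Longrightarrow> ln (real (Suc m)) ^ 2 / real (Suc m) \<le> ln (real m) ^ 2 / real m"
proof -
  assume m: "8 \<le> m"
  have "exp 1 \<le> sqrt (real m)"
  proof (rule real_le_rsqrt)
    have "exp (1::real) \<le> 2.75" using e_less_272 by simp
    hence "exp (1::real) ^ 2 \<le> 2.75 ^ 2" by (intro power_mono) auto
    also have "\<dots> \<le> 8" by (simp add: power2_eq_square)
    finally show "exp 1 ^ 2 \<le> real m" using m by simp
  qed
  hence lm: "1 \<le> ln (sqrt (real m))" using ln_ge_iff[of "sqrt (real m)" 1] m by simp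
  define s t where "s = sqrt (real m)" and "t = sqrt (real (Suc m))"
  have st: "0 < s" "s \<le> t" using m by (auto simp: s_def t_def)
  have "ln t = ln s + ln (t / s)" using st by (simp add: ln_div)
  also have "ln (t / s) \<le> t / s - 1" using st by (intro ln_le_minus_one) auto
  also have "\<dots> \<le> ln s * (t / s - 1)"
    using st lm mult_right_mono[of 1 "ln s" "t / s - 1"] by (simp add: s_def)
  finally have 1: "ln t / t \<le> ln s / s" using st by (simp add: field_simps)
  have "0 \<le> ln t" using lm st unfolding s_def[symmetric] by (meson ln_mono order.trans zero_le_one)
  hence "(ln t / t) ^ 2 \<le> (ln s / s) ^ 2" using 1 st by (intro power_mono) auto
  moreover have "ln (real m) = 2 * ln s" "ln (real (Suc m)) = 2 * ln t"
    using m by (simp_all add: s_def t_def ln_sqrt del: of_nat_Suc)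
  ultimately show ?thesis by (simp add: power_divide power_mult_distrib s_def t_def del: of_nat_Suc)
qed

text \<open>The intended instances are the nonprincipal Dirichlet characters.\<close>

locale bounded_character =
  fixes \<eta> :: "nat \<Rightarrow> complex" and B :: real
  assumes mult: "\<eta> (m * n) = \<eta> m * \<eta> n"
    and one: "\<eta> 1 = 1"
    and norm_le: "norm (\<eta> n) \<le> 1"
    and sums: "norm (\<Sum>n=1..k. \<eta> n) \<le> B"
begin

lemma B_nonneg: "B \<ge> 0" using sums[of 0] by simp

definition S where "S x = (\<Sum>n=1..x. \<eta> n / of_nat n)"
definition D where "D x = (\<Sum>n=1..x. \<eta> n * of_real (ln (real n)) / of_nat n)"

lemma S_limit: "\<exists>L. \<forall>x. norm (S x - L) \<le> 2 * B / (real x + 1)"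
proof -
  have "(\<lambda>n. 1 / real n) \<longlonglongrightarrow> 0" by real_asymp
  with bounded_partial_sums_limit[OF sums, of 1 "\<lambda>n. 1 / real n"]
  have "\<exists>L. \<forall>x. Suc x \<ge> 1 \<longrightarrow> norm ((\<Sum>n=1..x. \<eta> n * of_real (1 / real n)) - L) \<le> 2 * B * (1 / real (Suc x))"
    by (simp add: frac_le)
  thus ?thesis unfolding S_def by (simp add: add_ac)
qed

definition L where "L = (SOME L. \<forall>x. norm (S x - L) \<le> 2 * B / (real x + 1))"

lemma S_L: "norm (S x - L) \<le> 2 * B / (real x + 1)"
  using someI_ex[OF S_limit] by (simp add: L_def)

lemma S_L_div: "N > 0 \<Longrightarrow> d > 0 \<Longrightarrow> norm (S (N div d) - L) \<le> 2 * B * (real d / real N)"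
proof -
  assume "N > 0" "d > 0"
  hence "2 * B / (real (N div d) + 1) \<le> 2 * B / (real N / real d)"
    using B_nonneg real_div_gt[of N d] by (intro divide_left_mono) auto
  also have "\<dots> = 2 * B * (real d / real N)" by simp
  finally show ?thesis using S_L[of "N div d"] by linarith
qed

lemma D_limit: "\<exists>L'. \<forall>x\<ge>2. norm (D x - L') \<le> 2 * B * (ln (real x + 1) / (real x + 1))"
proof -
  have "(\<lambda>n. ln (real n) / real n) \<longlonglongrightarrow> 0" by real_asymp
  moreover have "n \<ge> 3 \<Longrightarrow> ln (real (Suc n)) / real (Suc n) \<le> ln (real n) / real n" for n
    using ln_div_antimono[of n "Suc n"] by simp
  ultimately have "\<exists>L'. \<forall>x. Suc x \<ge> 3 \<longrightarrow> norm ((\<Sum>n=1..x. \<eta> n * of_real (ln (real n) / real n)) - L')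
      \<le> 2 * B * (ln (real (Suc x)) / real (Suc x))"
    using bounded_partial_sums_limit[OF sums, of 3 "\<lambda>n. ln (real n) / real n"] by simp
  then obtain L' where "\<And>x. Suc x \<ge> 3 \<Longrightarrow> norm (D x - L') \<le> 2 * B * (ln (real (Suc x)) / real (Suc x))"
    by (auto simp: D_def)
  thus ?thesis by (intro exI[of _ L']) (auto simp: add_ac)
qed

text \<open>While \<open>L\<close> is the value at 1 of the L-function of \<open>\<eta>\<close>,
  this limit of \<open>D\<close> is minus its derivative there.\<close>

definition L' where "L' = (SOME L'. \<forall>x\<ge>2. norm (D x - L') \<le> 2 * B * (ln (real x + 1) / (real x + 1)))"

lemma D_L': "x \<ge> 2 \<Longrightarrow> norm (D x - L') \<le> 2 * B * (ln (real x + 1) / (real x + 1))"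
  using someI_ex[OF D_limit] by (simp add: L'_def)

text \<open>The summand with \<open>L'\<close> pays for the case \<open>N div d = 1\<close>, which
  \<open>D_L'\<close> does not cover: there \<open>D\<close> vanishes and \<open>d / N\<close> is at
  least 1/2.\<close>

definition C0 where "C0 = 2 * B + 2 * norm L'"

lemma C0_nonneg: "C0 \<ge> 0" using B_nonneg by (simp add: C0_def)

lemma D_L'_div:
  assumes "N > 0" "d > 0" "d \<le> N"
  shows "norm (D (N div d) - L') \<le> C0 * ((1 + ln (real N / real d)) * (real d / real N))"
proof -
  define m where "m = N div d"
  have m1: "m \<ge> 1" using assms by (simp add: m_def Suc_le_eq div_greater_zero_iff)
  have m2: "real N / real d < real m + 1" using real_div_gt[of N d] by (simp add: m_def)
  have m3: "real m \<le> real N / real d" using real_div_le[of N d] by (simp add: m_def)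
  have Nd: "real N / real d \<ge> 1" using assms by simp
  have ln0: "ln (real N / real d) \<ge> 0" using Nd by simp
  show ?thesis
  proof (cases "m \<ge> 2")
    case True
    have "norm (D m - L') \<le> 2 * B * (ln (real m + 1) / (real m + 1))" using D_L'[OF True] .
    also have "\<dots> \<le> 2 * B * ((1 + ln (real N / real d)) / (real N / real d))"
    proof (intro mult_left_mono frac_le)
      have "ln (real m + 1) \<le> ln (2 * (real N / real d))"
        using m1 m3 Nd by (subst ln_le_cancel_iff) linarith+
      also have "\<dots> = ln 2 + ln (real N / real d)" using Nd by (intro ln_mult_pos) auto
      finally show "ln (real m + 1) \<le> 1 + ln (real N / real d)" using ln_2_less_1 by linarith
    qed (use B_nonneg m2 Nd ln0 in auto)
    also have "\<dots> = 2 * B * ((1 + ln (real N / real d)) * (real d / real N))" by simp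
    also have "\<dots> \<le> C0 * ((1 + ln (real N / real d)) * (real d / real N))"
      using ln0 by (intro mult_right_mono) (auto simp: C0_def)
    finally show ?thesis by (simp add: m_def)
  next
    case False
    hence m: "m = 1" using m1 by simp
    have "D m = 0" by (simp add: m D_def)
    hence "norm (D m - L') = 2 * norm L' * (1 * (1/2))" by simp
    also have "\<dots> \<le> C0 * ((1 + ln (real N / real d)) * (real d / real N))"
    proof (intro mult_mono)
      show "1 / 2 \<le> real d / real N" using m2 m assms by (simp add: field_simps)
    qed (use B_nonneg ln0 in \<open>auto simp: C0_def\<close>)
    finally show ?thesis by (simp add: m_def)
  qed
qed

lemma D_bounded: "\<exists>C. \<forall>N. norm (D N) \<le> C"
proof -
  have "norm (D N) \<le> norm L' + 2 * B" for N
  proof (cases "N \<ge> 2")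
    case True
    have "ln (real N + 1) / (real N + 1) \<le> 1"
      using ln_bound[of "real N + 1"] by (simp add: divide_le_eq)
    hence "2 * B * (ln (real N + 1) / (real N + 1)) \<le> 2 * B * 1"
      using B_nonneg by (intro mult_left_mono) auto
    moreover have "norm (D N) \<le> norm (D N - L') + norm L'" using norm_triangle_sub[of "D N" L'] by simp
    ultimately show ?thesis using D_L'[OF True] by linarith
  next
    case False
    hence "N = 0 \<or> N = 1" by auto
    hence "D N = 0" by (auto simp: D_def)
    thus ?thesis using B_nonneg by simp
  qed
  thus ?thesis by blast
qed

text \<open>The partial sums at 1 of the Dirichlet series of minus the logarithmic derivative of the
  L-function.\<close>

definition W where "W N = (\<Sum>d=1..N. \<eta> d * of_real (\<Lambda> d) / of_nat d)"

lemma D_eq: "D N = (\<Sum>d=1..N. \<eta> d * of_real (\<Lambda> d) / of_nat d * S (N div d))"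
proof -
  have "D N = (\<Sum>n=1..N. \<Sum>d | d dvd n. \<eta> d * of_real (\<Lambda> d) / of_nat d * (\<eta> (n div d) / of_nat (n div d)))"
    unfolding D_def
  proof (intro sum.cong refl)
    fix n assume n: "n \<in> {1..N}"
    have "of_real (ln (real n)) = (\<Sum>d | d dvd n. complex_of_real (\<Lambda> d))"
      using n by (simp add: mangoldt_sum flip: of_real_sum)
    hence "\<eta> n * of_real (ln (real n)) / of_nat n = (\<Sum>d | d dvd n. \<eta> n * of_real (\<Lambda> d) / of_nat n)"
      by (simp add: sum_distrib_left sum_divide_distrib)
    also have "\<dots> = (\<Sum>d | d dvd n. \<eta> d * of_real (\<Lambda> d) / of_nat d * (\<eta> (n div d) / of_nat (n div d)))"
    proof (intro sum.cong refl)
      fix d assume "d \<in> {d. d dvd n}"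
      then obtain k where "n = d * k" by (auto elim: dvdE)
      thus "\<eta> n * of_real (\<Lambda> d) / of_nat n = \<eta> d * of_real (\<Lambda> d) / of_nat d * (\<eta> (n div d) / of_nat (n div d))"
        using n by (cases "d = 0") (auto simp: mult)
    qed
    finally show "\<eta> n * of_real (ln (real n)) / of_nat n =
        (\<Sum>d | d dvd n. \<eta> d * of_real (\<Lambda> d) / of_nat d * (\<eta> (n div d) / of_nat (n div d)))" .
  qed
  also have "\<dots> = (\<Sum>d=1..N. \<Sum>k=1..N div d. \<eta> d * of_real (\<Lambda> d) / of_nat d * (\<eta> k / of_nat k))"
    by (rule sum_divisors_swap[where F = "\<lambda>d k. \<eta> d * of_real (\<Lambda> d) / of_nat d * (\<eta> k / of_nat k)"])
  finally show ?thesis unfolding S_def sum_distrib_left .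
qed

text \<open>In \<open>D_eq\<close> each \<open>S (N div d)\<close> is replaced by \<open>L\<close>.
  The error \<open>2 * B * d / N\<close>, weighted by \<open>\<Lambda> d / d\<close>, adds up to
  \<open>2 * B * psi N / N \<le> 8 * B\<close>, so \<open>L * W N\<close> differs from the bounded
  \<open>D N\<close> by a bounded amount.\<close>

lemma W_bounded:
  assumes "L \<noteq> 0"
  shows "\<exists>C. \<forall>N. norm (W N) \<le> C"
proof -
  obtain C where C: "\<And>N. norm (D N) \<le> C" using D_bounded by blast
  have "norm (W N) \<le> (C + 8 * B) / norm L" for N
  proof (cases "N = 0")
    case False
    have "D N = L * W N + (\<Sum>d=1..N. \<eta> d * of_real (\<Lambda> d) / of_nat d * (S (N div d) - L))"
      unfolding D_eq W_def sum_distrib_left sum.distrib[symmetric]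
      by (intro sum.cong refl) (simp add: algebra_simps)
    hence "L * W N = D N - (\<Sum>d=1..N. \<eta> d * of_real (\<Lambda> d) / of_nat d * (S (N div d) - L))"
      by (simp only: add_diff_cancel_right')
    hence "norm (L * W N) \<le> norm (D N) + norm (\<Sum>d=1..N. \<eta> d * of_real (\<Lambda> d) / of_nat d * (S (N div d) - L))"
      by (simp only: norm_triangle_ineq4)
    also have "norm (\<Sum>d=1..N. \<eta> d * of_real (\<Lambda> d) / of_nat d * (S (N div d) - L)) \<le>
        (\<Sum>d=1..N. 2 * B / real N * \<Lambda> d)"
    proof (rule sum_norm_le)
      fix d assume d: "d \<in> {1..N}"
      have "norm (\<eta> d * of_real (\<Lambda> d) / of_nat d * (S (N div d) - L)) =
          norm (\<eta> d) * (\<Lambda> d / real d * norm (S (N div d) - L))"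
        by (simp add: norm_mult norm_divide)
      also have "\<dots> \<le> 1 * (\<Lambda> d / real d * (2 * B * (real d / real N)))"
        using d False by (intro mult_mono norm_le S_L_div) (auto simp: mangoldt_nonneg)
      also have "\<dots> = 2 * B / real N * \<Lambda> d" using d by simp
      finally show "norm (\<eta> d * of_real (\<Lambda> d) / of_nat d * (S (N div d) - L)) \<le> 2 * B / real N * \<Lambda> d" .
    qed
    also have "\<dots> = 2 * B / real N * psi N" by (simp add: psi_def sum_distrib_left)
    also have "\<dots> \<le> 2 * B / real N * (4 * real N)"
      using B_nonneg by (intro mult_left_mono psi_le) auto
    also have "\<dots> = 8 * B" using False by simp
    finally have "norm L * norm (W N) \<le> C + 8 * B" using C[of N] by (simp add: norm_mult)
    thus ?thesis using assms by (simp add: field_simps)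
  next
    case True
    thus ?thesis using B_nonneg order.trans[OF norm_ge_zero C[of 0]] by (simp add: W_def)
  qed
  thus ?thesis by blast
qed

end

section \<open>The case of a zero at 1\<close>

definition moebius :: "nat \<Rightarrow> real" where
  "moebius n = (if squarefree n then (-1) ^ card (prime_factors n) else 0)"

lemma moebius_1 [simp]: "moebius (Suc 0) = 1" by (simp add: moebius_def)

lemma abs_moebius_le: "\<bar>moebius n\<bar> \<le> 1"
  by (simp add: moebius_def power_abs)

lemma moebius_prime_mult:
  assumes "prime p" "\<not> p dvd d" "squarefree d"
  shows "squarefree (p * d)" "moebius (p * d) = - moebius d"
proof -
  have d0: "d > 0" using assms by (auto intro!: Nat.gr0I)
  have cop: "coprime p d" using assms by (simp add: prime_imp_coprime_nat)
  show sq: "squarefree (p * d)" using cop assms by (simp add: squarefree_mult_coprime squarefree_prime)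
  have "prime_factors (p * d) = insert p (prime_factors d)"
    using assms d0 by (subst prime_factors_product) (auto simp: prime_prime_factors prime_gt_0_nat)
  moreover have "p \<notin> prime_factors d" using assms by auto
  ultimately show "moebius (p * d) = - moebius d" using sq assms by (simp add: moebius_def)
qed

lemma sum_moebius: "n > 0 \<Longrightarrow> (\<Sum>d | d dvd n. moebius d) = (if n = 1 then 1 else 0)"
proof (cases "n = 1")
  case False
  assume n: "n > 0"
  then obtain p where p: "prime p" "p dvd n" using False prime_factor_nat by blast
  define A where "A = {d. d dvd n \<and> squarefree d \<and> \<not> p dvd d}"
  have fin: "finite A" using n by (auto simp: A_def intro: finite_subset[OF _ finite_divisors_nat[OF n]])
  have p0: "p > 0" using p prime_gt_0_nat by auto
  have "(\<Sum>d | d dvd n. moebius d) = (\<Sum>d | d dvd n \<and> squarefree d. moebius d)"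
    using n by (intro sum.mono_neutral_right) (auto simp: moebius_def)
  also have "{d. d dvd n \<and> squarefree d} = A \<union> (\<lambda>d. p * d) ` A"
  proof (intro equalityI subsetI)
    fix d assume d: "d \<in> {d. d dvd n \<and> squarefree d}"
    show "d \<in> A \<union> (\<lambda>d. p * d) ` A"
    proof (cases "p dvd d")
      case True
      then obtain e where e: "d = p * e" by (elim dvdE)
      have "\<not> p dvd e"
      proof
        assume "p dvd e"
        hence "p ^ 2 dvd d" by (simp add: e power2_eq_square mult_dvd_mono)
        hence "p dvd 1" using d by (auto simp: squarefree_def)
        thus False using p by simp
      qed
      moreover have "squarefree e" "e dvd n"
        using d e squarefree_mono[of e d] by (auto intro: dvd_trans)
      ultimately show ?thesis by (auto simp: A_def e)
    qed (use d in \<open>auto simp: A_def\<close>)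
  next
    fix d assume "d \<in> A \<union> (\<lambda>d. p * d) ` A"
    thus "d \<in> {d. d dvd n \<and> squarefree d}"
    proof
      assume "d \<in> (\<lambda>d. p * d) ` A"
      then obtain e where e: "e \<in> A" "d = p * e" by auto
      have "coprime p e" using e p by (simp add: A_def prime_imp_coprime_nat)
      hence "p * e dvd n" using e p by (intro divides_mult) (auto simp: A_def)
      thus ?thesis using e p moebius_prime_mult(1) by (auto simp: A_def)
    qed (auto simp: A_def)
  qed
  also have "(\<Sum>d\<in>A \<union> (\<lambda>d. p * d) ` A. moebius d) = (\<Sum>d\<in>A. moebius d) + (\<Sum>d\<in>(\<lambda>d. p * d) ` A. moebius d)"
    using fin by (intro sum.union_disjoint) (auto simp: A_def)
  also have "(\<Sum>d\<in>(\<lambda>d. p * d) ` A. moebius d) = (\<Sum>d\<in>A. moebius (p * d))"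
    using p0 by (subst sum.reindex) (auto simp: inj_on_def)
  also have "\<dots> = (\<Sum>d\<in>A. - moebius d)"
    using p moebius_prime_mult(2) by (intro sum.cong) (auto simp: A_def)
  finally show ?thesis using False by (simp add: sum_negf)
qed simp

context bounded_character
begin

text \<open>The sum of \<open>\<eta> k / k\<close> over \<open>k \<le> N div d\<close> with the
  weight \<open>ln (N / (d * k))\<close>, as \<open>H_eq\<close> shows. If \<open>L = 0\<close>, the
  first term is small and \<open>H N d\<close> is close to \<open>- L'\<close> for every
  \<open>d\<close>, so that sums over \<open>d\<close> weighted by \<open>H\<close> are nearly
  \<open>- L'\<close> times the plain ones.\<close>

definition H where "H N d = of_real (ln (real N / real d)) * S (N div d) - D (N div d)"

lemma H_eq: "d \<in> {1..N} \<Longrightarrow> H N d = (\<Sum>k=1..N div d. \<eta> k / of_nat k * of_real (ln (real N / real (d * k))))"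
proof -
  assume d: "d \<in> {1..N}"
  show ?thesis unfolding H_def S_def D_def sum_distrib_left sum_subtractf[symmetric]
  proof (intro sum.cong refl)
    fix k assume "k \<in> {1..N div d}"
    hence "ln (real N / real (d * k)) = ln (real N / real d) - ln (real k)"
      using d by (simp add: ln_div ln_mult)
    thus "complex_of_real (ln (real N / real d)) * (\<eta> k / of_nat k) - \<eta> k * complex_of_real (ln (real k)) / of_nat k =
         \<eta> k / of_nat k * complex_of_real (ln (real N / real (d * k)))"
      by (simp only: of_real_diff) (simp add: algebra_simps diff_divide_distrib)
  qed
qed

text \<open>Reordering by \<open>n = d * k\<close>. The divisor sum on the right is explicit in both
  applications: for the Moebius function only \<open>n = 1\<close> remains and yields
  \<open>ln N\<close>, and for the von Mangoldt function it is \<open>ln n\<close>.\<close>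

lemma sum_H:
  fixes c :: "nat \<Rightarrow> real"
  shows "(\<Sum>d=1..N. \<eta> d * of_real (c d) / of_nat d * H N d) =
    (\<Sum>n=1..N. \<eta> n / of_nat n * of_real (ln (real N / real n) * (\<Sum>d | d dvd n. c d)))"
proof -
  have "(\<Sum>n=1..N. \<eta> n / of_nat n * of_real (ln (real N / real n) * (\<Sum>d | d dvd n. c d))) =
    (\<Sum>n=1..N. \<Sum>d | d dvd n. \<eta> d * of_real (c d) / of_nat d *
      (\<eta> (n div d) / of_nat (n div d) * of_real (ln (real N / real (d * (n div d))))))"
  proof (intro sum.cong refl)
    fix n assume n: "n \<in> {1..N}"
    have "\<eta> n / of_nat n * of_real (ln (real N / real n) * (\<Sum>d | d dvd n. c d)) =
        (\<Sum>d | d dvd n. \<eta> n / of_nat n * (of_real (ln (real N / real n)) * of_real (c d)))"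
      by (simp add: sum_distrib_left)
    also have "\<dots> = (\<Sum>d | d dvd n. \<eta> d * of_real (c d) / of_nat d *
      (\<eta> (n div d) / of_nat (n div d) * of_real (ln (real N / real (d * (n div d))))))"
    proof (intro sum.cong refl)
      fix d assume "d \<in> {d. d dvd n}"
      then obtain k where "n = d * k" by (auto elim: dvdE)
      thus "\<eta> n / of_nat n * (of_real (ln (real N / real n)) * of_real (c d)) = \<eta> d * of_real (c d) / of_nat d *
          (\<eta> (n div d) / of_nat (n div d) * of_real (ln (real N / real (d * (n div d)))))"
        using n by (cases "d = 0") (auto simp: mult)
    qed
    finally show "\<eta> n / of_nat n * of_real (ln (real N / real n) * (\<Sum>d | d dvd n. c d)) =
      (\<Sum>d | d dvd n. \<eta> d * of_real (c d) / of_nat d *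
      (\<eta> (n div d) / of_nat (n div d) * of_real (ln (real N / real (d * (n div d))))))" .
  qed
  also have "\<dots> = (\<Sum>d=1..N. \<Sum>k=1..N div d. \<eta> d * of_real (c d) / of_nat d *
      (\<eta> k / of_nat k * of_real (ln (real N / real (d * k)))))"
    by (rule sum_divisors_swap[where F = "\<lambda>d k. \<eta> d * of_real (c d) / of_nat d *
      (\<eta> k / of_nat k * of_real (ln (real N / real (d * k))))"])
  also have "\<dots> = (\<Sum>d=1..N. \<eta> d * of_real (c d) / of_nat d * H N d)"
    unfolding sum_distrib_left[symmetric] by (intro sum.cong refl) (simp only: H_eq)
  finally show ?thesis by simp
qed

definition C1 where "C1 = 2 * B + C0"

lemma H_bound:
  assumes "L = 0" "d \<in> {1..N}"
  shows "norm (H N d + L') \<le> C1 * ((1 + ln (real N / real d)) * (real d / real N))"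
proof -
  have Nd: "real N / real d \<ge> 1" and N: "N > 0" using assms by auto
  have SL: "norm (S (N div d)) \<le> 2 * B * (real d / real N)" using S_L_div[of N d] assms N by simp
  have "norm (H N d + L') \<le> norm (of_real (ln (real N / real d)) * S (N div d)) + norm (D (N div d) - L')"
    unfolding H_def using norm_triangle_ineq4[of "of_real (ln (real N / real d)) * S (N div d)" "D (N div d) - L'"]
    by (simp add: algebra_simps)
  also have "norm (of_real (ln (real N / real d)) * S (N div d)) \<le> ln (real N / real d) * (2 * B * (real d / real N))"
    unfolding norm_mult norm_of_real using assms N Nd by (simp only: abs_of_nonneg ln_ge_zero) (rule mult_left_mono[OF SL]; simp)
  also have "\<dots> \<le> 2 * B * ((1 + ln (real N / real d)) * (real d / real N))"
  proof -
    have "2 * B * (ln (real N / real d) * (real d / real N)) \<le> 2 * B * ((1 + ln (real N / real d)) * (real d / real N))"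
      using B_nonneg by (intro mult_left_mono mult_right_mono) auto
    thus ?thesis by (simp only: mult.left_commute)
  qed
  also have "norm (D (N div d) - L') \<le> C0 * ((1 + ln (real N / real d)) * (real d / real N))"
    using assms by (intro D_L'_div) auto
  finally show ?thesis by (simp only: C1_def distrib_right add_left_mono)
qed

lemma sum_H_approx:
  fixes c :: "nat \<Rightarrow> real"
  assumes "L = 0" "N > 0"
  shows "norm ((\<Sum>d=1..N. \<eta> d * of_real (c d) / of_nat d * H N d) + L' * (\<Sum>d=1..N. \<eta> d * of_real (c d) / of_nat d))
    \<le> C1 / real N * (\<Sum>d=1..N. \<bar>c d\<bar> * (1 + ln (real N / real d)))"
proof -
  have "(\<Sum>d=1..N. \<eta> d * of_real (c d) / of_nat d * H N d) + L' * (\<Sum>d=1..N. \<eta> d * of_real (c d) / of_nat d) =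
      (\<Sum>d=1..N. \<eta> d * of_real (c d) / of_nat d * (H N d + L'))"
    by (simp add: sum_distrib_left sum.distrib[symmetric] algebra_simps add_divide_distrib)
  also have "norm \<dots> \<le> (\<Sum>d=1..N. C1 / real N * (\<bar>c d\<bar> * (1 + ln (real N / real d))))"
  proof (rule sum_norm_le)
    fix d assume d: "d \<in> {1..N}"
    have "norm (\<eta> d * of_real (c d) / of_nat d * (H N d + L')) = norm (\<eta> d) * (\<bar>c d\<bar> / real d * norm (H N d + L'))"
      by (simp add: norm_mult norm_divide)
    also have "\<dots> \<le> 1 * (\<bar>c d\<bar> / real d * (C1 * ((1 + ln (real N / real d)) * (real d / real N))))"
      using d by (intro mult_mono norm_le H_bound assms) auto
    also have "\<dots> = C1 / real N * (\<bar>c d\<bar> * (1 + ln (real N / real d)))" using d by (simp add: field_simps)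
    finally show "norm (\<eta> d * of_real (c d) / of_nat d * (H N d + L')) \<le> C1 / real N * (\<bar>c d\<bar> * (1 + ln (real N / real d)))" .
  qed
  finally show ?thesis by (simp add: sum_distrib_left)
qed

lemma C1_nonneg: "C1 \<ge> 0" using B_nonneg C0_nonneg by (simp add: C1_def)

text \<open>A zero at 1 is simple: with the Moebius function in \<open>sum_H\<close> the left side
  equals \<open>ln N\<close>, whereas \<open>L = L' = 0\<close> would bound it by
  \<open>2 * C1\<close>.\<close>

lemma L'_nonzero:
  assumes "L = 0"
  shows "L' \<noteq> 0"
proof
  assume L': "L' = 0"
  have le: "ln (real N) \<le> C1 * 2" if N: "N > 0" for N
  proof -
    have "(\<Sum>d=1..N. \<eta> d * of_real (moebius d) / of_nat d * H N d) =
        (\<Sum>n=1..N. \<eta> n / of_nat n * of_real (ln (real N / real n) * (if n = 1 then 1 else 0)))"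
      unfolding sum_H by (intro sum.cong refl) (simp add: sum_moebius)
    also have "\<dots> = (\<Sum>n\<in>{1..N}. if n = 1 then of_real (ln (real N)) else 0)"
      using one by (intro sum.cong refl) auto
    also have "\<dots> = of_real (ln (real N))" using N by simp
    finally have "norm (complex_of_real (ln (real N))) \<le> C1 / real N * (\<Sum>d=1..N. \<bar>moebius d\<bar> * (1 + ln (real N / real d)))"
      using sum_H_approx[OF assms N, of moebius] L' by simp
    also have "\<dots> \<le> C1 / real N * (\<Sum>d=1..N. 1 * (1 + ln (real N / real d)))"
      using C1_nonneg by (intro mult_left_mono sum_mono mult_right_mono abs_moebius_le) auto
    also have "\<dots> \<le> C1 / real N * (2 * real N)"
      using C1_nonneg sum_ln_div_le[of N] by (intro mult_left_mono) (auto simp: sum.distrib)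
    also have "\<dots> = C1 * 2" using N by simp
    finally show ?thesis using N by simp
  qed
  have "filterlim (\<lambda>N. ln (real N)) at_top sequentially" by real_asymp
  hence "eventually (\<lambda>N. ln (real N) > C1 * 2 \<and> N > 0) sequentially"
    by (intro eventually_conj) (auto simp: filterlim_at_top_dense eventually_gt_at_top)
  then obtain N where "ln (real N) > C1 * 2" "N > 0" by (auto simp: eventually_at_top_linorder)
  thus False using le[of N] by simp
qed

lemma sum_ln_sq_bounded: "\<exists>C. \<forall>N. norm (\<Sum>n=1..N. \<eta> n / of_nat n * of_real (ln (real n) ^ 2)) \<le> C"
proof -
  define T where "T N = (\<Sum>n=1..N. \<eta> n / of_nat n * of_real (ln (real n) ^ 2))" for N
  have "(\<lambda>n. ln (real n) ^ 2 / real n) \<longlonglongrightarrow> 0" by real_asymp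
  with bounded_partial_sums_limit[OF sums, of 8 "\<lambda>n. ln (real n) ^ 2 / real n"] ln_sq_div_antimono
  obtain M where M: "\<And>x. Suc x \<ge> 8 \<Longrightarrow> norm ((\<Sum>n=1..x. \<eta> n * of_real (ln (real n) ^ 2 / real n)) - M)
      \<le> 2 * B * (ln (real (Suc x)) ^ 2 / real (Suc x))" by auto
  have le: "ln (real (Suc x)) ^ 2 / real (Suc x) \<le> 4" for x
  proof -
    have "ln (real (Suc x)) ^ 2 \<le> (2 * sqrt (real (Suc x))) ^ 2"
      by (intro power_mono ln_le_two_sqrt) auto
    thus ?thesis by (simp add: power_mult_distrib divide_le_eq)
  qed
  have T: "T x = (\<Sum>n=1..x. \<eta> n * of_real (ln (real n) ^ 2 / real n))" for x
    unfolding T_def by (intro sum.cong refl) simp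
  have "norm (T x) \<le> norm M + 2 * B * 4 + (\<Sum>j<8. norm (T j))" for x
  proof (cases "x < 8")
    case True
    hence "norm (T x) \<le> (\<Sum>j<8. norm (T j))" by (intro member_le_sum) auto
    thus ?thesis using B_nonneg norm_ge_zero[of M] by linarith
  next
    case False
    have "norm (T x - M) \<le> 2 * B * (ln (real (Suc x)) ^ 2 / real (Suc x))"
      using M[of x] False T by simp
    also have "\<dots> \<le> 2 * B * 4" using B_nonneg le by (intro mult_left_mono) auto
    finally have "norm (T x) \<le> norm M + 2 * B * 4" using norm_triangle_sub[of "T x" M] by simp
    thus ?thesis using sum_nonneg[of "{..<8}" "\<lambda>j. norm (T j)"] by simp
  qed
  thus ?thesis unfolding T_def by blast
qed

lemma ln_sq_le: "x > 0 \<Longrightarrow> ln (real x + 1) * ln (real x) / (real x + 1) \<le> 4"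
proof -
  assume x: "x > 0"
  have "ln (real x + 1) * ln (real x) \<le> (2 * sqrt (real x + 1)) * (2 * sqrt (real x + 1))"
    using x ln_le_two_sqrt[of "real x"] real_sqrt_le_mono[of "real x" "real x + 1"]
    by (intro mult_mono ln_le_two_sqrt) (auto simp: intro: order.trans)
  also have "\<dots> = 4 * (real x + 1)" using x by simp
  finally show ?thesis by (simp add: divide_le_eq)
qed

text \<open>A simple zero contributes \<open>- ln N\<close> to the partial sums of minus the
  logarithmic derivative. With the von Mangoldt function, \<open>sum_H\<close> equals
  \<open>ln N * D N\<close> minus a bounded sum, hence \<open>L' * ln N\<close> up to a constant,
  and by \<open>sum_H_approx\<close> it is also \<open>- L' * W N\<close> up to a constant.\<close>

lemma W_zero_case:
  assumes "L = 0"
  shows "\<exists>C. \<forall>N>0. norm (W N + of_real (ln (real N))) \<le> C"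
proof -
  obtain C2 where C2: "\<And>N. norm (\<Sum>n=1..N. \<eta> n / of_nat n * of_real (ln (real n) ^ 2)) \<le> C2"
    using sum_ln_sq_bounded by blast
  have L'0: "L' \<noteq> 0" using L'_nonzero[OF assms] .
  define K where "K = C1 * 8 + 8 * B + C2"
  have "norm (W N + of_real (ln (real N))) \<le> K / norm L' + norm (W 1)" if N: "N > 0" for N
  proof (cases "N = 1")
    case False
    hence N2: "N \<ge> 2" using N by simp
    define T where "T = (\<Sum>n=1..N. \<eta> n / of_nat n * of_real (ln (real n) ^ 2))"
    have "(\<Sum>d=1..N. \<eta> d * of_real (\<Lambda> d) / of_nat d * H N d) =
        (\<Sum>n=1..N. \<eta> n / of_nat n * of_real (ln (real N / real n) * ln (real n)))"
      unfolding sum_H by (intro sum.cong refl) (simp add: mangoldt_sum)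
    also have "\<dots> = (\<Sum>n=1..N. of_real (ln (real N)) * (\<eta> n * of_real (ln (real n)) / of_nat n) -
        \<eta> n / of_nat n * of_real (ln (real n) ^ 2))"
      using N by (intro sum.cong refl) (auto simp: ln_div algebra_simps power2_eq_square diff_divide_distrib)
    also have "\<dots> = of_real (ln (real N)) * D N - T"
      by (simp add: D_def T_def sum_subtractf sum_distrib_left)
    finally have eq: "(\<Sum>d=1..N. \<eta> d * of_real (\<Lambda> d) / of_nat d * H N d) = of_real (ln (real N)) * D N - T" .
    have "norm (of_real (ln (real N)) * D N - T + L' * W N) \<le>
        C1 / real N * (\<Sum>d=1..N. \<Lambda> d * (1 + ln (real N / real d)))"
      using sum_H_approx[OF assms N, of \<Lambda>] unfolding eq W_def by simp
    also have "(\<Sum>d=1..N. \<Lambda> d * (1 + ln (real N / real d))) = psi N + (\<Sum>d=1..N. \<Lambda> d * ln (real N / real d))"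
      by (simp add: psi_def sum.distrib[symmetric] algebra_simps)
    also have "C1 / real N * \<dots> \<le> C1 / real N * (8 * real N)"
      using C1_nonneg psi_le[of N] sum_mangoldt_ln_le[of N] by (intro mult_left_mono) auto
    also have "\<dots> = C1 * 8" using N by simp
    finally have 1: "norm (of_real (ln (real N)) * D N - T + L' * W N) \<le> C1 * 8" .
    have "norm (of_real (ln (real N)) * (D N - L')) \<le> ln (real N) * (2 * B * (ln (real N + 1) / (real N + 1)))"
      unfolding norm_mult norm_of_real using D_L'[OF N2] N
      by (simp only: abs_of_nonneg ln_ge_zero_iff) (intro mult_mono; simp)
    also have "\<dots> = 2 * B * (ln (real N + 1) * ln (real N) / (real N + 1))" by simp
    also have "\<dots> \<le> 2 * B * 4" using B_nonneg N by (intro mult_left_mono ln_sq_le) auto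
    finally have 2: "norm (of_real (ln (real N)) * (D N - L')) \<le> 8 * B" by simp
    have "L' * (W N + of_real (ln (real N))) =
        (of_real (ln (real N)) * D N - T + L' * W N) - of_real (ln (real N)) * (D N - L') + T"
      by (simp add: algebra_simps)
    also have "norm \<dots> \<le> norm (of_real (ln (real N)) * D N - T + L' * W N) + norm (of_real (ln (real N)) * (D N - L')) + norm T"
      by (intro order.trans[OF norm_triangle_ineq] add_right_mono norm_triangle_ineq4)
    also have "\<dots> \<le> K" using 1 2 C2[of N] by (simp add: K_def T_def)
    finally have "norm L' * norm (W N + of_real (ln (real N))) \<le> K" by (simp add: norm_mult)
    hence "norm (W N + of_real (ln (real N))) \<le> K / norm L'" using L'0 by (simp add: field_simps)
    thus ?thesis using norm_ge_zero[of "W 1"] by linarith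
  next
    case True
    have "K \<ge> 0" unfolding K_def using C1_nonneg B_nonneg order.trans[OF norm_ge_zero C2[of 0]] by simp
    thus ?thesis using True by simp
  qed
  thus ?thesis by blast
qed

end

section \<open>Real characters, by a Lambert series\<close>

lemma sum_powers_ge:
  fixes s :: real
  assumes "0 \<le> s"
  shows "real n * s ^ (n - 1) \<le> (\<Sum>i<n. (s ^ 2) ^ i)"
proof -
  have "2 * (real n * s ^ (n - 1)) = (\<Sum>i<n. 2 * s ^ (n - 1))" by simp
  also have "\<dots> \<le> (\<Sum>i<n. (s ^ 2) ^ i + (s ^ 2) ^ (n - 1 - i))"
  proof (intro sum_mono)
    fix i assume i: "i \<in> {..<n}"
    have "s ^ (n - 1) = s ^ i * s ^ (n - 1 - i)" using i by (simp flip: power_add)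
    moreover have "2 * (s ^ i * s ^ (n - 1 - i)) \<le> (s ^ i) ^ 2 + (s ^ (n - 1 - i)) ^ 2"
      using sum_squares_bound[of "s ^ i" "s ^ (n - 1 - i)"] by simp
    ultimately show "2 * s ^ (n - 1) \<le> (s ^ 2) ^ i + (s ^ 2) ^ (n - 1 - i)"
      by (simp add: power_mult[symmetric] mult.commute)
  qed
  also have "\<dots> = (\<Sum>i<n. (s ^ 2) ^ i) + (\<Sum>i<n. (s ^ 2) ^ (n - 1 - i))" by (rule sum.distrib)
  also have "(\<Sum>i<n. (s ^ 2) ^ (n - 1 - i)) = (\<Sum>i<n. (s ^ 2) ^ i)"
    using sum.nat_diff_reindex[of "\<lambda>i. (s ^ 2) ^ i" n] by simp
  finally show ?thesis by simp
qed

text \<open>The Lambert term is compared with \<open>1 / (n * (1 - t))\<close>, its size for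
  \<open>t\<close> near 1. Since the difference decreases, it can be summed by parts against
  \<open>\<eta>\<close> with a bound uniform in \<open>t\<close>. The decrease amounts to
  \<open>n * (n + 1) * t ^ n \<le> P n * P (n + 1)\<close>, which comes from the
  arithmetic-geometric mean inequality in \<open>sum_powers_ge\<close>.\<close>

lemma lambert_term_antimono:
  fixes t :: real
  assumes t: "0 < t" "t < 1" and n: "n > 0"
  defines "b \<equiv> \<lambda>n. 1 / (real n * (1 - t)) - t ^ n / (1 - t ^ n)"
  shows "b n \<ge> 0" "b (Suc n) \<le> b n"
proof -
  define P where "P n = (\<Sum>i<n. t ^ i)" for n
  have P: "1 - t ^ n = (1 - t) * P n" for n unfolding P_def by (rule one_diff_power_eq)
  have Ppos: "P n > 0" if "n > 0" for n unfolding P_def using that t by (intro sum_pos) auto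
  have "real n * t ^ n = (\<Sum>i<n. t ^ n)" by simp
  also have "\<dots> \<le> P n" unfolding P_def using t by (intro sum_mono power_decreasing) auto
  finally have "t ^ n / P n \<le> 1 / real n" using Ppos[OF n] n by (simp add: field_simps)
  hence "t ^ n / P n / (1 - t) \<le> 1 / real n / (1 - t)" using t by (intro divide_right_mono) auto
  hence "t ^ n / (1 - t ^ n) \<le> 1 / (real n * (1 - t))" unfolding P by (simp add: mult.commute)
  thus "b n \<ge> 0" by (simp add: b_def)
  define s where "s = sqrt t"
  have s: "0 < s" "s < 1" "s ^ 2 = t" using t by (simp_all add: s_def)
  have "real n * s ^ (n - 1) * (real (Suc n) * s ^ n) \<le> P n * P (Suc n)"
    using sum_powers_ge[of s n] sum_powers_ge[of s "Suc n"] s unfolding P_def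
    by (intro mult_mono) (auto intro: sum_nonneg)
  moreover have "t ^ n \<le> s ^ (n - 1) * s ^ n"
  proof -
    have "t ^ n = s ^ (2 * n)" by (simp add: s(3)[symmetric] power_mult)
    also have "\<dots> \<le> s ^ (n - 1 + n)" using s by (intro power_decreasing) auto
    finally show ?thesis by (simp add: power_add)
  qed
  hence "real n * real (Suc n) * t ^ n \<le> real n * real (Suc n) * (s ^ (n - 1) * s ^ n)"
    by (intro mult_left_mono) auto
  ultimately have le: "real n * real (Suc n) * t ^ n \<le> P n * P (Suc n)" by (simp add: mult_ac)
  have PS: "P (Suc n) = P n + t ^ n" by (simp add: P_def)
  have pos: "P n > 0" "P (Suc n) > 0" "1 - t > 0" using Ppos n t by auto
  have "t ^ n / (1 - t ^ n) - t ^ Suc n / (1 - t ^ Suc n) = t ^ n * (P (Suc n) - t * P n) / ((1 - t) * (P n * P (Suc n)))"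
  proof -
    have "x / (c * p) - y * x / (c * q) = x * (q - y * p) / (c * (p * q))"
      if "c \<noteq> 0" "p \<noteq> 0" "q \<noteq> 0" for x y c p q :: real using that by (simp add: field_simps)
    from this[of "1 - t" "P n" "P (Suc n)" "t ^ n" t] pos show ?thesis unfolding P by simp
  qed
  also have "P (Suc n) - t * P n = 1"
    using P[of n] unfolding PS by (simp add: algebra_simps)
  also have "t ^ n * 1 / ((1 - t) * (P n * P (Suc n))) \<le> 1 / ((1 - t) * (real n * real (Suc n)))"
  proof -
    have "t ^ n / (P n * P (Suc n)) \<le> 1 / (real n * real (Suc n))"
    proof -
      have "a / b \<le> 1 / c" if "b > 0" "c > 0" "c * a \<le> b" for a b c :: real
        using that by (simp add: field_simps)
      thus ?thesis using pos le n by simp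
    qed
    from divide_right_mono[OF this, of "1 - t"] pos show ?thesis by (simp add: mult_ac)
  qed
  also have "\<dots> = 1 / (real n * (1 - t)) - 1 / (real (Suc n) * (1 - t))"
  proof -
    have "(y - x) / (c * (x * y)) = 1 / (x * c) - 1 / (y * c)" if "c > 0" "x > 0" "y > 0" for c x y :: real
      using that by (simp add: field_simps)
    from this[of "1 - t" "real n" "real (Suc n)"] pos n show ?thesis by simp
  qed
  finally show "b (Suc n) \<le> b n" by (simp add: b_def)
qed

context bounded_character
begin

definition divisor_sum where "divisor_sum n = (\<Sum>d | d dvd n. Re (\<eta> d))"

lemma real_values:
  assumes real: "\<And>n. \<eta> n \<in> \<real>"
  shows "Re (\<eta> (m * n)) = Re (\<eta> m) * Re (\<eta> n)" "Re (\<eta> (m ^ k)) = Re (\<eta> m) ^ k" "\<bar>Re (\<eta> n)\<bar> \<le> 1"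
    "\<eta> n = of_real (Re (\<eta> n))"
proof -
  have im: "Im (\<eta> n) = 0" for n using real by (simp add: complex_is_Real_iff)
  show m: "Re (\<eta> (m * n)) = Re (\<eta> m) * Re (\<eta> n)" for m n by (simp add: mult im)
  show "Re (\<eta> (m ^ k)) = Re (\<eta> m) ^ k" by (induction k) (use one m in simp_all)
  show "\<bar>Re (\<eta> n)\<bar> \<le> 1" using norm_le[of n] abs_Re_le_cmod[of "\<eta> n"] by linarith
  show "\<eta> n = of_real (Re (\<eta> n))" using im by (simp add: complex_eq_iff)
qed

text \<open>The divisor sum is multiplicative, and its factor at a prime of exponent
  \<open>a\<close> is the sum of \<open>e ^ i\<close> for \<open>i \<le> a\<close> with
  \<open>e\<close> one of -1, 0, 1. This is never negative and is at least 1 for even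
  \<open>a\<close>.\<close>

lemma divisor_sum_nonneg:
  assumes real: "\<And>n. \<eta> n \<in> \<real>" and val: "\<And>n. Re (\<eta> n) \<in> {-1, 0, 1}" and n: "n > 0"
  shows "divisor_sum n \<ge> 0 \<and> ((\<exists>k. n = k ^ 2) \<longrightarrow> divisor_sum n \<ge> 1)"
  using n
proof (induction n rule: less_induct)
  case (less n)
  show ?case
  proof (cases "n = 1")
    case True
    thus ?thesis using one by (simp add: divisor_sum_def)
  next
    case False
    then obtain p where p: "prime p" "p dvd n" using prime_factor_nat by blast
    define a where "a = multiplicity p n"
    obtain m where nm: "n = p ^ a * m" "\<not> p dvd m"
      using less.prems p multiplicity_decompose'[of n p] prime_gt_1_nat[OF p(1)] unfolding a_def by auto
    have a0: "a > 0" using p less.prems by (simp add: a_def prime_multiplicity_gt_zero_iff)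
    have m0: "m > 0" using less.prems nm by (auto intro!: Nat.gr0I)
    have mn: "m < n"
    proof -
      have "1 < p ^ a" using p a0 prime_gt_1_nat by (intro one_less_power) auto
      thus ?thesis using m0 by (simp add: nm(1))
    qed
    have bij: "bij_betw (\<lambda>(i, d). p ^ i * d) ({..a} \<times> {d. d dvd m}) {d. d dvd n}"
    proof (rule bij_betwI')
      fix x y assume xy: "x \<in> {..a} \<times> {d. d dvd m}" "y \<in> {..a} \<times> {d. d dvd m}"
      obtain i d j e where [simp]: "x = (i, d)" "y = (j, e)" by (cases x, cases y)
      have nd: "\<not> p dvd d" "\<not> p dvd e" using xy nm(2) by (auto dest: dvd_trans)
      show "((case x of (i, d) \<Rightarrow> p ^ i * d) = (case y of (i, d) \<Rightarrow> p ^ i * d)) = (x = y)"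
      proof
        assume eq: "(case x of (i, d) \<Rightarrow> p ^ i * d) = (case y of (i, d) \<Rightarrow> p ^ i * d)"
        hence eq: "p ^ i * d = p ^ j * e" by simp
        have "multiplicity p (p ^ i * d) = i" "multiplicity p (p ^ j * e) = j"
          using p nd prime_gt_1_nat[OF p(1)]
          by (auto simp: multiplicity_times_same multiplicity_prime_elem_times_other prime_elem_multiplicity_mult_distrib
              prime_multiplicity_other not_dvd_imp_multiplicity_0 intro!: multiplicity_decomposeI)
        thus "x = y" using eq p prime_gt_0_nat by auto
      qed auto
    next
      fix x assume "x \<in> {..a} \<times> {d. d dvd m}"
      thus "(case x of (i, d) \<Rightarrow> p ^ i * d) \<in> {d. d dvd n}"
        by (auto simp: nm(1) intro!: mult_dvd_mono le_imp_power_dvd)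
    next
      fix y assume y: "y \<in> {d. d dvd n}"
      then obtain u v where uv: "y = u * v" "u dvd p ^ a" "v dvd m"
        using nm(1) dvd_productE by (metis mem_Collect_eq)
      then obtain i where "i \<le> a" "u = p ^ i" using p by (auto simp: divides_primepow_nat)
      thus "\<exists>x\<in>{..a} \<times> {d. d dvd m}. y = (case x of (i, d) \<Rightarrow> p ^ i * d)"
        using uv by (intro bexI[of _ "(i, v)"]) auto
    qed
    define e where "e = Re (\<eta> p)"
    have "divisor_sum n = (\<Sum>(i, d)\<in>{..a} \<times> {d. d dvd m}. Re (\<eta> (p ^ i * d)))"
      unfolding divisor_sum_def using sum.reindex_bij_betw[OF bij, of "\<lambda>d. Re (\<eta> d)"] by (simp add: case_prod_unfold)
    also have "\<dots> = (\<Sum>i\<le>a. \<Sum>d | d dvd m. e ^ i * Re (\<eta> d))"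
      unfolding sum.cartesian_product by (simp add: real_values(1,2)[OF real] e_def)
    also have "\<dots> = (\<Sum>i\<le>a. e ^ i) * divisor_sum m"
      unfolding divisor_sum_def by (rule sum_product[symmetric])
    finally have divisor_sum: "divisor_sum n = (\<Sum>i\<le>a. e ^ i) * divisor_sum m" .
    have alt: "(\<Sum>i\<le>b. (-1::real) ^ i) = (if even b then 1 else 0)" for b
      by (induction b) auto
    have zer: "(\<Sum>i\<le>b. (0::real) ^ i) = 1" for b by (induction b) auto
    have e: "e \<in> {-1, 0, 1}" using val by (simp add: e_def)
    have 1: "(\<Sum>i\<le>a. e ^ i) \<ge> 0" using e alt[of a] zer[of a] by auto
    have 2: "(\<Sum>i\<le>a. e ^ i) \<ge> 1" if "even a" using e alt[of a] zer[of a] that by auto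
    have IH: "divisor_sum m \<ge> 0" "(\<exists>k. m = k ^ 2) \<Longrightarrow> divisor_sum m \<ge> 1" using less.IH[OF mn m0] by auto
    have "divisor_sum n \<ge> 1" if k: "n = k ^ 2" for k
    proof -
      have k0: "k > 0" using less.prems k by (auto intro!: Nat.gr0I)
      define c where "c = multiplicity p k"
      obtain k' where k': "k = p ^ c * k'" "\<not> p dvd k'"
        using k0 p multiplicity_decompose'[of k p] prime_gt_1_nat[OF p(1)] unfolding c_def by auto
      have ac: "a = 2 * c" unfolding a_def k c_def using p k0 by (simp add: prime_elem_multiplicity_power_distrib)
      have "p ^ a * m = p ^ a * k' ^ 2"
        using k nm(1) k'(1) by (simp add: ac power_mult_distrib power_mult[symmetric] mult.commute)
      hence "m = k' ^ 2" using p prime_gt_0_nat by simp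
      hence "divisor_sum m \<ge> 1" using IH by blast
      thus ?thesis unfolding divisor_sum using 2 ac mult_mono[of 1 "\<Sum>i\<le>a. e ^ i" 1 "divisor_sum m"] by simp
    qed
    thus ?thesis using divisor_sum 1 IH by auto
  qed
qed

text \<open>The power series of \<open>divisor_sum\<close> is the Lambert series of
  \<open>\<eta>\<close>. If \<open>L = 0\<close>, the main part \<open>L / (1 - t)\<close>
  disappears and the series stays below \<open>2 * B\<close> for all \<open>t < 1\<close>; but the
  squares alone make it unbounded as \<open>t\<close> tends to 1.\<close>

lemma L_nonzero_real:
  assumes real: "\<And>n. \<eta> n \<in> \<real>" and val: "\<And>n. Re (\<eta> n) \<in> {-1, 0, 1}"
  shows "L \<noteq> 0"
proof
  assume L: "L = 0"
  define e where "e n = Re (\<eta> n)" for n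
  \<comment> \<open>The last two terms come from truncating at \<open>M\<close> and vanish as
    \<open>M\<close> grows; only afterwards does \<open>t\<close> tend to 1.\<close>
  have main: "(\<Sum>k=1..K. t ^ (k ^ 2)) \<le> 2 * B + 2 * B / (real M * (1 - t)) + real M * t ^ M / (1 - t)"
    if t: "0 < t" "t < 1" and M: "K ^ 2 \<le> M" "M > 0" for t :: real and K M :: nat
  proof -
    have tn: "t ^ n \<le> t" "1 - t ^ n > 0" "1 - t ^ n \<ge> 1 - t" if "n > 0" for n
      using that t power_decreasing[of 1 n t] by auto
    define b where "b n = 1 / (real n * (1 - t)) - t ^ n / (1 - t ^ n)" for n
    have "(\<Sum>k=1..K. t ^ (k ^ 2)) = (\<Sum>m\<in>(\<lambda>k. k ^ 2) ` {1..K}. t ^ m)"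
      by (subst sum.reindex) (auto simp: inj_on_def power2_eq_iff_nonneg)
    also have "\<dots> \<le> (\<Sum>m\<in>(\<lambda>k. k ^ 2) ` {1..K}. divisor_sum m * t ^ m)"
    proof (rule sum_mono)
      fix m assume "m \<in> (\<lambda>k. k ^ 2) ` {1..K}"
      hence "divisor_sum m \<ge> 1" using divisor_sum_nonneg[OF real val, of m] by auto
      thus "t ^ m \<le> divisor_sum m * t ^ m" using t mult_right_mono[of 1 "divisor_sum m" "t ^ m"] by simp
    qed
    also have "\<dots> \<le> (\<Sum>m=1..M. divisor_sum m * t ^ m)"
    proof (rule sum_mono2)
      show "(\<lambda>k. k ^ 2) ` {1..K} \<subseteq> {1..M}"
        using M(1) by (auto simp: power_mono intro: order.trans[OF power_mono])
    qed (use divisor_sum_nonneg[OF real val] t in auto)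
    also have "\<dots> = (\<Sum>m=1..M. \<Sum>d | d dvd m. e d * t ^ (d * (m div d)))"
      unfolding divisor_sum_def sum_distrib_right e_def by (intro sum.cong) auto
    also have "\<dots> = (\<Sum>d=1..M. \<Sum>k=1..M div d. e d * t ^ (d * k))"
      by (rule sum_divisors_swap)
    also have "\<dots> \<le> (\<Sum>d=1..M. e d * (t ^ d / (1 - t ^ d)) + t ^ M / (1 - t))"
    proof (rule sum_mono)
      fix d assume d: "d \<in> {1..M}"
      have "(\<Sum>k=1..M div d. t ^ (d * k)) = (\<Sum>k=1..M div d. (t ^ d) ^ k)"
        by (simp add: power_mult)
      also have "\<dots> = (t ^ d - (t ^ d) ^ Suc (M div d)) / (1 - t ^ d)"
        using tn[of d] d by (subst sum_gp) (auto simp: div_greater_zero_iff Suc_le_eq)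
      finally have eq: "(\<Sum>k=1..M div d. t ^ (d * k)) = t ^ d / (1 - t ^ d) - t ^ (d * Suc (M div d)) / (1 - t ^ d)"
        by (simp add: diff_divide_distrib power_mult power_add)
      have "M < d * Suc (M div d)"
        using d by (simp add: dividend_less_times_div)
      hence "t ^ (d * Suc (M div d)) \<le> t ^ M" using t by (intro power_decreasing) auto
      hence "t ^ (d * Suc (M div d)) / (1 - t ^ d) \<le> t ^ M / (1 - t)"
        using tn[of d] d t by (intro frac_le) auto
      moreover have "\<bar>e d * (t ^ (d * Suc (M div d)) / (1 - t ^ d))\<bar> \<le> 1 * (t ^ (d * Suc (M div d)) / (1 - t ^ d))"
        unfolding abs_mult using real_values(3)[OF real] tn[of d] d t by (intro mult_mono) (auto simp: e_def)
      moreover have "(\<Sum>k=1..M div d. e d * t ^ (d * k)) =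
          e d * (t ^ d / (1 - t ^ d)) - e d * (t ^ (d * Suc (M div d)) / (1 - t ^ d))"
        unfolding sum_distrib_left[symmetric] eq by (simp add: algebra_simps)
      ultimately show "(\<Sum>k=1..M div d. e d * t ^ (d * k)) \<le> e d * (t ^ d / (1 - t ^ d)) + t ^ M / (1 - t)"
        by linarith
    qed
    also have "\<dots> = (\<Sum>d=1..M. e d * (t ^ d / (1 - t ^ d))) + real M * t ^ M / (1 - t)"
      by (simp add: sum.distrib)
    also have "(\<Sum>d=1..M. e d * (t ^ d / (1 - t ^ d))) = (\<Sum>d=1..M. e d / real d) / (1 - t) - (\<Sum>d=1..M. e d * b d)"
      by (simp add: b_def sum_subtractf[symmetric] sum_divide_distrib algebra_simps)
    finally have 1: "(\<Sum>k=1..K. t ^ (k ^ 2)) \<le> (\<Sum>d=1..M. e d / real d) / (1 - t) -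
        (\<Sum>d=1..M. e d * b d) + real M * t ^ M / (1 - t)" .
    have 2: "(\<Sum>d=1..M. e d / real d) / (1 - t) \<le> 2 * B / (real M * (1 - t))"
    proof -
      have "(\<Sum>d=1..M. e d / real d) = Re (S M)" by (simp add: S_def e_def)
      also have "\<dots> \<le> norm (S M)" by (rule complex_Re_le_cmod)
      also have "\<dots> \<le> 2 * B / (real M + 1)" using S_L[of M] L by simp
      also have "\<dots> \<le> 2 * B / real M" using M B_nonneg by (intro divide_left_mono) auto
      finally have "(\<Sum>d=1..M. e d / real d) / (1 - t) \<le> 2 * B / real M / (1 - t)"
        using t by (intro divide_right_mono) auto
      thus ?thesis by simp
    qed
    have 3: "- (\<Sum>d=1..M. e d * b d) \<le> 2 * B"
    proof -
      have "norm (\<Sum>d=Suc 0..M. \<eta> d * of_real (b d)) \<le> 2 * B * b (Suc 0)"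
        using lambert_term_antimono[OF t] by (intro norm_sum_by_parts_le sums) (auto simp: b_def)
      also have "b (Suc 0) = 1" using t by (simp add: b_def field_simps)
      finally have "norm (\<Sum>d=1..M. \<eta> d * of_real (b d)) \<le> 2 * B" by simp
      moreover have "Re (\<Sum>d=1..M. \<eta> d * of_real (b d)) = (\<Sum>d=1..M. e d * b d)" by (simp add: e_def)
      moreover have "\<bar>Re (\<Sum>d=1..M. \<eta> d * of_real (b d))\<bar> \<le> norm (\<Sum>d=1..M. \<eta> d * of_real (b d))"
        by (rule abs_Re_le_cmod)
      ultimately show ?thesis by linarith
    qed
    from 1 2 3 show ?thesis by linarith
  qed
  have main2: "(\<Sum>k=1..K. t ^ (k ^ 2)) \<le> 2 * B" if t: "0 < t" "t < 1" for t :: real and K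
  proof (rule tendsto_le)
    have "(\<lambda>M. real M * t ^ M) \<longlonglongrightarrow> 0" using powser_times_n_limit_0[of t] t by simp
    moreover have "(\<lambda>M. inverse (real M)) \<longlonglongrightarrow> 0" by (rule lim_inverse_n)
    ultimately have "(\<lambda>M. 2 * B + (2 * B / (1 - t)) * inverse (real M) + (1 / (1 - t)) * (real M * t ^ M))
        \<longlonglongrightarrow> 2 * B + (2 * B / (1 - t)) * 0 + (1 / (1 - t)) * 0" by (intro tendsto_intros)
    thus "(\<lambda>M. 2 * B + (2 * B / (1 - t)) * inverse (real M) + (1 / (1 - t)) * (real M * t ^ M)) \<longlonglongrightarrow> 2 * B" by simp
    show "(\<lambda>M::nat. (\<Sum>k=1..K. t ^ (k ^ 2))) \<longlonglongrightarrow> (\<Sum>k=1..K. t ^ (k ^ 2))" by simp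
    show "eventually (\<lambda>M. (\<Sum>k=1..K. t ^ (k ^ 2)) \<le> 2 * B + (2 * B / (1 - t)) * inverse (real M) + (1 / (1 - t)) * (real M * t ^ M)) sequentially"
      using eventually_ge_at_top[of "K ^ 2"] eventually_gt_at_top[of 0]
    proof eventually_elim
      case (elim M)
      thus ?case using main[OF t, of K M] by (simp add: field_simps)
    qed
  qed simp
  have "real K \<le> 2 * B" for K :: nat
  proof (rule tendsto_le)
    have "((\<lambda>t. \<Sum>k=1..K. t ^ (k ^ 2)) \<longlongrightarrow> (\<Sum>k=1..K. 1 ^ (k ^ 2))) (at_left (1::real))"
      by (intro tendsto_intros)
    thus "((\<lambda>t. \<Sum>k=1..K. t ^ (k ^ 2)) \<longlongrightarrow> real K) (at_left (1::real))" by simp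
    have "eventually (\<lambda>t::real. t \<in> {0<..<1}) (at_left 1)" by (rule eventually_at_left_real) simp
    thus "eventually (\<lambda>t::real. (\<Sum>k=1..K. t ^ (k ^ 2)) \<le> 2 * B) (at_left 1)"
      by eventually_elim (use main2 in auto)
    show "((\<lambda>t::real. 2 * B) \<longlongrightarrow> 2 * B) (at_left 1)" by simp
  qed simp
  moreover obtain K :: nat where "2 * B < real K" using reals_Archimedean2 by blast
  ultimately show False by (metis not_le)
qed

end

section \<open>Dirichlet characters\<close>

lemma cis_2pi_div_eq_1_iff:
  assumes "n > 0"
  shows "cis (2 * pi * real j / real n) = 1 \<longleftrightarrow> n dvd j"
proof
  assume "n dvd j"
  then obtain i where "j = n * i" by (elim dvdE)
  thus "cis (2 * pi * real j / real n) = 1"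
    using assms cis_multiple_2pi[of "real i"] by (simp add: mult.assoc)
next
  assume "cis (2 * pi * real j / real n) = 1"
  hence "cos (2 * pi * real j / real n) = 1" by (simp add: complex_eq_iff)
  then obtain i :: int where "2 * pi * real j / real n = of_int i * 2 * pi"
    by (auto simp: cos_one_2pi_int)
  hence "real j = of_int i * real n" using assms by (simp add: field_simps)
  hence "int j = i * int n" by (metis of_int_eq_iff of_int_mult of_int_of_nat_eq)
  thus "n dvd j" by (metis dvd_triv_right int_dvd_int_iff)
qed

lemma dc_mult: "dirichlet_character q \<psi> \<Longrightarrow> \<psi> (m * n) = \<psi> m * \<psi> n"
  and dc_pos: "dirichlet_character q \<psi> \<Longrightarrow> q > 0"
  and dc_zero_iff: "dirichlet_character q \<psi> \<Longrightarrow> \<psi> n = 0 \<longleftrightarrow> \<not> coprime n (int q)"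
  by (auto simp: dirichlet_character_def)

lemma dc_1: "dirichlet_character q \<psi> \<Longrightarrow> \<psi> 1 = 1"
  using dc_mult[of q \<psi> 1 1] dc_zero_iff[of q \<psi> 1] by simp

lemma dc_power: "dirichlet_character q \<psi> \<Longrightarrow> \<psi> (n ^ k) = \<psi> n ^ k"
  by (induction k) (simp_all add: dc_1 dc_mult)

lemma dc_add_mult: "dirichlet_character q \<psi> \<Longrightarrow> \<psi> (n + int q * k) = \<psi> n"
proof -
  assume dc: "dirichlet_character q \<psi>"
  have nat: "\<psi> (n + int q * int k) = \<psi> n" for k n
  proof (induction k)
    case (Suc k)
    have "\<psi> (n + int q * int (Suc k)) = \<psi> ((n + int q * int k) + int q)"
      by (simp add: algebra_simps)
    thus ?case using dc Suc by (simp add: dirichlet_character_def)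
  qed simp
  show ?thesis
  proof (cases "k \<ge> 0")
    case True
    thus ?thesis using nat[of n "nat k"] by simp
  next
    case False
    thus ?thesis using nat[of "n + int q * k" "nat (-k)"] by simp
  qed
qed

lemma dc_cong: "dirichlet_character q \<psi> \<Longrightarrow> [m = n] (mod int q) \<Longrightarrow> \<psi> m = \<psi> n"
  by (metis cong_iff_lin dc_add_mult)

lemma dc_power_totient:
  assumes "dirichlet_character q \<psi>" "coprime n (int q)"
  shows "\<psi> n ^ totient q = 1"
proof -
  define m where "m = nat (n mod int q)"
  have q: "int q > 0" using dc_pos[OF assms(1)] by simp
  have m: "[int m = n] (mod int q)" using q by (simp add: m_def cong_def)
  hence "coprime (int m) (int q)" using assms(2) by (metis cong_imp_coprime cong_sym)
  hence "[m ^ totient q = 1] (mod q)" by (intro euler_theorem) simp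
  hence "[int m ^ totient q = 1] (mod int q)" by (metis cong_int_iff of_nat_1 of_nat_power)
  hence "\<psi> (int m ^ totient q) = \<psi> 1" by (rule dc_cong[OF assms(1)])
  moreover have "\<psi> (int m) = \<psi> n" by (rule dc_cong[OF assms(1) m])
  ultimately show ?thesis using assms(1) by (simp add: dc_power dc_1)
qed

lemma dc_norm:
  assumes "dirichlet_character q \<psi>"
  shows "norm (\<psi> n) = (if coprime n (int q) then 1 else 0)"
proof (cases "coprime n (int q)")
  case True
  have "norm (\<psi> n) ^ totient q = 1" using dc_power_totient[OF assms True] by (metis norm_one norm_power)
  moreover have "totient q > 0" using dc_pos[OF assms] by simp
  ultimately show ?thesis using True power_eq_imp_eq_base[of "norm (\<psi> n)" "totient q" 1] by simp
qed (use dc_zero_iff[OF assms] in simp)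

lemma dc_norm_le: "dirichlet_character q \<psi> \<Longrightarrow> norm (\<psi> n) \<le> 1"
  by (simp add: dc_norm)

lemma dc_principal: "q > 0 \<Longrightarrow> dirichlet_character q (principal_character q)"
  by (auto simp: dirichlet_character_def principal_character_def coprime_iff_gcd_eq_1 gcd_add_mult
      coprime_mult_left_iff[unfolded coprime_iff_gcd_eq_1])

lemma dc_times:
  "dirichlet_character q \<psi> \<Longrightarrow> dirichlet_character q \<phi> \<Longrightarrow> dirichlet_character q (\<lambda>n. \<psi> n * \<phi> n)"
  by (auto simp: dirichlet_character_def)

lemma dc_cnj: "dirichlet_character q \<psi> \<Longrightarrow> dirichlet_character q (\<lambda>n. cnj (\<psi> n))"
  by (auto simp: dirichlet_character_def)

lemma dc_pow: "dirichlet_character q \<psi> \<Longrightarrow> k > 0 \<Longrightarrow> dirichlet_character q (\<lambda>n. \<psi> n ^ k)"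
  by (auto simp: dirichlet_character_def power_mult_distrib)

lemma dc_mult_cnj: "dirichlet_character q \<psi> \<Longrightarrow> \<psi> n * cnj (\<psi> n) = principal_character q n"
  by (simp add: complex_norm_square[symmetric] dc_norm principal_character_def)

lemma dc_lift:
  assumes "dirichlet_character m \<psi>" "m dvd M" "M > 0"
  shows "dirichlet_character M (\<lambda>n. \<psi> n * principal_character M n)"
proof -
  obtain k where k: "M = m * k" using assms(2) by (elim dvdE)
  have cop: "coprime n (int M) \<Longrightarrow> coprime n (int m)" for n by (simp add: k)
  have "\<psi> (n + int M) = \<psi> n" for n
    using dc_add_mult[OF assms(1), of n "int k"] by (simp add: k)
  thus ?thesis using assms(1) dc_principal[OF assms(3)] cop
    by (auto simp: dirichlet_character_def principal_character_def)
qed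

lemma sum_mult_residues:
  fixes f :: "int \<Rightarrow> 'a :: comm_monoid_add"
  assumes q: "q > 0" and a: "coprime a (int q)" and f: "\<And>m n. [m = n] (mod int q) \<Longrightarrow> f m = f n"
  shows "(\<Sum>n<q. f (a * int n)) = (\<Sum>n<q. f (int n))"
proof -
  define h where "h n = nat ((a * int n) mod int q)" for n
  have hq: "h n < q" for n using q by (simp add: h_def nat_less_iff)
  have h: "[int (h n) = a * int n] (mod int q)" for n using q by (simp add: h_def cong_def)
  have "inj_on h {..<q}"
  proof (rule inj_onI)
    fix m n assume mn: "m \<in> {..<q}" "n \<in> {..<q}" "h m = h n"
    have "[a * int m = a * int n] (mod int q)" using h[of m] h[of n] mn(3) by (metis cong_sym cong_trans)
    hence "[int m = int n] (mod int q)" using a by (simp add: cong_mult_lcancel)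
    thus "m = n" using mn by (simp add: cong_int_iff cong_def)
  qed
  moreover have "h ` {..<q} \<subseteq> {..<q}" using hq by auto
  ultimately have "bij_betw h {..<q} {..<q}" by (simp add: bij_betw_def endo_inj_surj)
  from sum.reindex_bij_betw[OF this, of "\<lambda>n. f (int n)"] have "(\<Sum>n<q. f (int (h n))) = (\<Sum>n<q. f (int n))" .
  moreover have "f (int (h n)) = f (a * int n)" for n by (rule f) (rule h)
  ultimately show ?thesis by simp
qed

lemma dc_neq_principal:
  assumes "dirichlet_character q \<psi>" "\<psi> \<noteq> principal_character q"
  obtains a where "coprime a (int q)" "\<psi> a \<noteq> 1"
proof -
  obtain a where a: "\<psi> a \<noteq> principal_character q a" using assms(2) by auto
  hence "coprime a (int q)" using dc_zero_iff[OF assms(1), of a] by (auto simp: principal_character_def split: if_splits)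
  thus ?thesis using a that by (auto simp: principal_character_def)
qed

lemma dc_sum_eq_0:
  assumes dc: "dirichlet_character q \<psi>" and np: "\<psi> \<noteq> principal_character q"
  shows "(\<Sum>n<q. \<psi> (int n)) = 0"
proof -
  obtain a where a: "coprime a (int q)" "\<psi> a \<noteq> 1" using dc_neq_principal[OF assms] .
  have "\<psi> a * (\<Sum>n<q. \<psi> (int n)) = (\<Sum>n<q. \<psi> (a * int n))"
    by (simp add: sum_distrib_left dc_mult[OF dc])
  also have "\<dots> = (\<Sum>n<q. \<psi> (int n))"
    using dc_pos[OF dc] a(1) dc_cong[OF dc] by (intro sum_mult_residues) auto
  finally show ?thesis using a(2) by simp
qed

lemma dc_partial_sum_le:
  assumes dc: "dirichlet_character q \<psi>" and np: "\<psi> \<noteq> principal_character q"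
  shows "norm (\<Sum>n=1..k. \<psi> (int n)) \<le> real q"
proof (induction k rule: less_induct)
  case (less k)
  show ?case
  proof (cases "k < q")
    case True
    have "norm (\<Sum>n=1..k. \<psi> (int n)) \<le> (\<Sum>n=1..k. 1)"
      using dc_norm_le[OF dc] by (intro sum_norm_le) auto
    thus ?thesis using True by simp
  next
    case False
    have per: "\<psi> (int (n + q)) = \<psi> (int n)" for n
      using dc_add_mult[OF dc, of "int n" 1] by simp
    have "(\<Sum>n=1..q. \<psi> (int n)) = (\<Sum>n<q. \<psi> (int (Suc n)))"
      by (rule sum.reindex_bij_witness[of _ Suc "\<lambda>n. n - 1"]) auto
    also have "\<dots> = (\<Sum>n<q. \<psi> (int n)) + \<psi> (int q) - \<psi> 0"
      using sum.lessThan_Suc_shift[of "\<lambda>n. \<psi> (int n)" q] by (simp add: algebra_simps)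
    also have "\<dots> = 0" using dc_sum_eq_0[OF assms] per[of 0] by simp
    finally have 0: "(\<Sum>n=1..q. \<psi> (int n)) = 0" .
    have "(\<Sum>n=1..k. \<psi> (int n)) = (\<Sum>n=1..q. \<psi> (int n)) + (\<Sum>n=Suc q..k. \<psi> (int n))"
      using False sum.ub_add_nat[of 1 q "\<lambda>n. \<psi> (int n)" "k - q"] by simp
    also have "(\<Sum>n=Suc q..k. \<psi> (int n)) = (\<Sum>n=1..k-q. \<psi> (int (n + q)))"
      using False by (intro sum.reindex_bij_witness[of _ "\<lambda>n. n + q" "\<lambda>n. n - q"]) auto
    finally have "(\<Sum>n=1..k. \<psi> (int n)) = (\<Sum>n=1..k-q. \<psi> (int n))" by (simp only: 0 per add_0)
    thus ?thesis using less.IH[of "k - q"] False dc_pos[OF dc] by simp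
  qed
qed

text \<open>A character is determined by its values on one period, and these are 0 or roots of unity
  of order dividing \<open>totient q\<close>.\<close>

lemma finite_dc: "finite {\<psi>. dirichlet_character q \<psi>}"
proof (cases "q = 0")
  case False
  define Z where "Z = insert 0 {z::complex. z ^ totient q = 1}"
  define F where "F = PiE {..<q} (\<lambda>_. Z)"
  have "finite {z::complex. z ^ totient q = 1}" using False by (intro finite_roots_unity) (simp add: Suc_le_eq)
  hence "finite F" unfolding F_def Z_def by (intro finite_PiE) auto
  define r where "r \<psi> = (\<lambda>n\<in>{..<q}. \<psi> (int n))" for \<psi> :: "int \<Rightarrow> complex"
  have "r ` {\<psi>. dirichlet_character q \<psi>} \<subseteq> F"
  proof
    fix f assume "f \<in> r ` {\<psi>. dirichlet_character q \<psi>}"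
    then obtain \<psi> where \<psi>: "dirichlet_character q \<psi>" "f = r \<psi>" by auto
    have "\<psi> (int n) \<in> Z" for n
      using dc_power_totient[OF \<psi>(1), of "int n"] dc_zero_iff[OF \<psi>(1), of "int n"] by (auto simp: Z_def)
    thus "f \<in> F" by (auto simp: F_def \<psi>(2) r_def)
  qed
  moreover have "inj_on r {\<psi>. dirichlet_character q \<psi>}"
  proof (rule inj_onI)
    fix \<psi> \<phi> assume a: "\<psi> \<in> {\<psi>. dirichlet_character q \<psi>}" "\<phi> \<in> {\<psi>. dirichlet_character q \<psi>}" "r \<psi> = r \<phi>"
    show "\<psi> = \<phi>"
    proof
      fix n
      define m where "m = nat (n mod int q)"
      have m: "m < q" "[n = int m] (mod int q)" using False by (auto simp: m_def cong_def nat_less_iff)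
      have "\<psi> (int m) = \<phi> (int m)" using fun_cong[OF a(3), of m] m by (simp add: r_def)
      thus "\<psi> n = \<phi> n" using a m(2) dc_cong by (metis mem_Collect_eq)
    qed
  qed
  ultimately show ?thesis using \<open>finite F\<close> finite_subset finite_imageD by metis
next
  case True
  hence "{\<psi>. dirichlet_character q \<psi>} = {}" by (auto simp: dirichlet_character_def)
  thus ?thesis by simp
qed

lemma dc_sum_characters_eq_0:
  assumes dc: "dirichlet_character q \<phi>" and a: "\<phi> a \<noteq> 1" "coprime a (int q)"
  shows "(\<Sum>\<psi> | dirichlet_character q \<psi>. \<psi> a) = 0"
proof -
  define T where "T = (\<lambda>\<psi> n. \<phi> n * \<psi> n :: complex)"
  have "bij_betw T {\<psi>. dirichlet_character q \<psi>} {\<psi>. dirichlet_character q \<psi>}"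
  proof (rule bij_betwI[of _ _ _ "\<lambda>\<psi> n. cnj (\<phi> n) * \<psi> n"])
    have "principal_character q n * \<psi> n = \<psi> n" if "dirichlet_character q \<psi>" for \<psi> n
      using dc_zero_iff[OF that, of n] by (auto simp: principal_character_def)
    thus "(\<lambda>n. cnj (\<phi> n) * T \<psi> n) = \<psi>" if "\<psi> \<in> {\<psi>. dirichlet_character q \<psi>}" for \<psi>
      using that dc_mult_cnj[OF dc] by (auto simp: T_def mult.assoc[symmetric] mult.commute[of "cnj _"])
    thus "T (\<lambda>n. cnj (\<phi> n) * \<psi> n) = \<psi>" if "\<psi> \<in> {\<psi>. dirichlet_character q \<psi>}" for \<psi>
      using that unfolding T_def by (auto simp: mult.left_commute)
  qed (auto simp: T_def intro!: dc_times dc dc_cnj)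
  from sum.reindex_bij_betw[OF this, of "\<lambda>\<psi>. \<psi> a"]
  have "\<phi> a * (\<Sum>\<psi> | dirichlet_character q \<psi>. \<psi> a) = (\<Sum>\<psi> | dirichlet_character q \<psi>. \<psi> a)"
    by (simp add: T_def sum_distrib_left)
  thus ?thesis using a by simp
qed

text \<open>The character is the exponential of the discrete logarithm to base
  \<open>\<rho>\<close>. The logarithm is only chosen, but any two choices are congruent modulo
  \<open>totient m\<close>, which the exponential does not see.\<close>

lemma generator_character:
  assumes m: "m > 0" and \<rho>: "residue_primroot m \<rho>"
  shows "\<exists>\<psi>. dirichlet_character m \<psi> \<and> (\<forall>j. \<psi> (int \<rho> ^ j) = cis (2 * pi * real j / real (totient m)))"
proof -
  define \<phi> where "\<phi> = totient m"
  have \<phi>0: "\<phi> > 0" using m by (simp add: \<phi>_def)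
  have cop: "coprime m \<rho>" and ord: "ord m \<rho> = \<phi>" using \<rho> by (auto simp: residue_primroot_def \<phi>_def)
  have gen: "\<exists>j. [int \<rho> ^ j = n] (mod int m)" if "coprime n (int m)" for n
  proof (cases "m = 1")
    case False
    define a where "a = nat (n mod int m)"
    have a: "[int a = n] (mod int m)" using m by (simp add: a_def cong_def)
    hence "coprime (int a) (int m)" using that by (metis cong_imp_coprime cong_sym)
    hence "coprime a m" by simp
    moreover have "a < m" using m by (simp add: a_def nat_less_iff)
    ultimately have "a \<in> totatives m" using False by (auto simp: totatives_def intro!: Nat.gr0I)
    moreover have "bij_betw (\<lambda>i. \<rho> ^ i mod m) {..<totient m} (totatives m)"
      using residue_primroot_is_generator[OF _ \<rho>] m False by simp
    ultimately obtain j where "a = \<rho> ^ j mod m" by (auto simp: bij_betw_def)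
    hence "[int \<rho> ^ j = int a] (mod int m)" by (simp add: cong_def zmod_int)
    thus ?thesis using a by (meson cong_trans)
  qed auto
  have idx: "[int \<rho> ^ i = int \<rho> ^ j] (mod int m) \<longleftrightarrow> [i = j] (mod \<phi>)" for i j
    using order_divides_expdiff[of m \<rho> i j] cop ord by (metis cong_int_iff of_nat_power)
  have cisc: "cis (2 * pi * real i / real \<phi>) = cis (2 * pi * real j / real \<phi>)" if "[i = j] (mod \<phi>)" for i j
  proof -
    have "cis (2 * pi * real (j + \<phi> * k) / real \<phi>) = cis (2 * pi * real j / real \<phi>)" for j k
    proof -
      have "2 * pi * real (j + \<phi> * k) / real \<phi> = 2 * pi * real j / real \<phi> + 2 * pi * real k"
        using \<phi>0 by (simp add: field_simps)
      thus ?thesis by (simp add: cis_mult[symmetric] cis_multiple_2pi)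
    qed
    note * = this
    have "i = j mod \<phi> + \<phi> * (i div \<phi>)" "j = j mod \<phi> + \<phi> * (j div \<phi>)"
      using that mod_mult_div_eq[of i \<phi>] by (auto simp: cong_def)
    thus ?thesis using *[of "j mod \<phi>"] by metis
  qed
  define dlog where "dlog n = (SOME j. [int \<rho> ^ j = n] (mod int m))" for n
  have dlog: "[int \<rho> ^ dlog n = n] (mod int m)" if "coprime n (int m)" for n
    using gen[OF that] unfolding dlog_def by (rule someI_ex)
  define \<psi> where "\<psi> n = (if coprime n (int m) then cis (2 * pi * real (dlog n) / real \<phi>) else 0)" for n
  have \<psi>_eq: "\<psi> n = cis (2 * pi * real j / real \<phi>)" if "[int \<rho> ^ j = n] (mod int m)" for n j
  proof -
    have "coprime (int \<rho> ^ j) (int m)" using cop by (simp add: coprime_commute)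
    hence c: "coprime n (int m)" using that by (metis cong_imp_coprime)
    have "[int \<rho> ^ dlog n = int \<rho> ^ j] (mod int m)" using dlog[OF c] that by (meson cong_sym cong_trans)
    thus ?thesis using c cisc by (simp add: \<psi>_def idx)
  qed
  have "dirichlet_character m \<psi>" unfolding dirichlet_character_def
  proof (intro conjI allI m)
    fix a b
    show "\<psi> (a * b) = \<psi> a * \<psi> b"
    proof (cases "coprime a (int m) \<and> coprime b (int m)")
      case True
      hence "[int \<rho> ^ (dlog a + dlog b) = a * b] (mod int m)"
        using dlog by (simp add: power_add cong_mult)
      from \<psi>_eq[OF this] show ?thesis using True
        by (simp add: \<psi>_def cis_mult add_divide_distrib distrib_left)
    qed (auto simp: \<psi>_def)
  next
    fix n
    show "\<psi> n = 0 \<longleftrightarrow> \<not> coprime n (int m)" by (simp add: \<psi>_def)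
    have c: "coprime (n + int m) (int m) \<longleftrightarrow> coprime n (int m)"
      by (simp add: coprime_iff_gcd_eq_1 gcd_add_mult)
    show "\<psi> (n + int m) = \<psi> n"
    proof (cases "coprime n (int m)")
      case True
      have "[int \<rho> ^ dlog n = n + int m] (mod int m)" using dlog[OF True] by (simp add: cong_def)
      from \<psi>_eq[OF this] True show ?thesis by (simp add: \<psi>_def)
    qed (use c in \<open>simp add: \<psi>_def\<close>)
  qed
  moreover have "\<psi> (int \<rho> ^ j) = cis (2 * pi * real j / real (totient m))" for j
    using \<psi>_eq[OF cong_refl] by (simp add: \<phi>_def)
  ultimately show ?thesis by blast
qed

section \<open>Primes in arithmetic progressions\<close>

text \<open>Some prime power dividing \<open>M\<close> does not divide \<open>a - 1\<close>. As
  \<open>M\<close> is odd, this prime power has a primitive root, and the generating character to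
  that modulus differs from 1 at \<open>a\<close>. Hence the odd moduli throughout: no structure
  theorem for finite abelian groups is involved.\<close>

lemma separating_character:
  assumes M: "M > 0" "odd M" and a: "coprime a (int M)" "\<not> [a = 1] (mod int M)"
  shows "\<exists>\<psi>. dirichlet_character M \<psi> \<and> \<psi> a \<noteq> 1"
proof -
  have "\<not> int M dvd a - 1" using a(2) by (simp add: cong_iff_dvd_diff)
  then obtain p k where pk: "prime p" "p ^ k dvd M" "\<not> int (p ^ k) dvd a - 1"
  proof -
    have "\<not> (\<forall>p k. prime p \<longrightarrow> p ^ k dvd M \<longrightarrow> p ^ k dvd nat \<bar>a - 1\<bar>)"
    proof
      assume *: "\<forall>p k. prime p \<longrightarrow> p ^ k dvd M \<longrightarrow> p ^ k dvd nat \<bar>a - 1\<bar>"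
      have "M dvd nat \<bar>a - 1\<bar>"
      proof (cases "nat \<bar>a - 1\<bar> = 0")
        case False
        show ?thesis
        proof (rule multiplicity_le_imp_dvd)
          fix p :: nat assume p: "prime p"
          have "p ^ multiplicity p M dvd nat \<bar>a - 1\<bar>" using * p multiplicity_dvd by blast
          thus "multiplicity p M \<le> multiplicity p (nat \<bar>a - 1\<bar>)"
            using False p by (intro multiplicity_geI) auto
        qed (use M in auto)
      qed simp
      hence "int M dvd a - 1" by (simp add: dvd_nat_abs_iff)
      thus False using \<open>\<not> int M dvd a - 1\<close> by simp
    qed
    thus ?thesis using that by (auto simp: dvd_nat_abs_iff)
  qed
  define m where "m = p ^ k"
  have k: "k > 0" using pk(3) by (cases k) auto
  have "odd p" using pk(2) M(2) k by (meson dvd_power dvd_trans even_power)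
  have m0: "m > 0" using pk(1) prime_gt_0_nat by (simp add: m_def)
  obtain g where "\<forall>k>0. residue_primroot (p ^ k) g"
    using residue_primroot_odd_prime_power_exists[OF pk(1) \<open>odd p\<close>] by blast
  hence \<rho>: "residue_primroot m g" using k by (simp add: m_def)
  obtain \<psi> where \<psi>: "dirichlet_character m \<psi>" "\<And>j. \<psi> (int g ^ j) = cis (2 * pi * real j / real (totient m))"
    using generator_character[OF m0 \<rho>] by blast
  have am: "coprime a (int m)" using a(1) pk(2) unfolding m_def by (auto elim!: dvdE)
  have m1: "m > 1" using one_less_power[OF prime_gt_1_nat[OF pk(1)] k] by (simp add: m_def)
  define b where "b = nat (a mod int m)"
  have b: "[int b = a] (mod int m)" "b < m" using m0 by (auto simp: b_def cong_def nat_less_iff)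
  hence "coprime (int b) (int m)" using am by (metis cong_imp_coprime cong_sym)
  hence "b \<in> totatives m" using b(2) m1 by (auto simp: totatives_def intro!: Nat.gr0I)
  then obtain j where j: "j < totient m" "b = g ^ j mod m"
    using residue_primroot_is_generator[OF m1 \<rho>] by (auto simp: bij_betw_def)
  hence "[int g ^ j = int b] (mod int m)" by (simp add: cong_def zmod_int)
  hence ga: "[int g ^ j = a] (mod int m)" using b(1) by (meson cong_trans)
  have j0: "j > 0"
  proof (rule Nat.gr0I)
    assume "j = 0"
    hence "[1 = a] (mod int m)" using ga by simp
    thus False using pk(3) by (simp add: m_def cong_iff_dvd_diff dvd_diff_commute)
  qed
  have "\<psi> a = cis (2 * pi * real j / real (totient m))"
    using dc_cong[OF \<psi>(1) ga] \<psi>(2) by simp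
  moreover have "cis (2 * pi * real j / real (totient m)) \<noteq> 1"
    using j(1) j0 m0 by (auto simp: cis_2pi_div_eq_1_iff dest: dvd_imp_le)
  ultimately have "\<psi> a * principal_character M a \<noteq> 1" using a(1) by (simp add: principal_character_def)
  thus ?thesis using dc_lift[OF \<psi>(1) _ M(1)] pk(2) unfolding m_def by blast
qed

definition twist :: "(int \<Rightarrow> complex) \<Rightarrow> nat \<Rightarrow> complex" where
  "twist \<psi> N = (\<Sum>d=1..N. \<psi> (int d) * of_real (\<Lambda> d) / of_nat d)"

text \<open>The dichotomy according to whether the L-function vanishes at 1. The second alternative
  is confined to nonreal characters, so that \<open>twist_bounded\<close> can play a character
  against its conjugate.\<close>

lemma twist_nonprincipal:
  assumes dc: "dirichlet_character q \<psi>" and np: "\<psi> \<noteq> principal_character q"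
  shows "(\<exists>C. \<forall>N>0. norm (twist \<psi> N) \<le> C) \<or>
    ((\<exists>n. cnj (\<psi> n) \<noteq> \<psi> n) \<and> (\<exists>C. \<forall>N>0. norm (twist \<psi> N + of_real (ln (real N))) \<le> C))"
proof -
  interpret bounded_character "\<lambda>n. \<psi> (int n)" "real q"
    by standard (use dc_1[OF dc] dc_mult[OF dc] dc_norm_le[OF dc] dc_partial_sum_le[OF assms] in auto)
  have W: "W = twist \<psi>" by (rule ext) (simp add: W_def twist_def)
  show ?thesis
  proof (cases "L = 0")
    case False
    thus ?thesis using W_bounded by (auto simp: W)
  next
    case True
    have "\<exists>n. cnj (\<psi> n) \<noteq> \<psi> n"
    proof (rule ccontr)
      assume "\<not> ?thesis"
      hence re: "\<psi> n \<in> \<real>" for n by (simp add: complex_is_Real_iff complex_eq_iff)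
      have "Re (\<psi> n) \<in> {-1, 0, 1}" for n
      proof (cases "\<psi> n = 0")
        case False
        hence "norm (\<psi> n) = 1" using dc_norm[OF dc] dc_zero_iff[OF dc] by auto
        hence "\<bar>Re (\<psi> n)\<bar> = 1" using re[of n] by (auto simp: complex_is_Real_iff cmod_def power2_eq_1_iff)
        thus ?thesis by auto
      qed simp
      thus False using L_nonzero_real re True by blast
    qed
    thus ?thesis using W_zero_case[OF True] by (simp add: W)
  qed
qed

lemma twist_cnj: "twist (\<lambda>n. cnj (\<psi> n)) N = cnj (twist \<psi> N)"
proof -
  have "cnj (mangoldt d) = mangoldt d" for d
    by (metis complex_cnj_complex_of_real of_real_mangoldt)
  thus ?thesis by (simp add: twist_def)
qed

text \<open>The terms lost by coprimality belong to proper prime powers or to primes dividing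
  \<open>M\<close>, and both have bounded sum.\<close>

lemma twist_principal:
  assumes "M > 0"
  shows "\<exists>C. \<forall>N>0. norm (twist (principal_character M) N - of_real (ln (real N))) \<le> C"
proof -
  obtain C where C: "\<And>N. (\<Sum>d | d \<in> {1..N} \<and> \<not> prime d. \<Lambda> d / real d) \<le> C"
    using prime_power_sum_bounded by blast
  define E where "E = (\<Sum>d=1..M. \<Lambda> d / real d)"
  have "norm (twist (principal_character M) N - of_real (ln (real N))) \<le> 5 + C + E" if N: "N > 0" for N
  proof -
    define T where "T = (\<Sum>d | d \<in> {1..N} \<and> coprime d M. \<Lambda> d / real d)"
    define U where "U = (\<Sum>d | d \<in> {1..N} \<and> \<not> coprime d M. \<Lambda> d / real d)"
    have "twist (principal_character M) N = (\<Sum>d=1..N. if coprime d M then of_real (\<Lambda> d / real d) else 0)"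
      unfolding twist_def principal_character_def by (intro sum.cong) auto
    also have "\<dots> = of_real T" unfolding T_def of_real_sum
      by (intro sum.mono_neutral_cong_right) auto
    finally have eq: "twist (principal_character M) N = of_real T" .
    have split: "(\<Sum>d=1..N. \<Lambda> d / real d) = T + U"
      unfolding T_def U_def by (subst sum.union_disjoint[symmetric]) (auto intro!: sum.cong)
    have "U \<le> (\<Sum>d\<in>{d. d \<in> {1..N} \<and> \<not> prime d} \<union> {1..M}. \<Lambda> d / real d)"
      unfolding U_def
    proof (rule sum_mono2)
      show "{d \<in> {1..N}. \<not> coprime d M} \<subseteq> {d \<in> {1..N}. \<not> prime d} \<union> {1..M}"
      proof
        fix d assume d: "d \<in> {d \<in> {1..N}. \<not> coprime d M}"
        show "d \<in> {d \<in> {1..N}. \<not> prime d} \<union> {1..M}"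
        proof (cases "prime d")
          case True
          hence "d dvd M" using d prime_imp_coprime_nat by blast
          thus ?thesis using d assms by (auto dest: dvd_imp_le)
        qed (use d in auto)
      qed
    qed (auto simp: mangoldt_nonneg)
    also have "\<dots> \<le> (\<Sum>d\<in>{d. d \<in> {1..N} \<and> \<not> prime d}. \<Lambda> d / real d) + (\<Sum>d\<in>{1..M}. \<Lambda> d / real d)"
      by (subst sum.union_inter[symmetric]) (auto simp: mangoldt_nonneg intro!: sum_nonneg)
    also have "\<dots> \<le> C + E" using C[of N] unfolding E_def by simp
    finally have "U \<le> C + E" .
    moreover have "U \<ge> 0" unfolding U_def by (intro sum_nonneg) (simp add: mangoldt_nonneg)
    ultimately have "\<bar>T - ln (real N)\<bar> \<le> 5 + C + E"
      using split mertens_lower[OF N] mertens_upper[OF N] by linarith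
    moreover have "twist (principal_character M) N - of_real (ln (real N)) = of_real (T - ln (real N))"
      by (simp add: eq)
    ultimately show ?thesis by (simp only: norm_of_real)
  qed
  thus ?thesis by blast
qed

lemma ln_unbounded: "\<exists>N>0. ln (real N) > K"
proof -
  obtain N :: nat where "exp K < real N" using reals_Archimedean2 by blast
  moreover from this have "real N > 0" using exp_gt_zero[of K] by linarith
  ultimately show ?thesis using ln_less_cancel_iff[of "exp K" "real N"] by (intro exI[of _ N]) auto
qed

lemma sum_characters:
  assumes M: "M > 0" "odd M" and a: "coprime a (int M)"
  shows "(\<Sum>\<psi> | dirichlet_character M \<psi>. \<psi> a) =
    (if [a = 1] (mod int M) then of_nat (card {\<psi>. dirichlet_character M \<psi>}) else 0)"
proof (cases "[a = 1] (mod int M)")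
  case True
  have "(\<Sum>\<psi> | dirichlet_character M \<psi>. \<psi> a) = (\<Sum>\<psi> | dirichlet_character M \<psi>. 1)"
    using dc_cong True dc_1 by (intro sum.cong refl) (metis mem_Collect_eq)
  thus ?thesis using True by simp
next
  case False
  then obtain \<phi> where "dirichlet_character M \<phi>" "\<phi> a \<noteq> 1" using separating_character[OF M a] by blast
  thus ?thesis using dc_sum_characters_eq_0 a False by simp
qed

lemma sum_principal: "M > 1 \<Longrightarrow> (\<Sum>n<M. principal_character M (int n)) = of_nat (totient M)"
proof -
  assume M: "M > 1"
  have "(\<Sum>n<M. principal_character M (int n)) = (\<Sum>n\<in>{n\<in>{..<M}. coprime n M}. 1)"
    unfolding principal_character_def by (simp add: sum.If_cases Int_def)
  also have "{n\<in>{..<M}. coprime n M} = totatives M"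
    using M by (auto simp: totatives_def intro!: Nat.gr0I order.not_eq_order_implies_strict)
  finally show ?thesis by (simp add: totient_def)
qed

text \<open>The sum of all characters over one period is evaluated in both orders: one leaves only
  the residue 1, the other only the principal character.\<close>

lemma card_characters:
  assumes M: "M > 1" "odd M"
  shows "card {\<psi>. dirichlet_character M \<psi>} = totient M"
proof -
  let ?D = "{\<psi>. dirichlet_character M \<psi>}"
  have "(\<Sum>n<M. \<Sum>\<psi>\<in>?D. \<psi> (int n)) = (\<Sum>n<M. if n = 1 then of_nat (card ?D) else 0)"
  proof (intro sum.cong refl)
    fix n assume n: "n \<in> {..<M}"
    show "(\<Sum>\<psi>\<in>?D. \<psi> (int n)) = (if n = 1 then of_nat (card ?D) else (0::complex))"
    proof (cases "coprime n M")
      case True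
      have "[int n = 1] (mod int M) \<longleftrightarrow> n = 1"
        using n M cong_int_iff[of n 1 M] by (auto simp: cong_def)
      thus ?thesis using sum_characters[of M "int n"] M True by simp
    next
      case False
      hence "\<psi> (int n) = 0" if "\<psi> \<in> ?D" for \<psi> using that dc_zero_iff[of M \<psi> "int n"] by simp
      hence "(\<Sum>\<psi>\<in>?D. \<psi> (int n)) = 0" by (intro sum.neutral) blast
      moreover have "n \<noteq> 1" using False by auto
      ultimately show ?thesis by simp
    qed
  qed
  also have "\<dots> = of_nat (card ?D)" using M by simp
  finally have 1: "(\<Sum>n<M. \<Sum>\<psi>\<in>?D. \<psi> (int n)) = of_nat (card ?D)" .
  have "(\<Sum>n<M. \<Sum>\<psi>\<in>?D. \<psi> (int n)) = (\<Sum>\<psi>\<in>?D. \<Sum>n<M. \<psi> (int n))" by (rule sum.swap)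
  also have "\<dots> = (\<Sum>\<psi>\<in>?D. if \<psi> = principal_character M then of_nat (totient M) else 0)"
    using dc_sum_eq_0 sum_principal[OF M(1)] by (intro sum.cong refl) auto
  also have "\<dots> = of_nat (totient M)"
    using finite_dc[of M] dc_principal[of M] M by simp
  finally have "complex_of_nat (card ?D) = of_nat (totient M)" using 1 by simp
  thus ?thesis by (simp only: of_nat_eq_iff)
qed

text \<open>If the L-function of \<open>\<phi>\<close> vanished at 1, so would that of its
  conjugate. Summed over all characters, \<open>twist\<close> would then be at most
  \<open>ln N - 2 * ln N\<close> plus a constant, but the sum is nonnegative because it only counts
  \<open>d\<close> congruent to 1.\<close>

lemma twist_bounded:
  assumes M: "M > 1" "odd M" and dc: "dirichlet_character M \<phi>" and np: "\<phi> \<noteq> principal_character M"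
  shows "\<exists>C. \<forall>N>0. norm (twist \<phi> N) \<le> C"
proof (rule ccontr)
  assume "\<not> ?thesis"
  with twist_nonprincipal[OF dc np] have re: "\<exists>n. cnj (\<phi> n) \<noteq> \<phi> n"
    and bd: "\<exists>C. \<forall>N>0. norm (twist \<phi> N + of_real (ln (real N))) \<le> C" by auto
  let ?D = "{\<psi>. dirichlet_character M \<psi>}"
  define \<phi>' where "\<phi>' = (\<lambda>n. cnj (\<phi> n))"
  have dc': "dirichlet_character M \<phi>'" unfolding \<phi>'_def by (rule dc_cnj[OF dc])
  have ne: "\<phi> \<noteq> \<phi>'" using re by (metis \<phi>'_def)
  have np': "\<phi>' \<noteq> principal_character M"
  proof
    assume "\<phi>' = principal_character M"
    hence "cnj (\<phi>' n) = cnj (principal_character M n)" for n by simp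
    hence "\<phi> n = principal_character M n" for n by (simp add: \<phi>'_def principal_character_def split: if_splits)
    thus False using np by blast
  qed
  obtain C1 where C1: "\<And>N. N > 0 \<Longrightarrow> norm (twist \<phi> N + of_real (ln (real N))) \<le> C1" using bd by blast
  have C1': "norm (twist \<phi>' N + of_real (ln (real N))) \<le> C1" if "N > 0" for N
  proof -
    have "twist \<phi>' N + of_real (ln (real N)) = cnj (twist \<phi> N + of_real (ln (real N)))"
      by (simp add: \<phi>'_def twist_cnj)
    thus ?thesis using C1[OF that] by (simp only: complex_mod_cnj)
  qed
  obtain C2 where C2: "\<And>N. N > 0 \<Longrightarrow> norm (twist (principal_character M) N - of_real (ln (real N))) \<le> C2"
    using twist_principal[of M] M by auto
  \<comment> \<open>For the remaining characters an upper bound of the real part is enough, so a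
    zero at 1 does no harm: it would push the real part down to about \<open>- ln N\<close>.\<close>
  have "\<exists>C. \<forall>N>0. Re (twist \<psi> N) \<le> C" if "\<psi> \<in> ?D" "\<psi> \<noteq> principal_character M" for \<psi>
  proof -
    from twist_nonprincipal[OF _ that(2)] that(1)
    have "(\<exists>C. \<forall>N>0. norm (twist \<psi> N) \<le> C) \<or> (\<exists>C. \<forall>N>0. norm (twist \<psi> N + of_real (ln (real N))) \<le> C)" by blast
    thus ?thesis
    proof
      assume "\<exists>C. \<forall>N>0. norm (twist \<psi> N) \<le> C"
      thus ?thesis by (meson complex_Re_le_cmod order_trans)
    next
      assume "\<exists>C. \<forall>N>0. norm (twist \<psi> N + of_real (ln (real N))) \<le> C"
      then obtain C where C: "\<And>N. N > 0 \<Longrightarrow> norm (twist \<psi> N + of_real (ln (real N))) \<le> C" by blast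
      have "Re (twist \<psi> N) \<le> C" if "N > 0" for N
      proof -
        have "Re (twist \<psi> N) + ln (real N) \<le> C"
          using C[OF that] complex_Re_le_cmod[of "twist \<psi> N + of_real (ln (real N))"] by simp
        moreover have "ln (real N) \<ge> 0" using that by simp
        ultimately show ?thesis by linarith
      qed
      thus ?thesis by blast
    qed
  qed
  then obtain K where K: "\<And>\<psi> N. \<psi> \<in> ?D \<Longrightarrow> \<psi> \<noteq> principal_character M \<Longrightarrow> N > 0 \<Longrightarrow> Re (twist \<psi> N) \<le> K \<psi>"
    by metis
  define R where "R = ?D - {principal_character M, \<phi>, \<phi>'}"
  have le: "ln (real N) \<le> C2 + 2 * C1 + (\<Sum>\<psi>\<in>R. K \<psi>)" if N: "N > 0" for N
  proof -
    have "0 \<le> Re (\<Sum>\<psi>\<in>?D. twist \<psi> N)"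
    proof -
      have "(\<Sum>\<psi>\<in>?D. twist \<psi> N) = (\<Sum>d=1..N. (\<Sum>\<psi>\<in>?D. \<psi> (int d)) * of_real (\<Lambda> d) / of_nat d)"
        unfolding twist_def by (subst sum.swap) (simp add: sum_distrib_right sum_divide_distrib)
      also have "Re \<dots> = (\<Sum>d=1..N. Re (\<Sum>\<psi>\<in>?D. \<psi> (int d)) * \<Lambda> d / real d)" by simp
      also have "\<dots> \<ge> 0"
      proof (intro sum_nonneg divide_nonneg_nonneg mult_nonneg_nonneg mangoldt_nonneg)
        fix d
        show "Re (\<Sum>\<psi>\<in>?D. \<psi> (int d)) \<ge> 0"
        proof (cases "coprime d M")
          case True
          thus ?thesis using sum_characters[of M "int d"] M by simp
        next
          case False
          hence "\<psi> (int d) = 0" if "\<psi> \<in> ?D" for \<psi> using that dc_zero_iff[of M \<psi> "int d"] by simp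
          hence "(\<Sum>\<psi>\<in>?D. \<psi> (int d)) = 0" by (intro sum.neutral) blast
          thus ?thesis by simp
        qed
      qed auto
      finally show ?thesis .
    qed
    also have "?D = insert (principal_character M) (insert \<phi> (insert \<phi>' R))"
      using dc dc' dc_principal[of M] M by (auto simp: R_def)
    also have "(\<Sum>\<psi>\<in>\<dots>. twist \<psi> N) = twist (principal_character M) N + (twist \<phi> N + (twist \<phi>' N + (\<Sum>\<psi>\<in>R. twist \<psi> N)))"
      using finite_dc[of M] ne np np' by (subst sum.insert; (simp add: R_def)?)+
    also have "Re \<dots> = Re (twist (principal_character M) N) + Re (twist \<phi> N) + Re (twist \<phi>' N) + (\<Sum>\<psi>\<in>R. Re (twist \<psi> N))"
      by simp
    also have "(\<Sum>\<psi>\<in>R. Re (twist \<psi> N)) \<le> (\<Sum>\<psi>\<in>R. K \<psi>)"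
      using N by (intro sum_mono K) (auto simp: R_def)
    finally show ?thesis
      using C1[OF N] C1'[OF N] C2[OF N] complex_Re_le_cmod[of "twist \<phi> N + of_real (ln (real N))"]
        complex_Re_le_cmod[of "twist \<phi>' N + of_real (ln (real N))"]
        complex_Re_le_cmod[of "twist (principal_character M) N - of_real (ln (real N))"] by simp
  qed
  obtain N where "N > 0" "ln (real N) > C2 + 2 * C1 + (\<Sum>\<psi>\<in>R. K \<psi>)" using ln_unbounded by blast
  with le[of N] show False by linarith
qed

theorem mertens_progression:
  assumes M: "M > 1" "odd M" and c: "coprime c M"
  shows "\<exists>C. \<forall>N>0. (\<Sum>p | p \<in> {1..N} \<and> prime p \<and> [p = c] (mod M). ln (real p) / real p) \<ge>
    ln (real N) / real (totient M) - C"
proof -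
  let ?D = "{\<psi>. dirichlet_character M \<psi>}"
  obtain C1 where C1: "\<And>N. (\<Sum>d | d \<in> {1..N} \<and> \<not> prime d. \<Lambda> d / real d) \<le> C1"
    using prime_power_sum_bounded by blast
  obtain C2 where C2: "\<And>N. N > 0 \<Longrightarrow> norm (twist (principal_character M) N - of_real (ln (real N))) \<le> C2"
    using twist_principal[of M] M by auto
  have "\<exists>C. \<forall>N>0. norm (twist \<psi> N) \<le> C" if "\<psi> \<in> ?D" "\<psi> \<noteq> principal_character M" for \<psi>
    using twist_bounded[OF M _ that(2)] that(1) by blast
  then obtain K where K: "\<And>\<psi> N. \<psi> \<in> ?D \<Longrightarrow> \<psi> \<noteq> principal_character M \<Longrightarrow> N > 0 \<Longrightarrow> norm (twist \<psi> N) \<le> K \<psi>"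
    by metis
  define R where "R = ?D - {principal_character M}"
  define C3 where "C3 = C2 + (\<Sum>\<psi>\<in>R. K \<psi>)"
  have tot0: "totient M > 0" using M by simp
  \<comment> \<open>Evaluation at the inverse \<open>c'\<close> plays the part of the conjugate of
    \<open>\<psi> c\<close> in the orthogonality relation.\<close>
  obtain c' where c': "[int c * c' = 1] (mod int M)"
    using c cong_solve_coprime_int[of "int c" "int M"] by auto
  have copc': "coprime c' (int M)"
    using c' by (metis coprime_1_left coprime_mult_left_iff cong_imp_coprime cong_sym)
  have "(\<Sum>p | p \<in> {1..N} \<and> prime p \<and> [p = c] (mod M). ln (real p) / real p) \<ge>
      ln (real N) / real (totient M) - (C3 / real (totient M) + C1)" if N: "N > 0" for N
  proof -
    define A where "A = {d \<in> {1..N}. [d = c] (mod M)}"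
    have "(\<Sum>\<psi>\<in>?D. \<psi> c' * twist \<psi> N) =
        (\<Sum>d=1..N. (\<Sum>\<psi>\<in>?D. \<psi> (c' * int d)) * of_real (\<Lambda> d) / of_nat d)"
    proof -
      have "(\<Sum>\<psi>\<in>?D. \<psi> c' * twist \<psi> N) = (\<Sum>\<psi>\<in>?D. \<Sum>d=1..N. \<psi> (c' * int d) * of_real (\<Lambda> d) / of_nat d)"
        unfolding twist_def sum_distrib_left by (intro sum.cong refl) (auto simp: dc_mult)
      also have "\<dots> = (\<Sum>d=1..N. \<Sum>\<psi>\<in>?D. \<psi> (c' * int d) * of_real (\<Lambda> d) / of_nat d)" by (rule sum.swap)
      finally show ?thesis by (simp add: sum_distrib_right sum_divide_distrib)
    qed
    also have "\<dots> = (\<Sum>d=1..N. if [d = c] (mod M) then of_real (real (totient M) * (\<Lambda> d / real d)) else 0)"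
    proof (intro sum.cong refl)
      fix d
      have eq: "(\<Sum>\<psi>\<in>?D. \<psi> (c' * int d)) = (if [d = c] (mod M) then of_nat (totient M) else 0)"
      proof (cases "coprime d M")
        case True
        have "[c' * int d = 1] (mod int M) \<longleftrightarrow> [int d = int c] (mod int M)"
        proof
          assume "[c' * int d = 1] (mod int M)"
          hence "[int c * (c' * int d) = int c * 1] (mod int M)" by (rule cong_scalar_left)
          moreover have "[int c * (c' * int d) = 1 * int d] (mod int M)"
            using cong_scalar_right[OF c', of "int d"] by (simp add: mult.assoc)
          ultimately show "[int d = int c] (mod int M)" by (metis cong_sym cong_trans mult_1 mult_1_right)
        next
          assume "[int d = int c] (mod int M)"
          hence "[c' * int d = c' * int c] (mod int M)" by (rule cong_scalar_left)
          thus "[c' * int d = 1] (mod int M)" using c' by (metis cong_trans mult.commute)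
        qed
        thus ?thesis using sum_characters[of M "c' * int d"] M True copc' card_characters[OF M]
          by (simp add: cong_int_iff)
      next
        case False
        hence "\<psi> (c' * int d) = 0" if "\<psi> \<in> ?D" for \<psi>
          using that dc_zero_iff[of M \<psi> "c' * int d"] by simp
        hence "(\<Sum>\<psi>\<in>?D. \<psi> (c' * int d)) = 0" by (intro sum.neutral) blast
        moreover have "\<not> [d = c] (mod M)" using False c by (metis cong_imp_coprime cong_sym)
        ultimately show ?thesis by simp
      qed
      show "(\<Sum>\<psi>\<in>?D. \<psi> (c' * int d)) * of_real (\<Lambda> d) / of_nat d =
          (if [d = c] (mod M) then of_real (real (totient M) * (\<Lambda> d / real d)) else 0)"
        unfolding eq by simp
    qed
    also have "\<dots> = of_real (real (totient M) * (\<Sum>d\<in>A. \<Lambda> d / real d))"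
      unfolding A_def sum_distrib_left of_real_sum by (intro sum.mono_neutral_cong_right) auto
    finally have main: "real (totient M) * (\<Sum>d\<in>A. \<Lambda> d / real d) = Re (\<Sum>\<psi>\<in>?D. \<psi> c' * twist \<psi> N)" by simp
    have D: "?D = insert (principal_character M) R" using dc_principal[of M] M by (auto simp: R_def)
    have "finite R" "principal_character M \<notin> R" using finite_dc[of M] by (auto simp: R_def)
    hence "(\<Sum>\<psi>\<in>?D. \<psi> c' * twist \<psi> N) =
        principal_character M c' * twist (principal_character M) N + (\<Sum>\<psi>\<in>R. \<psi> c' * twist \<psi> N)"
      unfolding D by (rule sum.insert)
    hence "(\<Sum>\<psi>\<in>?D. \<psi> c' * twist \<psi> N) = twist (principal_character M) N + (\<Sum>\<psi>\<in>R. \<psi> c' * twist \<psi> N)"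
      using copc' by (simp only: principal_character_def if_True mult_1)
    moreover have "Re (\<Sum>\<psi>\<in>R. \<psi> c' * twist \<psi> N) \<ge> - (\<Sum>\<psi>\<in>R. K \<psi>)"
    proof -
      have "norm (\<Sum>\<psi>\<in>R. \<psi> c' * twist \<psi> N) \<le> (\<Sum>\<psi>\<in>R. K \<psi>)"
      proof (rule sum_norm_le)
        fix \<psi> assume "\<psi> \<in> R"
        hence \<psi>: "\<psi> \<in> ?D" "\<psi> \<noteq> principal_character M" by (auto simp: R_def)
        have "norm (\<psi> c') * norm (twist \<psi> N) \<le> 1 * K \<psi>"
          using \<psi> N by (intro mult_mono K) (auto simp: dc_norm_le)
        thus "norm (\<psi> c' * twist \<psi> N) \<le> K \<psi>" by (simp add: norm_mult)
      qed
      thus ?thesis using abs_Re_le_cmod[of "\<Sum>\<psi>\<in>R. \<psi> c' * twist \<psi> N"] by linarith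
    qed
    moreover have "Re (twist (principal_character M) N) \<ge> ln (real N) - C2"
      using C2[OF N] abs_Re_le_cmod[of "twist (principal_character M) N - of_real (ln (real N))"] by simp
    ultimately have "real (totient M) * (\<Sum>d\<in>A. \<Lambda> d / real d) \<ge> ln (real N) - C3"
      unfolding main C3_def by simp
    hence 1: "(\<Sum>d\<in>A. \<Lambda> d / real d) \<ge> ln (real N) / real (totient M) - C3 / real (totient M)"
      using tot0 by (simp add: field_simps)
    have "(\<Sum>d\<in>A. \<Lambda> d / real d) = (\<Sum>d | d \<in> A \<and> prime d. \<Lambda> d / real d) + (\<Sum>d | d \<in> A \<and> \<not> prime d. \<Lambda> d / real d)"
      by (subst sum.union_disjoint[symmetric]) (auto simp: A_def intro!: sum.cong)
    also have "(\<Sum>d | d \<in> A \<and> \<not> prime d. \<Lambda> d / real d) \<le> (\<Sum>d | d \<in> {1..N} \<and> \<not> prime d. \<Lambda> d / real d)"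
      by (intro sum_mono2) (auto simp: A_def mangoldt_nonneg)
    also have "\<dots> \<le> C1" by (rule C1)
    also have "(\<Sum>d | d \<in> A \<and> prime d. \<Lambda> d / real d) =
        (\<Sum>p | p \<in> {1..N} \<and> prime p \<and> [p = c] (mod M). ln (real p) / real p)"
      by (intro sum.cong) (auto simp: A_def)
    finally show ?thesis using 1 by linarith
  qed
  thus ?thesis by blast
qed

section \<open>Abel summation, from weights ln p / p to weights 1 / p\<close>

lemma abel_ln:
  fixes a :: "nat \<Rightarrow> real"
  assumes "N \<ge> 2"
  defines "A \<equiv> \<lambda>n. \<Sum>k=2..n. a k"
  shows "(\<Sum>n=2..N. a n / ln (real n)) =
    A N / ln (real N) + (\<Sum>n=2..<N. A n * (1 / ln (real n) - 1 / ln (real (Suc n))))"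
  using assms(1)
proof (induction N rule: dec_induct)
  case (step m)
  have "A (Suc m) = A m + a (Suc m)" using step by (simp add: A_def)
  thus ?case using step by (simp add: algebra_simps add_divide_distrib)
qed (simp add: A_def)

text \<open>Both bounds telescope when summed over \<open>n\<close>, and so replace the integral of
  \<open>1 / (x * ln x)\<close>. The first is shifted by one index because it rests on
  \<open>n * (n + 2) \<le> (n + 1) ^ 2\<close>, that is, on decreasing increments of the
  logarithm.\<close>

lemma ln_ratio_bounds:
  assumes "n \<ge> 2"
  shows "1 - ln (real n) / ln (real (Suc n)) \<ge> ln (ln (real (n + 2))) - ln (ln (real (Suc n)))"
    and "1 - ln (real n) / ln (real (Suc n)) \<le> ln (ln (real (Suc n))) - ln (ln (real n))"
proof -
  define x y z where "x = ln (real n)" and "y = ln (real (Suc n))" and "z = ln (real (n + 2))"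
  have pos: "x > 0" "y > 0" "z > 0" using assms by (auto simp: x_def y_def z_def)
  have "x + z = ln (real n * real (n + 2))" using assms by (simp add: x_def z_def ln_mult)
  also have "\<dots> \<le> ln (real (Suc n) * real (Suc n))"
  proof (rule ln_mono)
    show "0 < real n * real (n + 2)" using assms by (intro mult_pos_pos) auto
    show "real n * real (n + 2) \<le> real (Suc n) * real (Suc n)" by (simp add: algebra_simps)
  qed
  also have "\<dots> = 2 * y" using assms by (simp add: y_def ln_mult)
  finally have xz: "z - y \<le> y - x" by simp
  have "ln z - ln y = ln (z / y)" using pos by (simp add: ln_div)
  also have "\<dots> \<le> z / y - 1" using pos by (intro ln_le_minus_one) auto
  also have "\<dots> = (z - y) / y" using pos by (simp add: field_simps)
  also have "\<dots> \<le> (y - x) / y" using xz pos by (intro divide_right_mono) auto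
  also have "\<dots> = 1 - x / y" using pos by (simp add: field_simps)
  finally show "1 - ln (real n) / ln (real (Suc n)) \<ge> ln (ln (real (n + 2))) - ln (ln (real (Suc n)))"
    by (simp add: x_def y_def z_def)
  have "ln (x / y) \<le> x / y - 1" using pos by (intro ln_le_minus_one) auto
  moreover have "ln (x / y) = ln x - ln y" using pos by (simp add: ln_div)
  ultimately show "1 - ln (real n) / ln (real (Suc n)) \<le> ln (ln (real (Suc n))) - ln (ln (real n))"
    by (simp add: x_def y_def)
qed

lemma ln_mult_diff_inverse: "n \<ge> 2 \<Longrightarrow>
    ln (real n) * (1 / ln (real n) - 1 / ln (real (Suc n))) = 1 - ln (real n) / ln (real (Suc n))"
  by (simp add: right_diff_distrib)

lemma inverse_ln_antimono: "n \<ge> 2 \<Longrightarrow> 1 / ln (real n) - 1 / ln (real (Suc n)) \<ge> 0"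
  by (simp add: frac_le)

lemma sum_inverse_ln_telescope: "N \<ge> 2 \<Longrightarrow>
    (\<Sum>n=2..<N. 1 / ln (real n) - 1 / ln (real (Suc n))) = 1 / ln 2 - 1 / ln (real N)"
  by (induction N rule: dec_induct) simp_all

lemma abel_lower:
  fixes a :: "nat \<Rightarrow> real"
  assumes A: "\<And>n. n \<ge> 2 \<Longrightarrow> (\<Sum>k=2..n. a k) \<ge> \<alpha> * ln (real n) - C" and \<alpha>: "\<alpha> \<ge> 0" and N: "N \<ge> 2"
  shows "(\<Sum>n=2..N. a n / ln (real n)) \<ge> \<alpha> * ln (ln (real N)) - (C / ln 2 + \<alpha> * ln (ln 3))"
proof -
  define A' where "A' n = (\<Sum>k=2..n. a k)" for n
  define w where "w n = 1 / ln (real n) - 1 / ln (real (Suc n))" for n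
  have tele: "ln (ln (real (Suc N))) - ln (ln 3) = (\<Sum>n=2..<N. ln (ln (real (n + 2))) - ln (ln (real (Suc n))))"
    using N by (induction N rule: dec_induct) (simp_all add: add_ac)
  have "\<alpha> * (ln (ln (real N)) - ln (ln 3)) \<le> \<alpha> * (ln (ln (real (Suc N))) - ln (ln 3))"
    using \<alpha> N by (intro mult_left_mono diff_right_mono) auto
  also have "\<dots> \<le> \<alpha> * (\<Sum>n=2..<N. 1 - ln (real n) / ln (real (Suc n)))"
    unfolding tele using \<alpha> ln_ratio_bounds(1) by (intro mult_left_mono sum_mono) auto
  finally have 1: "\<alpha> * (ln (ln (real N)) - ln (ln 3)) \<le> \<alpha> * (\<Sum>n=2..<N. 1 - ln (real n) / ln (real (Suc n)))" .
  have "(\<Sum>n=2..<N. A' n * w n) \<ge> (\<Sum>n=2..<N. (\<alpha> * ln (real n) - C) * w n)"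
    using A inverse_ln_antimono unfolding A'_def w_def by (intro sum_mono mult_right_mono) auto
  moreover have "(\<Sum>n=2..<N. (\<alpha> * ln (real n) - C) * w n) =
      \<alpha> * (\<Sum>n=2..<N. 1 - ln (real n) / ln (real (Suc n))) - C * (1 / ln 2 - 1 / ln (real N))"
  proof -
    have "(\<Sum>n=2..<N. (\<alpha> * ln (real n) - C) * w n) = (\<Sum>n=2..<N. \<alpha> * (1 - ln (real n) / ln (real (Suc n))) - C * w n)"
      using ln_mult_diff_inverse by (intro sum.cong refl) (simp add: w_def left_diff_distrib mult.assoc)
    thus ?thesis using sum_inverse_ln_telescope[OF N]
      by (simp add: sum_subtractf sum_distrib_left[symmetric] w_def)
  qed
  moreover have "A' N / ln (real N) \<ge> (\<alpha> * ln (real N) - C) / ln (real N)"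
    using A[OF N] N unfolding A'_def by (intro divide_right_mono) auto
  moreover have "(\<alpha> * ln (real N) - C) / ln (real N) = \<alpha> - C / ln (real N)" using N by (simp add: field_simps)
  ultimately show ?thesis
    using 1 \<alpha> unfolding abel_ln[OF N] A'_def[symmetric] w_def[symmetric] by (simp add: algebra_simps)
qed

lemma abel_upper:
  fixes a :: "nat \<Rightarrow> real"
  assumes A: "\<And>n. n \<ge> 2 \<Longrightarrow> (\<Sum>k=2..n. a k) \<le> ln (real n) + C" and N: "N \<ge> 2"
  shows "(\<Sum>n=2..N. a n / ln (real n)) \<le> ln (ln (real N)) + (1 + C / ln 2 - ln (ln 2))"
proof -
  define A' where "A' n = (\<Sum>k=2..n. a k)" for n
  define w where "w n = 1 / ln (real n) - 1 / ln (real (Suc n))" for n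
  have tele: "ln (ln (real N)) - ln (ln 2) = (\<Sum>n=2..<N. ln (ln (real (Suc n))) - ln (ln (real n)))"
    using N by (induction N rule: dec_induct) (simp_all add: add_ac)
  have 1: "(\<Sum>n=2..<N. 1 - ln (real n) / ln (real (Suc n))) \<le> ln (ln (real N)) - ln (ln 2)"
    unfolding tele using ln_ratio_bounds(2) by (intro sum_mono) auto
  have "(\<Sum>n=2..<N. A' n * w n) \<le> (\<Sum>n=2..<N. (ln (real n) + C) * w n)"
    using A inverse_ln_antimono unfolding A'_def w_def by (intro sum_mono mult_right_mono) auto
  moreover have "(\<Sum>n=2..<N. (ln (real n) + C) * w n) =
      (\<Sum>n=2..<N. 1 - ln (real n) / ln (real (Suc n))) + C * (1 / ln 2 - 1 / ln (real N))"
  proof -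
    have "(\<Sum>n=2..<N. (ln (real n) + C) * w n) = (\<Sum>n=2..<N. (1 - ln (real n) / ln (real (Suc n))) + C * w n)"
      using ln_mult_diff_inverse by (intro sum.cong refl) (simp add: w_def distrib_right)
    thus ?thesis using sum_inverse_ln_telescope[OF N]
      by (simp add: sum.distrib sum_distrib_left[symmetric] w_def)
  qed
  moreover have "A' N / ln (real N) \<le> (ln (real N) + C) / ln (real N)"
    using A[OF N] N unfolding A'_def by (intro divide_right_mono) auto
  moreover have "(ln (real N) + C) / ln (real N) = 1 + C / ln (real N)" using N by (simp add: field_simps)
  ultimately show ?thesis
    using 1 unfolding abel_ln[OF N] A'_def[symmetric] w_def[symmetric] by (simp add: algebra_simps)
qed

lemma prime_sum_conv:
  fixes N :: nat and f :: "nat \<Rightarrow> real"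
  shows
  "(\<Sum>p | p \<in> {1..N} \<and> prime p \<and> P p. f p) = (\<Sum>n=2..N. if prime n \<and> P n then f n else 0)"
  by (intro sum.mono_neutral_cong_left) (auto dest: prime_ge_2_nat)

lemma sum_inverse_primes_progression:
  assumes M: "M > 1" "odd M" and c: "coprime c M"
  shows "\<exists>C. \<forall>N\<ge>2. (\<Sum>p | p \<in> {1..N} \<and> prime p \<and> [p = c] (mod M). 1 / real p) \<ge>
    ln (ln (real N)) / real (totient M) - C"
proof -
  obtain C where C: "\<And>N. N > 0 \<Longrightarrow> (\<Sum>p | p \<in> {1..N} \<and> prime p \<and> [p = c] (mod M). ln (real p) / real p) \<ge>
    ln (real N) / real (totient M) - C" using mertens_progression[OF assms] by blast
  define \<alpha> where "\<alpha> = 1 / real (totient M)"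
  define a where "a n = (if prime n \<and> [n = c] (mod M) then ln (real n) / real n else 0)" for n
  have "(\<Sum>p | p \<in> {1..N} \<and> prime p \<and> [p = c] (mod M). 1 / real p) \<ge>
      ln (ln (real N)) / real (totient M) - (C / ln 2 + \<alpha> * ln (ln 3))" if N: "N \<ge> 2" for N
  proof -
    have "\<alpha> * ln (ln (real N)) - (C / ln 2 + \<alpha> * ln (ln 3)) \<le> (\<Sum>n=2..N. a n / ln (real n))"
    proof (rule abel_lower[OF _ _ N])
      fix n :: nat assume "n \<ge> 2"
      thus "\<alpha> * ln (real n) - C \<le> (\<Sum>k=2..n. a k)"
        using C[of n] unfolding prime_sum_conv a_def[symmetric] by (simp add: \<alpha>_def)
    qed (simp add: \<alpha>_def)
    also have "(\<Sum>n=2..N. a n / ln (real n)) = (\<Sum>n=2..N. if prime n \<and> [n = c] (mod M) then 1 / real n else 0)"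
      by (intro sum.cong refl) (auto simp: a_def)
    finally show ?thesis unfolding prime_sum_conv by (simp add: \<alpha>_def)
  qed
  thus ?thesis by blast
qed

lemma sum_ln_primes_le: "N > 0 \<Longrightarrow> (\<Sum>p | p \<in> {1..N} \<and> prime p. ln (real p) / real p) \<le> ln (real N) + 4"
proof -
  assume N: "N > 0"
  have "(\<Sum>p | p \<in> {1..N} \<and> prime p. ln (real p) / real p) = (\<Sum>p | p \<in> {1..N} \<and> prime p. \<Lambda> p / real p)"
    by (intro sum.cong) auto
  also have "\<dots> \<le> (\<Sum>d=1..N. \<Lambda> d / real d)"
    by (intro sum_mono2) (auto simp: mangoldt_nonneg)
  also have "\<dots> \<le> ln (real N) + 4" by (rule mertens_upper[OF N])
  finally show ?thesis .
qed

lemma sum_inverse_primes_le: "N \<ge> 2 \<Longrightarrow>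
    (\<Sum>p | p \<in> {1..N} \<and> prime p. 1 / real p) \<le> ln (ln (real N)) + (1 + 4 / ln 2 - ln (ln 2))"
proof -
  assume N: "N \<ge> 2"
  define a where "a n = (if prime n \<and> True then ln (real n) / real n else 0)" for n
  have "(\<Sum>n=2..N. a n / ln (real n)) \<le> ln (ln (real N)) + (1 + 4 / ln 2 - ln (ln 2))"
  proof (rule abel_upper[OF _ N])
    fix n :: nat assume "n \<ge> 2"
    thus "(\<Sum>k=2..n. a k) \<le> ln (real n) + 4"
      using sum_ln_primes_le[of n] prime_sum_conv[where N = n and f = "\<lambda>p. ln (real p) / real p" and P = "\<lambda>_. True"]
      unfolding a_def by simp
  qed
  also have "(\<Sum>n=2..N. a n / ln (real n)) = (\<Sum>n=2..N. if prime n \<and> True then 1 / real n else 0)"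
    by (intro sum.cong refl) (auto simp: a_def)
  finally show ?thesis using prime_sum_conv[where N = N and f = "\<lambda>p. 1 / real p" and P = "\<lambda>_. True"] by simp
qed

section \<open>Norms from prime power cyclotomic fields\<close>

text \<open>Integer polynomials evaluated at a root of unity stand for elements of the cyclotomic
  ring, so that no number field or ideal has to be constructed.\<close>

definition ceval :: "int poly \<Rightarrow> complex \<Rightarrow> complex" where
  "ceval p z = poly (map_poly of_int p) z"

lemma ceval_0 [simp]: "ceval 0 z = 0"
  by (simp add: ceval_def)

lemma ceval_pCons [simp]: "ceval (pCons a p) z = of_int a + z * ceval p z"
  by (simp add: ceval_def map_poly_pCons)

lemma ceval_1 [simp]: "ceval 1 z = 1"
  by (simp add: one_pCons)

lemma ceval_add [simp]: "ceval (p + q) z = ceval p z + ceval q z"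
  by (induction p q rule: poly_induct2) (simp_all add: algebra_simps)

lemma ceval_smult [simp]: "ceval (smult a p) z = of_int a * ceval p z"
  by (induction p) (simp_all add: algebra_simps)

lemma ceval_minus [simp]: "ceval (- p) z = - ceval p z"
  using ceval_smult [of "-1" p z] by simp

lemma ceval_diff [simp]: "ceval (p - q) z = ceval p z - ceval q z"
  using ceval_add [of p "-q" z] by simp

lemma ceval_mult [simp]: "ceval (p * q) z = ceval p z * ceval q z"
  by (induction p) (simp_all add: algebra_simps)

lemma ceval_power [simp]: "ceval (p ^ n) z = ceval p z ^ n"
  by (induction n) simp_all

lemma ceval_sum [simp]: "ceval (\<Sum>i\<in>I. p i) z = (\<Sum>i\<in>I. ceval (p i) z)"
  by (induction I rule: infinite_finite_induct) simp_all

lemma ceval_prod [simp]: "ceval (\<Prod>i\<in>I. p i) z = (\<Prod>i\<in>I. ceval (p i) z)"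
  by (induction I rule: infinite_finite_induct) simp_all

lemma ceval_monom [simp]: "ceval (monom a n) z = of_int a * z ^ n"
  by (simp add: ceval_def map_poly_monom poly_monom)

lemma ceval_pcompose [simp]: "ceval (pcompose p q) z = ceval p (ceval q z)"
  by (induction p) (simp_all add: pcompose_pCons)

lemma ceval_altdef: "degree p < n \<Longrightarrow> ceval p z = (\<Sum>i<n. of_int (coeff p i) * z ^ i)"
proof -
  assume "degree p < n"
  have "p = (\<Sum>i\<le>degree p. monom (coeff p i) i)"
    by (simp add: poly_as_sum_of_monoms)
  also have "\<dots> = (\<Sum>i<n. monom (coeff p i) i)"
    using \<open>degree p < n\<close> by (intro sum.mono_neutral_left) (auto simp: coeff_eq_0)
  finally have "ceval p z = ceval (\<Sum>i<n. monom (coeff p i) i) z" by simp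
  thus ?thesis by simp
qed

lemma pcompose_monom_1: "pcompose (monom 1 n) q = q ^ n"
  for q :: "'a :: comm_semiring_1 poly"
  by (induction n) (simp_all add: monom_Suc pcompose_pCons pcompose_1)

lemma freshman_dream:
  fixes a b :: "'a :: comm_ring_1"
  assumes "prime p"
  shows "\<exists>e. (a + b) ^ p = a ^ p + b ^ p + of_nat p * e"
proof -
  have p: "p > 1" using assms prime_gt_1_nat by auto
  have "(a + b) ^ p = (\<Sum>k\<le>p. of_nat (p choose k) * a ^ k * b ^ (p - k))"
    by (rule binomial_ring)
  also have "{..p} = insert 0 (insert p {1..<p})" using p by auto
  also have "(\<Sum>k\<in>\<dots>. of_nat (p choose k) * a ^ k * b ^ (p - k)) =
      b ^ p + (a ^ p + (\<Sum>k\<in>{1..<p}. of_nat (p choose k) * a ^ k * b ^ (p - k)))"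
    using p by (subst sum.insert; simp)+
  also have "(\<Sum>k\<in>{1..<p}. of_nat (p choose k) * a ^ k * b ^ (p - k)) =
      (\<Sum>k\<in>{1..<p}. of_nat p * (of_nat ((p choose k) div p) * a ^ k * b ^ (p - k)))"
  proof (intro sum.cong refl)
    fix k assume "k \<in> {1..<p}"
    hence "p dvd (p choose k)" using assms by (intro dvd_choose_prime) auto
    hence "p choose k = p * ((p choose k) div p)" by simp
    hence "(of_nat (p choose k) :: 'a) = of_nat p * of_nat ((p choose k) div p)"
      by (metis of_nat_mult)
    thus "of_nat (p choose k) * a ^ k * b ^ (p - k) =
        of_nat p * (of_nat ((p choose k) div p) * a ^ k * b ^ (p - k))"
      by (simp add: mult_ac)
  qed
  also have "\<dots> = of_nat p * (\<Sum>k\<in>{1..<p}. of_nat ((p choose k) div p) * a ^ k * b ^ (p - k))"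
    by (simp add: sum_distrib_left)
  finally have "(a + b) ^ p = a ^ p + b ^ p +
      of_nat p * (\<Sum>k\<in>{1..<p}. of_nat ((p choose k) div p) * a ^ k * b ^ (p - k))"
    by (simp only: add_ac)
  thus ?thesis by blast
qed

lemma int_power_prime_cong: "prime p \<Longrightarrow> \<exists>e::int. a ^ p = a + int p * e"
proof -
  assume p: "prime p"
  have "[a ^ p = a] (mod int p)"
  proof (cases "int p dvd a")
    case True
    moreover have "int p dvd a ^ p" using True p prime_gt_0_nat dvd_power[of p a] dvd_trans by blast
    ultimately show ?thesis by (simp add: cong_def mod_eq_0_iff_dvd[symmetric])
  next
    case False
    define b where "b = nat (a mod int p)"
    have pp: "int p > 0" using p prime_gt_0_nat by auto
    have ab: "[a = int b] (mod int p)" using pp by (simp add: b_def cong_def)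
    have "\<not> p dvd b" using False ab by (metis cong_dvd_iff int_dvd_int_iff)
    hence "[b ^ (p - 1) = 1] (mod p)" by (rule fermat_theorem[OF p])
    hence "[b ^ (p - 1) * b = 1 * b] (mod p)" by (rule cong_scalar_right)
    hence "[b ^ p = b] (mod p)" using p by (simp add: power_eq_if mult.commute prime_gt_0_nat)
    hence "[int b ^ p = int b] (mod int p)" by (metis cong_int_iff of_nat_power)
    thus ?thesis using ab by (meson cong_pow cong_sym cong_trans)
  qed
  hence "int p dvd a ^ p - a" by (simp add: cong_iff_dvd_diff)
  then obtain e where "a ^ p - a = int p * e" by (elim dvdE)
  thus ?thesis by (intro exI[of _ e]) simp
qed

lemma int_poly_power_prime:
  fixes c :: "int poly"
  assumes "prime p"
  shows "\<exists>e. c ^ p = pcompose c (monom 1 p) + smult (int p) e"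
proof (induction c)
  case 0
  thus ?case using assms prime_gt_0_nat by (intro exI[of _ 0]) (simp add: power_0_left)
next
  case (pCons a c)
  then obtain e where e: "c ^ p = pcompose c (monom 1 p) + smult (int p) e" by blast
  have "pCons a c = [:a:] + [:0,1:] * c" by simp
  then obtain e1 where e1: "pCons a c ^ p = [:a:] ^ p + ([:0,1:] * c) ^ p + of_nat p * e1"
    using freshman_dream[OF assms] by metis
  obtain e2 where e2: "a ^ p = a + int p * e2" using int_power_prime_cong[OF assms] by blast
  have x: "([:0,1:] :: int poly) ^ p = monom 1 p" by (simp add: monom_altdef)
  have "pCons a c ^ p = [:a + int p * e2:] + monom 1 p * (pcompose c (monom 1 p) + smult (int p) e) + of_nat p * e1"
    unfolding e1 power_mult_distrib e x poly_const_pow e2 ..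
  also have "\<dots> = pcompose (pCons a c) (monom 1 p) + smult (int p) ([:e2:] + monom 1 p * e + e1)"
    by (simp add: pcompose_pCons of_nat_poly algebra_simps smult_add_right)
  finally show ?case by blast
qed

text \<open>The iterated Frobenius map. At a root of unity of order prime to \<open>p\<close> and
  for suitable \<open>f\<close>, the substitution on the right does nothing, and every element of
  the cyclotomic ring is its own \<open>p ^ f\<close>-th power modulo \<open>p\<close>.\<close>

lemma int_poly_power_prime_power:
  fixes c :: "int poly"
  assumes "prime p"
  shows "\<exists>e. c ^ (p ^ f) = pcompose c (monom 1 (p ^ f)) + smult (int p) e"
proof (induction f)
  case 0
  have "pcompose c (monom 1 1) = c" by (metis monom_altdef pcompose_idR power_one_right smult_1_left)
  thus ?case by (intro exI[of _ 0]) simp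
next
  case (Suc f)
  then obtain e where e: "c ^ (p ^ f) = pcompose c (monom 1 (p ^ f)) + smult (int p) e" by blast
  define d where "d = pcompose c (monom 1 (p ^ f))"
  obtain e1 where e1: "(d + smult (int p) e) ^ p = d ^ p + smult (int p) e ^ p + of_nat p * e1"
    using freshman_dream[OF assms] by blast
  obtain e2 where e2: "d ^ p = pcompose d (monom 1 p) + smult (int p) e2"
    using int_poly_power_prime[OF assms] by blast
  have "pcompose d (monom 1 p) = pcompose c (pcompose (monom 1 (p ^ f)) (monom 1 p))"
    unfolding d_def by (rule pcompose_assoc[symmetric])
  also have "pcompose (monom 1 (p ^ f)) (monom 1 p) = monom (1::int) (p ^ Suc f)"
    by (simp add: pcompose_monom_1 monom_power mult.commute)
  finally have d2: "pcompose d (monom 1 p) = pcompose c (monom 1 (p ^ Suc f))" .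
  have p0: "p \<noteq> 0" using assms by auto
  have e3: "smult (int p) e ^ p = smult (int p) (e * smult (int p) e ^ (p - 1))"
    unfolding power_eq_if[of _ p] using p0 by (simp only: if_False mult_smult_left)
  have "c ^ (p ^ Suc f) = (c ^ (p ^ f)) ^ p" by (simp only: power_mult[symmetric] power_Suc mult.commute)
  also have "\<dots> = (d + smult (int p) e) ^ p" by (simp add: e d_def)
  also have "\<dots> = pcompose c (monom 1 (p ^ Suc f)) + smult (int p) (e2 + e * smult (int p) e ^ (p - 1) + e1)"
    unfolding e1 e2 d2 e3 by (simp add: of_nat_poly smult_add_right)
  finally show ?case by blast
qed

section \<open>The cyclotomic polynomial of prime power order and its norm\<close>

locale prime_power_cyclotomic =
  fixes l k :: nat
  assumes prime_l: "prime l"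
begin

definition d where "d = l ^ k"
definition n where "n = l ^ Suc k"
definition units where "units = {t \<in> {..<n}. \<not> l dvd t}"
text \<open>The \<open>n\<close>-th cyclotomic polynomial, written as the quotient of
  \<open>x ^ n - 1\<close> by \<open>x ^ d - 1\<close>.\<close>

definition Phi :: "int poly" where "Phi = (\<Sum>i<l. monom 1 (i * d))"
definition root :: "nat \<Rightarrow> complex" where "root t = cis (2 * pi * real t / real n)"

lemma l_gt_1: "l > 1" using prime_l prime_gt_1_nat by auto

lemma d_pos: "d > 0" using l_gt_1 by (simp add: d_def)
lemma n_pos: "n > 0" using l_gt_1 by (simp add: n_def)
lemma n_eq: "n = l * d" by (simp add: n_def d_def)

lemma finite_units [simp]: "finite units" by (simp add: units_def)

lemma card_units: "card units = (l - 1) * d"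
proof -
  have "units = {..<n} - (\<lambda>i. l * i) ` {..<d}"
  proof (intro equalityI subsetI)
    fix t assume "t \<in> units"
    thus "t \<in> {..<n} - (\<lambda>i. l * i) ` {..<d}" by (auto simp: units_def)
  next
    fix t assume t: "t \<in> {..<n} - (\<lambda>i. l * i) ` {..<d}"
    have "\<not> l dvd t"
    proof
      assume "l dvd t"
      then obtain i where "t = l * i" by (elim dvdE)
      with t show False using l_gt_1 by (auto simp: n_eq)
    qed
    thus "t \<in> units" using t by (auto simp: units_def)
  qed
  also have "card \<dots> = n - card ((\<lambda>i. l * i) ` {..<d})"
    by (subst card_Diff_subset) (use l_gt_1 in \<open>auto simp: n_eq\<close>)
  also have "card ((\<lambda>i. l * i) ` {..<d}) = d"
    by (subst card_image) (use l_gt_1 in \<open>auto simp: inj_on_def\<close>)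
  finally show ?thesis by (simp add: n_eq algebra_simps)
qed

lemma coprime_unit: "t \<in> units \<Longrightarrow> coprime t n"
  by (simp add: units_def n_def coprime_commute prime_imp_coprime_nat prime_l)

lemma coeff_Phi_top: "coeff Phi ((l - Suc 0) * d) = 1"
proof -
  have "coeff Phi ((l - Suc 0) * d) = (\<Sum>i<l. if i = l - 1 then 1 else 0)"
    unfolding Phi_def coeff_sum coeff_monom using d_pos by (intro sum.cong refl) auto
  thus ?thesis using l_gt_1 by simp
qed

lemma degree_Phi: "degree Phi = (l - 1) * d"
proof (rule antisym)
  show "degree Phi \<le> (l - 1) * d"
    unfolding Phi_def using l_gt_1
    by (intro degree_sum_le) (auto intro!: order.trans[OF degree_monom_le] mult_right_mono)
  show "(l - 1) * d \<le> degree Phi"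
    by (rule le_degree) (simp add: coeff_Phi_top)
qed

lemma lead_coeff_Phi: "lead_coeff Phi = 1"
  by (simp add: degree_Phi coeff_Phi_top)

lemma Phi_nonzero: "Phi \<noteq> 0" using lead_coeff_Phi by auto

lemma degree_Phi_pos: "degree Phi > 0" using l_gt_1 d_pos by (simp add: degree_Phi)

lemma poly_Phi: "poly Phi s = (\<Sum>i<l. s ^ (i * d))"
  by (simp add: Phi_def poly_sum poly_monom)

lemma ceval_Phi: "ceval Phi z = (\<Sum>i<l. z ^ (i * d))"
  by (simp add: Phi_def)

lemma ceval_Phi_mult: "(z ^ d - 1) * ceval Phi z = z ^ n - 1"
  unfolding ceval_Phi n_eq
  using power_diff_1_eq[of "z ^ d" l] by (simp add: power_mult[symmetric] mult.commute)

lemma root_power: "root t ^ j = root (t * j)"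
  by (simp add: root_def Complex.DeMoivre field_simps)

lemma root_eq_1_iff: "root t = 1 \<longleftrightarrow> n dvd t"
  unfolding root_def by (rule cis_2pi_div_eq_1_iff[OF n_pos])

lemma root_mult: "root s * root t = root (s + t)"
  by (simp add: root_def cis_mult add_divide_distrib distrib_left)

lemma root_cong: "[s = t] (mod n) \<Longrightarrow> root s = root t"
proof (induction s t rule: linorder_wlog)
  case (le s t)
  hence "n dvd t - s" using cong_altdef_nat[of s t n] cong_sym_eq[of s t n] by simp
  hence "root (t - s) = 1" by (simp add: root_eq_1_iff)
  hence "root s * root (t - s) = root s" by simp
  thus ?case using le by (simp add: root_mult)
qed (metis cong_sym)

lemma root_eq_iff: "root s = root t \<longleftrightarrow> [s = t] (mod n)"
proof (induction s t rule: linorder_wlog)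
  case (le s t)
  have "root t = root s * root (t - s)" using le by (simp add: root_mult)
  moreover have "root s \<noteq> 0" by (simp add: root_def)
  ultimately have "root s = root t \<longleftrightarrow> root (t - s) = 1" by auto
  also have "\<dots> \<longleftrightarrow> [s = t] (mod n)" using le cong_altdef_nat[of s t n] cong_sym_eq[of s t n]
    by (simp add: root_eq_1_iff)
  finally show ?case .
qed (metis cong_sym)

lemma root_inj: "inj_on root {..<n}"
  by (auto simp: inj_on_def root_eq_iff cong_def)

lemma ceval_Phi_root: "\<not> l dvd t \<Longrightarrow> ceval Phi (root t) = 0"
proof -
  assume t: "\<not> l dvd t"
  have "root t ^ n = 1" by (simp add: root_power root_eq_1_iff)
  moreover have "root t ^ d \<noteq> 1"
    using t d_pos by (simp add: root_power root_eq_1_iff n_eq)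
  ultimately show ?thesis using ceval_Phi_mult[of "root t"] by auto
qed

lemma Phi_roots: "ceval Phi z = 0 \<Longrightarrow> \<exists>t\<in>units. z = root t"
proof -
  assume z: "ceval Phi z = 0"
  hence "z ^ n = 1" using ceval_Phi_mult[of z] by simp
  hence "z \<in> {z. z ^ n = 1}" by simp
  also have "{z::complex. z ^ n = 1} = (\<lambda>j. cis (2 * pi * real j / real n)) ` {..<n}"
    using Complex.bij_betw_roots_unity[OF n_pos] by (simp add: bij_betw_def)
  finally obtain t where t: "t < n" "z = root t" by (auto simp: root_def)
  have "\<not> l dvd t"
  proof
    assume "l dvd t"
    then obtain j where "t = l * j" by (elim dvdE)
    hence "z ^ d = 1" by (simp add: t root_power root_eq_1_iff n_eq)
    hence "ceval Phi z = of_nat l" by (simp add: ceval_Phi power_mult mult.commute[of _ d])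
    thus False using z l_gt_1 by simp
  qed
  thus ?thesis using t by (auto simp: units_def)
qed

lemma units_mult_bij:
  assumes "u \<in> units"
  shows "bij_betw (\<lambda>t. (u * t) mod n) units units"
proof -
  have inj: "inj_on (\<lambda>t. (u * t) mod n) units"
  proof (rule inj_onI)
    fix s t assume st: "s \<in> units" "t \<in> units" "(u * s) mod n = (u * t) mod n"
    hence "[s = t] (mod n)" using coprime_unit[OF assms]
      by (metis cong_def cong_mult_lcancel_nat)
    thus "s = t" using st by (auto simp: units_def cong_def)
  qed
  moreover have "(\<lambda>t. (u * t) mod n) ` units \<subseteq> units"
  proof safe
    fix t assume t: "t \<in> units"
    have "\<not> l dvd u * t" using assms t prime_l by (auto simp: units_def prime_dvd_mult_iff)
    thus "(u * t) mod n \<in> units" using n_pos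
      by (auto simp: units_def dvd_mod_iff n_def)
  qed
  ultimately show ?thesis by (simp add: bij_betw_def endo_inj_surj)
qed

lemma int_poly_div_Phi: "\<exists>q r. p = Phi * q + r \<and> degree r < degree Phi"
proof -
  obtain q r where qr: "pseudo_divmod p Phi = (q, r)" by fastforce
  from pseudo_divmod[OF Phi_nonzero qr] show ?thesis
    using degree_Phi_pos lead_coeff_Phi by (metis degree_0 power_one smult_1_left)
qed

text \<open>The norm before reduction modulo \<open>Phi\<close>: substituting \<open>x ^ t\<close>
  is the Galois conjugation that raises the root of unity to the power \<open>t\<close>. As a
  polynomial it can be evaluated not only at complex roots but also at 1 and at roots of
  \<open>Phi\<close> modulo a prime.\<close>

definition conj_prod :: "int poly \<Rightarrow> int poly" where
  "conj_prod A = (\<Prod>t\<in>units. pcompose A (monom 1 t))"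

lemma poly_conj_prod: "poly (conj_prod A) s = (\<Prod>t\<in>units. poly A (s ^ t))"
  by (simp add: conj_prod_def poly_prod poly_pcompose poly_monom)

lemma ceval_conj_prod: "ceval (conj_prod A) z = (\<Prod>t\<in>units. ceval A (z ^ t))"
  by (simp add: conj_prod_def)

text \<open>Modulo \<open>Phi\<close> the product is an integer: its remainder takes the same value at
  all \<open>degree Phi\<close> roots of \<open>Phi\<close>, and so is constant.\<close>

lemma conj_prod_eq:
  "\<exists>N q. conj_prod A = Phi * q + [:N:] \<and> of_int N = (\<Prod>t\<in>units. ceval A (root t))"
proof -
  define V where "V = (\<Prod>t\<in>units. ceval A (root t))"
  obtain q r where qr: "conj_prod A = Phi * q + r" "degree r < degree Phi"
    using int_poly_div_Phi by blast
  have val: "ceval r (root u) = V" if u: "u \<in> units" for u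
  proof -
    have "ceval r (root u) = ceval (conj_prod A) (root u)"
      using qr(1) ceval_Phi_root[of u] u by (simp add: units_def)
    also have "\<dots> = (\<Prod>t\<in>units. ceval A (root ((u * t) mod n)))"
      unfolding ceval_conj_prod root_power by (intro prod.cong refl arg_cong[of _ _ "ceval A"] root_cong) (simp add: cong_def)
    also have "\<dots> = V" unfolding V_def
      by (rule prod.reindex_bij_betw[OF units_mult_bij[OF u]])
    finally show ?thesis .
  qed
  define R where "R = map_poly complex_of_int r - [:V:]"
  have degR: "degree R < degree Phi"
    unfolding R_def using qr(2) degree_Phi_pos
    by (intro le_less_trans[OF degree_diff_le_max]) (auto simp: degree_map_poly)
  have "R = 0"
  proof (rule ccontr)
    assume "R \<noteq> 0"
    have "root ` units \<subseteq> {z. poly R z = 0}"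
      using val by (auto simp: R_def ceval_def)
    hence "card (root ` units) \<le> card {z. poly R z = 0}"
      by (intro card_mono poly_roots_finite \<open>R \<noteq> 0\<close>)
    also have "\<dots> \<le> degree R" by (intro card_poly_roots_bound \<open>R \<noteq> 0\<close>)
    also have "card (root ` units) = card units"
      by (intro card_image inj_on_subset[OF root_inj]) (auto simp: units_def)
    finally show False using degR by (simp add: card_units degree_Phi)
  qed
  hence R: "map_poly complex_of_int r = [:V:]" by (simp add: R_def)
  have "degree r = 0"
    using R by (metis degree_map_poly degree_pCons_0 of_int_eq_0_iff)
  then obtain N where N: "r = [:N:]" by (metis degree_0_id)
  have "of_int N = V" using R by (simp add: N map_poly_pCons)
  thus ?thesis using qr N V_def by blast
qed

definition Nm :: "int poly \<Rightarrow> int" where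
  "Nm A = (THE N. of_int N = (\<Prod>t\<in>units. ceval A (root t)))"

lemma of_int_Nm: "of_int (Nm A) = (\<Prod>t\<in>units. ceval A (root t))"
  unfolding Nm_def
  by (rule theI') (metis conj_prod_eq of_int_eq_iff)

lemma conj_prod_Nm: "\<exists>q. conj_prod A = Phi * q + [:Nm A:]"
  using conj_prod_eq[of A] of_int_Nm[of A] by (metis of_int_eq_iff)

text \<open>A zero at one primitive root makes the norm vanish, so \<open>Phi\<close> divides
  \<open>conj_prod A\<close>; at 1 the former is \<open>l\<close> and the latter a power of
  \<open>poly A 1\<close>. This takes the place of Eisenstein's criterion.\<close>

lemma prime_dvd_at_1:
  assumes "t \<in> units" "ceval A (root t) = 0"
  shows "int l dvd poly A 1"
proof -
  have "complex_of_int (Nm A) = 0" unfolding of_int_Nm using assms by (auto intro: prod_zero)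
  hence "Nm A = 0" by simp
  then obtain q where q: "conj_prod A = Phi * q" using conj_prod_Nm[of A] by auto
  have "poly A 1 ^ card units = int l * poly q 1"
    using poly_conj_prod[of A 1] q by (simp add: poly_Phi)
  hence "int l dvd poly A 1 ^ card units" by simp
  thus ?thesis using prime_l prime_dvd_power by (metis prime_nat_int_transfer)
qed

text \<open>Irreducibility of \<open>Phi\<close>. A proper factorisation into integer polynomials
  \<open>A * B\<close> would make both values at 1 divisible by \<open>l\<close>, because each
  factor vanishes at some primitive root; but \<open>poly Phi 1 = l\<close>.\<close>

lemma Phi_minimal:
  assumes t: "t \<in> units" and c: "ceval c (root t) = 0" "degree c < degree Phi"
  shows "c = 0"
proof (rule ccontr)
  assume "c \<noteq> 0"
  define S where "S = {p::int poly. p \<noteq> 0 \<and> ceval p (root t) = 0}"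
  have "c \<in> S" using c \<open>c \<noteq> 0\<close> by (simp add: S_def)
  obtain b where b: "b \<in> S" "\<And>b'. b' \<in> S \<Longrightarrow> degree b \<le> degree b'"
    using ex_has_least_nat[of "\<lambda>p. p \<in> S" c degree] \<open>c \<in> S\<close> by auto
  have b0: "b \<noteq> 0" and bz: "ceval b (root t) = 0" using b by (auto simp: S_def)
  have bdeg: "degree b < degree Phi" using b(2)[OF \<open>c \<in> S\<close>] c(2) by simp
  obtain q r where qr: "pseudo_divmod Phi b = (q, r)" by fastforce
  define e where "e = coeff b (degree b) ^ (Suc (degree Phi) - degree b)"
  have e: "smult e Phi = b * q + r" "r = 0 \<or> degree r < degree b"
    using pseudo_divmod[OF b0 qr] by (simp_all add: e_def)
  have e0: "e \<noteq> 0" using b0 by (simp add: e_def)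
  have Pt: "ceval Phi (root t) = 0" using t ceval_Phi_root by (simp add: units_def)
  have "ceval r (root t) = 0"
    using arg_cong[OF e(1), of "\<lambda>p. ceval p (root t)"] bz Pt by simp
  hence r: "r = 0" using e(2) b(2)[of r] by (force simp: S_def)
  \<comment> \<open>Gauss's lemma: pseudo-division by the polynomial \<open>b\<close> of least
    degree only factors a multiple of \<open>Phi\<close>, and primitive parts turn this into a
    factorisation of \<open>Phi\<close> itself.\<close>
  have contPhi: "content Phi = 1"
  proof -
    have "content Phi dvd coeff Phi (degree Phi)" by (rule content_dvd_coeff)
    hence "is_unit (content Phi)" using lead_coeff_Phi by simp
    thus ?thesis by (metis is_unit_normalize normalize_content)
  qed
  have eq: "smult e Phi = b * q" using e r by simp
  have "primitive_part (smult e Phi) = smult (unit_factor e) (primitive_part Phi)"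
    by (rule primitive_part_smult)
  moreover have "primitive_part Phi = Phi"
    using contPhi content_times_primitive_part[of Phi] by simp
  ultimately have "smult (unit_factor e) Phi = primitive_part b * primitive_part q"
    using eq by (metis primitive_part_mult)
  moreover have "unit_factor e * unit_factor e = 1" using e0
    by (simp add: unit_factor_int_def sgn_if)
  ultimately have fac: "Phi = primitive_part b * smult (unit_factor e) (primitive_part q)"
    by (metis mult_smult_right smult_smult smult_1_left)
  define B where "B = smult (unit_factor e) (primitive_part q)"
  define A where "A = primitive_part b"
  have fac: "Phi = A * B" using fac by (simp add: A_def B_def)
  have "b = smult (content b) A" by (simp add: A_def)
  hence "of_int (content b) * ceval A (root t) = 0" using bz by (metis ceval_smult)
  hence Az: "ceval A (root t) = 0" using b0 by auto
  have "degree Phi = degree A + degree B"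
    using fac Phi_nonzero degree_mult_eq[of A B] by auto
  hence "degree B > 0" using bdeg by (simp add: A_def)
  hence "degree (map_poly complex_of_int B) > 0" by (simp add: degree_map_poly)
  then obtain z where "ceval B z = 0"
    unfolding ceval_def
    using fundamental_theorem_of_algebra[of "map_poly complex_of_int B"] by (auto simp: constant_degree)
  moreover from this have "ceval Phi z = 0" by (simp add: fac)
  ultimately obtain u where "u \<in> units" "ceval B (root u) = 0" using Phi_roots by blast
  hence "int l dvd poly B 1" "int l dvd poly A 1" using prime_dvd_at_1 t Az by blast+
  hence "int l * int l dvd poly Phi 1" by (simp add: fac mult_dvd_mono)
  moreover have "poly Phi 1 = int l" by (simp add: poly_Phi)
  ultimately have "l * l dvd l" by (metis int_dvd_int_iff of_nat_mult)
  thus False using l_gt_1 by (auto dest: dvd_imp_le)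
qed

end

section \<open>Unramified primes, binary forms, and roots modulo r\<close>

context prime_power_cyclotomic
begin

lemma degree_less_smult_diff:
  "degree (c :: int poly) < m \<Longrightarrow> degree r < m \<Longrightarrow> degree (c - smult a r) < m"
  by (meson degree_diff_less degree_smult_le le_less_trans)

text \<open>Primes other than \<open>l\<close> are unramified. With \<open>p ^ f\<close> congruent
  to 1 modulo \<open>n\<close> and larger than \<open>e\<close>, the element \<open>c\<close> agrees
  modulo \<open>p\<close> with its power of exponent \<open>p ^ f\<close>, which is divisible by
  \<open>p\<close>. By \<open>Phi_minimal\<close> the divisibility passes to the
  coefficients.\<close>

lemma prime_dvd_of_power:
  assumes t: "t \<in> units" and p: "prime p" "p \<noteq> l"
    and c: "degree c < degree Phi" "ceval c (root t) ^ e = of_nat p * ceval h (root t)"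
  shows "\<exists>c'. c = smult (int p) c' \<and> degree c' < degree Phi"
proof -
  have "coprime p n" using p prime_l by (simp add: n_def primes_coprime)
  define f where "f = totient n * Suc e"
  have "[p ^ totient n = 1] (mod n)" using \<open>coprime p n\<close> by (rule euler_theorem)
  hence "[(p ^ totient n) ^ Suc e = 1 ^ Suc e] (mod n)" by (rule cong_pow)
  hence pf: "[p ^ f = 1] (mod n)" unfolding f_def power_mult by simp
  have "totient n > 0" using n_pos by simp
  hence "e < f" unfolding f_def by (cases "totient n") simp_all
  also have "f < p ^ f" using p(1) prime_gt_1_nat by (intro power_gt_expt) auto
  finally have ef: "e < p ^ f" .
  have rt: "root t ^ (p ^ f) = root t"
    unfolding root_power using cong_mult[OF cong_refl[of t n] pf] by (intro root_cong) simp
  obtain e' where e': "c ^ (p ^ f) = pcompose c (monom 1 (p ^ f)) + smult (int p) e'"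
    using int_poly_power_prime_power[OF p(1)] by blast
  have "ceval c (root t) ^ (p ^ f) = ceval c (root t) + of_nat p * ceval e' (root t)"
    using arg_cong[OF e', of "\<lambda>q. ceval q (root t)"] by (simp add: rt)
  moreover have "ceval c (root t) ^ (p ^ f) =
      of_nat p * (ceval h (root t) * ceval c (root t) ^ (p ^ f - e))"
    using c(2) power_add[of "ceval c (root t)" e "p ^ f - e"] ef by (simp add: mult_ac)
  ultimately have *: "ceval c (root t) = of_nat p * ceval (h * c ^ (p ^ f - e) - e') (root t)"
    by (simp add: algebra_simps)
  obtain q r where qr: "h * c ^ (p ^ f - e) - e' = Phi * q + r" "degree r < degree Phi"
    using int_poly_div_Phi by blast
  have "ceval Phi (root t) = 0" using t ceval_Phi_root by (simp add: units_def)
  hence "ceval (c - smult (int p) r) (root t) = 0" using * qr(1) by simp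
  moreover have "degree (c - smult (int p) r) < degree Phi"
    using c(1) qr(2) by (intro degree_less_smult_diff)
  ultimately have "c - smult (int p) r = 0" using Phi_minimal[OF t] by blast
  thus ?thesis using qr(2) by (intro exI[of _ r]) simp
qed

text \<open>One step of an infinite descent. Divisibility of \<open>c0\<close> is immediate from
  \<open>0 < b\<close>; cancelling \<open>p ^ b\<close> then leaves a positive power of
  \<open>p\<close> on the side of \<open>c0\<close>, thanks to \<open>b < l\<close>, and this forces
  \<open>p\<close> into \<open>c1\<close> too.\<close>

lemma not_lth_power_step:
  assumes t: "t \<in> units" and p: "prime p" "p \<noteq> l" and N: "N = p ^ b * N'" "0 < b" "b < l" "\<not> p dvd N'"
    and c: "degree c0 < degree Phi" "degree c1 < degree Phi"
      "ceval c0 (root t) ^ l = of_nat N * ceval c1 (root t) ^ l"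
  shows "\<exists>c0' c1'. c0 = smult (int p) c0' \<and> c1 = smult (int p) c1' \<and> degree c0' < degree Phi \<and>
    degree c1' < degree Phi \<and> ceval c0' (root t) ^ l = of_nat N * ceval c1' (root t) ^ l"
proof -
  define z where "z = root t"
  have "ceval c0 z ^ l = of_nat p * ceval (smult (int (p ^ (b - 1) * N')) (c1 ^ l)) z"
    using c(3) N(2) power_Suc[of "of_nat p :: complex" "b - 1"] by (simp add: z_def N(1))
  from prime_dvd_of_power[OF t p c(1) this[unfolded z_def]]
  obtain c0' where c0': "c0 = smult (int p) c0'" "degree c0' < degree Phi" by blast
  have p0: "p > 0" using p prime_gt_0_nat by auto
  have "of_nat p ^ b * (of_nat p ^ (l - b) * ceval c0' z ^ l) = ceval c0 z ^ l"
    using N(3) by (simp add: c0' power_mult_distrib mult.assoc[symmetric] power_add[symmetric])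
  also have "\<dots> = of_nat p ^ b * (of_nat N' * ceval c1 z ^ l)"
    using c(3) by (simp add: N(1) z_def)
  finally have e1: "of_nat p ^ (l - b) * ceval c0' z ^ l = of_nat N' * ceval c1 z ^ l" using p0 by simp
  \<comment> \<open>A Bezout relation makes \<open>N'\<close> invertible modulo \<open>p\<close>, so
    that \<open>c1 ^ l\<close> itself becomes a multiple of \<open>p\<close>.\<close>
  have "coprime N' p" using N(4) p by (metis coprime_commute prime_imp_coprime_nat)
  hence "coprime (int N') (int p)" by simp
  then obtain x y where xy: "int N' * x + int p * y = 1"
    using bezout_int[of "int N'" "int p"] by (metis coprime_imp_gcd_eq_1 mult.commute)
  have "ceval c1 z ^ l = of_int (int N' * x + int p * y) * ceval c1 z ^ l" by (simp add: xy)
  also have "\<dots> = of_int x * (of_nat N' * ceval c1 z ^ l) + of_nat p * of_int y * ceval c1 z ^ l"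
    by (simp add: algebra_simps)
  also have "\<dots> = of_int x * (of_nat p ^ (l - b) * ceval c0' z ^ l) + of_nat p * of_int y * ceval c1 z ^ l"
    by (simp only: e1)
  also have pw: "(of_nat p :: complex) ^ (l - b) = of_nat p * of_nat p ^ (l - b - 1)"
    using N(3) by (subst power_Suc[symmetric]) (simp add: Suc_diff_Suc)
  also have "of_int x * (of_nat p * of_nat p ^ (l - b - 1) * ceval c0' z ^ l) + of_nat p * of_int y * ceval c1 z ^ l
      = of_nat p * ceval (smult (x * int p ^ (l - b - 1)) (c0' ^ l) + smult y (c1 ^ l)) z"
    by (simp add: algebra_simps)
  finally have *: "ceval c1 z ^ l = \<dots>" .
  from prime_dvd_of_power[OF t p c(2) *[unfolded z_def]]
  obtain c1' where c1': "c1 = smult (int p) c1'" "degree c1' < degree Phi" by blast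
  have "of_nat p ^ l * ceval c0' z ^ l = of_nat p ^ l * (of_nat N * ceval c1' z ^ l)"
    using c(3) by (simp add: c0' c1' z_def power_mult_distrib mult_ac)
  thus ?thesis using c0' c1' p0 by (auto simp: z_def)
qed

text \<open>\<open>N\<close> is not an \<open>l\<close>-th power in the cyclotomic field: by descent
  all coefficients would be divisible by every power of \<open>p\<close>. This is what keeps the
  norms of \<open>form\<close> away from zero.\<close>

lemma not_lth_power:
  assumes t: "t \<in> units" and p: "prime p" "p \<noteq> l" and N: "N = p ^ b * N'" "0 < b" "b < l" "\<not> p dvd N'"
    and c: "degree c0 < degree Phi" "degree c1 < degree Phi"
      "ceval c0 (root t) ^ l = of_nat N * ceval c1 (root t) ^ l"
  shows "c0 = 0 \<and> c1 = 0"
proof -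
  have main: "\<exists>c0' c1'. c0 = smult (int p ^ j) c0' \<and> c1 = smult (int p ^ j) c1' \<and> degree c0' < degree Phi \<and>
    degree c1' < degree Phi \<and> ceval c0' (root t) ^ l = of_nat N * ceval c1' (root t) ^ l" for j
  proof (induction j)
    case 0
    thus ?case using c by auto
  next
    case (Suc j)
    then obtain a0 a1 where a: "c0 = smult (int p ^ j) a0" "c1 = smult (int p ^ j) a1"
      "degree a0 < degree Phi" "degree a1 < degree Phi"
      "ceval a0 (root t) ^ l = of_nat N * ceval a1 (root t) ^ l" by blast
    from not_lth_power_step[OF t p N a(3-5)] obtain b0 b1 where
      "a0 = smult (int p) b0" "a1 = smult (int p) b1" "degree b0 < degree Phi"
      "degree b1 < degree Phi" "ceval b0 (root t) ^ l = of_nat N * ceval b1 (root t) ^ l" by blast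
    thus ?case using a by (intro exI[of _ b0] exI[of _ b1]) (simp add: mult.commute)
  qed
  have zero: "x = 0" if "\<And>j. int p ^ j dvd x" for x :: int
  proof (rule ccontr)
    assume "x \<noteq> 0"
    have "nat \<bar>x\<bar> < p ^ nat \<bar>x\<bar>" using p(1) prime_gt_1_nat by (intro power_gt_expt) auto
    hence "int (nat \<bar>x\<bar>) < int (p ^ nat \<bar>x\<bar>)" by (simp only: of_nat_less_iff)
    moreover have "int p ^ nat \<bar>x\<bar> \<le> \<bar>x\<bar>"
      using that[of "nat \<bar>x\<bar>"] \<open>x \<noteq> 0\<close> by (intro zdvd_imp_le) auto
    ultimately show False by simp
  qed
  have "coeff c0 i = 0" "coeff c1 i = 0" for i
    by (rule zero, metis main coeff_smult dvd_triv_left)+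
  thus ?thesis by (auto simp: poly_eq_iff)
qed

definition form :: "nat \<Rightarrow> int poly \<Rightarrow> int poly \<Rightarrow> int poly" where
  "form N c0 c1 = c0 ^ l - smult (int N) (c1 ^ l)"

lemma Nm_form_nonzero:
  assumes p: "prime p" "p \<noteq> l" and N: "N = p ^ b * N'" "0 < b" "b < l" "\<not> p dvd N'"
    and c: "degree c0 < degree Phi" "degree c1 < degree Phi" "c0 \<noteq> 0 \<or> c1 \<noteq> 0"
  shows "Nm (form N c0 c1) \<noteq> 0"
proof
  assume "Nm (form N c0 c1) = 0"
  hence "(\<Prod>t\<in>units. ceval (form N c0 c1) (root t)) = 0" by (metis of_int_0 of_int_Nm)
  then obtain t where t: "t \<in> units" "ceval (form N c0 c1) (root t) = 0" by auto
  hence "ceval c0 (root t) ^ l = of_nat N * ceval c1 (root t) ^ l" by (simp add: form_def)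
  from not_lth_power[OF t(1) p N c(1,2) this] c(3) show False by simp
qed

lemma norm_ceval_le:
  assumes "degree c < m" "\<And>i. \<bar>coeff c i\<bar> \<le> int X"
  shows "norm (ceval c (root t)) \<le> real (m * X)"
proof -
  have "norm (ceval c (root t)) \<le> (\<Sum>i<m. norm (of_int (coeff c i) * root t ^ i))"
    unfolding ceval_altdef[OF assms(1)] by (rule norm_sum)
  also have "\<dots> \<le> (\<Sum>i<m. real X)"
  proof (intro sum_mono)
    fix i
    have "real_of_int \<bar>coeff c i\<bar> \<le> real X" using assms(2)[of i] by (metis of_int_le_iff of_int_of_nat_eq)
    thus "norm (of_int (coeff c i) * root t ^ i) \<le> real X"
      by (simp add: norm_mult norm_power root_def)
  qed
  finally show ?thesis by simp
qed

lemma Nm_form_le: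
  assumes "degree c0 < degree Phi" "\<And>i. \<bar>coeff c0 i\<bar> \<le> int X"
    "degree c1 < degree Phi" "\<And>i. \<bar>coeff c1 i\<bar> \<le> int X"
  shows "real_of_int \<bar>Nm (form N c0 c1)\<bar> \<le> (real (degree Phi * X) ^ l * (1 + real N)) ^ degree Phi"
proof -
  have "real_of_int \<bar>Nm (form N c0 c1)\<bar> = norm (complex_of_int (Nm (form N c0 c1)))" by simp
  also have "\<dots> = (\<Prod>t\<in>units. norm (ceval (form N c0 c1) (root t)))"
    unfolding of_int_Nm by (simp add: prod_norm)
  also have "\<dots> \<le> (\<Prod>t\<in>units. real (degree Phi * X) ^ l * (1 + real N))"
  proof (intro prod_mono conjI norm_ge_zero)
    fix t
    have "norm (ceval (form N c0 c1) (root t)) \<le>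
        norm (ceval c0 (root t)) ^ l + real N * norm (ceval c1 (root t)) ^ l"
      unfolding form_def by (simp add: norm_mult norm_power order.trans[OF norm_triangle_ineq4])
    also have "\<dots> \<le> real (degree Phi * X) ^ l + real N * real (degree Phi * X) ^ l"
      by (intro add_mono mult_left_mono power_mono norm_ceval_le assms) auto
    finally show "norm (ceval (form N c0 c1) (root t)) \<le> real (degree Phi * X) ^ l * (1 + real N)"
      by (simp add: algebra_simps)
  qed
  finally show ?thesis by (simp add: card_units degree_Phi)
qed

text \<open>Evaluation at \<open>s\<close> replaces reduction modulo a prime ideal above
  \<open>r\<close>; the powers \<open>s ^ t\<close> account for all conjugates.\<close>

lemma Nm_cong:
  assumes "r dvd poly Phi s"
  shows "[Nm A = (\<Prod>t\<in>units. poly A (s ^ t))] (mod r)"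
proof -
  obtain q where q: "conj_prod A = Phi * q + [:Nm A:]" using conj_prod_Nm by blast
  have "(\<Prod>t\<in>units. poly A (s ^ t)) = poly Phi s * poly q s + Nm A"
    using poly_conj_prod[of A s] by (simp add: q)
  thus ?thesis using assms by (simp add: cong_iff_dvd_diff)
qed

text \<open>\<open>s\<close> is the power of a primitive root modulo \<open>r\<close> with exponent
  \<open>totient (r ^ K) / n\<close>, so Euler's theorem yields a root modulo \<open>r ^ K\<close>
  without lifting. The high power is needed because norms will be shown divisible by powers of
  \<open>r\<close> with exponent up to \<open>K\<close>. Moreover \<open>s ^ d\<close> is a
  primitive \<open>l\<close>-th root of unity modulo \<open>r\<close>.\<close>

lemma root_mod_exists:
  assumes r: "prime r" "n dvd r - 1" and K: "K > 0"
  shows "\<exists>s::int. int r ^ K dvd poly Phi s \<and> \<not> [s ^ d = 1] (mod int r)"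
proof -
  have r1: "r > 1" using r prime_gt_1_nat by auto
  have "l dvd r - 1" using r(2) by (auto simp: n_def intro: dvd_trans)
  hence lr: "l \<noteq> r" using r1 l_gt_1
    by (metis Suc_pred' dvd_imp_le less_imp_Suc_add less_not_refl nat_dvd_not_less zero_less_diff diff_Suc_1 lessI)
  obtain m where m: "r - 1 = n * m" using r(2) by (elim dvdE)
  have m0: "m > 0" using m r1 by (cases m) auto
  obtain \<rho> where \<rho>: "residue_primroot r \<rho>"
    using prime_primitive_root_exists[OF r1 r(1)] by auto
  have ordr: "ord r \<rho> = r - 1" and cop: "coprime r \<rho>"
    using \<rho> r(1) by (auto simp: residue_primroot_def totient_prime)
  define h where "h = r ^ (K - 1) * m"
  define s where "s = \<rho> ^ h"
  have "[\<rho> ^ totient (r ^ K) = 1] (mod r ^ K)"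
    using cop by (intro euler_theorem) (simp add: coprime_commute)
  moreover have "totient (r ^ K) = h * n"
    using totient_prime_power[OF r(1) K] m by (simp add: h_def mult_ac)
  ultimately have "[s ^ n = 1] (mod r ^ K)" by (simp add: s_def power_mult)
  hence "[int s ^ n = 1] (mod int r ^ K)" by (metis cong_int_iff of_nat_1 of_nat_power)
  hence 1: "int r ^ K dvd int s ^ n - 1" by (simp add: cong_iff_dvd_diff)
  have 2: "\<not> [int s ^ d = 1] (mod int r)"
  proof
    assume "[int s ^ d = 1] (mod int r)"
    hence "[s ^ d = 1] (mod r)" by (metis cong_int_iff of_nat_1 of_nat_power)
    hence "[\<rho> ^ (h * d) = 1] (mod r)" by (simp add: s_def power_mult)
    hence "r - 1 dvd h * d" by (metis ord_divides ordr)
    hence "l * (d * m) dvd r ^ (K - 1) * (d * m)" unfolding m by (simp add: h_def n_eq mult_ac)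
    hence "l dvd r ^ (K - 1)" using m0 d_pos by simp
    hence "l dvd r" using prime_l prime_dvd_power by blast
    thus False using lr prime_l r(1) by (simp add: primes_dvd_imp_eq)
  qed
  have "(int s ^ d - 1) * poly Phi (int s) = int s ^ n - 1"
    unfolding poly_Phi n_eq
    using power_diff_1_eq[of "int s ^ d" l] by (simp add: power_mult[symmetric] mult.commute)
  hence "int r ^ K dvd (int s ^ d - 1) * poly Phi (int s)" using 1 by simp
  moreover have "coprime (int r ^ K) (int s ^ d - 1)"
  proof -
    have "\<not> int r dvd int s ^ d - 1" using 2 by (simp add: cong_iff_dvd_diff)
    hence "coprime (int r) (int s ^ d - 1)" using r(1) by (simp add: prime_imp_coprime)
    thus ?thesis by simp
  qed
  ultimately have "int r ^ K dvd poly Phi (int s)" by (simp add: coprime_dvd_mult_right_iff)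
  thus ?thesis using 2 by blast
qed

lemma roots_of_unity_distinct:
  assumes r: "prime r" and s: "int r dvd poly Phi s" "\<not> [s ^ d = 1] (mod int r)"
    and ij: "i < j" "j < l"
  shows "\<not> [s ^ (d * i) = s ^ (d * j)] (mod int r)"
proof
  define w where "w = s ^ d"
  have "(w - 1) * poly Phi s = w ^ l - 1" unfolding poly_Phi w_def
    using power_diff_1_eq[of "s ^ d" l] by (simp add: power_mult[symmetric] mult.commute)
  hence wl: "[w ^ l = 1] (mod int r)" using s(1) by (metis cong_iff_dvd_diff dvd_mult)
  have "\<not> int r dvd w"
  proof
    assume "int r dvd w"
    hence "[w ^ l = 0] (mod int r)" using l_gt_1 
      by (simp add: cong_0_iff dvd_trans[OF _ dvd_power[of l w]])
    hence "[0 = 1] (mod int r)" using wl by (meson cong_sym cong_trans)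
    thus False using r by (auto simp: cong_iff_dvd_diff)
  qed
  hence cop: "coprime w (int r)" using r by (metis coprime_commute prime_imp_coprime prime_nat_int_transfer)
  assume "[s ^ (d * i) = s ^ (d * j)] (mod int r)"
  hence "[w ^ i * 1 = w ^ i * w ^ (j - i)] (mod int r)"
    using ij by (simp add: w_def power_mult power_add[symmetric])
  hence wij: "[w ^ (j - i) = 1] (mod int r)"
    using cop by (subst (asm) cong_mult_lcancel) (auto simp: coprime_power_left_iff cong_sym_eq)
  have "coprime (j - i) l" using ij prime_l
    by (metis coprime_commute diff_le_self dvd_imp_le le_less_trans linorder_not_less prime_imp_coprime_nat zero_less_diff)
  then obtain x y where xy: "(j - i) * x = l * y + 1"
    using ij by (metis bezout_nat coprime_imp_gcd_eq_1 zero_less_diff neq0_conv)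
  have "[w ^ ((j - i) * x) = 1] (mod int r)" using cong_pow[OF wij, of x] by (simp add: power_mult)
  moreover have "[w ^ ((j - i) * x) = w] (mod int r)"
    using cong_mult[OF cong_pow[OF wl, of y] cong_refl[of w]]
    by (simp only: xy power_add power_mult power_one_right power_one mult_1)
  ultimately have "[w = 1] (mod int r)" by (meson cong_sym cong_trans)
  thus False using s(2) by (simp add: w_def)
qed

end

section \<open>Small primes with a prescribed nonresidue\<close>

text \<open>The Cauchy-Schwarz inequality over the \<open>r\<close> residue classes of
  \<open>f\<close>: the number of congruent pairs is least when the classes are equally
  large.\<close>

lemma card_congruent_pairs:
  fixes f :: "'a \<Rightarrow> int"
  assumes "finite B" "r > 0"
  shows "(card B)\<^sup>2 \<le> r * card {(u, v) \<in> B \<times> B. int r dvd f u - f v}"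
proof -
  define g where "g j = {u \<in> B. f u mod int r = int j}" for j
  have fin: "finite (g j)" for j using assms by (simp add: g_def)
  have disj: "i \<noteq> j \<Longrightarrow> g i \<inter> g j = {}" for i j by (auto simp: g_def)
  have B: "B = (\<Union>j<r. g j)"
  proof (intro equalityI subsetI)
    fix u assume "u \<in> B"
    moreover have "f u mod int r = int (nat (f u mod int r))" "nat (f u mod int r) < r"
      using assms by (simp_all add: nat_less_iff)
    ultimately show "u \<in> (\<Union>j<r. g j)"
      unfolding g_def by (intro UN_I[of "nat (f u mod int r)"] CollectI conjI) simp_all
  qed (auto simp: g_def)
  have "card B = (\<Sum>j<r. card (g j))"
    unfolding arg_cong[OF B, of card] using fin disj by (intro card_UN_disjoint) auto
  hence "(real (card B))\<^sup>2 = (\<Sum>j<r. real (card (g j)))\<^sup>2" by simp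
  also have "\<dots> \<le> (\<Sum>j<r. (real (card (g j)))\<^sup>2) * card {..<r}"
    by (rule sum_squared_le_sum_of_squares)
  also have "(\<Sum>j<r. (real (card (g j)))\<^sup>2) = real (\<Sum>j<r. card (g j \<times> g j))"
    by (simp add: power2_eq_square card_cartesian_product)
  also have "(\<Sum>j<r. card (g j \<times> g j)) = card (\<Union>j<r. g j \<times> g j)"
  proof (subst card_UN_disjoint)
    show "\<forall>i\<in>{..<r}. \<forall>j\<in>{..<r}. i \<noteq> j \<longrightarrow> g i \<times> g i \<inter> g j \<times> g j = {}"
      using disj by blast
  qed (use fin in auto)
  also have "(\<Union>j<r. g j \<times> g j) = {(u, v) \<in> B \<times> B. int r dvd f u - f v}"
  proof (intro equalityI subsetI)
    fix x assume "x \<in> {(u, v) \<in> B \<times> B. int r dvd f u - f v}"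
    then obtain u v where x: "x = (u, v)" "u \<in> B" "v \<in> B" "f u mod int r = f v mod int r"
      by (auto simp: mod_eq_dvd_iff)
    then obtain j where "j < r" "u \<in> g j" using B by blast
    thus "x \<in> (\<Union>j<r. g j \<times> g j)" using x by (auto simp: g_def)
  next
    fix x assume "x \<in> (\<Union>j<r. g j \<times> g j)"
    thus "x \<in> {(u, v) \<in> B \<times> B. int r dvd f u - f v}"
      by (auto simp: g_def mod_eq_dvd_iff[symmetric])
  qed
  finally have "real ((card B)\<^sup>2) \<le> real (r * card {(u, v) \<in> B \<times> B. int r dvd f u - f v})"
    by (simp add: mult.commute)
  thus ?thesis by (simp only: of_nat_le_iff)
qed

lemma prod_prime_powers_dvd:
  fixes N :: int
  assumes "finite R" "\<And>r. r \<in> R \<Longrightarrow> prime r" "\<And>r. r \<in> R \<Longrightarrow> int r ^ e r dvd N"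
  shows "(\<Prod>r\<in>R. int r ^ e r) dvd N"
  using assms
proof (induction R rule: finite_induct)
  case (insert r R)
  have "coprime (int r ^ e r) (\<Prod>r\<in>R. int r ^ e r)"
  proof (intro prod_coprime_right)
    fix q assume q: "q \<in> R"
    hence "coprime r q" using insert by (intro primes_coprime) auto
    thus "coprime (int r ^ e r) (int q ^ e q)" by simp
  qed
  thus ?case using insert by (simp add: divides_mult)
qed simp

section \<open>Linear factors modulo r and the counting inequality\<close>

context prime_power_cyclotomic
begin

text \<open>One vector \<open>w\<close> of \<open>2 * degree Phi\<close> integers encodes both
  arguments of \<open>form\<close>: the offset \<open>a\<close> is 0 for the first and
  \<open>degree Phi\<close> for the second.\<close>

definition lin :: "(nat \<Rightarrow> int) \<Rightarrow> nat \<Rightarrow> int poly" where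
  "lin w a = (\<Sum>i<degree Phi. monom (w (a + i)) i)"

lemma coeff_lin: "coeff (lin w a) i = (if i < degree Phi then w (a + i) else 0)"
  by (simp add: lin_def coeff_sum sum.delta)

lemma degree_lin: "degree (lin w a) < degree Phi"
  using degree_Phi_pos
  by (metis (no_types, lifting) coeff_lin degree_0 leading_coeff_0_iff)

lemma lin_diff: "lin (\<lambda>i. u i - v i) a = lin u a - lin v a"
  by (rule poly_eqI) (simp add: coeff_lin)

text \<open>Since \<open>\<tau> ^ l\<close> is \<open>N\<close> modulo \<open>r\<close>, the form
  splits modulo \<open>r\<close> into \<open>l\<close> linear factors, and \<open>I\<close> lists
  those that vanish. The splitting holds only modulo \<open>r\<close>, so multiplicities need an
  argument: a single vanishing factor gives one \<open>r\<close>, and two of them force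
  \<open>r\<close> to divide both arguments, whence \<open>r ^ l\<close> divides the form.\<close>

lemma form_dvd:
  fixes c0 c1 :: "int poly"
  assumes r: "prime r" "\<not> r dvd N" and s: "int r dvd poly Phi s" "\<not> [s ^ d = 1] (mod int r)"
    and \<tau>: "[\<tau> ^ l = int N] (mod int r)" and t: "t \<in> units"
  defines "I \<equiv> {k. k < l \<and> int r dvd poly c0 (s ^ t) - \<tau> * s ^ (d * k) * poly c1 (s ^ t)}"
  shows "int r ^ card I dvd poly (form N c0 c1) (s ^ t)"
proof -
  define a b where "a = poly c0 (s ^ t)" and "b = poly c1 (s ^ t)"
  have fin: "finite I" by (simp add: I_def)
  have F: "poly (form N c0 c1) (s ^ t) = a ^ l - int N * b ^ l"
    by (simp add: form_def a_def b_def)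
  have "I \<subseteq> {..<l}" by (auto simp: I_def)
  hence cardl: "card I \<le> l" using card_mono[of "{..<l}" I] by simp
  have "(s ^ d - 1) * poly Phi s = (s ^ d) ^ l - 1" unfolding poly_Phi
    using power_diff_1_eq[of "s ^ d" l] by (simp add: power_mult[symmetric] mult.commute)
  hence sl: "[(s ^ d) ^ l = 1] (mod int r)" using s(1) by (metis cong_iff_dvd_diff dvd_mult)
  consider "card I = 0" | "card I = 1" | "card I \<ge> 2" by linarith
  thus ?thesis
  proof cases
    case 2
    then obtain k where "k \<in> I" by (metis card_1_singletonE insertI1)
    hence "[a = \<tau> * s ^ (d * k) * b] (mod int r)" by (simp add: I_def a_def b_def cong_iff_dvd_diff)
    hence "[a ^ l = (\<tau> * s ^ (d * k) * b) ^ l] (mod int r)" by (rule cong_pow)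
    also have "(\<tau> * s ^ (d * k) * b) ^ l = \<tau> ^ l * ((s ^ d) ^ l) ^ k * b ^ l"
      by (simp add: power_mult_distrib power_mult[symmetric] mult_ac)
    also have "[\<dots> = int N * 1 ^ k * b ^ l] (mod int r)"
      by (intro cong_mult \<tau> cong_pow sl cong_refl)
    finally show ?thesis using 2 by (simp add: F cong_iff_dvd_diff)
  next
    case 3
    then obtain i j where ij: "i \<in> I" "j \<in> I" "i < j"
    proof -
      obtain i j where "i \<in> I" "j \<in> I" "i \<noteq> j"
        using 3 by (metis One_nat_def Suc_1 card_le_Suc0_iff_eq fin not_less_eq_eq)
      thus ?thesis using that by (cases i j rule: linorder_cases) auto
    qed
    have Ia: "int r dvd a - \<tau> * s ^ (d * i) * b" if "i \<in> I" for i
      using that by (simp add: I_def a_def b_def)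
    have "int r dvd (a - \<tau> * s ^ (d * i) * b) - (a - \<tau> * s ^ (d * j) * b)"
      by (rule dvd_diff[OF Ia[OF ij(1)] Ia[OF ij(2)]])
    hence "int r dvd \<tau> * (s ^ (d * j) - s ^ (d * i)) * b" by (simp add: algebra_simps)
    moreover have "\<not> int r dvd \<tau>"
    proof
      assume "int r dvd \<tau>"
      hence "int r dvd \<tau> ^ l" using l_gt_1 by (intro dvd_trans[OF _ dvd_power]) auto
      hence "int r dvd int N" using \<tau> cong_dvd_iff[of "\<tau> ^ l" "int N" "int r"] by simp
      thus False using r(2) by simp
    qed
    moreover have "\<not> int r dvd s ^ (d * j) - s ^ (d * i)"
      using roots_of_unity_distinct[OF r(1) s ij(3)] ij(2) by (auto simp: I_def cong_iff_dvd_diff dvd_diff_commute)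
    ultimately have rb: "int r dvd b" using r(1)
      by (metis prime_dvd_mult_iff prime_nat_int_transfer)
    have "int r dvd (a - \<tau> * s ^ (d * i) * b) + \<tau> * s ^ (d * i) * b"
      by (rule dvd_add[OF Ia[OF ij(1)] dvd_mult[OF rb]])
    hence ra: "int r dvd a" by simp
    have "int r ^ l dvd a ^ l - int N * b ^ l"
      using ra rb by (intro dvd_diff dvd_mult dvd_power_same)
    thus ?thesis unfolding F using cardl by (meson dvd_trans le_imp_power_dvd)
  qed simp
qed

text \<open>With \<open>D = degree Phi\<close>, the norm of \<open>form\<close> splits modulo
  \<open>r\<close> into \<open>K = l * D\<close> linear factors in \<open>2 * D\<close> variables.
  Among pairs of distinct vectors from a box of \<open>H = X ^ (2 * D)\<close> points, at least
  \<open>H ^ 2 / r - H\<close> agree under a given linear factor, and each agreement puts a factor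
  \<open>r\<close> into the norm of the difference, which is nonzero. Adding \<open>ln r\<close>
  over pairs, factors and primes and comparing with the size of the norms gives the bound, since
  both sides carry the factor \<open>K\<close>.\<close>

lemma lattice_inequality:
  assumes p: "prime p" "p \<noteq> l" and N: "N = p ^ b * N'" "0 < b" "b < l" "\<not> p dvd N'"
    and R: "finite R" "\<And>r. r \<in> R \<Longrightarrow> prime r" "\<And>r. r \<in> R \<Longrightarrow> n dvd r - 1" "\<And>r. r \<in> R \<Longrightarrow> \<not> r dvd N"
      "\<And>r. r \<in> R \<Longrightarrow> \<exists>\<tau>. [\<tau> ^ l = int N] (mod int r)"
    and X: "X > 0"
  shows "(\<Sum>r\<in>R. ln (real r) * (1 / real r - 1 / real X ^ (2 * degree Phi))) \<le>
    ln (real (degree Phi)) + ln (real X) + ln (1 + real N)"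
proof -
  define D where "D = degree Phi"
  have D0: "D > 0" using degree_Phi_pos by (simp add: D_def)
  define K where "K = l * D"
  have K0: "K > 0" using D0 l_gt_1 by (simp add: K_def)
  define B where "B = PiE {..<2 * D} (\<lambda>_. {0..<int X})"
  have finB: "finite B" by (auto simp: B_def intro!: finite_PiE)
  define H where "H = card B"
  have H: "H = X ^ (2 * D)" by (simp add: H_def B_def card_PiE)
  have H0: "H > 0" using X by (simp add: H)
  define G where "G w = Nm (form N (lin w 0) (lin w D))" for w
  define Bd where "Bd = (real (D * X) ^ l * (1 + real N)) ^ D"
  have "\<exists>s \<tau>. int r ^ K dvd poly Phi s \<and> \<not> [s ^ d = 1] (mod int r) \<and> [\<tau> ^ l = int N] (mod int r)"
    if "r \<in> R" for r using R(2,3,5)[OF that] root_mod_exists[of r K] K0 by blast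
  then obtain s \<tau> where s: "\<And>r. r \<in> R \<Longrightarrow> int r ^ K dvd poly Phi (s r)"
      "\<And>r. r \<in> R \<Longrightarrow> \<not> [s r ^ d = 1] (mod int r)"
    and \<tau>: "\<And>r. r \<in> R \<Longrightarrow> [\<tau> r ^ l = int N] (mod int r)" by metis
  define L where "L r t k w = poly (lin w 0) (s r ^ t) - \<tau> r * s r ^ (d * k) * poly (lin w D) (s r ^ t)" for r t k w
  define TK where "TK = units \<times> {..<l}"
  have finTK: "finite TK" by (simp add: TK_def)
  define \<nu> where "\<nu> r w = card {tk \<in> TK. int r dvd L r (fst tk) (snd tk) w}" for r w
  have cardTK: "card TK = K" by (simp add: TK_def card_units K_def D_def degree_Phi)
  have \<nu>_dvd: "int r ^ \<nu> r w dvd G w" if r: "r \<in> R" for r w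
  proof -
    have "int r dvd poly Phi (s r)" using s(1)[OF r] K0 by (metis dvd_power dvd_trans)
    hence "int r ^ card {k. k < l \<and> int r dvd L r t k w} dvd poly (form N (lin w 0) (lin w D)) (s r ^ t)"
      if "t \<in> units" for t unfolding L_def
      using form_dvd[OF R(2)[OF r] R(4)[OF r] _ s(2)[OF r] \<tau>[OF r] that] by blast
    hence "(\<Prod>t\<in>units. int r ^ card {k. k < l \<and> int r dvd L r t k w}) dvd
        (\<Prod>t\<in>units. poly (form N (lin w 0) (lin w D)) (s r ^ t))"
      by (intro prod_dvd_prod) auto
    also have "(\<Prod>t\<in>units. int r ^ card {k. k < l \<and> int r dvd L r t k w}) = int r ^ \<nu> r w"
    proof -
      have "{tk \<in> TK. int r dvd L r (fst tk) (snd tk) w} =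
          (SIGMA t:units. {k. k < l \<and> int r dvd L r t k w})" by (auto simp: TK_def)
      thus ?thesis by (simp add: \<nu>_def power_sum[symmetric])
    qed
    finally have 1: "int r ^ \<nu> r w dvd (\<Prod>t\<in>units. poly (form N (lin w 0) (lin w D)) (s r ^ t))" .
    have "\<nu> r w \<le> K" unfolding \<nu>_def cardTK[symmetric] by (intro card_mono finTK) auto
    hence "int r ^ \<nu> r w dvd poly Phi (s r)" using s(1)[OF r] by (meson dvd_trans le_imp_power_dvd)
    from Nm_cong[OF this, of "form N (lin w 0) (lin w D)"] 1 show ?thesis
      unfolding G_def by (simp add: cong_dvd_iff)
  qed
  have pair: "(\<Sum>r\<in>R. real (\<nu> r (\<lambda>i. u i - v i)) * ln (real r)) \<le> ln Bd"
    if uv: "u \<in> B" "v \<in> B" "u \<noteq> v" for u v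
  proof -
    define w where "w = (\<lambda>i. u i - v i)"
    have "\<exists>i<2 * D. u i \<noteq> v i" using uv unfolding B_def by (metis PiE_ext lessThan_iff)
    then obtain i where i: "i < 2 * D" "w i \<noteq> 0" by (auto simp: w_def)
    have "lin w 0 \<noteq> 0 \<or> lin w D \<noteq> 0"
    proof (cases "i < D")
      case True
      hence "coeff (lin w 0) i \<noteq> 0" using i by (simp add: coeff_lin D_def)
      thus ?thesis by auto
    next
      case False
      hence "coeff (lin w D) (i - D) \<noteq> 0" using i by (auto simp: coeff_lin D_def[symmetric])
      thus ?thesis by auto
    qed
    hence G0: "G w \<noteq> 0" unfolding G_def
      by (intro Nm_form_nonzero[OF p N]) (auto simp: degree_lin)
    have wX: "\<bar>w i\<bar> \<le> int X" if "i < 2 * D" for i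
    proof -
      have "u i \<in> {0..<int X}" "v i \<in> {0..<int X}"
        using that by (intro PiE_mem[OF uv(1)[unfolded B_def]] PiE_mem[OF uv(2)[unfolded B_def]]; simp)+
      thus ?thesis by (auto simp: w_def)
    qed
    have cX: "\<bar>coeff (lin w a) i\<bar> \<le> int X" if "a \<le> D" for a i
      using that wX by (auto simp: coeff_lin D_def)
    have GB: "real_of_int \<bar>G w\<bar> \<le> Bd" unfolding G_def Bd_def D_def
      by (intro Nm_form_le degree_lin cX) (auto simp: D_def)
    have "(\<Prod>r\<in>R. int r ^ \<nu> r w) dvd G w"
      by (intro prod_prime_powers_dvd R \<nu>_dvd)
    hence "(\<Prod>r\<in>R. int r ^ \<nu> r w) \<le> \<bar>G w\<bar>" using G0 by (intro zdvd_imp_le) auto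
    hence "real_of_int (\<Prod>r\<in>R. int r ^ \<nu> r w) \<le> Bd" using GB by linarith
    hence le: "(\<Prod>r\<in>R. real r ^ \<nu> r w) \<le> Bd" by simp
    have pos: "real r > 0" if "r \<in> R" for r using R(2)[OF that] prime_gt_0_nat by simp
    have "ln (\<Prod>r\<in>R. real r ^ \<nu> r w) \<le> ln Bd"
      using le pos by (subst ln_le_cancel_iff) (auto intro!: prod_pos less_le_trans[OF _ le])
    also have "ln (\<Prod>r\<in>R. real r ^ \<nu> r w) = (\<Sum>r\<in>R. real (\<nu> r w) * ln (real r))"
      using pos R(1) by (subst ln_prod) (auto simp: ln_realpow)
    finally show ?thesis by (simp add: w_def)
  qed
  define Q where "Q = {(u, v) \<in> B \<times> B. u \<noteq> v}"
  have finQ: "finite Q" using finB by (auto simp: Q_def intro: finite_subset[of _ "B \<times> B"])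
  have cardQ: "card Q \<le> H * H"
    using card_mono[of "B \<times> B" Q] finB by (auto simp: Q_def card_cartesian_product H_def)
  have lower: "real (card Q) * ln Bd \<ge> (\<Sum>r\<in>R. ln (real r) * (K * (real H ^ 2 / real r - real H)))"
  proof -
    have cnt: "real H ^ 2 / real r - real H \<le> card {x \<in> Q. int r dvd L r t k (\<lambda>i. fst x i - snd x i)}"
      if r: "r \<in> R" for r t k
    proof -
      have r0: "r > 0" using R(2)[OF r] prime_gt_0_nat by simp
      define f where "f w = L r t k w" for w
      have fd: "f (\<lambda>i. u i - v i) = f u - f v" for u v
        by (simp add: f_def L_def lin_diff algebra_simps)
      define P where "P = {(u, v) \<in> B \<times> B. int r dvd f u - f v}"
      have "P \<subseteq> {x \<in> Q. int r dvd L r t k (\<lambda>i. fst x i - snd x i)} \<union> (\<lambda>u. (u, u)) ` B"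
        by (auto simp: P_def Q_def fd[symmetric]) (auto simp: f_def)
      hence "card P \<le> card ({x \<in> Q. int r dvd L r t k (\<lambda>i. fst x i - snd x i)} \<union> (\<lambda>u. (u, u)) ` B)"
        using finQ finB by (intro card_mono) auto
      also have "\<dots> \<le> card {x \<in> Q. int r dvd L r t k (\<lambda>i. fst x i - snd x i)} + H"
        using card_Un_le[of "{x \<in> Q. int r dvd L r t k (\<lambda>i. fst x i - snd x i)}" "(\<lambda>u. (u, u)) ` B"]
          card_image_le[OF finB, of "\<lambda>u. (u, u)"] by (simp add: H_def)
      finally have 1: "card P \<le> card {x \<in> Q. int r dvd L r t k (\<lambda>i. fst x i - snd x i)} + H" .
      have "H ^ 2 \<le> r * card P" unfolding H_def P_def by (rule card_congruent_pairs[OF finB r0])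
      hence "real (H ^ 2) \<le> real (r * card P)" by (simp only: of_nat_le_iff)
      hence "real H ^ 2 / real r \<le> real (card P)" using r0 by (simp add: field_simps)
      thus ?thesis using 1 by linarith
    qed
    have "(\<Sum>r\<in>R. ln (real r) * (K * (real H ^ 2 / real r - real H))) \<le>
        (\<Sum>r\<in>R. ln (real r) * (\<Sum>x\<in>Q. real (\<nu> r (\<lambda>i. fst x i - snd x i))))"
    proof (intro sum_mono mult_left_mono)
      fix r assume r: "r \<in> R"
      show "ln (real r) \<ge> 0" using R(2)[OF r] prime_ge_1_nat[of r] by simp
      have "K * (real H ^ 2 / real r - real H) = (\<Sum>tk\<in>TK. real H ^ 2 / real r - real H)"
        by (simp add: cardTK)
      also have "\<dots> \<le> (\<Sum>tk\<in>TK. card {x \<in> Q. int r dvd L r (fst tk) (snd tk) (\<lambda>i. fst x i - snd x i)})"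
        unfolding of_nat_sum by (intro sum_mono cnt r)
      also have "(\<Sum>tk\<in>TK. card {x \<in> Q. int r dvd L r (fst tk) (snd tk) (\<lambda>i. fst x i - snd x i)}) =
          (\<Sum>x\<in>Q. \<nu> r (\<lambda>i. fst x i - snd x i))"
        unfolding \<nu>_def by (rule sum_multicount_gen) (use finTK finQ in auto)
      finally show "K * (real H ^ 2 / real r - real H) \<le> (\<Sum>x\<in>Q. real (\<nu> r (\<lambda>i. fst x i - snd x i)))"
        by simp
    qed
    also have "\<dots> = (\<Sum>x\<in>Q. \<Sum>r\<in>R. real (\<nu> r (\<lambda>i. fst x i - snd x i)) * ln (real r))"
      unfolding sum_distrib_left by (subst sum.swap) (simp add: mult.commute)
    also have "\<dots> \<le> (\<Sum>x\<in>Q. ln Bd)"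
      by (intro sum_mono) (auto simp: Q_def intro!: pair)
    finally show ?thesis by simp
  qed
  have DX: "real (D * X) \<ge> 1" using D0 X by (simp add: Suc_le_eq flip: of_nat_mult)
  have "Bd \<ge> 1" unfolding Bd_def using DX by (intro one_le_power mult_ge1_I) auto
  hence lnB: "ln Bd \<ge> 0" by simp
  have "H0'": "real H > 0" using H0 by simp
  have "real H ^ 2 * (K * (\<Sum>r\<in>R. ln (real r) * (1 / real r - 1 / real H))) =
      (\<Sum>r\<in>R. ln (real r) * (K * (real H ^ 2 / real r - real H)))"
    unfolding sum_distrib_left using H0 by (intro sum.cong refl) (simp add: field_simps power2_eq_square)
  also have "\<dots> \<le> real (card Q) * ln Bd" by (rule lower)
  also have "\<dots> \<le> real (H * H) * ln Bd" using cardQ lnB by (intro mult_right_mono) (simp_all only: of_nat_le_iff)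
  finally have "K * (\<Sum>r\<in>R. ln (real r) * (1 / real r - 1 / real H)) \<le> ln Bd"
    using H0' by (simp add: power2_eq_square)
  also have "ln Bd = D * (l * ln (real (D * X)) + ln (1 + real N))"
    unfolding Bd_def using DX D0 X by (simp add: ln_realpow ln_mult)
  also have "\<dots> \<le> D * (l * ln (real (D * X)) + l * ln (1 + real N))"
    using l_gt_1 mult_right_mono[of 1 "real l" "ln (1 + real N)"] by (intro mult_left_mono add_mono) auto
  also have "\<dots> = K * (ln (real (D * X)) + ln (1 + real N))"
    by (simp add: K_def algebra_simps)
  finally have "(\<Sum>r\<in>R. ln (real r) * (1 / real r - 1 / real H)) \<le> ln (real (D * X)) + ln (1 + real N)"
    using K0 by simp
  also have "ln (real (D * X)) = ln (real D) + ln (real X)" using D0 X by (simp add: ln_mult)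
  finally show ?thesis by (simp add: H D_def)
qed

end

context prime_power_cyclotomic
begin

text \<open>Suppose \<open>N = p ^ b * N'\<close> is an \<open>l\<close>-th power modulo every prime
  \<open>r\<close> that is 1 modulo \<open>n\<close> with \<open>M < r \<le> X ^ (2 * D)\<close>. By
  Mertens these primes have \<open>ln r / r\<close> summing to about \<open>2 * ln X - ln M\<close>,
  but \<open>lattice_inequality\<close> allows only about \<open>ln X + ln N\<close>. So
  \<open>X\<close> slightly above \<open>N * M\<close> gives a contradiction.\<close>

lemma exists_nonresidue_prime:
  assumes odd_l: "odd l"
  shows "\<exists>C\<ge>1. \<forall>p b N' M. prime p \<longrightarrow> p \<noteq> l \<longrightarrow> 0 < b \<longrightarrow> b < l \<longrightarrow> \<not> p dvd N' \<longrightarrow>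
    (\<forall>r. prime r \<longrightarrow> r dvd p ^ b * N' \<longrightarrow> r \<le> M) \<longrightarrow> M > 0 \<longrightarrow> N' > 0 \<longrightarrow>
    (\<exists>r. prime r \<and> n dvd r - 1 \<and> M < r \<and> ln (real r) \<le> C * (1 + ln (real (p ^ b * N')) + ln (real M)) \<and>
      (\<nexists>\<tau>. [\<tau> ^ l = int (p ^ b * N')] (mod int r)))"
proof -
  have tot: "totient n = degree Phi"
    unfolding n_def degree_Phi d_def using totient_prime_power[OF prime_l, of "Suc k"] by (simp add: mult.commute)
  have nodd: "n > 1" "odd n"
  proof -
    show "n > 1" using one_less_power[OF l_gt_1, of "Suc k"] by (simp add: n_def)
    show "odd n" using odd_l by (simp add: n_def)
  qed
  obtain C1 where C1: "\<And>N. N > 0 \<Longrightarrow> (\<Sum>p | p \<in> {1..N} \<and> prime p \<and> [p = 1] (mod n). ln (real p) / real p) \<ge>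
      ln (real N) / real (totient n) - C1"
    using mertens_progression[OF nodd, of 1] by auto
  define D where "D = degree Phi"
  have D0: "D > 0" using degree_Phi_pos by (simp add: D_def)
  \<comment> \<open>Two terms 4 have to be covered, from the primes up to \<open>M\<close> and from
    Chebyshev's bound for the \<open>1 / H\<close> correction; one more makes the contradiction
    strict.\<close>
  define C2 where "C2 = max 0 (C1 + 9 + ln 2 + ln (real D))"
  define C where "C = 2 * real D * (C2 + 2)"
  have "C2 \<ge> 0" by (simp add: C2_def)
  have "C \<ge> 1"
  proof -
    have "2 * 1 * (0 + 2) \<le> 2 * real D * (C2 + 2)"
      using D0 \<open>C2 \<ge> 0\<close> by (intro mult_mono) auto
    thus ?thesis by (simp add: C_def)
  qed
  have "\<exists>r. prime r \<and> n dvd r - 1 \<and> M < r \<and> ln (real r) \<le> C * (1 + ln (real N) + ln (real M)) \<and>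
      (\<nexists>\<tau>. [\<tau> ^ l = int N] (mod int r))"
    if p: "prime p" "p \<noteq> l" and b: "0 < b" "b < l" and N': "\<not> p dvd N'"
      and N: "N = p ^ b * N'" and M: "\<And>r. prime r \<Longrightarrow> r dvd N \<Longrightarrow> r \<le> M" "M > 0" "N' > 0" for p b N' N M
  proof (rule ccontr)
    assume none: "\<not> ?thesis"
    have N0: "N > 0" using N M(3) p prime_gt_0_nat by simp
    have lnN: "ln (real N) \<ge> 0" "ln (real M) \<ge> 0" using N0 M by auto
    define X where "X = nat \<lceil>exp (C2 + ln (real N) + ln (real M))\<rceil>"
    have X1: "exp (C2 + ln (real N) + ln (real M)) \<le> real X" unfolding X_def by linarith
    have ge1: "exp (C2 + ln (real N) + ln (real M)) \<ge> 1" using \<open>C2 \<ge> 0\<close> lnN by simp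
    have X0: "X > 0" using X1 ge1 by (cases X) auto
    have "real X \<le> exp (C2 + ln (real N) + ln (real M)) + 1" unfolding X_def using ge1 by linarith
    also have "\<dots> \<le> 2 * exp (C2 + ln (real N) + ln (real M))" using ge1 by linarith
    also have "\<dots> \<le> exp 1 * exp (C2 + ln (real N) + ln (real M))"
      using exp_ge_add_one_self[of 1] by (intro mult_right_mono) auto
    also have "\<dots> = exp (C2 + ln (real N) + ln (real M) + 1)" by (simp add: exp_add)
    finally have lnX2: "ln (real X) \<le> C2 + ln (real N) + ln (real M) + 1"
      using X0 ln_mono[of "real X" "exp (C2 + ln (real N) + ln (real M) + 1)"] by simp
    have lnX: "ln (real X) \<ge> C2 + ln (real N) + ln (real M)"
      using X1 X0 by (subst ln_ge_iff) auto
    define H where "H = X ^ (2 * D)"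
    have H0: "H > 0" using X0 by (simp add: H_def)
    have lnH: "ln (real H) = 2 * real D * ln (real X)" using X0 by (simp add: H_def ln_realpow)
    define R where "R = {r. prime r \<and> [r = 1] (mod n) \<and> M < r \<and> r \<le> H}"
    have finR: "finite R" by (auto simp: R_def)
    have Rn: "n dvd r - 1" if "r \<in> R" for r
      using that prime_ge_1_nat[of r] by (auto simp: R_def cong_altdef_nat)
    have Rres: "\<exists>\<tau>. [\<tau> ^ l = int N] (mod int r)" if r: "r \<in> R" for r
    proof -
      have "r > 0" using r by (auto simp: R_def prime_gt_0_nat)
      have "real r \<le> real H" using r by (simp add: R_def)
      hence "ln (real r) \<le> ln (real H)" using \<open>r > 0\<close> by (intro ln_mono) auto
      also have "\<dots> \<le> 2 * real D * (C2 + ln (real N) + ln (real M) + 1)"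
        unfolding lnH using lnX2 by (intro mult_left_mono) auto
      also have "\<dots> \<le> 2 * real D * ((C2 + 2) * (1 + ln (real N) + ln (real M)))"
        using lnN \<open>C2 \<ge> 0\<close> by (intro mult_left_mono) (auto simp: algebra_simps)
      finally have "ln (real r) \<le> C * (1 + ln (real N) + ln (real M))" by (simp add: C_def mult.assoc)
      thus ?thesis using none r Rn[OF r] by (auto simp: R_def)
    qed
    have "(\<Sum>r\<in>R. ln (real r) * (1 / real r - 1 / real X ^ (2 * degree Phi))) \<le>
        ln (real (degree Phi)) + ln (real X) + ln (1 + real N)"
    proof (rule lattice_inequality[OF p N b N' finR])
      fix r assume r: "r \<in> R"
      show "prime r" using r by (simp add: R_def)
      show "\<not> r dvd N" using r M(1)[of r] by (auto simp: R_def)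
    qed (use Rn Rres X0 in auto)
    hence 1: "(\<Sum>r\<in>R. ln (real r) * (1 / real r - 1 / real H)) \<le> ln (real D) + ln (real X) + ln (1 + real N)"
      by (simp add: D_def H_def)
    have "(\<Sum>r\<in>R. ln (real r)) \<le> psi H"
    proof -
      have "(\<Sum>r\<in>R. ln (real r)) = (\<Sum>r\<in>R. \<Lambda> r)" by (intro sum.cong) (auto simp: R_def)
      also have "\<dots> \<le> psi H" unfolding psi_def
        by (intro sum_mono2) (auto simp: R_def mangoldt_nonneg intro: prime_ge_1_nat)
      finally show ?thesis .
    qed
    also have "\<dots> \<le> 4 * real H" by (rule psi_le)
    finally have 2: "(\<Sum>r\<in>R. ln (real r)) * (1 / real H) \<le> 4" using H0 by (simp add: field_simps)
    have 3: "(\<Sum>r\<in>R. ln (real r) * (1 / real r - 1 / real H)) =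
        (\<Sum>r\<in>R. ln (real r) / real r) - (\<Sum>r\<in>R. ln (real r)) * (1 / real H)"
      by (simp add: sum_subtractf sum_distrib_right right_diff_distrib sum_divide_distrib)
    have "(\<Sum>p | p \<in> {1..H} \<and> prime p \<and> [p = 1] (mod n). ln (real p) / real p) \<le>
        (\<Sum>p\<in>R \<union> {p \<in> {1..M}. prime p}. ln (real p) / real p)"
      by (intro sum_mono2) (auto simp: R_def)
    also have "\<dots> \<le> (\<Sum>p\<in>R. ln (real p) / real p) + (\<Sum>p | p \<in> {1..M} \<and> prime p. ln (real p) / real p)"
      using finR by (subst sum.union_inter[symmetric]) (auto intro!: sum_nonneg)
    also have "(\<Sum>p | p \<in> {1..M} \<and> prime p. ln (real p) / real p) \<le> ln (real M) + 4"
      by (rule sum_ln_primes_le[OF M(2)])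
    finally have 4: "(\<Sum>p\<in>R. ln (real p) / real p) \<ge> ln (real H) / real D - C1 - ln (real M) - 4"
      using C1[OF H0] by (simp add: tot D_def)
    have 5: "ln (real H) / real D = 2 * ln (real X)" using D0 by (simp add: lnH)
    have 6: "ln (1 + real N) \<le> ln 2 + ln (real N)"
    proof -
      have "ln (1 + real N) \<le> ln (2 * real N)" using N0 by (intro ln_mono) auto
      thus ?thesis using N0 by (simp add: ln_mult)
    qed
    have "2 * ln (real X) - C1 - ln (real M) - 4 - 4 \<le> ln (real D) + ln (real X) + ln 2 + ln (real N)"
      using 1 2 3 4 5 6 by linarith
    hence "ln (real X) \<le> C1 + 8 + ln 2 + ln (real D) + ln (real N) + ln (real M)" by linarith
    moreover have "C2 \<ge> C1 + 9 + ln 2 + ln (real D)" by (simp add: C2_def)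
    ultimately show False using lnX by linarith
  qed
  thus ?thesis using \<open>C \<ge> 1\<close> by blast
qed

end

section \<open>Characters of order g with prescribed values\<close>

lemma nonresidue_prime:
  assumes "prime l" "odd l"
  shows "\<exists>C\<ge>1. \<forall>p b N' M. prime p \<longrightarrow> p \<noteq> l \<longrightarrow> 0 < b \<longrightarrow> b < l \<longrightarrow> \<not> p dvd N' \<longrightarrow>
    (\<forall>r. prime r \<longrightarrow> r dvd p ^ b * N' \<longrightarrow> r \<le> M) \<longrightarrow> M > 0 \<longrightarrow> N' > 0 \<longrightarrow>
    (\<exists>r. prime r \<and> l ^ Suc k dvd r - 1 \<and> M < r \<and> ln (real r) \<le> C * (1 + ln (real (p ^ b * N')) + ln (real M)) \<and>
      (\<nexists>\<tau>. [\<tau> ^ l = int (p ^ b * N')] (mod int r)))"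
proof -
  interpret prime_power_cyclotomic l k by standard (rule assms(1))
  show ?thesis using exists_nonresidue_prime[OF assms(2)] unfolding n_def .
qed

text \<open>A generating character is raised to the power that leaves the order
  \<open>h = gcd g (r - 1)\<close>. If \<open>l ^ Suc k\<close> divides \<open>h\<close>, then
  \<open>\<eta> x ^ (l ^ c) = 1\<close> with \<open>c \<le> k\<close> forces \<open>l\<close> to
  divide the discrete logarithm of \<open>x\<close>.\<close>

lemma power_residue_character:
  assumes r: "prime r" and g: "g > 0"
  shows "\<exists>\<eta>. dirichlet_character r \<eta> \<and> (\<forall>n. coprime n (int r) \<longrightarrow> \<eta> n ^ g = 1) \<and>
    (\<forall>l k c x. prime l \<longrightarrow> l ^ Suc k dvd g \<longrightarrow> l ^ Suc k dvd r - 1 \<longrightarrow> c \<le> k \<longrightarrow> coprime x (int r) \<longrightarrow>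
      \<eta> x ^ (l ^ c) = 1 \<longrightarrow> (\<exists>\<tau>. [\<tau> ^ l = x] (mod int r)))"
proof -
  have r1: "r > 1" using r prime_gt_1_nat by auto
  obtain \<rho> where \<rho>: "residue_primroot r \<rho>" using prime_primitive_root_exists[OF r1 r] by auto
  have tot: "totient r = r - 1" using r by (simp add: totient_prime)
  obtain \<psi> where \<psi>: "dirichlet_character r \<psi>" "\<And>j. \<psi> (int \<rho> ^ j) = cis (2 * pi * real j / real (r - 1))"
    using generator_character[OF _ \<rho>] r1 unfolding tot by auto
  have gen: "\<exists>j. [int \<rho> ^ j = x] (mod int r)" if x: "coprime x (int r)" for x
  proof -
    define b where "b = nat (x mod int r)"
    have b: "[int b = x] (mod int r)" "b < r" using r1 by (auto simp: b_def cong_def nat_less_iff)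
    hence "coprime (int b) (int r)" using x by (metis cong_imp_coprime cong_sym)
    hence "b \<in> totatives r" using b(2) r1 by (auto simp: totatives_def intro!: Nat.gr0I)
    then obtain j where "b = \<rho> ^ j mod r"
      using residue_primroot_is_generator[OF r1 \<rho>] by (auto simp: bij_betw_def)
    hence "[int \<rho> ^ j = int b] (mod int r)" by (simp add: cong_def zmod_int)
    thus ?thesis using b(1) cong_trans by blast
  qed
  define h where "h = gcd g (r - 1)"
  define m where "m = (r - 1) div h"
  have hm: "r - 1 = h * m" by (simp add: m_def h_def)
  have m0: "m > 0" using hm r1 by (cases m) auto
  define \<eta> where "\<eta> n = \<psi> n ^ m" for n
  have dc: "dirichlet_character r \<eta>" unfolding \<eta>_def by (rule dc_pow[OF \<psi>(1) m0])
  have one: "\<eta> x ^ e = 1 \<longleftrightarrow> h dvd j * e" if "[int \<rho> ^ j = x] (mod int r)" for x j e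
  proof -
    have "\<eta> x ^ e = \<psi> (int \<rho> ^ (j * (m * e)))"
      using dc_cong[OF \<psi>(1) that] by (simp add: \<eta>_def dc_power[OF \<psi>(1)] power_mult)
    also have "\<dots> = 1 \<longleftrightarrow> r - 1 dvd j * (m * e)"
      unfolding \<psi>(2) using r1 by (intro cis_2pi_div_eq_1_iff) simp
    also have "\<dots> \<longleftrightarrow> m * h dvd m * (j * e)" unfolding hm by (simp only: mult_ac)
    also have "\<dots> \<longleftrightarrow> h dvd j * e" using m0 by simp
    finally show ?thesis .
  qed
  have "\<eta> n ^ g = 1" if n: "coprime n (int r)" for n
  proof -
    obtain j where j: "[int \<rho> ^ j = n] (mod int r)" using gen[OF n] by blast
    show ?thesis unfolding one[OF j] by (simp add: h_def)
  qed
  moreover have "\<exists>\<tau>. [\<tau> ^ l = x] (mod int r)"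
    if l: "prime l" "l ^ Suc k dvd g" "l ^ Suc k dvd r - 1" "c \<le> k" "coprime x (int r)" "\<eta> x ^ (l ^ c) = 1" for l k c x
  proof -
    obtain j where j: "[int \<rho> ^ j = x] (mod int r)" using gen[OF l(5)] by blast
    have "l ^ Suc k dvd h" using l by (simp add: h_def del: power_Suc)
    hence "l ^ Suc k dvd j * l ^ c" using one[OF j] l(6) dvd_trans by blast
    moreover have "l ^ Suc c dvd l ^ Suc k" using l(4) by (intro le_imp_power_dvd) auto
    ultimately have "l ^ c * l dvd l ^ c * j" by (metis dvd_trans mult.commute power_Suc)
    hence "l dvd j" using l(1) by simp
    then obtain i where "j = i * l" by (metis dvd_def mult.commute)
    hence "[(int \<rho> ^ i) ^ l = x] (mod int r)" using j by (simp add: power_mult)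
    thus ?thesis by blast
  qed
  ultimately show ?thesis using dc by blast
qed

definition residue_char :: "nat \<Rightarrow> nat \<Rightarrow> int \<Rightarrow> complex" where
  "residue_char g r = (SOME \<eta>. dirichlet_character r \<eta> \<and> (\<forall>n. coprime n (int r) \<longrightarrow> \<eta> n ^ g = 1) \<and>
    (\<forall>l k c x. prime l \<longrightarrow> l ^ Suc k dvd g \<longrightarrow> l ^ Suc k dvd r - 1 \<longrightarrow> c \<le> k \<longrightarrow> coprime x (int r) \<longrightarrow>
      \<eta> x ^ (l ^ c) = 1 \<longrightarrow> (\<exists>\<tau>. [\<tau> ^ l = x] (mod int r))))"

lemma
  assumes "prime r" "g > 0"
  shows residue_char_dc: "dirichlet_character r (residue_char g r)"
    and residue_char_power: "coprime n (int r) \<Longrightarrow> residue_char g r n ^ g = 1"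
    and residue_char_detect: "prime l \<Longrightarrow> l ^ Suc k dvd g \<Longrightarrow> l ^ Suc k dvd r - 1 \<Longrightarrow> c \<le> k \<Longrightarrow> coprime x (int r) \<Longrightarrow>
      residue_char g r x ^ (l ^ c) = 1 \<Longrightarrow> \<exists>\<tau>. [\<tau> ^ l = x] (mod int r)"
  using someI_ex[OF power_residue_character[OF assms]] unfolding residue_char_def[symmetric] by blast+

lemma exists_prime_multiplicity_less:
  fixes b g :: nat
  assumes "0 < b" "b < g"
  shows "\<exists>l. prime l \<and> multiplicity l b < multiplicity l g"
proof (rule ccontr)
  assume "\<not> ?thesis"
  hence "g dvd b" using assms by (intro multiplicity_le_imp_dvd) (auto simp: not_less)
  thus False using assms by (auto dest: dvd_imp_le)
qed

text \<open>Once the common power \<open>l ^ c\<close> is removed from the exponents, the product of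
  the primes in \<open>P\<close> is no longer an \<open>l\<close>-th power. A prime \<open>r\<close>
  modulo which it is not an \<open>l\<close>-th power residue, and which is 1 modulo the full
  \<open>l\<close>-part of \<open>g\<close>, separates by \<open>residue_char_detect\<close>.
  Detection needs \<open>c\<close> below the exponent of \<open>l\<close> in \<open>g\<close>, so
  \<open>l\<close> is chosen to occur less often in some \<open>b p\<close> than in
  \<open>g\<close>.\<close>

lemma separating_prime:
  assumes g: "g \<ge> 3" "odd g"
  shows "\<exists>C\<ge>1. \<forall>N P b. N > 0 \<longrightarrow> P \<subseteq> {p. prime p \<and> p \<le> N \<and> \<not> p dvd g} \<longrightarrow> (\<forall>p\<in>P. b p < g) \<longrightarrow>
    (\<exists>p\<in>P. b p \<noteq> 0) \<longrightarrow>
    (\<exists>r. prime r \<and> N < r \<and> ln (real r) \<le> C * real N ^ 2 \<and> (\<Prod>p\<in>P. residue_char g r (int p) ^ b p) \<noteq> 1)"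
proof -
  have "\<exists>C\<ge>1. \<forall>p b N' M. prime p \<longrightarrow> p \<noteq> l \<longrightarrow> 0 < b \<longrightarrow> b < l \<longrightarrow> \<not> p dvd N' \<longrightarrow>
    (\<forall>r. prime r \<longrightarrow> r dvd p ^ b * N' \<longrightarrow> r \<le> M) \<longrightarrow> M > 0 \<longrightarrow> N' > 0 \<longrightarrow>
    (\<exists>r. prime r \<and> l ^ multiplicity l g dvd r - 1 \<and> M < r \<and> ln (real r) \<le> C * (1 + ln (real (p ^ b * N')) + ln (real M)) \<and>
      (\<nexists>\<tau>. [\<tau> ^ l = int (p ^ b * N')] (mod int r)))" if "l \<in> prime_factors g" for l
  proof -
    have l: "prime l" "l dvd g" using that by auto
    have "odd l" using l g by (meson dvd_trans even_iff_mod_2_eq_zero dvd_refl)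
    have "multiplicity l g > 0" using l g by (simp add: prime_multiplicity_gt_zero_iff)
    hence "multiplicity l g = Suc (multiplicity l g - 1)" by simp
    thus ?thesis using nonresidue_prime[OF l(1) \<open>odd l\<close>, of "multiplicity l g - 1"] by metis
  qed
  then obtain Cf where Cf1: "\<And>l. l \<in> prime_factors g \<Longrightarrow> Cf l \<ge> (1::real)" and
    Cf: "\<And>l p b N' M. l \<in> prime_factors g \<Longrightarrow> prime p \<Longrightarrow> p \<noteq> l \<Longrightarrow> 0 < b \<Longrightarrow> b < l \<Longrightarrow> \<not> p dvd N' \<Longrightarrow>
    (\<And>r. prime r \<Longrightarrow> r dvd p ^ b * N' \<Longrightarrow> r \<le> M) \<Longrightarrow> M > 0 \<Longrightarrow> N' > 0 \<Longrightarrow>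
    (\<exists>r. prime r \<and> l ^ multiplicity l g dvd r - 1 \<and> M < r \<and> ln (real r) \<le> Cf l * (1 + ln (real (p ^ b * N')) + ln (real M)) \<and>
      (\<nexists>\<tau>. [\<tau> ^ l = int (p ^ b * N')] (mod int r)))" by metis
  define C0 where "C0 = (\<Sum>l\<in>prime_factors g. Cf l)"
  have C0: "Cf l \<le> C0" if "l \<in> prime_factors g" for l
    unfolding C0_def using that by (intro member_le_sum) (auto intro: order.trans[OF zero_le_one Cf1])
  have C0_nonneg: "C0 \<ge> 0" unfolding C0_def by (intro sum_nonneg) (auto intro: order.trans[OF zero_le_one Cf1])
  define C where "C = 1 + C0 * (2 + real g)"
  have C1: "C \<ge> 1" using C0_nonneg by (simp add: C_def)
  have "\<exists>r. prime r \<and> N < r \<and> ln (real r) \<le> C * real N ^ 2 \<and> (\<Prod>p\<in>P. residue_char g r (int p) ^ b p) \<noteq> 1"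
    if N: "N > 0" and P: "P \<subseteq> {p. prime p \<and> p \<le> N \<and> \<not> p dvd g}" and b: "\<And>p. p \<in> P \<Longrightarrow> b p < g"
      and nz: "p1 \<in> P" "b p1 \<noteq> 0" for N P b p1
  proof -
    have finP: "finite P" by (rule finite_subset[OF P]) simp
    obtain l where l: "prime l" "multiplicity l (b p1) < multiplicity l g"
      using exists_prime_multiplicity_less[of "b p1" g] b nz by auto
    have lg: "l \<in> prime_factors g" using l g
      by (metis gr_implies_not0 in_prime_factors_iff multiplicity_eq_zero_iff not_dvd_imp_multiplicity_0
          odd_pos zero_less_iff_neq_zero neq0_conv)
    define a where "a = multiplicity l g"
    \<comment> \<open>The multiplicity of \<open>l\<close> in \<open>b p1\<close> bounds
      \<open>c\<close>, hence \<open>c < a\<close>; maximality provides \<open>p0\<close> whose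
      reduced exponent is not divisible by \<open>l\<close>.\<close>
    define c where "c = (GREATEST c. \<forall>p\<in>P. l ^ c dvd b p)"
    have bound: "c' \<le> multiplicity l (b p1)" if "\<forall>p\<in>P. l ^ c' dvd b p" for c'
      using that nz l(1) by (intro multiplicity_geI) auto
    have c: "\<forall>p\<in>P. l ^ c dvd b p" unfolding c_def
      by (rule GreatestI_nat[of "\<lambda>c. \<forall>p\<in>P. l ^ c dvd b p" 0 "multiplicity l (b p1)"]) (use bound in auto)
    have ca: "c < a" using bound[OF c] l(2) by (simp add: a_def)
    have "\<not> (\<forall>p\<in>P. l ^ Suc c dvd b p)"
    proof
      assume "\<forall>p\<in>P. l ^ Suc c dvd b p"
      hence "Suc c \<le> c" unfolding c_def
        by (intro Greatest_le_nat[where b = "multiplicity l (b p1)"]) (use bound in auto)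
      thus False by simp
    qed
    then obtain p0 where p0: "p0 \<in> P" "\<not> l ^ Suc c dvd b p0" by blast
    define b' where "b' p = b p div l ^ c" for p
    have bb': "b p = l ^ c * b' p" if "p \<in> P" for p using c that by (simp add: b'_def)
    have lb': "\<not> l dvd b' p0" using p0 bb'[OF p0(1)] l(1) by auto
    \<comment> \<open>Reducing the exponents modulo \<open>l\<close> changes the product only by the
      \<open>l\<close>-th power of \<open>y\<close>, and puts the exponent of \<open>p0\<close>
      strictly between 0 and \<open>l\<close>, as required for the nonresidue prime.\<close>
    define e where "e p = b' p mod l" for p
    have l0: "l > 0" using l(1) prime_gt_0_nat by auto
    have el: "e p < l" for p using l0 by (simp add: e_def)
    have e0: "e p0 > 0" using lb' by (simp add: e_def dvd_eq_mod_eq_0)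
    define N' where "N' = (\<Prod>p\<in>P - {p0}. p ^ e p)"
    define n2 where "n2 = p0 ^ e p0 * N'"
    have n2: "n2 = (\<Prod>p\<in>P. p ^ e p)" unfolding n2_def N'_def 
      by (rule prod.remove[OF finP p0(1), of "\<lambda>p. p ^ e p", symmetric])
    define y where "y = (\<Prod>p\<in>P. p ^ (b' p div l))"
    have Pp: "prime p" "p \<le> N" "\<not> p dvd g" if "p \<in> P" for p using P that by auto
    have N'0: "N' > 0" unfolding N'_def using Pp prime_gt_0_nat by (intro prod_pos) auto
    have pN': "\<not> p0 dvd N'"
    proof
      assume "p0 dvd N'"
      then obtain p where p: "p \<in> P - {p0}" "p0 dvd p ^ e p" unfolding N'_def
        using prime_dvd_prod_iff[of "P - {p0}" p0] finP Pp[OF p0(1)] by auto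
      hence "p0 dvd p" using Pp[OF p0(1)] prime_dvd_power by blast
      thus False using p Pp p0 primes_dvd_imp_eq by blast
    qed
    have small: "r \<le> N" if r: "prime r" "r dvd n2" for r
    proof -
      obtain p where p: "p \<in> P" "r dvd p ^ e p"
        using r prime_dvd_prod_iff[of P r] finP unfolding n2 by auto
      hence "r dvd p" using r prime_dvd_power by blast
      thus ?thesis using r p Pp primes_dvd_imp_eq by blast
    qed
    have "p0 \<noteq> l" using Pp[OF p0(1)] lg by auto
    obtain r where r: "prime r" "l ^ a dvd r - 1" "N < r"
      "ln (real r) \<le> Cf l * (1 + ln (real n2) + ln (real N))" "\<nexists>\<tau>. [\<tau> ^ l = int n2] (mod int r)"
      using Cf[OF lg Pp(1)[OF p0(1)] \<open>p0 \<noteq> l\<close> e0 el pN' small[unfolded n2_def] N N'0]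
      unfolding a_def n2_def by blast
    have copr: "coprime (int p) (int r)" if "p \<in> P" for p
      using Pp[OF that] r by (simp add: primes_coprime)
    have lnn2: "ln (real n2) \<le> real N * (real g * ln (real N))"
    proof -
      have "ln (real n2) = (\<Sum>p\<in>P. real (e p) * ln (real p))"
        unfolding n2 of_nat_prod using Pp prime_gt_0_nat finP by (subst ln_prod) (auto simp: ln_realpow)
      also have "\<dots> \<le> (\<Sum>p\<in>P. real g * ln (real N))"
      proof (intro sum_mono mult_mono)
        fix p assume p: "p \<in> P"
        have "e p \<le> b' p" by (simp add: e_def)
        also have "b' p \<le> b p" by (simp add: b'_def)
        also have "b p \<le> g" using b[OF p] by simp
        finally show "real (e p) \<le> real g" by simp
        show "ln (real p) \<le> ln (real N)" using Pp[OF p] prime_gt_0_nat by (intro ln_mono) auto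
        show "ln (real p) \<ge> 0" using Pp[OF p] prime_ge_1_nat by simp
      qed auto
      also have "\<dots> = real (card P) * (real g * ln (real N))" by simp
      also have "\<dots> \<le> real N * (real g * ln (real N))"
      proof -
        have "P \<subseteq> {1..N}" using Pp prime_ge_1_nat by auto
        hence "card P \<le> N" using card_mono[of "{1..N}" P] by simp
        thus ?thesis using N by (intro mult_right_mono) auto
      qed
      finally show ?thesis .
    qed
    have lnN: "ln (real N) \<le> real N" using N by (intro ln_bound) auto
    have "ln (real r) \<le> C0 * (1 + ln (real n2) + ln (real N))"
    proof -
      have "n2 > 0" using N'0 Pp(1)[OF p0(1)] prime_gt_0_nat by (simp add: n2_def)
      hence "ln (real n2) \<ge> 0" by simp
      thus ?thesis using r(4) C0[OF lg] N mult_right_mono[OF C0[OF lg], of "1 + ln (real n2) + ln (real N)"] by simp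
    qed
    also have "\<dots> \<le> C0 * (real N * real N + real N * (real g * real N) + real N * real N)"
    proof (intro mult_left_mono add_mono)
      have N1: "real N \<ge> 1" using N by simp
      show "1 \<le> real N * real N" using N1 mult_mono[of 1 "real N" 1 "real N"] by simp
      show "ln (real N) \<le> real N * real N" using lnN N1 mult_left_mono[of 1 "real N" "real N"] by linarith
      have "real N * (real g * ln (real N)) \<le> real N * (real g * real N)" using lnN by (intro mult_left_mono) auto
      thus "ln (real n2) \<le> real N * (real g * real N)" using lnn2 by linarith
    qed (rule C0_nonneg)
    also have "\<dots> \<le> C * real N ^ 2" using C0_nonneg by (simp add: C_def algebra_simps power2_eq_square)
    finally have lnr: "ln (real r) \<le> C * real N ^ 2" .
    have "(\<Prod>p\<in>P. residue_char g r (int p) ^ b p) \<noteq> 1"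
    proof
      assume one: "(\<Prod>p\<in>P. residue_char g r (int p) ^ b p) = 1"
      have g0: "g > 0" using g by simp
      define n1 where "n1 = int (\<Prod>p\<in>P. p ^ b' p)"
      note dc = residue_char_dc[OF r(1) g0]
      have "residue_char g r n1 ^ (l ^ c) = (\<Prod>p\<in>P. residue_char g r (int p) ^ b p)"
      proof -
        have dcprod: "residue_char g r (int (\<Prod>p\<in>A. p ^ f p)) = (\<Prod>p\<in>A. residue_char g r (int p) ^ f p)" for A f
          by (induction A rule: infinite_finite_induct) (use dc_1[OF dc] in \<open>simp_all add: dc_mult[OF dc] dc_power[OF dc]\<close>)
        show ?thesis unfolding n1_def dcprod prod_power_distrib
          by (intro prod.cong refl) (simp add: bb' power_mult[symmetric] mult.commute)
      qed
      hence n1': "residue_char g r n1 ^ (l ^ c) = 1" using one by simp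
      have cop1: "coprime n1 (int r)" unfolding n1_def of_nat_prod using copr by (intro prod_coprime_left) auto
      have copy: "coprime (int y) (int r)" unfolding y_def of_nat_prod using copr by (intro prod_coprime_left) auto
      obtain k where k: "a = Suc k" using ca by (cases a) auto
      have "l ^ Suc k dvd g" using multiplicity_dvd[of l g] by (simp add: a_def[symmetric] k[symmetric] del: power_Suc)
      then obtain \<tau> where \<tau>: "[\<tau> ^ l = n1] (mod int r)"
        using residue_char_detect[OF r(1) g0 l(1) _ _ _ cop1 n1', of k] r(2) ca k by auto
      have n12: "n1 = int n2 * int y ^ l"
      proof -
        have "(\<Prod>p\<in>P. p ^ b' p) = (\<Prod>p\<in>P. p ^ e p * (p ^ (b' p div l)) ^ l)"
          by (intro prod.cong refl) (simp add: e_def power_mult[symmetric] power_add[symmetric])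
        also have "\<dots> = n2 * y ^ l" by (simp add: prod.distrib n2 y_def prod_power_distrib)
        finally show ?thesis by (simp add: n1_def)
      qed
      obtain y' where y': "[int y * y' = 1] (mod int r)" using cong_solve_coprime_int[OF copy] by blast
      have "[(\<tau> * y') ^ l = n1 * y' ^ l] (mod int r)"
        using cong_scalar_right[OF \<tau>, of "y' ^ l"] by (simp add: power_mult_distrib)
      also have "n1 * y' ^ l = int n2 * (int y * y') ^ l" by (simp add: n12 power_mult_distrib mult_ac)
      also have "[\<dots> = int n2 * 1 ^ l] (mod int r)" by (intro cong_mult cong_refl cong_pow y')
      finally show False using r(5) by auto
    qed
    thus ?thesis using r lnr by blast
  qed
  note main = this
  show ?thesis
  proof (intro exI[of _ C] conjI C1 allI impI)
    fix N :: nat and P and b :: "nat \<Rightarrow> nat"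
    assume "N > 0" "P \<subseteq> {p. prime p \<and> p \<le> N \<and> \<not> p dvd g}" "\<forall>p\<in>P. b p < g" "\<exists>p\<in>P. b p \<noteq> 0"
    thus "\<exists>r. prime r \<and> N < r \<and> ln (real r) \<le> C * real N ^ 2 \<and> (\<Prod>p\<in>P. residue_char g r (int p) ^ b p) \<noteq> 1"
      using main[of N P b] by blast
  qed
qed

text \<open>A family of homomorphisms on \<open>(\<int>/g)\<^sup>P\<close> with trivial common kernel has a subfamily of at most
  \<open>card P * log 2 g\<close> members with trivial common kernel, as each useful member halves the kernel.\<close>

lemma halving:
  fixes h :: "'r \<Rightarrow> (nat \<Rightarrow> nat) \<Rightarrow> complex"
  assumes P: "finite P" and g: "g > 0"
    and hom: "\<And>r b b'. r \<in> A \<Longrightarrow> b \<in> PiE P (\<lambda>_. {..<g}) \<Longrightarrow> b' \<in> PiE P (\<lambda>_. {..<g}) \<Longrightarrow>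
      h r (\<lambda>p\<in>P. (b p + b' p) mod g) = h r b * h r b'"
    and zero: "\<And>r. r \<in> A \<Longrightarrow> h r (\<lambda>p\<in>P. 0) = 1"
    and sep: "\<And>b. b \<in> PiE P (\<lambda>_. {..<g}) \<Longrightarrow> \<exists>p\<in>P. b p \<noteq> 0 \<Longrightarrow> \<exists>r\<in>A. h r b \<noteq> 1"
  shows "\<exists>R. finite R \<and> R \<subseteq> A \<and> 2 ^ card R \<le> g ^ card P \<and>
    (\<forall>b\<in>PiE P (\<lambda>_. {..<g}). (\<exists>p\<in>P. b p \<noteq> 0) \<longrightarrow> (\<exists>r\<in>R. h r b \<noteq> 1))"
proof -
  define Box where "Box = PiE P (\<lambda>_. {..<g})"
  have finB: "finite Box" using P by (auto simp: Box_def intro: finite_PiE)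
  have cardB: "card Box = g ^ card P" using P by (simp add: Box_def card_PiE)
  define Ker where "Ker R = {b \<in> Box. \<forall>r\<in>R. h r b = 1}" for R
  have finK: "finite (Ker R)" for R using finB by (simp add: Ker_def)
  define z where "z = (\<lambda>p\<in>P. 0::nat)"
  have zK: "z \<in> Ker R" if "R \<subseteq> A" for R
    using that zero g by (auto simp: Ker_def Box_def z_def)
  have main: "\<exists>R'. finite R' \<and> R' \<subseteq> A \<and> 2 ^ card R' \<le> card Box \<and> (\<forall>b\<in>Ker R'. \<forall>p\<in>P. b p = 0)"
    if "finite R" "R \<subseteq> A" "2 ^ card R * card (Ker R) \<le> card Box" for R
    using that
  proof (induction "card (Ker R)" arbitrary: R rule: less_induct)
    case less
    have pos: "card (Ker R) > 0" using zK[OF less.prems(2)] finK[of R] by (auto simp: card_gt_0_iff)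
    show ?case
    proof (cases "\<forall>b\<in>Ker R. \<forall>p\<in>P. b p = 0")
      case True
      have "2 ^ card R * 1 \<le> 2 ^ card R * card (Ker R)" using pos by (intro mult_left_mono) auto
      hence "2 ^ card R \<le> card Box" using less.prems(3) by linarith
      thus ?thesis using True less.prems by (intro exI[of _ R]) auto
    next
      case False
      then obtain b where b: "b \<in> Ker R" "\<exists>p\<in>P. b p \<noteq> 0" by blast
      hence bB: "b \<in> Box" by (simp add: Ker_def)
      then obtain r where r: "r \<in> A" "h r b \<noteq> 1" using sep[of b] b(2) by (auto simp: Box_def)
      hence rR: "r \<notin> R" using b(1) by (auto simp: Ker_def)
      define R' where "R' = insert r R"
      have R'A: "R' \<subseteq> A" using less.prems r by (simp add: R'_def)
      \<comment> \<open>Translation by \<open>b\<close> carries the smaller kernel injectively into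
        its complement in the larger one, because \<open>h r b\<close> is not 1.\<close>
      define sh where "sh x = (\<lambda>p\<in>P. (b p + x p) mod g)" for x
      have shB: "sh x \<in> Box" for x using g by (auto simp: sh_def Box_def)
      have hsh: "h r' (sh x) = h r' b * h r' x" if "r' \<in> A" "x \<in> Box" for r' x
        unfolding sh_def using hom that bB by (auto simp: Box_def)
      have inj: "inj_on sh Box"
      proof (rule inj_onI)
        fix x y assume xy: "x \<in> Box" "y \<in> Box" "sh x = sh y"
        show "x = y"
        proof (rule PiE_ext[of x P "\<lambda>_. {..<g}" y])
          fix p assume p: "p \<in> P"
          have "[b p + x p = b p + y p] (mod g)" using fun_cong[OF xy(3), of p] p by (simp add: sh_def cong_def)
          hence "[x p = y p] (mod g)" by (simp add: cong_add_lcancel_nat)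
          moreover have "x p < g" "y p < g" using xy p by (auto simp: Box_def)
          ultimately show "x p = y p" by (simp add: cong_def)
        qed (use xy in \<open>auto simp: Box_def\<close>)
      qed
      have sub: "Ker R' \<subseteq> Ker R" by (auto simp: Ker_def R'_def)
      have img: "sh ` Ker R' \<subseteq> Ker R - Ker R'"
      proof
        fix y assume "y \<in> sh ` Ker R'"
        then obtain x where x: "x \<in> Ker R'" "y = sh x" by blast
        have xB: "x \<in> Box" using x by (simp add: Ker_def)
        have "h r' y = 1" if "r' \<in> R" for r'
          using that x b(1) hsh[of r' x] xB less.prems(2) by (auto simp: Ker_def R'_def)
        moreover have "h r y \<noteq> 1" using x hsh[OF r(1) xB] r(2) by (auto simp: Ker_def R'_def)
        ultimately show "y \<in> Ker R - Ker R'" using shB x by (auto simp: Ker_def R'_def)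
      qed
      have "card (sh ` Ker R') = card (Ker R')"
        by (intro card_image inj_on_subset[OF inj]) (auto simp: Ker_def)
      moreover have "card (sh ` Ker R') \<le> card (Ker R - Ker R')" using img finK by (intro card_mono) auto
      moreover have "card (Ker R - Ker R') = card (Ker R) - card (Ker R')"
        using sub finK by (intro card_Diff_subset) auto
      moreover have "card (Ker R') \<le> card (Ker R)" using sub finK by (intro card_mono) auto
      ultimately have half: "2 * card (Ker R') \<le> card (Ker R)" by linarith
      have pos': "card (Ker R') > 0" using zK[OF R'A] finK[of R'] by (auto simp: card_gt_0_iff)
      have "2 ^ card R' * card (Ker R') = 2 ^ card R * (2 * card (Ker R'))"
        using rR less.prems(1) by (simp add: R'_def)
      also have "\<dots> \<le> 2 ^ card R * card (Ker R)" using half by (intro mult_left_mono) auto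
      also have "\<dots> \<le> card Box" by (rule less.prems(3))
      finally show ?thesis using half pos' R'A less.prems(1) less.hyps[of R'] by (simp add: R'_def)
    qed
  qed
  have "Ker {} = Box" by (auto simp: Ker_def)
  hence "\<exists>R'. finite R' \<and> R' \<subseteq> A \<and> 2 ^ card R' \<le> card Box \<and> (\<forall>b\<in>Ker R'. \<forall>p\<in>P. b p = 0)"
    using main[of "{}"] by simp
  then obtain R' where R': "finite R'" "R' \<subseteq> A" "2 ^ card R' \<le> card Box" "\<And>b p. b \<in> Ker R' \<Longrightarrow> p \<in> P \<Longrightarrow> b p = 0"
    by blast
  have "\<exists>r\<in>R'. h r b \<noteq> 1" if "b \<in> Box" "p \<in> P" "b p \<noteq> 0" for b p
    using R'(4)[of b p] that by (auto simp: Ker_def)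
  hence "\<forall>b\<in>Box. (\<exists>p\<in>P. b p \<noteq> 0) \<longrightarrow> (\<exists>r\<in>R'. h r b \<noteq> 1)" by blast
  thus ?thesis using R'(1-3) unfolding cardB[symmetric] Box_def[symmetric] by (intro exI[of _ R'] conjI)
qed

text \<open>Orthogonality: the number of exponent vectors \<open>e\<close> with the prescribed values is
  \<open>g ^ card R / g ^ card P\<close>; here it suffices that the corresponding character sum is nonzero.\<close>

lemma prescribe_values:
  fixes v :: "'r \<Rightarrow> nat \<Rightarrow> complex" and z :: "nat \<Rightarrow> complex"
  assumes fin: "finite P" "finite R" and g: "g > 0"
    and v: "\<And>r p. r \<in> R \<Longrightarrow> p \<in> P \<Longrightarrow> v r p ^ g = 1" and z: "\<And>p. p \<in> P \<Longrightarrow> z p ^ g = 1"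
    and sep: "\<And>b. b \<in> PiE P (\<lambda>_. {..<g}) \<Longrightarrow> \<exists>p\<in>P. b p \<noteq> 0 \<Longrightarrow> \<exists>r\<in>R. (\<Prod>p\<in>P. v r p ^ b p) \<noteq> 1"
  shows "\<exists>e. \<forall>p\<in>P. (\<Prod>r\<in>R. v r p ^ e r) = z p"
proof -
  define Box where "Box = PiE P (\<lambda>_. {..<g})"
  define E where "E = PiE R (\<lambda>_. {..<g})"
  define y where "y p = inverse (z p)" for p
  have y: "y p ^ g = 1" "y p * z p = 1" if "p \<in> P" for p
  proof -
    have "z p \<noteq> 0" using z[OF that] g by (auto simp: power_0_left)
    thus "y p ^ g = 1" "y p * z p = 1" using z[OF that] by (simp_all add: y_def power_inverse)
  qed
  define X where "X e p = (\<Prod>r\<in>R. v r p ^ e r)" for e p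
  have Xg: "(X e p * y p) ^ g = 1" if "p \<in> P" for e p
  proof -
    have "X e p ^ g = (\<Prod>r\<in>R. (v r p ^ g) ^ e r)"
      unfolding X_def prod_power_distrib by (intro prod.cong refl) (simp add: power_mult[symmetric] mult.commute)
    also have "\<dots> = 1" using v that by simp
    finally show ?thesis using y(1)[OF that] by (simp add: power_mult_distrib)
  qed
  have geo: "(\<Sum>i<g. w ^ i) = (if w = 1 then of_nat g else 0)" if "w ^ g = 1" for w :: complex
    using that by (auto simp: geometric_sum)
  have hb: "(\<Prod>p\<in>P. v r p ^ b p) ^ g = 1" if "r \<in> R" for r b
  proof -
    have "(\<Prod>p\<in>P. v r p ^ b p) ^ g = (\<Prod>p\<in>P. (v r p ^ g) ^ b p)"
      unfolding prod_power_distrib by (intro prod.cong refl) (simp add: power_mult[symmetric] mult.commute)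
    thus ?thesis using v that by simp
  qed
  define b0 where "b0 = (\<lambda>p\<in>P. 0::nat)"
  have b0: "b0 \<in> Box" using g by (auto simp: b0_def Box_def)
  have "(\<Sum>e\<in>E. \<Prod>p\<in>P. \<Sum>i<g. (X e p * y p) ^ i) = (\<Sum>e\<in>E. \<Sum>b\<in>Box. \<Prod>p\<in>P. (X e p * y p) ^ b p)"
    unfolding Box_def using fin by (subst prod_sum_PiE) auto
  also have "\<dots> = (\<Sum>b\<in>Box. \<Sum>e\<in>E. \<Prod>p\<in>P. (X e p * y p) ^ b p)" by (rule sum.swap)
  also have "\<dots> = (\<Sum>b\<in>Box. if b = b0 then of_nat g ^ card R else 0)"
  proof (intro sum.cong refl)
    fix b assume b: "b \<in> Box"
    have "(\<Sum>e\<in>E. \<Prod>p\<in>P. (X e p * y p) ^ b p) =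
        (\<Sum>e\<in>E. (\<Prod>p\<in>P. y p ^ b p) * (\<Prod>r\<in>R. (\<Prod>p\<in>P. v r p ^ b p) ^ e r))"
    proof (intro sum.cong refl)
      fix e
      have "(\<Prod>p\<in>P. (X e p * y p) ^ b p) = (\<Prod>p\<in>P. y p ^ b p) * (\<Prod>p\<in>P. X e p ^ b p)"
        by (simp add: power_mult_distrib prod.distrib mult.commute)
      also have "(\<Prod>p\<in>P. X e p ^ b p) = (\<Prod>p\<in>P. \<Prod>r\<in>R. v r p ^ (e r * b p))"
        by (simp add: X_def prod_power_distrib power_mult)
      also have "\<dots> = (\<Prod>r\<in>R. \<Prod>p\<in>P. v r p ^ (e r * b p))" by (rule prod.swap)
      also have "\<dots> = (\<Prod>r\<in>R. (\<Prod>p\<in>P. v r p ^ b p) ^ e r)"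
        unfolding prod_power_distrib by (intro prod.cong refl) (simp add: power_mult[symmetric] mult.commute)
      finally show "(\<Prod>p\<in>P. (X e p * y p) ^ b p) = (\<Prod>p\<in>P. y p ^ b p) * (\<Prod>r\<in>R. (\<Prod>p\<in>P. v r p ^ b p) ^ e r)" .
    qed
    also have "\<dots> = (\<Prod>p\<in>P. y p ^ b p) * (\<Sum>e\<in>E. \<Prod>r\<in>R. (\<Prod>p\<in>P. v r p ^ b p) ^ e r)"
      by (simp add: sum_distrib_left)
    also have "(\<Sum>e\<in>E. \<Prod>r\<in>R. (\<Prod>p\<in>P. v r p ^ b p) ^ e r) = (\<Prod>r\<in>R. \<Sum>i<g. (\<Prod>p\<in>P. v r p ^ b p) ^ i)"
      unfolding E_def using fin by (subst prod_sum_PiE) auto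
    also have "\<dots> = (\<Prod>r\<in>R. if (\<Prod>p\<in>P. v r p ^ b p) = 1 then of_nat g else 0)"
      using geo[OF hb] by (intro prod.cong refl) auto
    also have "(\<Prod>p\<in>P. y p ^ b p) * \<dots> = (if b = b0 then of_nat g ^ card R else 0)"
    proof (cases "b = b0")
      case True
      thus ?thesis by (simp add: b0_def)
    next
      case False
      have "\<exists>p\<in>P. b p \<noteq> 0"
      proof (rule ccontr)
        assume "\<not> ?thesis"
        hence "b = b0" using b b0 unfolding Box_def by (intro PiE_ext[of b P _ b0]) (auto simp: b0_def)
        thus False using False by simp
      qed
      then obtain r where "r \<in> R" "(\<Prod>p\<in>P. v r p ^ b p) \<noteq> 1" using sep[of b] b by (auto simp: Box_def)
      hence "(\<Prod>r\<in>R. if (\<Prod>p\<in>P. v r p ^ b p) = 1 then of_nat g else 0) = (0::complex)"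
        using fin(2) by (intro prod_zero) auto
      thus ?thesis using False by simp
    qed
    finally show "(\<Sum>e\<in>E. \<Prod>p\<in>P. (X e p * y p) ^ b p) = (if b = b0 then of_nat g ^ card R else 0)" .
  qed
  also have "\<dots> = of_nat g ^ card R" using b0 fin by (simp add: Box_def finite_PiE)
  also have "\<dots> \<noteq> 0" using g by simp
  finally have "\<exists>e\<in>E. (\<Prod>p\<in>P. \<Sum>i<g. (X e p * y p) ^ i) \<noteq> 0" by (metis (no_types, lifting) sum.neutral)
  then obtain e where e: "(\<Prod>p\<in>P. \<Sum>i<g. (X e p * y p) ^ i) \<noteq> 0" by blast
  have "X e p = z p" if p: "p \<in> P" for p
  proof -
    have "(\<Sum>i<g. (X e p * y p) ^ i) \<noteq> 0" using e p fin by (auto simp: prod_zero_iff)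
    hence "X e p * y p = 1" using geo[OF Xg[OF p]] by (auto split: if_splits)
    hence "X e p * (y p * z p) = z p" by (simp add: mult.assoc[symmetric])
    thus ?thesis using y(2)[OF p] by simp
  qed
  thus ?thesis unfolding X_def by blast
qed

section \<open>Products of characters to distinct prime moduli\<close>

lemma coprime_prod_iff:
  fixes n :: int
  shows "finite Q \<Longrightarrow> coprime n (\<Prod>r\<in>Q. f r) \<longleftrightarrow> (\<forall>r\<in>Q. coprime n (f r))"
  by (induction Q rule: finite_induct) auto

lemma dc_prod:
  assumes "finite Q" "\<And>r. r \<in> Q \<Longrightarrow> dirichlet_character r (\<phi> r)"
  shows "dirichlet_character (\<Prod>Q) (\<lambda>n. \<Prod>r\<in>Q. \<phi> r n)"
  unfolding dirichlet_character_def
proof (intro conjI allI)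
  show "\<Prod>Q > 0" using assms by (auto intro!: prod_pos dest: dc_pos)
  show "(\<Prod>r\<in>Q. \<phi> r (m * n)) = (\<Prod>r\<in>Q. \<phi> r m) * (\<Prod>r\<in>Q. \<phi> r n)" for m n
    unfolding prod.distrib[symmetric] by (intro prod.cong refl dc_mult[OF assms(2)])
  show "(\<Prod>r\<in>Q. \<phi> r (n + int (\<Prod>Q))) = (\<Prod>r\<in>Q. \<phi> r n)" for n
  proof (intro prod.cong refl)
    fix r assume r: "r \<in> Q"
    hence "r dvd \<Prod>Q" using dvd_prodI[OF assms(1) r, of "\<lambda>x. x"] by simp
    then obtain k where "\<Prod>Q = r * k" by (elim dvdE)
    thus "\<phi> r (n + int (\<Prod>Q)) = \<phi> r n" using dc_add_mult[OF assms(2)[OF r], of n "int k"] by simp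
  qed
  show "(\<Prod>r\<in>Q. \<phi> r n) = 0 \<longleftrightarrow> \<not> coprime n (int (\<Prod>Q))" for n
    using assms(1) dc_zero_iff[OF assms(2)] by (auto simp: of_nat_prod coprime_prod_iff)
qed

text \<open>The form in which primitivity of a character is used: it makes the Gauss sum at
  \<open>k\<close> vanish whenever \<open>k\<close> is not coprime to \<open>q\<close>.\<close>

definition separates :: "nat \<Rightarrow> (int \<Rightarrow> complex) \<Rightarrow> bool" where
  "separates q \<chi>' \<longleftrightarrow> (\<forall>k. \<not> coprime k (int q) \<longrightarrow>
     (\<exists>a. coprime a (int q) \<and> \<chi>' a \<noteq> 1 \<and> [a * k = k] (mod int q)))"

text \<open>If the prime \<open>r\<close> divides \<open>k\<close>, the Chinese remainder theorem
  gives \<open>a\<close> that is 1 modulo the other moduli and has nontrivial value at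
  \<open>r\<close>. Multiplication by \<open>a\<close> fixes \<open>k\<close> modulo the product, as
  \<open>r\<close> divides \<open>k\<close> and the remaining modulus divides
  \<open>a - 1\<close>.\<close>

lemma separates_prod:
  assumes fin: "finite Q" and pr: "\<And>r. r \<in> Q \<Longrightarrow> prime r" and dc: "\<And>r. r \<in> Q \<Longrightarrow> dirichlet_character r (\<phi> r)"
    and np: "\<And>r. r \<in> Q \<Longrightarrow> \<exists>n. coprime n (int r) \<and> \<phi> r n \<noteq> 1"
  shows "separates (\<Prod>Q) (\<lambda>n. \<Prod>r\<in>Q. \<phi> r n)"
  unfolding separates_def
proof (intro allI impI)
  fix k assume k: "\<not> coprime k (int (\<Prod>Q))"
  then obtain r where r: "r \<in> Q" "\<not> coprime k (int r)"
    using prod_coprime_right[of Q k int] by (auto simp: of_nat_prod)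
  hence rk: "int r dvd k" using pr[OF r(1)]
    by (metis coprime_commute prime_imp_coprime prime_nat_int_transfer)
  obtain n0 where n0: "coprime n0 (int r)" "\<phi> r n0 \<noteq> 1" using np[OF r(1)] by blast
  define m where "m = \<Prod>(Q - {r})"
  have Qm: "\<Prod>Q = r * m" unfolding m_def using prod.remove[OF fin r(1), of "\<lambda>x. x"] by simp
  have "coprime r m" unfolding m_def
    using pr r(1) by (intro prod_coprime_right primes_coprime) auto
  hence "coprime (int r) (int m)" by simp
  then obtain a where a: "[a = n0] (mod int r)" "[a = 1] (mod int m)"
    using binary_chinese_remainder_int[of "int r" "int m" n0 1] by blast
  have m': "[a = 1] (mod int r')" if "r' \<in> Q - {r}" for r'
  proof -
    have "r' dvd m" unfolding m_def using dvd_prodI[of "Q - {r}" r' "\<lambda>x. x"] fin that by simp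
    thus ?thesis using a(2) cong_dvd_modulus[of a 1 "int m" "int r'"] by simp
  qed
  have "\<phi> r' a = 1" if "r' \<in> Q - {r}" for r'
    using dc_cong[OF dc m'[OF that]] dc_1[OF dc] that by auto
  hence "(\<Prod>r\<in>Q. \<phi> r a) = \<phi> r a" using prod.remove[OF fin r(1), of "\<lambda>r. \<phi> r a"] by simp
  also have "\<phi> r a = \<phi> r n0" by (rule dc_cong[OF dc[OF r(1)] a(1)])
  finally have ne: "(\<Prod>r\<in>Q. \<phi> r a) \<noteq> 1" using n0 by simp
  have "coprime a (int r')" if "r' \<in> Q" for r'
  proof (cases "r' = r")
    case True
    thus ?thesis using n0(1) a(1) by (metis cong_imp_coprime cong_sym)
  next
    case False
    thus ?thesis using m'[of r'] that by (metis DiffI cong_imp_coprime cong_sym coprime_1_left singletonD)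
  qed
  hence cop: "coprime a (int (\<Prod>Q))" unfolding of_nat_prod by (intro prod_coprime_right) auto
  have "int r * int m dvd k * (a - 1)"
    using rk a(2) by (intro mult_dvd_mono) (simp_all add: cong_iff_dvd_diff)
  hence "[a * k = k] (mod int (\<Prod>Q))" unfolding Qm by (simp add: cong_iff_dvd_diff algebra_simps)
  thus "\<exists>a. coprime a (int (\<Prod>Q)) \<and> (\<Prod>r\<in>Q. \<phi> r a) \<noteq> 1 \<and> [a * k = k] (mod int (\<Prod>Q))"
    using cop ne by blast
qed

text \<open>The prime with value \<open>cis (2 * pi / g)\<close> forces the order to be exactly
  \<open>g\<close> and rules out the empty product, hence \<open>N < q\<close>. In
  \<open>N ^ 3\<close> one factor \<open>N\<close> is the number of moduli, at most
  \<open>2 * g * N\<close> because of \<open>2 ^ card R \<le> g ^ card P\<close>, and the other two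
  come from \<open>separating_prime\<close>.\<close>

theorem prescribed_character:
  assumes g: "g \<ge> 3" "odd g"
  shows "\<exists>C\<ge>1. \<forall>N z. N > 0 \<longrightarrow> (\<forall>p. z p ^ g = 1) \<longrightarrow>
     (\<exists>p. prime p \<and> p \<le> N \<and> \<not> p dvd g \<and> z p = cis (2 * pi / real g)) \<longrightarrow>
     (\<exists>q \<eta>. dirichlet_character q \<eta> \<and> character_order q \<eta> = g \<and> separates q \<eta> \<and> N < q \<and>
        ln (real q) \<le> C * real N ^ 3 \<and> (\<forall>n. \<eta> n ^ g = principal_character q n) \<and>
        (\<forall>p. prime p \<longrightarrow> p \<le> N \<longrightarrow> \<not> p dvd g \<longrightarrow> \<eta> (int p) = z p))"
proof -
  obtain C where C1: "C \<ge> 1" and C': "\<forall>N P b. N > 0 \<longrightarrow> P \<subseteq> {p. prime p \<and> p \<le> N \<and> \<not> p dvd g} \<longrightarrow>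
    (\<forall>p\<in>P. b p < g) \<longrightarrow> (\<exists>p\<in>P. b p \<noteq> 0) \<longrightarrow>
    (\<exists>r. prime r \<and> N < r \<and> ln (real r) \<le> C * real N ^ 2 \<and> (\<Prod>p\<in>P. residue_char g r (int p) ^ b p) \<noteq> 1)"
    using separating_prime[OF g] by (elim exE conjE)
  note C = C'[rule_format]
  have g0: "g > 0" using g by simp
  have "\<exists>q \<eta>. dirichlet_character q \<eta> \<and> character_order q \<eta> = g \<and> separates q \<eta> \<and> N < q \<and>
        ln (real q) \<le> (2 * real g * C) * real N ^ 3 \<and> (\<forall>n. \<eta> n ^ g = principal_character q n) \<and>
        (\<forall>p. prime p \<longrightarrow> p \<le> N \<longrightarrow> \<not> p dvd g \<longrightarrow> \<eta> (int p) = z p)"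
    if N: "N > 0" and z: "\<And>p. z p ^ g = 1"
      and p1: "prime p1" "p1 \<le> N" "\<not> p1 dvd g" "z p1 = cis (2 * pi / real g)" for N z p1
  proof -
    define P where "P = {p. prime p \<and> p \<le> N \<and> \<not> p dvd g}"
    have finP: "finite P" by (simp add: P_def)
    define A where "A = {r. prime r \<and> N < r \<and> ln (real r) \<le> C * real N ^ 2}"
    have cop: "coprime (int p) (int r)" if "p \<in> P" "r \<in> A" for p r
      using that by (auto simp: P_def A_def intro!: primes_coprime)
    have dc: "dirichlet_character r (residue_char g r)" if "r \<in> A" for r
      using that g0 by (auto simp: A_def intro: residue_char_dc)
    have vg: "residue_char g r (int p) ^ g = 1" if "r \<in> A" "p \<in> P" for r p
      using residue_char_power[OF _ g0 cop[OF that(2,1)]] that by (simp add: A_def)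
    have pm: "residue_char g r (int p) ^ (k mod g) = residue_char g r (int p) ^ k" if "r \<in> A" "p \<in> P" for r p k
    proof -
      have "residue_char g r (int p) ^ k = residue_char g r (int p) ^ (k mod g + g * (k div g))" by simp
      also have "\<dots> = residue_char g r (int p) ^ (k mod g) * (residue_char g r (int p) ^ g) ^ (k div g)"
        by (simp only: power_add power_mult)
      finally show ?thesis using vg[OF that] by simp
    qed
    have "\<exists>R. finite R \<and> R \<subseteq> A \<and> 2 ^ card R \<le> g ^ card P \<and>
      (\<forall>b\<in>PiE P (\<lambda>_. {..<g}). (\<exists>p\<in>P. b p \<noteq> 0) \<longrightarrow> (\<exists>r\<in>R. (\<Prod>p\<in>P. residue_char g r (int p) ^ b p) \<noteq> 1))"
    proof (rule halving[OF finP g0])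
      fix r b b' assume r: "r \<in> A"
      have "(\<Prod>p\<in>P. residue_char g r (int p) ^ ((b p + b' p) mod g)) = (\<Prod>p\<in>P. residue_char g r (int p) ^ (b p + b' p))"
        using pm[OF r] by (intro prod.cong refl) auto
      thus "(\<Prod>p\<in>P. residue_char g r (int p) ^ (\<lambda>p\<in>P. (b p + b' p) mod g) p) =
          (\<Prod>p\<in>P. residue_char g r (int p) ^ b p) * (\<Prod>p\<in>P. residue_char g r (int p) ^ b' p)"
        by (simp add: power_add prod.distrib)
    next
      fix b assume "b \<in> PiE P (\<lambda>_. {..<g})" "\<exists>p\<in>P. b p \<noteq> 0"
      thus "\<exists>r\<in>A. (\<Prod>p\<in>P. residue_char g r (int p) ^ b p) \<noteq> 1"
      proof -
        assume b: "b \<in> PiE P (\<lambda>_. {..<g})" "\<exists>p\<in>P. b p \<noteq> 0"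
        have "b p < g" if "p \<in> P" for p using PiE_mem[OF b(1) that] by simp
        from C[of N P b, OF N _ this b(2)] show ?thesis by (auto simp: P_def A_def)
      qed
    qed simp
    then obtain R where R: "finite R" "R \<subseteq> A" "2 ^ card R \<le> g ^ card P"
      and sep': "\<forall>b\<in>PiE P (\<lambda>_. {..<g}). (\<exists>p\<in>P. b p \<noteq> 0) \<longrightarrow> (\<exists>r\<in>R. (\<Prod>p\<in>P. residue_char g r (int p) ^ b p) \<noteq> 1)"
      by (elim exE conjE)
    note sep = sep'[rule_format]
    have "\<exists>e. \<forall>p\<in>P. (\<Prod>r\<in>R. residue_char g r (int p) ^ e r) = z p"
      by (rule prescribe_values[OF finP R(1) g0]) (use R(2) vg z sep in auto)
    then obtain e where e: "\<And>p. p \<in> P \<Longrightarrow> (\<Prod>r\<in>R. residue_char g r (int p) ^ e r) = z p" by blast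
    \<comment> \<open>Moduli whose chosen power is principal are dropped. Their factor is 1 at every
      prime in \<open>P\<close>, and what remains consists of nonprincipal factors, as
      \<open>separates_prod\<close> requires.\<close>
    define Q where "Q = {r \<in> R. \<exists>n. coprime n (int r) \<and> residue_char g r n ^ e r \<noteq> 1}"
    have QA: "r \<in> A" if "r \<in> Q" for r using that R(2) by (auto simp: Q_def)
    have finQ: "finite Q" using R(1) by (simp add: Q_def)
    have Qprime: "prime r" "N < r" "ln (real r) \<le> C * real N ^ 2" if "r \<in> Q" for r
      using QA[OF that] by (auto simp: A_def)
    define \<phi> where "\<phi> r n = residue_char g r n ^ e r" for r n
    define q where "q = \<Prod>Q"
    define \<eta> where "\<eta> n = (\<Prod>r\<in>Q. \<phi> r n)" for n
    have \<phi>dc: "dirichlet_character r (\<phi> r)" if r: "r \<in> Q" for r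
    proof -
      have "e r > 0" using r by (auto simp: Q_def intro!: Nat.gr0I)
      thus ?thesis unfolding \<phi>_def using dc[OF QA[OF r]] by (intro dc_pow)
    qed
    have \<eta>dc: "dirichlet_character q \<eta>" unfolding q_def \<eta>_def by (intro dc_prod finQ \<phi>dc)
    have sep\<eta>: "separates q \<eta>" unfolding q_def \<eta>_def
      by (intro separates_prod finQ Qprime \<phi>dc) (auto simp: Q_def \<phi>_def)
    have val: "\<eta> (int p) = z p" if p: "p \<in> P" for p
    proof -
      have "(\<Prod>r\<in>Q. residue_char g r (int p) ^ e r) = (\<Prod>r\<in>R. residue_char g r (int p) ^ e r)"
      proof (rule prod.mono_neutral_left[OF R(1)])
        show "\<forall>i\<in>R - Q. residue_char g i (int p) ^ e i = 1"
        proof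
          fix i assume i: "i \<in> R - Q"
          hence "coprime (int p) (int i)" using cop[OF p, of i] R(2) by blast
          thus "residue_char g i (int p) ^ e i = 1" using i unfolding Q_def by blast
        qed
      qed (auto simp: Q_def)
      thus ?thesis using e[OF p] by (simp add: \<eta>_def \<phi>_def)
    qed
    have p1P: "p1 \<in> P" using p1 by (simp add: P_def)
    have prim: "cis (2 * pi / real g) ^ k = 1 \<longleftrightarrow> g dvd k" for k
      using cis_2pi_div_eq_1_iff[OF g0, of k] by (simp add: Complex.DeMoivre mult_ac)
    have "Q \<noteq> {}"
    proof
      assume "Q = {}"
      hence "z p1 = 1" using val[OF p1P] by (simp add: \<eta>_def)
      thus False using prim[of 1] p1 g by simp
    qed
    then obtain r0 where r0: "r0 \<in> Q" by blast
    have q0: "q > 0" using dc_pos[OF \<eta>dc] .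
    have rq: "r dvd q" if "r \<in> Q" for r
      using dvd_prodI[OF finQ that, of "\<lambda>x. x"] by (simp add: q_def)
    have "r0 \<le> q" using rq[OF r0] q0 by (intro dvd_imp_le)
    hence Nq: "N < q" using Qprime(2)[OF r0] by simp
    have power: "\<eta> n ^ g = principal_character q n" for n
    proof (cases "coprime n (int q)")
      case True
      have "\<phi> r n ^ g = 1" if r: "r \<in> Q" for r
      proof -
        have "r dvd q" by (rule rq[OF r])
        hence "coprime n (int r)" using True by (metis coprime_divisors dvd_refl int_dvd_int_iff)
        hence "residue_char g r n ^ g = 1" using residue_char_power[OF Qprime(1)[OF r] g0] by simp
        moreover have "\<phi> r n ^ g = (residue_char g r n ^ g) ^ e r"
          by (simp add: \<phi>_def power_mult[symmetric] mult.commute)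
        ultimately show ?thesis by simp
      qed
      thus ?thesis using True by (simp add: \<eta>_def prod_power_distrib principal_character_def)
    next
      case False
      thus ?thesis using dc_zero_iff[OF \<eta>dc, of n] g0 by (simp add: principal_character_def)
    qed
    have order: "character_order q \<eta> = g" unfolding character_order_def
    proof (rule Least_equality)
      show "g > 0 \<and> (\<lambda>n. \<eta> n ^ g) = principal_character q" using g0 power by auto
    next
      fix k assume k: "k > 0 \<and> (\<lambda>n. \<eta> n ^ k) = principal_character q"
      have "\<eta> (int p1) \<noteq> 0" using val[OF p1P] p1(4) by simp
      hence "coprime (int p1) (int q)" using dc_zero_iff[OF \<eta>dc] by blast
      hence "\<eta> (int p1) ^ k = 1" using fun_cong[of _ _ "int p1", OF conjunct2[OF k]] by (simp add: principal_character_def)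
      hence "g dvd k" using val[OF p1P] p1(4) prim by simp
      thus "g \<le> k" using k by (auto dest: dvd_imp_le)
    qed
    have lnq: "ln (real q) \<le> (2 * real g * C) * real N ^ 3"
    proof -
      have "ln (real q) = (\<Sum>r\<in>Q. ln (real r))"
        unfolding q_def of_nat_prod using Qprime(1) prime_gt_0_nat finQ by (subst ln_prod) auto
      also have "\<dots> \<le> (\<Sum>r\<in>Q. C * real N ^ 2)" by (intro sum_mono Qprime)
      also have "\<dots> = real (card Q) * (C * real N ^ 2)" by simp
      also have "\<dots> \<le> (2 * real g * real N) * (C * real N ^ 2)"
      proof (rule mult_right_mono)
        have "card Q \<le> card R" using R(1) by (intro card_mono) (auto simp: Q_def)
        note cQR = this
        have "P \<subseteq> {1..N}" using prime_ge_1_nat by (auto simp: P_def)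
        hence cardP: "card P \<le> N" using card_mono[of "{1..N}" P] by simp
        have "2 ^ card R \<le> real (g ^ card P)" using R(3) by (metis of_nat_le_iff of_nat_numeral of_nat_power)
        hence "ln (2 ^ card R) \<le> ln (real (g ^ card P))" by (intro ln_mono) auto
        hence "real (card R) * ln 2 \<le> real (card P) * ln (real g)" using g0 by (simp add: ln_realpow)
        also have "\<dots> \<le> real N * real g" using cardP g0 ln_bound[of "real g"] by (intro mult_mono) auto
        finally have "real (card R) * ln 2 \<le> real N * real g" .
        moreover have "real (card R) * (1 / 2) \<le> real (card R) * ln 2"
          using ln2_ge_two_thirds by (intro mult_left_mono) auto
        moreover have "real (card Q) \<le> real (card R)" using cQR by simp
        ultimately show "real (card Q) \<le> 2 * real g * real N" by (simp add: mult_ac)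
      qed (use C1 in auto)
      also have "\<dots> = (2 * real g * C) * real N ^ 3" by (simp add: power2_eq_square power3_eq_cube)
      finally show ?thesis .
    qed
    show ?thesis
    proof (intro exI[of _ q] exI[of _ \<eta>] conjI allI impI)
      fix p assume "prime p" "p \<le> N" "\<not> p dvd g"
      thus "\<eta> (int p) = z p" by (intro val) (simp add: P_def)
    qed (rule \<eta>dc order sep\<eta> Nq lnq power)+
  qed
  note main = this
  have "2 * real g * C \<ge> 1"
    using C1 g mult_mono[of 1 "2 * real g" 1 C] by simp
  show ?thesis
  proof (intro exI[of _ "2 * real g * C"] conjI allI impI)
    fix N and z :: "nat \<Rightarrow> complex"
    assume N: "N > 0" and z: "\<forall>p. z p ^ g = 1"
      and "\<exists>p. prime p \<and> p \<le> N \<and> \<not> p dvd g \<and> z p = cis (2 * pi / real g)"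
    then obtain p1 where "prime p1" "p1 \<le> N" "\<not> p1 dvd g" "z p1 = cis (2 * pi / real g)" by (elim exE conjE)
    from main[of N z, OF N z[rule_format] this]
    show "\<exists>q \<eta>. dirichlet_character q \<eta> \<and> character_order q \<eta> = g \<and> separates q \<eta> \<and> N < q \<and>
        ln (real q) \<le> (2 * real g * C) * real N ^ 3 \<and> (\<forall>n. \<eta> n ^ g = principal_character q n) \<and>
        (\<forall>p. prime p \<longrightarrow> p \<le> N \<longrightarrow> \<not> p dvd g \<longrightarrow> \<eta> (int p) = z p)" .
  qed fact
qed

section \<open>Character sums and logarithmic sums\<close>

definition add_char :: "nat \<Rightarrow> int \<Rightarrow> complex" where
  "add_char q k = cis (2 * pi * real_of_int k / real q)"

lemma add_char_add: "add_char q (k + l) = add_char q k * add_char q l"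
  by (simp add: add_char_def cis_mult add_divide_distrib distrib_left)

lemma add_char_diff: "add_char q (k - l) = add_char q k * add_char q (- l)"
  using add_char_add[of q k "- l"] by simp

lemma add_char_0 [simp]: "add_char q 0 = 1" by (simp add: add_char_def)

lemma norm_add_char [simp]: "norm (add_char q k) = 1" by (simp add: add_char_def)

lemma add_char_power: "add_char q k ^ n = add_char q (k * int n)"
  by (simp add: add_char_def Complex.DeMoivre mult_ac)

lemma cnj_add_char: "cnj (add_char q k) = add_char q (- k)"
  by (simp add: add_char_def cis_cnj)

lemma add_char_eq_1_iff: "q > 0 \<Longrightarrow> add_char q k = 1 \<longleftrightarrow> int q dvd k"
proof -
  assume q: "q > 0"
  have nat: "add_char q (int j) = 1 \<longleftrightarrow> q dvd j" for j
    using cis_2pi_div_eq_1_iff[OF q, of j] by (simp add: add_char_def)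
  show ?thesis
  proof (cases "k \<ge> 0")
    case True
    thus ?thesis using nat[of "nat k"] by (metis int_dvd_int_iff nat_0_le)
  next
    case False
    have "add_char q k = 1 \<longleftrightarrow> cnj (add_char q k) = 1" by (metis complex_cnj_cnj complex_cnj_one)
    also have "\<dots> \<longleftrightarrow> add_char q (int (nat (- k))) = 1" using False by (simp add: cnj_add_char)
    also have "\<dots> \<longleftrightarrow> int q dvd int (nat (- k))" by (simp only: nat int_dvd_int_iff)
    also have "int (nat (- k)) = - k" using False by simp
    finally show ?thesis by simp
  qed
qed

lemma add_char_cong: "q > 0 \<Longrightarrow> [k = l] (mod int q) \<Longrightarrow> add_char q k = add_char q l"
proof -
  assume q: "q > 0" and kl: "[k = l] (mod int q)"
  have "add_char q (k - l) = 1" using q kl by (simp add: add_char_eq_1_iff cong_iff_dvd_diff)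
  thus ?thesis using add_char_add[of q "k - l" l] by simp
qed

lemma sum_add_char: "q > 0 \<Longrightarrow> (\<Sum>t<q. add_char q (k * int t)) = (if int q dvd k then of_nat q else 0)"
proof -
  assume q: "q > 0"
  have "(\<Sum>t<q. add_char q (k * int t)) = (\<Sum>t<q. add_char q k ^ t)" by (simp add: add_char_power)
  also have "\<dots> = (if int q dvd k then of_nat q else 0)"
  proof (cases "int q dvd k")
    case True
    thus ?thesis using add_char_eq_1_iff[OF q, of k] by simp
  next
    case False
    moreover have "add_char q k ^ q = 1" using add_char_eq_1_iff[OF q, of "k * int q"] by (simp add: add_char_power)
    ultimately show ?thesis using add_char_eq_1_iff[OF q, of k] by (simp add: geometric_sum)
  qed
  finally show ?thesis .
qed

lemma sum_rotate:
  "(\<Sum>a\<in>A. \<Sum>b\<in>B. \<Sum>c\<in>C. f a b c) = (\<Sum>b\<in>B. \<Sum>c\<in>C. \<Sum>a\<in>A. f a b c)"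
  by (rule trans[OF sum.swap]) (intro sum.cong refl sum.swap)

section \<open>Gauss sums and the Fourier coefficients of partial sums\<close>

locale separating_char =
  fixes q :: nat and \<eta> :: "int \<Rightarrow> complex"
  assumes dc: "dirichlet_character q \<eta>" and np: "\<eta> \<noteq> principal_character q"
    and sep: "separates q \<eta>" and even: "\<eta> (- 1) = 1"
begin

lemma q_pos: "q > 0" by (rule dc_pos[OF dc])

definition G where "G k = (\<Sum>n<q. \<eta> (int n) * add_char q (int n * k))"

text \<open>For \<open>k\<close> not coprime to \<open>q\<close> both sides vanish: with
  \<open>a\<close> from \<open>separates\<close>, replacing \<open>n\<close> by \<open>a * n\<close>
  multiplies the Gauss sum by \<open>\<eta> a \<noteq> 1\<close> and yet leaves it
  unchanged.\<close>

lemma G_eq: "G k = cnj (\<eta> k) * G 1"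
proof (cases "coprime k (int q)")
  case True
  have "\<eta> k * G k = (\<Sum>n<q. \<eta> (k * int n) * add_char q (k * int n))"
    unfolding G_def sum_distrib_left by (intro sum.cong refl) (simp add: dc_mult[OF dc] mult_ac)
  also have "\<dots> = (\<Sum>n<q. \<eta> (int n) * add_char q (int n))"
    using q_pos True dc_cong[OF dc] add_char_cong[OF q_pos] by (intro sum_mult_residues) auto
  finally have "\<eta> k * G k = G 1" by (simp add: G_def)
  hence "cnj (\<eta> k) * G 1 = (\<eta> k * cnj (\<eta> k)) * G k" by simp
  thus ?thesis using dc_mult_cnj[OF dc, of k] True by (simp add: principal_character_def)
next
  case False
  then obtain a where a: "coprime a (int q)" "\<eta> a \<noteq> 1" "[a * k = k] (mod int q)"
    using sep by (auto simp: separates_def)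
  have "\<eta> a * G k = (\<Sum>n<q. \<eta> (a * int n) * add_char q (a * int n * k))"
    unfolding G_def sum_distrib_left
  proof (intro sum.cong refl)
    fix n
    have "[int n * k = a * int n * k] (mod int q)"
      using cong_scalar_left[OF a(3), of "int n"] by (simp add: cong_sym mult_ac)
    thus "\<eta> a * (\<eta> (int n) * add_char q (int n * k)) = \<eta> (a * int n) * add_char q (a * int n * k)"
      using add_char_cong[OF q_pos] by (simp add: dc_mult[OF dc])
  qed
  also have "\<dots> = G k" unfolding G_def
  proof (rule sum_mult_residues[where f = "\<lambda>n. \<eta> n * add_char q (n * k)", OF q_pos a(1)])
    fix m n assume "[m = n] (mod int q)"
    thus "\<eta> m * add_char q (m * k) = \<eta> n * add_char q (n * k)"
      using dc_cong[OF dc, of m n] add_char_cong[OF q_pos, of "m * k" "n * k"] by (simp add: cong_scalar_right)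
  qed
  finally have "G k = 0" using a(2) by simp
  thus ?thesis using False dc_zero_iff[OF dc, of k] by simp
qed

text \<open>Parseval: the sum of the squares of \<open>norm (G k)\<close> over a period is
  \<open>q * U\<close> by orthogonality and \<open>U * norm (G 1) ^ 2\<close> by
  \<open>G_eq\<close>, with the same positive \<open>U\<close>.\<close>

lemma norm_G1: "norm (G 1) = sqrt (real q)"
proof -
  define U where "U = (\<Sum>n<q. norm (\<eta> (int n)) ^ 2)"
  have "(\<Sum>k<q. G (int k) * cnj (G (int k))) =
      (\<Sum>k<q. \<Sum>n<q. \<Sum>n'<q. \<eta> (int n) * cnj (\<eta> (int n')) * add_char q ((int n - int n') * int k))"
    unfolding G_def cnj_sum sum_product
    by (intro sum.cong refl) (simp add: cnj_add_char add_char_add[symmetric] algebra_simps flip: mult.assoc)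
  also have "\<dots> = (\<Sum>n<q. \<Sum>n'<q. \<eta> (int n) * cnj (\<eta> (int n')) * (\<Sum>k<q. add_char q ((int n - int n') * int k)))"
    unfolding sum_distrib_left by (rule sum_rotate)
  also have "\<dots> = (\<Sum>n<q. \<Sum>n'<q. if n' = n then of_nat q * of_real (norm (\<eta> (int n)) ^ 2) else 0)"
  proof (intro sum.cong refl)
    fix n n' assume n: "n \<in> {..<q}" "n' \<in> {..<q}"
    have "int q dvd int n - int n' \<longleftrightarrow> n' = n"
      using n cong_iff_dvd_diff[of "int n" "int n'" "int q"] by (auto simp: cong_int_iff cong_def)
    thus "\<eta> (int n) * cnj (\<eta> (int n')) * (\<Sum>k<q. add_char q ((int n - int n') * int k)) =
        (if n' = n then of_nat q * of_real (norm (\<eta> (int n)) ^ 2) else 0)"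
      using sum_add_char[OF q_pos, of "int n - int n'"]
      by (simp add: complex_norm_square del: of_real_power)
  qed
  also have "\<dots> = of_real (real q * U)" by (simp add: U_def sum_distrib_left)
  finally have 1: "(\<Sum>k<q. G (int k) * cnj (G (int k))) = of_real (real q * U)" .
  have "(\<Sum>k<q. G (int k) * cnj (G (int k))) = (\<Sum>k<q. of_real (norm (\<eta> (int k)) ^ 2) * (G 1 * cnj (G 1)))"
  proof (intro sum.cong refl)
    fix k
    show "G (int k) * cnj (G (int k)) = of_real (norm (\<eta> (int k)) ^ 2) * (G 1 * cnj (G 1))"
      unfolding G_eq[of "int k"] complex_norm_square by simp
  qed
  also have "\<dots> = of_real (U * norm (G 1) ^ 2)"
    by (simp add: U_def sum_distrib_right complex_norm_square del: of_real_power)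
  finally have "U * norm (G 1) ^ 2 = U * real q" using 1 by (metis mult.commute of_real_eq_iff)
  moreover have "U > 0"
  proof -
    have "norm (\<eta> (int (1 mod q))) ^ 2 = 1"
      using dc_cong[OF dc, of "int (1 mod q)" 1] dc_1[OF dc] by (simp add: zmod_int cong_def)
    moreover have "norm (\<eta> (int (1 mod q))) ^ 2 \<le> U"
      unfolding U_def using q_pos by (intro member_le_sum) auto
    ultimately show ?thesis by simp
  qed
  ultimately have "norm (G 1) ^ 2 = real q" by simp
  thus ?thesis by (metis norm_ge_zero real_sqrt_unique)
qed

definition S where "S t = (\<Sum>n=1..t. \<eta> (int n))"

text \<open>Polya's Fourier expansion in finite form. The geometric sum over \<open>t\<close> from
  \<open>n\<close> to \<open>q - 1\<close> equals
  \<open>(\<omega> ^ n - 1) / (1 - \<omega>)\<close>; the parts with -1 cancel because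
  \<open>\<eta>\<close> sums to zero over a period, and the rest is the Gauss sum at
  \<open>- k\<close>, where evenness removes the sign.\<close>

lemma fourier_S:
  assumes k: "\<not> int q dvd k"
  shows "(\<Sum>t<q. S t * add_char q (- k * int t)) = cnj (\<eta> k) * G 1 / (1 - add_char q (- k))"
proof -
  define \<omega> where "\<omega> = add_char q (- k)"
  have \<omega>1: "\<omega> \<noteq> 1" using k add_char_eq_1_iff[OF q_pos, of "- k"] by (simp add: \<omega>_def)
  have \<omega>q: "\<omega> ^ q = 1" unfolding \<omega>_def add_char_power using add_char_eq_1_iff[OF q_pos, of "- k * int q"] by simp
  have \<omega>: "add_char q (- k * int t) = \<omega> ^ t" for t by (simp add: \<omega>_def add_char_power)
  have gs: "(1 - \<omega>) * (\<Sum>t\<in>{n..<q}. \<omega> ^ t) = \<omega> ^ n - 1" if "n \<le> q" for n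
  proof -
    have "(1 - \<omega>) * (\<Sum>t\<in>{n..<q}. \<omega> ^ t) = \<omega> ^ n - \<omega> ^ q"
      using that
    proof (induction q rule: dec_induct)
      case (step m)
      have "(\<Sum>t\<in>{n..<Suc m}. \<omega> ^ t) = (\<Sum>t\<in>{n..<m}. \<omega> ^ t) + \<omega> ^ m" using step by simp
      thus ?case by (simp only: distrib_left step.IH) (simp add: algebra_simps)
    qed simp
    thus ?thesis by (simp add: \<omega>q)
  qed
  have sum0: "(\<Sum>n=1..<q. \<eta> (int n)) + \<eta> 0 = 0"
    using dc_sum_eq_0[OF dc np] q_pos by (simp add: lessThan_atLeast0 sum.atLeast_Suc_lessThan add.commute)
  have "(\<Sum>t<q. S t * add_char q (- k * int t)) = (\<Sum>t<q. \<Sum>n=1..<q. if n \<le> t then \<eta> (int n) * \<omega> ^ t else 0)"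
    unfolding S_def \<omega> sum_distrib_right by (intro sum.cong sum.mono_neutral_cong_left refl) auto
  also have "\<dots> = (\<Sum>n=1..<q. \<Sum>t<q. if n \<le> t then \<eta> (int n) * \<omega> ^ t else 0)" by (rule sum.swap)
  also have "\<dots> = (\<Sum>n=1..<q. \<eta> (int n) * (\<Sum>t\<in>{n..<q}. \<omega> ^ t))"
    unfolding sum_distrib_left by (intro sum.cong sum.mono_neutral_cong_right refl) auto
  finally have "(1 - \<omega>) * (\<Sum>t<q. S t * add_char q (- k * int t)) =
      (\<Sum>n=1..<q. \<eta> (int n) * ((1 - \<omega>) * (\<Sum>t\<in>{n..<q}. \<omega> ^ t)))"
    by (simp add: sum_distrib_left mult_ac)
  also have "\<dots> = (\<Sum>n=1..<q. \<eta> (int n) * \<omega> ^ n - \<eta> (int n))"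
    by (intro sum.cong refl, subst gs) (auto simp: algebra_simps)
  also have "\<dots> = ((\<Sum>n=1..<q. \<eta> (int n) * \<omega> ^ n) + \<eta> 0) - ((\<Sum>n=1..<q. \<eta> (int n)) + \<eta> 0)"
    by (simp add: sum_subtractf)
  also have "(\<Sum>n=1..<q. \<eta> (int n) * \<omega> ^ n) + \<eta> 0 = (\<Sum>n<q. \<eta> (int n) * \<omega> ^ n)"
    using q_pos by (simp add: lessThan_atLeast0 sum.atLeast_Suc_lessThan add.commute)
  also have "\<dots> = G (- k)" unfolding G_def \<omega>_def by (intro sum.cong refl) (simp add: add_char_power mult.commute)
  also have "\<dots> = cnj (\<eta> k) * G 1"
    using G_eq[of "- k"] dc_mult[OF dc, of "-1" k] even by simp
  finally have "(1 - \<omega>) * (\<Sum>t<q. S t * add_char q (- k * int t)) = cnj (\<eta> k) * G 1"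
    unfolding sum0 by simp
  thus ?thesis using \<omega>1 by (simp add: eq_divide_eq mult.commute \<omega>_def)
qed

lemma norm_S_le: "t \<le> q \<Longrightarrow> norm (S t) \<le> max_character_sum q \<eta>"
  unfolding max_character_sum_def S_def by (intro Max_ge) auto

end

section \<open>The twisted Fejer kernel\<close>

lemma fourier_inversion:
  fixes a :: "int \<Rightarrow> complex"
  assumes m: "m > 0" and per: "\<And>n. a (n + int m) = a n" and bd: "\<And>n. norm (a n) \<le> 1"
  shows "\<exists>A. (\<forall>b. norm (A b) \<le> 1) \<and> (\<forall>k. a k = (\<Sum>b<m. A b * add_char m (int b * k)))"
proof -
  define A where "A b = (\<Sum>x<m. a (int x) * add_char m (- (int b * int x))) / of_nat m" for b :: nat
  have A: "norm (A b) \<le> 1" for b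
  proof -
    have "norm (\<Sum>x<m. a (int x) * add_char m (- (int b * int x))) \<le> (\<Sum>x<m. 1)"
      using bd by (intro sum_norm_le) (simp add: norm_mult)
    thus ?thesis using m by (simp add: A_def norm_divide)
  qed
  have per2: "a (n + int m * int i) = a n" for n i
  proof (induction i)
    case (Suc i)
    have "a (n + int m * int (Suc i)) = a ((n + int m * int i) + int m)" by (simp add: algebra_simps)
    thus ?case using Suc per by simp
  qed simp
  have per3: "a k = a (k mod int m)" for k
  proof (cases "k div int m \<ge> 0")
    case True
    thus ?thesis using per2[of "k mod int m" "nat (k div int m)"] by simp
  next
    case False
    thus ?thesis using per2[of k "nat (- (k div int m))"]
      by (simp add: minus_mult_div_eq_mod[symmetric])
  qed
  have "a k = (\<Sum>b<m. A b * add_char m (int b * k))" for k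
  proof -
    define y where "y = nat (k mod int m)"
    have y: "int y = k mod int m" "y < m" using m by (simp_all add: y_def nat_less_iff)
    have "(\<Sum>b<m. A b * add_char m (int b * k)) =
        (\<Sum>b<m. \<Sum>x<m. a (int x) / of_nat m * add_char m ((k - int x) * int b))"
      unfolding A_def sum_divide_distrib sum_distrib_right
      by (intro sum.cong refl) (simp add: add_char_add[symmetric] algebra_simps flip: mult.assoc)
    also have "\<dots> = (\<Sum>x<m. a (int x) / of_nat m * (\<Sum>b<m. add_char m ((k - int x) * int b)))"
      unfolding sum_distrib_left by (rule sum.swap)
    also have "\<dots> = (\<Sum>x<m. if x = y then a (int x) else 0)"
    proof (intro sum.cong refl)
      fix x assume x: "x \<in> {..<m}"
      have "int m dvd k - int x \<longleftrightarrow> k mod int m = int x mod int m" by (simp add: mod_eq_dvd_iff)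
      also have "\<dots> \<longleftrightarrow> x = y" using x y by auto
      finally show "a (int x) / of_nat m * (\<Sum>b<m. add_char m ((k - int x) * int b)) = (if x = y then a (int x) else 0)"
        using sum_add_char[OF m, of "k - int x"] m by simp
    qed
    also have "\<dots> = a (int y)" using y by simp
    also have "\<dots> = a k" using per3[of k] y by simp
    finally show ?thesis by simp
  qed
  thus ?thesis using A by blast
qed

text \<open>Origin of the Fejer weights: \<open>N - k\<close> pairs have a given difference
  \<open>k > 0\<close>.\<close>

lemma sum_differences:
  fixes c :: "int \<Rightarrow> complex"
  shows "(\<Sum>i<N. \<Sum>j<N. c (int i - int j)) =
    of_nat N * c 0 + (\<Sum>k=1..<N. of_nat (N - k) * (c (int k) + c (- int k)))"
proof (induction N)
  case (Suc N)
  have "(\<Sum>i<Suc N. \<Sum>j<Suc N. c (int i - int j)) =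
      (\<Sum>i<N. \<Sum>j<N. c (int i - int j)) + (\<Sum>i<N. c (int i - int N)) + (\<Sum>j<N. c (int N - int j)) + c 0"
    by (simp add: sum.distrib)
  also have "(\<Sum>i<N. c (int i - int N)) = (\<Sum>k=1..N. c (- int k))"
    by (intro sum.reindex_bij_witness[of _ "\<lambda>k. N - k" "\<lambda>i. N - i"]) (auto simp: of_nat_diff)
  also have "(\<Sum>j<N. c (int N - int j)) = (\<Sum>k=1..N. c (int k))"
    by (intro sum.reindex_bij_witness[of _ "\<lambda>k. N - k" "\<lambda>i. N - i"]) (auto simp: of_nat_diff)
  finally have "(\<Sum>i<Suc N. \<Sum>j<Suc N. c (int i - int j)) = of_nat (Suc N) * c 0 +
      ((\<Sum>k=1..<N. of_nat (N - k) * (c (int k) + c (- int k))) + (\<Sum>k=1..N. c (int k) + c (- int k)))"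
    by (simp add: Suc.IH sum.distrib algebra_simps)
  also have "(\<Sum>k=1..<N. of_nat (N - k) * (c (int k) + c (- int k))) =
      (\<Sum>k=1..N. of_nat (N - k) * (c (int k) + c (- int k)))"
    by (intro sum.mono_neutral_left) auto
  also have "\<dots> + (\<Sum>k=1..N. c (int k) + c (- int k)) = (\<Sum>k=1..N. of_nat (Suc N - k) * (c (int k) + c (- int k)))"
    unfolding sum.distrib[symmetric] by (intro sum.cong refl) (simp add: Suc_diff_le algebra_simps)
  also have "{1..N} = {1..<Suc N}" by auto
  finally show ?case .
qed simp

lemma cot_diff_bound:
  fixes x :: real
  assumes x: "0 < x" "x \<le> 1"
  shows "\<bar>cos x / sin x - 1 / x\<bar> \<le> x"
proof -
  have "\<bar>sin x - (\<Sum>m<3. sin_coeff m * x ^ m)\<bar> \<le> inverse (fact 3) * \<bar>x\<bar> ^ 3"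
    by (rule Maclaurin_sin_bound)
  hence s: "\<bar>sin x - x\<bar> \<le> x ^ 3 / 6"
    using x by (simp add: sin_coeff_def eval_nat_numeral)
  have "cos x = 1 - 2 * sin (x / 2) ^ 2" using cos_double_sin[of "x / 2"] by simp
  moreover have "\<bar>sin (x / 2)\<bar> \<le> x / 2" using abs_sin_x_le_abs_x[of "x / 2"] x by simp
  hence "sin (x / 2) ^ 2 \<le> (x / 2) ^ 2" using x by (metis abs_le_square_iff abs_of_pos half_gt_zero)
  ultimately have c: "cos x \<ge> 1 - x ^ 2 / 2" by (simp add: power_divide)
  have x3: "x ^ 3 \<le> x" using x power_decreasing[of 1 3 x] by simp
  have sp: "sin x \<ge> 5 / 6 * x" using s x3 by linarith
  hence s0: "sin x > 0" using x by linarith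
  have xc: "x * cos x \<ge> x - x ^ 3 / 2" using mult_left_mono[OF c, of x] x
    by (simp add: algebra_simps power2_eq_square power3_eq_cube)
  have xc2: "x * cos x \<le> x" using x by (simp add: mult_left_le)
  have "\<bar>x * cos x - sin x\<bar> \<le> 2 / 3 * x ^ 3" using s xc xc2 zero_le_power[of x 3] x by linarith
  also have "\<dots> \<le> x ^ 2 * (5 / 6 * x)" using x by (simp add: power2_eq_square power3_eq_cube)
  also have "\<dots> \<le> x ^ 2 * sin x" using sp by (intro mult_left_mono) auto
  finally have le: "\<bar>x * cos x - sin x\<bar> \<le> x * (x * sin x)" by (simp add: power2_eq_square)
  have "cos x / sin x - 1 / x = (x * cos x - sin x) / (x * sin x)" using x s0 by (simp add: field_simps)
  hence "\<bar>cos x / sin x - 1 / x\<bar> = \<bar>x * cos x - sin x\<bar> / (x * sin x)"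
    using x s0 by (simp add: abs_mult abs_divide)
  also have "\<dots> \<le> x" using le x s0 by (simp add: divide_le_eq)
  finally show ?thesis .
qed

text \<open>For odd \<open>a\<close> and even \<open>\<eta>\<close> the frequencies \<open>k\<close>
  and \<open>- k\<close> combine to exactly this difference, a cotangent, which for small
  \<open>x\<close> is close to \<open>1 / x\<close> and so produces the weight
  \<open>1 / k\<close>.\<close>

lemma inverse_one_minus_cis:
  assumes "sin x \<noteq> 0"
  shows "1 / (1 - cis (- 2 * x)) - 1 / (1 - cis (2 * x)) = - \<i> * of_real (cos x / sin x)"
proof -
  have sq: "cis (2 * x) = cis x * cis x" "cis (- 2 * x) = cis (- x) * cis (- x)"
    and one: "1 = cis x * cis (- x)" by (simp_all add: cis_mult)
  have d: "cis (- x) - cis x = - 2 * \<i> * of_real (sin x)" by (simp add: complex_eq_iff)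
  have "1 - cis (2 * x) = cis x * (cis (- x) - cis x)"
    unfolding sq by (subst one) (simp add: algebra_simps)
  hence 1: "1 - cis (2 * x) = - 2 * \<i> * of_real (sin x) * cis x" unfolding d by simp
  have "1 - cis (- 2 * x) = - cis (- x) * (cis (- x) - cis x)"
    unfolding sq by (subst one) (simp add: algebra_simps)
  hence 2: "1 - cis (- 2 * x) = 2 * \<i> * of_real (sin x) * cis (- x)" unfolding d by simp
  have inv: "1 / cis x = cis (- x)" "1 / cis (- x) = cis x" by (simp_all add: cis_inverse divide_inverse)
  have "1 / (1 - cis (- 2 * x)) - 1 / (1 - cis (2 * x)) =
      (1 / cis (- x) + 1 / cis x) / (2 * \<i> * of_real (sin x))"
    unfolding 1 2 using assms by (simp add: field_simps)
  also have "1 / cis (- x) + 1 / cis x = 2 * of_real (cos x)" unfolding inv by (simp add: complex_eq_iff)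
  also have "2 * of_real (cos x) / (2 * \<i> * of_real (sin x)) = - \<i> * of_real (cos x / sin x)"
    using assms by (simp add: field_simps)
  finally show ?thesis .
qed

context separating_char
begin

text \<open>The partial sums \<open>S t\<close> are paired with the kernel \<open>T t\<close>.
  Expanding \<open>a\<close> by Fourier inversion writes \<open>T t\<close> as a combination, with
  coefficients of norm at most 1, of the \<open>m\<close> nonnegative shifted Fejer kernels
  \<open>norm (V b t) ^ 2\<close>, each of total mass \<open>q * N\<close>; hence the pairing is at
  most \<open>m * q * N\<close> times the maximum. In terms of Fourier coefficients it is the
  weighted sum of \<open>a k * cnj (\<eta> k)\<close> times cotangents, and replacing these by
  \<open>1 / x\<close> costs the final \<open>- pi\<close>.\<close>

theorem max_sum_lower_bound:
  fixes a :: "int \<Rightarrow> complex"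
  assumes m: "m > 0" and per: "\<And>n. a (n + int m) = a n" and bd: "\<And>n. norm (a n) \<le> 1"
    and odd: "\<And>n. a (- n) = - a n" and N: "N > 0" "4 * N \<le> q"
  shows "real m * max_character_sum q \<eta> \<ge>
    sqrt (real q) * (norm (\<Sum>k=1..<N. of_real (1 - real k / real N) * a (int k) * cnj (\<eta> (int k)) / of_nat k) / pi - pi)"
proof -
  obtain A where A: "\<And>b. norm (A b) \<le> 1" "\<And>k. a k = (\<Sum>b<m. A b * add_char m (int b * k))"
    using fourier_inversion[of m a, OF m per bd] by blast
  define M where "M = max_character_sum q \<eta>"
  have M0: "M \<ge> 0" using norm_S_le[of 0] by (simp add: M_def S_def)
  define V where "V b t = (\<Sum>i<N. add_char m (int b * int i) * add_char q (- (int i * int t)))" for b t :: nat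
  define T where "T t = (\<Sum>i<N. \<Sum>j<N. a (int i - int j) * add_char q (- (int i - int j) * int t))" for t :: nat
  have T_eq: "T t = (\<Sum>b<m. A b * of_real (norm (V b t) ^ 2))" for t
  proof -
    have "of_real (norm (V b t) ^ 2) = (\<Sum>i<N. \<Sum>j<N. add_char m (int b * (int i - int j)) * add_char q (- (int i - int j) * int t))" for b
      unfolding complex_norm_square V_def cnj_sum sum_product
      by (intro sum.cong refl) (simp add: cnj_add_char left_diff_distrib right_diff_distrib add_char_diff mult_ac)
    hence "(\<Sum>b<m. A b * of_real (norm (V b t) ^ 2)) =
        (\<Sum>b<m. \<Sum>i<N. \<Sum>j<N. A b * add_char m (int b * (int i - int j)) * add_char q (- (int i - int j) * int t))"
      by (simp add: sum_distrib_left mult.assoc)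
    also have "\<dots> = (\<Sum>i<N. \<Sum>j<N. \<Sum>b<m. A b * add_char m (int b * (int i - int j)) * add_char q (- (int i - int j) * int t))"
      by (rule sum_rotate)
    also have "\<dots> = T t" unfolding T_def A(2) sum_distrib_right ..
    finally show ?thesis by simp
  qed
  have V_sum: "(\<Sum>t<q. norm (V b t) ^ 2) = real q * real N" for b
  proof -
    have "of_real (\<Sum>t<q. norm (V b t) ^ 2) =
        (\<Sum>t<q. \<Sum>i<N. \<Sum>j<N. add_char m (int b * (int i - int j)) * add_char q ((int j - int i) * int t))"
      unfolding of_real_sum complex_norm_square V_def cnj_sum sum_product
      by (intro sum.cong refl) (simp add: cnj_add_char left_diff_distrib right_diff_distrib add_char_diff mult_ac)
    also have "\<dots> = (\<Sum>i<N. \<Sum>j<N. add_char m (int b * (int i - int j)) * (\<Sum>t<q. add_char q ((int j - int i) * int t)))"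
      unfolding sum_distrib_left by (rule sum_rotate)
    also have "\<dots> = (\<Sum>i<N. \<Sum>j<N. if j = i then of_nat q else 0)"
    proof (intro sum.cong refl)
      fix i j assume ij: "i \<in> {..<N}" "j \<in> {..<N}"
      have "int q dvd int j - int i \<longleftrightarrow> j = i"
      proof
        assume "int q dvd int j - int i"
        moreover have "\<bar>int j - int i\<bar> < int q" using ij N by auto
        ultimately show "j = i" using dvd_imp_le_int[of "int j - int i" "int q"] by force
      qed simp
      thus "add_char m (int b * (int i - int j)) * (\<Sum>t<q. add_char q ((int j - int i) * int t)) = (if j = i then of_nat q else 0)"
        using sum_add_char[OF q_pos, of "int j - int i"] by simp
    qed
    also have "\<dots> = of_real (real q * real N)" by simp
    finally show ?thesis by (simp only: of_real_eq_iff)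
  qed
  have "norm (\<Sum>t<q. S t * T t) \<le> (\<Sum>t<q. M * (\<Sum>b<m. norm (V b t) ^ 2))"
  proof (rule sum_norm_le)
    fix t assume "t \<in> {..<q}"
    have "norm (T t) \<le> (\<Sum>b<m. norm (V b t) ^ 2)" unfolding T_eq
    proof (rule sum_norm_le)
      fix b
      have "norm (A b) * norm (V b t) ^ 2 \<le> 1 * norm (V b t) ^ 2" by (intro mult_right_mono A) auto
      thus "norm (A b * of_real (norm (V b t) ^ 2)) \<le> norm (V b t) ^ 2" by (simp add: norm_mult norm_power)
    qed
    thus "norm (S t * T t) \<le> M * (\<Sum>b<m. norm (V b t) ^ 2)"
      using \<open>t \<in> {..<q}\<close> norm_S_le[of t] M0 unfolding norm_mult M_def by (intro mult_mono) auto
  qed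
  also have "\<dots> = M * (\<Sum>b<m. \<Sum>t<q. norm (V b t) ^ 2)"
    unfolding sum_distrib_left[symmetric] by (subst sum.swap) simp
  also have "\<dots> = M * real m * real q * real N" by (simp add: V_sum)
  finally have upper: "norm (\<Sum>t<q. S t * T t) \<le> M * real m * real q * real N" .
  define c where "c k = a k * (cnj (\<eta> k) * G 1 / (1 - add_char q (- k)))" for k
  have a0: "a 0 = 0" using odd[of 0] by simp
  have "(\<Sum>t<q. S t * T t) = (\<Sum>t<q. \<Sum>i<N. \<Sum>j<N. a (int i - int j) * (S t * add_char q (- (int i - int j) * int t)))"
    unfolding T_def sum_distrib_left by (intro sum.cong refl) (simp add: mult_ac)
  also have "\<dots> = (\<Sum>i<N. \<Sum>j<N. a (int i - int j) * (\<Sum>t<q. S t * add_char q (- (int i - int j) * int t)))"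
    unfolding sum_distrib_left by (rule sum_rotate)
  also have "\<dots> = (\<Sum>i<N. \<Sum>j<N. c (int i - int j))"
  proof (intro sum.cong refl)
    fix i j assume ij: "i \<in> {..<N}" "j \<in> {..<N}"
    show "a (int i - int j) * (\<Sum>t<q. S t * add_char q (- (int i - int j) * int t)) = c (int i - int j)"
    proof (cases "i = j")
      case False
      have "\<not> int q dvd int i - int j"
      proof
        assume "int q dvd int i - int j"
        moreover have "\<bar>int i - int j\<bar> < int q" using ij N by auto
        ultimately show False using dvd_imp_le_int[of "int i - int j" "int q"] False by force
      qed
      thus ?thesis unfolding c_def by (subst fourier_S) auto
    qed (simp add: c_def a0)
  qed
  also have "\<dots> = of_nat N * c 0 + (\<Sum>k=1..<N. of_nat (N - k) * (c (int k) + c (- int k)))"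
    by (rule sum_differences)
  also have "c 0 = 0" by (simp add: c_def a0)
  finally have ST: "(\<Sum>t<q. S t * T t) = (\<Sum>k=1..<N. of_nat (N - k) * (c (int k) + c (- int k)))" by simp
  \<comment> \<open>From \<open>4 * N \<le> q\<close> and \<open>pi < 4\<close> every
    \<open>x k\<close> is at most 1, the range of \<open>cot_diff_bound\<close>.\<close>
  define x where "x k = pi * real k / real q" for k :: nat
  define E where "E k = cos (x k) / sin (x k) - 1 / x k" for k
  have xk: "0 < x k" "x k \<le> 1" "x k \<le> pi * real N / real q" if "k \<in> {1..<N}" for k
  proof -
    show "0 < x k" using that q_pos by (simp add: x_def)
    show 1: "x k \<le> pi * real N / real q" unfolding x_def using that by (intro divide_right_mono mult_left_mono) auto
    have "real (4 * N) \<le> real q" using N by (simp only: of_nat_le_iff)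
    hence "pi * (4 * real N) \<le> 4 * real q" using pi_less_4 by (intro mult_mono) auto
    hence "pi * real N / real q \<le> 1" using q_pos by (simp add: divide_le_eq)
    thus "x k \<le> 1" using 1 by linarith
  qed
  define \<sigma> where "\<sigma> k = of_real (1 - real k / real N) * a (int k) * cnj (\<eta> (int k))" for k :: nat
  have \<sigma>1: "norm (\<sigma> k) \<le> 1" if "k \<in> {1..<N}" for k
  proof -
    have "\<bar>1 - real k / real N\<bar> \<le> 1" using that by (auto simp: abs_le_iff)
    hence "\<bar>1 - real k / real N\<bar> * norm (a (int k)) * norm (\<eta> (int k)) \<le> 1 * 1 * 1"
      using bd dc_norm_le[OF dc] by (intro mult_mono) auto
    thus ?thesis unfolding \<sigma>_def by (simp only: norm_mult norm_of_real complex_mod_cnj)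
  qed
  have "(\<Sum>t<q. S t * T t) = (\<Sum>k=1..<N. (of_nat N * (- \<i>) * G 1) * (\<sigma> k * of_real (1 / x k) + \<sigma> k * of_real (E k)))"
    unfolding ST
  proof (intro sum.cong refl)
    fix k assume k: "k \<in> {1..<N}"
    have s0: "sin (x k) \<noteq> 0" using xk[OF k] sin_gt_zero[of "x k"] pi_gt3 by simp
    have e1: "add_char q (- int k) = cis (- 2 * x k)" "add_char q (int k) = cis (2 * x k)"
      by (simp_all add: add_char_def x_def mult.assoc)
    have cn: "\<eta> (- int k) = \<eta> (int k)" using dc_mult[OF dc, of "-1" "int k"] even by simp
    have "c (int k) + c (- int k) = a (int k) * cnj (\<eta> (int k)) * G 1 *
        (1 / (1 - cis (- 2 * x k)) - 1 / (1 - cis (2 * x k)))"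
      unfolding c_def e1 cn odd by (simp add: e1 algebra_simps)
    also have "\<dots> = a (int k) * cnj (\<eta> (int k)) * G 1 * (- \<i> * of_real (1 / x k + E k))"
      unfolding inverse_one_minus_cis[OF s0] by (simp add: E_def)
    finally have cc: "c (int k) + c (- int k) = a (int k) * cnj (\<eta> (int k)) * G 1 * (- \<i> * of_real (1 / x k + E k))" .
    have Nk: "(of_nat (N - k) :: complex) = of_nat N * of_real (1 - real k / real N)"
      using k N by (simp add: of_nat_diff field_simps)
    show "of_nat (N - k) * (c (int k) + c (- int k)) =
        (of_nat N * (- \<i>) * G 1) * (\<sigma> k * of_real (1 / x k) + \<sigma> k * of_real (E k))"
    proof -
      have "(n * s) * (a * c * g * (- j * (u + v))) = (n * (- j) * g) * ((s * a * c) * u + (s * a * c) * v)"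
        for n s a c g j u v :: complex by (simp add: algebra_simps)
      thus ?thesis unfolding cc Nk \<sigma>_def of_real_add .
    qed
  qed
  also have "\<dots> = (of_nat N * (- \<i>) * G 1) * ((\<Sum>k=1..<N. \<sigma> k * of_real (1 / x k)) + (\<Sum>k=1..<N. \<sigma> k * of_real (E k)))"
    by (simp only: sum_distrib_left[symmetric] sum.distrib)
  finally have ST2: "norm (\<Sum>t<q. S t * T t) =
      real N * sqrt (real q) * norm ((\<Sum>k=1..<N. \<sigma> k * of_real (1 / x k)) + (\<Sum>k=1..<N. \<sigma> k * of_real (E k)))"
    by (simp add: norm_mult norm_G1)
  define \<Sigma> where "\<Sigma> = (\<Sum>k=1..<N. \<sigma> k / of_nat k)"
  have "(\<Sum>k=1..<N. \<sigma> k * of_real (1 / x k)) = of_real (real q / pi) * \<Sigma>"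
    unfolding \<Sigma>_def sum_distrib_left by (intro sum.cong refl) (simp add: x_def)
  hence n1: "norm (\<Sum>k=1..<N. \<sigma> k * of_real (1 / x k)) = real q / pi * norm \<Sigma>"
    by (simp only: norm_mult norm_of_real) simp
  have "norm (\<Sum>k=1..<N. \<sigma> k * of_real (E k)) \<le> (\<Sum>k=1..<N. pi * real N / real q)"
  proof (rule sum_norm_le)
    fix k assume k: "k \<in> {1..<N}"
    have "\<bar>E k\<bar> \<le> x k" unfolding E_def using xk[OF k] by (intro cot_diff_bound)
    hence "norm (\<sigma> k) * \<bar>E k\<bar> \<le> 1 * (pi * real N / real q)"
      using xk[OF k] \<sigma>1[OF k] by (intro mult_mono) auto
    thus "norm (\<sigma> k * of_real (E k)) \<le> pi * real N / real q" by (simp add: norm_mult)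
  qed
  also have "\<dots> \<le> real N * (pi * real N / real q)"
    unfolding sum_constant by (rule mult_right_mono) auto
  also have "\<dots> \<le> real q * pi"
  proof -
    have "real N \<le> real q" using N by simp
    hence "real N * (pi * (real N / real q)) \<le> real q * (pi * 1)"
      using q_pos by (intro mult_mono) (auto simp: divide_le_eq)
    thus ?thesis by simp
  qed
  finally have n2: "norm (\<Sum>k=1..<N. \<sigma> k * of_real (E k)) \<le> real q * pi" .
  have "real q / pi * norm \<Sigma> - real q * pi \<le>
      norm ((\<Sum>k=1..<N. \<sigma> k * of_real (1 / x k)) + (\<Sum>k=1..<N. \<sigma> k * of_real (E k)))"
    using n1 n2 norm_diff_ineq[of "\<Sum>k=1..<N. \<sigma> k * of_real (1 / x k)" "\<Sum>k=1..<N. \<sigma> k * of_real (E k)"] by linarith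
  hence "real N * sqrt (real q) * (real q / pi * norm \<Sigma> - real q * pi) \<le> M * real m * real q * real N"
    using upper unfolding ST2 by (meson mult_left_mono mult_nonneg_nonneg of_nat_0_le_iff order_trans real_sqrt_ge_zero)
  hence "(real N * real q) * (sqrt (real q) * (norm \<Sigma> / pi - pi)) \<le> (real N * real q) * (real m * M)"
    by (simp add: algebra_simps)
  hence "sqrt (real q) * (norm \<Sigma> / pi - pi) \<le> real m * M" using N q_pos by simp
  thus ?thesis by (simp add: M_def \<Sigma>_def \<sigma>_def)
qed

end

section \<open>Nearest g-th roots of unity\<close>

definition nearest :: "nat \<Rightarrow> complex \<Rightarrow> real" where
  "nearest g w = Max ((\<lambda>i. Re (w * cnj (cis (2 * pi * real i / real g)))) ` {..<g})"

lemma nearest_ge: "i < g \<Longrightarrow> nearest g w \<ge> Re (w * cnj (cis (2 * pi * real i / real g)))"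
  unfolding nearest_def by (intro Max_ge) auto

lemma nearest_attained: "g > 0 \<Longrightarrow> \<exists>i<g. nearest g w = Re (w * cnj (cis (2 * pi * real i / real g)))"
proof -
  assume "g > 0"
  hence "nearest g w \<in> (\<lambda>i. Re (w * cnj (cis (2 * pi * real i / real g)))) ` {..<g}"
    unfolding nearest_def by (intro Max_in) auto
  thus ?thesis by auto
qed

lemma nearest_le: "g > 0 \<Longrightarrow> norm w \<le> 1 \<Longrightarrow> nearest g w \<le> 1"
proof -
  assume g: "g > 0" "norm w \<le> 1"
  obtain i where "nearest g w = Re (w * cnj (cis (2 * pi * real i / real g)))"
    using nearest_attained[OF g(1)] by blast
  also have "\<dots> \<le> norm (w * cnj (cis (2 * pi * real i / real g)))" by (rule complex_Re_le_cmod)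
  finally show ?thesis using g(2) by (simp add: norm_mult)
qed

text \<open>The \<open>g\<close>-th roots of unity sum to zero, so the real parts have mean 0 and
  their maximum cannot be negative.\<close>

lemma nearest_nonneg: "g \<ge> 2 \<Longrightarrow> nearest g w \<ge> 0"
proof -
  assume g: "g \<ge> 2"
  define \<omega> where "\<omega> = cis (- 2 * pi / real g)"
  have "\<omega> ^ i = cnj (cis (2 * pi * real i / real g))" for i
    by (simp add: \<omega>_def Complex.DeMoivre cis_cnj mult_ac)
  hence "(\<Sum>i<g. Re (w * cnj (cis (2 * pi * real i / real g)))) = Re (w * (\<Sum>i<g. \<omega> ^ i))"
    by (simp add: sum_distrib_left)
  also have "(\<Sum>i<g. \<omega> ^ i) = 0"
  proof -
    have "\<omega> = cnj (cis (2 * pi * real 1 / real g))" by (simp add: \<omega>_def cis_cnj)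
    moreover have "cis (2 * pi * real 1 / real g) \<noteq> 1"
      using cis_2pi_div_eq_1_iff[of g 1] g by simp
    ultimately have "\<omega> \<noteq> 1" by (metis complex_cnj_cnj complex_cnj_one)
    moreover have "\<omega> ^ g = 1" using g cis_multiple_2pi[of "-1"] by (simp add: \<omega>_def Complex.DeMoivre)
    ultimately show ?thesis by (simp add: geometric_sum)
  qed
  finally have "0 = (\<Sum>i<g. Re (w * cnj (cis (2 * pi * real i / real g))))" by simp
  also have "\<dots> \<le> (\<Sum>i<g. nearest g w)" by (intro sum_mono nearest_ge) auto
  finally show ?thesis using g by (simp add: zero_le_mult_iff)
qed

lemma abs_cos_diff_le: "\<bar>cos a - cos b\<bar> \<le> \<bar>a - b\<bar>" for a b :: real
proof -
  have "cos a - cos b = 2 * (sin ((a + b) / 2) * sin ((b - a) / 2))" by (simp add: cos_diff_cos)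
  hence "\<bar>cos a - cos b\<bar> = 2 * (\<bar>sin ((a + b) / 2)\<bar> * \<bar>sin ((b - a) / 2)\<bar>)" by (simp add: abs_mult)
  also have "\<dots> \<le> 2 * (1 * \<bar>(b - a) / 2\<bar>)"
    by (intro mult_left_mono mult_mono abs_sin_x_le_abs_x) auto
  finally show ?thesis by (simp add: abs_minus_commute)
qed

lemma sin_diff_le: "0 \<le> a \<Longrightarrow> a \<le> b \<Longrightarrow> b \<le> pi / 2 \<Longrightarrow> sin b - sin a \<le> (b - a) * cos a" for a b :: real
proof -
  assume ab: "0 \<le> a" "a \<le> b" "b \<le> pi / 2"
  have "sin b = sin a * cos (b - a) + cos a * sin (b - a)" using sin_add[of a "b - a"] by simp
  also have "\<dots> \<le> sin a * 1 + cos a * (b - a)"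
    using ab by (intro add_mono mult_left_mono sin_x_le_x cos_le_one sin_ge_zero cos_ge_zero) auto
  finally show ?thesis by (simp add: algebra_simps)
qed

text \<open>A Riemann sum of the cosine over the half sector from 0 to \<open>pi / g\<close>, where
  its mean is \<open>g / pi * sin (pi / g)\<close>; this is where the exponent arises. The loss of 1
  is one step of the sum.\<close>

lemma sum_cos_ge:
  assumes g: "g \<ge> 3" and K: "K \<ge> 2"
  defines "\<phi> \<equiv> pi / (real K * real g)"
  shows "(\<Sum>w=1..K. cos (real w * \<phi>)) \<ge> real K * real g / pi * sin (pi / real g) - 1"
    and "real (Suc K) * \<phi> \<le> pi / 2"
proof -
  have \<phi>0: "\<phi> > 0" using g K by (simp add: \<phi>_def)
  have K\<phi>: "real K * \<phi> = pi / real g" using g K by (simp add: \<phi>_def)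
  have "pi / real g \<le> pi / 3" using g by (intro divide_left_mono) auto
  hence K3: "real K * \<phi> \<le> pi / 3" by (simp add: K\<phi>)
  moreover have "2 * \<phi> \<le> real K * \<phi>" using K \<phi>0 by (intro mult_right_mono) auto
  ultimately show le: "real (Suc K) * \<phi> \<le> pi / 2" by (simp add: algebra_simps)
  have "(\<Sum>w=1..K. cos (real w * \<phi>)) * \<phi> \<ge> (\<Sum>w=1..K. sin (real (Suc w) * \<phi>) - sin (real w * \<phi>))"
    unfolding sum_distrib_right
  proof (intro sum_mono)
    fix w assume w: "w \<in> {1..K}"
    have "real (Suc w) * \<phi> \<le> real (Suc K) * \<phi>" using w \<phi>0 by (intro mult_right_mono) auto
    hence "real (Suc w) * \<phi> \<le> pi / 2" using le by linarith
    hence "sin (real (Suc w) * \<phi>) - sin (real w * \<phi>) \<le> (real (Suc w) * \<phi> - real w * \<phi>) * cos (real w * \<phi>)"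
      using \<phi>0 by (intro sin_diff_le) auto
    thus "sin (real (Suc w) * \<phi>) - sin (real w * \<phi>) \<le> cos (real w * \<phi>) * \<phi>"
      by (simp add: algebra_simps)
  qed
  also have "(\<Sum>w=1..K. sin (real (Suc w) * \<phi>) - sin (real w * \<phi>)) = sin (real (Suc K) * \<phi>) - sin \<phi>"
    using sum_Suc_diff[of 1 K "\<lambda>w. sin (real w * \<phi>)"] K by simp
  finally have "(\<Sum>w=1..K. cos (real w * \<phi>)) * \<phi> \<ge> sin (real (Suc K) * \<phi>) - sin \<phi>" .
  moreover have "sin (real (Suc K) * \<phi>) \<ge> sin (real K * \<phi>)"
    using le \<phi>0 by (intro sin_monotone_2pi_le) (auto simp: algebra_simps intro: order.trans[of _ 0])
  moreover have "sin \<phi> \<le> \<phi>" using \<phi>0 by (intro sin_x_le_x) auto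
  ultimately have "(\<Sum>w=1..K. cos (real w * \<phi>)) * \<phi> \<ge> sin (pi / real g) - \<phi>"
    unfolding K\<phi> by linarith
  hence "(\<Sum>w=1..K. cos (real w * \<phi>)) \<ge> (sin (pi / real g) - \<phi>) / \<phi>"
    using \<phi>0 by (simp add: divide_le_eq)
  also have "(sin (pi / real g) - \<phi>) / \<phi> = real K * real g / pi * sin (pi / real g) - 1"
    using \<phi>0 g K by (simp add: diff_divide_distrib) (simp add: \<phi>_def)
  finally show "(\<Sum>w=1..K. cos (real w * \<phi>)) \<ge> real K * real g / pi * sin (pi / real g) - 1" .
qed

lemma Re_cis_cnj: "Re (cis a * cnj (cis b)) = cos (a - b)"
  by (simp add: cis_cnj cis_mult)

lemma nearest_lipschitz:
  assumes "g > 0"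
  shows "nearest g (cis a) \<ge> nearest g (cis b) - \<bar>a - b\<bar>"
proof -
  obtain i where i: "i < g" "nearest g (cis b) = Re (cis b * cnj (cis (2 * pi * real i / real g)))"
    using nearest_attained[OF assms] by blast
  have "nearest g (cis a) \<ge> cos (a - 2 * pi * real i / real g)"
    using nearest_ge[OF i(1), of "cis a"] unfolding Re_cis_cnj .
  moreover have "nearest g (cis b) = cos (b - 2 * pi * real i / real g)" using i(2) unfolding Re_cis_cnj .
  ultimately show ?thesis
    using abs_cos_diff_le[of "a - 2 * pi * real i / real g" "b - 2 * pi * real i / real g"] by (simp add: abs_le_iff)
qed

text \<open>Comparing each of the \<open>k\<close> points with \<open>g\<close> nearby points of the \<open>k g\<close>-th roots of unity makes
  the sum split into \<open>g\<close> equal sectors, whatever \<open>gcd k g\<close> is.\<close>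

lemma sum_nearest_ge:
  assumes g: "g \<ge> 3" and K: "K \<ge> 2"
  shows "(\<Sum>j<2*K. nearest g (cis (2 * pi * real j / real (2 * K)))) \<ge>
    2 * real K * (real g / pi * sin (pi / real g)) - (2 + 2 * pi)"
proof -
  define \<phi> where "\<phi> = pi / (real K * real g)"
  have \<phi>0: "\<phi> > 0" using g K by (simp add: \<phi>_def)
  have \<phi>K: "2 * real K * \<phi> = 2 * pi / real g" using g K by (simp add: \<phi>_def)
  note cosK = sum_cos_ge[OF g K, folded \<phi>_def]
  \<comment> \<open>\<open>v\<close> is the position within a sector of \<open>2 * K\<close> steps
    between neighbouring \<open>g\<close>-th roots of unity. In the first half the angle is enlarged
    by one step, so that both halves become the same sum over \<open>w\<close> from 1 to
    \<open>K\<close>.\<close>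
  define lo where "lo v = (if v < K then cos (real (Suc v) * \<phi>) else cos (real (2 * K - v) * \<phi>))" for v
  have low: "nearest g (cis (real u * \<phi>)) \<ge> lo (u mod (2 * K))" if u: "u < g * (2 * K)" for u
  proof -
    define i v where "i = u div (2 * K)" and "v = u mod (2 * K)"
    have uv: "u = 2 * K * i + v" by (simp add: i_def v_def)
    have ig: "i < g" using u by (simp add: i_def less_mult_imp_div_less)
    have v: "v < 2 * K" using K by (simp add: v_def)
    have ang: "real u * \<phi> - 2 * pi * real i / real g = real v * \<phi>"
    proof -
      have "real u * \<phi> = (2 * real K * \<phi>) * real i + real v * \<phi>" by (simp add: uv algebra_simps)
      thus ?thesis unfolding \<phi>K by simp
    qed
    have n1: "nearest g (cis (real u * \<phi>)) \<ge> cos (real v * \<phi>)"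
      using nearest_ge[OF ig, of "cis (real u * \<phi>)"] unfolding Re_cis_cnj ang .
    show ?thesis
    proof (cases "v < K")
      case True
      have "real (Suc v) * \<phi> \<le> real (Suc K) * \<phi>" using True \<phi>0 by (intro mult_right_mono) auto
      hence "real (Suc v) * \<phi> \<le> pi" using cosK(2) pi_gt_zero by linarith
      hence "cos (real (Suc v) * \<phi>) \<le> cos (real v * \<phi>)"
        using \<phi>0 by (intro cos_monotone_0_pi_le) auto
      thus ?thesis using n1 True by (simp add: lo_def v_def)
    next
      case False
      have "nearest g (cis (real u * \<phi>)) \<ge> cos (real (2 * K - v) * \<phi>)"
      \<comment> \<open>In the last sector the next root of unity is the one with index 0, so the
        angle wraps around.\<close>
      proof (cases "Suc i = g")
        case True
        have "cos (real u * \<phi> - 2 * pi * real 0 / real g) = cos (2 * pi - real (2 * K - v) * \<phi>)"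
        proof -
          have "real (2 * K - v) * \<phi> = 2 * real K * \<phi> - real v * \<phi>"
            using v by (simp add: of_nat_diff algebra_simps)
          moreover have "2 * pi * real i / real g + 2 * pi / real g = 2 * pi"
          proof -
            have gi: "real g = real i + 1" using True by simp
            have "2 * pi * real i / real g + 2 * pi / real g = 2 * pi * (real i + 1) / real g"
              by (simp add: add_divide_distrib algebra_simps)
            thus ?thesis unfolding gi[symmetric] using g by simp
          qed
          ultimately have "real u * \<phi> = 2 * pi - real (2 * K - v) * \<phi>" using ang \<phi>K by linarith
          thus ?thesis by simp
        qed
        also have "\<dots> = cos (real (2 * K - v) * \<phi>)" by simp
        finally show ?thesis using nearest_ge[of 0 g "cis (real u * \<phi>)"] g unfolding Re_cis_cnj by simp
      next
        case False
        hence "Suc i < g" using ig by simp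
        have "real u * \<phi> - 2 * pi * real (Suc i) / real g = - (real (2 * K - v) * \<phi>)"
        proof -
          have "real (2 * K - v) * \<phi> = 2 * real K * \<phi> - real v * \<phi>"
            using v by (simp add: of_nat_diff algebra_simps)
          moreover have "2 * pi * real (Suc i) / real g = 2 * pi * real i / real g + 2 * pi / real g"
            by (simp add: add_divide_distrib algebra_simps)
          ultimately show ?thesis using ang \<phi>K by linarith
        qed
        thus ?thesis using nearest_ge[OF \<open>Suc i < g\<close>, of "cis (real u * \<phi>)"] unfolding Re_cis_cnj by simp
      qed
      thus ?thesis using False by (simp add: lo_def v_def)
    qed
  qed
  have "(\<Sum>v<2*K. lo v) = (\<Sum>v<K. lo v) + (\<Sum>v=K..<2*K. lo v)"
    using sum.atLeastLessThan_concat[of 0 K "2 * K" lo] by (simp add: lessThan_atLeast0)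
  also have "(\<Sum>v<K. lo v) = (\<Sum>w=1..K. cos (real w * \<phi>))"
    by (rule sum.reindex_bij_witness[of _ "\<lambda>w. w - 1" Suc]) (auto simp: lo_def)
  also have "(\<Sum>v=K..<2*K. lo v) = (\<Sum>w=1..K. cos (real w * \<phi>))"
    by (rule sum.reindex_bij_witness[of _ "\<lambda>w. 2 * K - w" "\<lambda>v. 2 * K - v"]) (auto simp: lo_def)
  finally have lsum: "(\<Sum>v<2*K. lo v) \<ge> 2 * real K * (real g / pi * sin (pi / real g)) - 2"
    using cosK(1) by simp
  define h where "h j = nearest g (cis (2 * pi * real j / real (2 * K)))" for j
  have shift: "(\<Sum>u\<in>{i*M..<i*M+M}. lo (u mod M)) = (\<Sum>v<M. lo v)" for i M :: nat
  proof -
    have "(\<Sum>u\<in>{0+i*M..<M+i*M}. lo (u mod M)) = (\<Sum>v\<in>{0..<M}. lo ((v + i * M) mod M))"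
      by (rule sum.shift_bounds_nat_ivl)
    also have "\<dots> = (\<Sum>v\<in>{0..<M}. lo v)" by (intro sum.cong refl) simp
    finally show ?thesis by (simp add: add.commute atLeast0LessThan)
  qed
  have "(\<Sum>u<g*(2*K). lo (u mod (2 * K))) = (\<Sum>i<g. \<Sum>u\<in>{i*(2*K)..<i*(2*K)+2*K}. lo (u mod (2 * K)))"
    by (rule sum.nat_group[symmetric])
  also have "\<dots> = (\<Sum>i<g. \<Sum>v<2*K. lo v)"
  proof (rule sum.cong[OF refl])
    fix i
    show "(\<Sum>u\<in>{i*(2*K)..<i*(2*K)+2*K}. lo (u mod (2 * K))) = (\<Sum>v<2*K. lo v)"
      by (rule shift)
  qed
  finally have 1: "(\<Sum>u<g*(2*K). lo (u mod (2 * K))) = real g * (\<Sum>v<2*K. lo v)" by simp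
  have "(\<Sum>u<g*(2*K). lo (u mod (2 * K))) = (\<Sum>u<2*K*g. lo (u mod (2 * K)))" by (simp add: mult.commute)
  also have "\<dots> = (\<Sum>j<2*K. \<Sum>u\<in>{j*g..<j*g+g}. lo (u mod (2 * K)))"
    by (rule sum.nat_group[symmetric])
  also have "\<dots> \<le> (\<Sum>j<2*K. \<Sum>u\<in>{j*g..<j*g+g}. h j + real g * \<phi>)"
  proof (intro sum_mono)
    fix j u assume j: "j \<in> {..<2*K}" and u: "u \<in> {j*g..<j*g+g}"
    have "u < Suc j * g" using u by simp
    also have "Suc j * g \<le> 2 * K * g" using j by (intro mult_right_mono) auto
    finally have "u < g * (2 * K)" by (simp add: mult.commute)
    hence "lo (u mod (2 * K)) \<le> nearest g (cis (real u * \<phi>))" by (rule low)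
    also have "\<dots> \<le> h j + \<bar>2 * pi * real j / real (2 * K) - real u * \<phi>\<bar>"
      using nearest_lipschitz[of g "real u * \<phi>" "2 * pi * real j / real (2 * K)"] g unfolding h_def by linarith
    also have "2 * pi * real j / real (2 * K) = real (j * g) * \<phi>" using g K by (simp add: \<phi>_def)
    also have "real (j * g) * \<phi> - real u * \<phi> = - (real (u - j * g) * \<phi>)"
      using u by (simp add: of_nat_diff algebra_simps)
    also have "\<bar>- (real (u - j * g) * \<phi>)\<bar> \<le> real g * \<phi>"
    proof -
      have "u - j * g \<le> g" using u by auto
      hence "real (u - j * g) \<le> real g" by (simp only: of_nat_le_iff)
      hence "real (u - j * g) * \<phi> \<le> real g * \<phi>" using \<phi>0 by (intro mult_right_mono) auto
      moreover have "0 \<le> real (u - j * g) * \<phi>" using \<phi>0 by (intro mult_nonneg_nonneg) auto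
      ultimately show ?thesis by linarith
    qed
    finally show "lo (u mod (2 * K)) \<le> h j + real g * \<phi>" by simp
  qed
  also have "\<dots> = real g * (\<Sum>j<2*K. h j) + real g * (2 * real K * real g * \<phi>)"
    by (simp add: sum.distrib sum_distrib_left algebra_simps)
  also have "2 * real K * real g * \<phi> = 2 * pi" using g K by (simp add: \<phi>_def)
  finally have "real g * (\<Sum>v<2*K. lo v) \<le> real g * ((\<Sum>j<2*K. h j) + 2 * pi)"
    unfolding 1 by (simp add: algebra_simps)
  hence "(\<Sum>v<2*K. lo v) \<le> (\<Sum>j<2*K. h j) + 2 * pi" using g by simp
  thus ?thesis using lsum unfolding h_def by linarith
qed

text \<open>This is the character to be mimicked by characters of order \<open>g\<close>.\<close>

lemma exists_equidistributed_character:
  assumes g: "g \<ge> 3" and \<epsilon>: "\<epsilon> > 0"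
  shows "\<exists>m \<psi>. prime m \<and> odd m \<and> m > g \<and> dirichlet_character m \<psi> \<and> \<psi> (- 1) = - 1 \<and>
    (\<Sum>c\<in>totatives m. nearest g (\<psi> (int c))) \<ge> (real g / pi * sin (pi / real g) - \<epsilon>) * real (totient m)"
proof -
  \<comment> \<open>A large modulus makes the loss \<open>2 + 2 * pi\<close> of
    \<open>sum_nearest_ge\<close> at most \<open>\<epsilon> * totient m\<close>; the other summands
    ensure that \<open>m\<close> is odd and exceeds \<open>g\<close> and 5.\<close>
  define B where "B = nat \<lceil>(2 + 2 * pi) / \<epsilon>\<rceil> + g + 5"
  obtain m where m: "prime m" "m > B" using bigger_prime by blast
  have odd: "odd m" using m prime_odd_nat[of m] by (simp add: B_def)
  have mg: "m > g" and m5: "m > 5" using m by (simp_all add: B_def)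
  have tot: "totient m = m - 1" using m by (simp add: totient_prime)
  obtain \<rho> where \<rho>: "residue_primroot m \<rho>" using prime_primitive_root_exists[of m] m m5 by auto
  obtain \<psi> where \<psi>: "dirichlet_character m \<psi>" "\<And>j. \<psi> (int \<rho> ^ j) = cis (2 * pi * real j / real (m - 1))"
    using generator_character[OF _ \<rho>] m5 unfolding tot by auto
  have bij: "bij_betw (\<lambda>i. \<rho> ^ i mod m) {..<m - 1} (totatives m)"
    using residue_primroot_is_generator[OF _ \<rho>] m5 by (simp add: tot)
  have \<psi>val: "\<psi> (int (\<rho> ^ j mod m)) = cis (2 * pi * real j / real (m - 1))" for j
  proof -
    have "[int (\<rho> ^ j mod m) = int \<rho> ^ j] (mod int m)" by (simp add: cong_def zmod_int)
    from dc_cong[OF \<psi>(1) this] \<psi>(2) show ?thesis by simp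
  qed
  define K where "K = (m - 1) div 2"
  have K: "m - 1 = 2 * K" using odd by (simp add: K_def)
  have K2: "K \<ge> 2" using K m5 by simp
  have "m - 1 \<in> totatives m" using m5 coprime_diff_one_right_nat[of m] by (auto simp: totatives_def coprime_commute)
  moreover have "totatives m = (\<lambda>i. \<rho> ^ i mod m) ` {..<m - 1}" using bij by (simp add: bij_betw_def)
  ultimately have "m - 1 \<in> (\<lambda>i. \<rho> ^ i mod m) ` {..<m - 1}" by simp
  then obtain j where j: "j < m - 1" "m - 1 = \<rho> ^ j mod m" by blast
  have j0: "j \<noteq> 0"
  proof
    assume "j = 0"
    thus False using j(2) m5 by simp
  qed
  have "[- 1 = int (m - 1)] (mod int m)" using m5 by (simp add: cong_iff_dvd_diff of_nat_diff)
  hence e1: "\<psi> (- 1) = \<psi> (int (m - 1))" by (rule dc_cong[OF \<psi>(1)])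
  also have "\<dots> = cis (2 * pi * real j / real (m - 1))" using \<psi>val[of j] j(2) by simp
  finally have e2: "\<psi> (- 1) = cis (2 * pi * real j / real (m - 1))" .
  \<comment> \<open>\<open>\<psi>\<close> has full order, so only residues congruent to 1 are sent
    to 1, and its value at -1 is the other square root of 1.\<close>
  have "\<not> m - 1 dvd j" using j j0 by (auto dest: dvd_imp_le)
  hence "\<psi> (- 1) \<noteq> 1" unfolding e2 using cis_2pi_div_eq_1_iff[of "m - 1" j] m5 by simp
  moreover have "\<psi> (- 1) ^ 2 = 1" using dc_power[OF \<psi>(1), of "-1" 2] dc_1[OF \<psi>(1)] by simp
  ultimately have neg: "\<psi> (- 1) = - 1" by (simp add: power2_eq_1_iff)
  have "(\<Sum>c\<in>totatives m. nearest g (\<psi> (int c))) = (\<Sum>j<2*K. nearest g (cis (2 * pi * real j / real (2 * K))))"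
    using sum.reindex_bij_betw[OF bij, of "\<lambda>c. nearest g (\<psi> (int c))"] unfolding \<psi>val K by simp
  also have "\<dots> \<ge> 2 * real K * (real g / pi * sin (pi / real g)) - (2 + 2 * pi)"
    by (rule sum_nearest_ge[OF g K2])
  finally have 0: "(\<Sum>c\<in>totatives m. nearest g (\<psi> (int c))) \<ge>
      2 * real K * (real g / pi * sin (pi / real g)) - (2 + 2 * pi)" .
  have 1: "(\<Sum>c\<in>totatives m. nearest g (\<psi> (int c))) \<ge>
      real (totient m) * (real g / pi * sin (pi / real g)) - (2 + 2 * pi)"
  proof -
    have "real (totient m) = 2 * real K" unfolding tot K by simp
    thus ?thesis using 0 by simp
  qed
  have "(2 + 2 * pi) / \<epsilon> \<le> real (nat \<lceil>(2 + 2 * pi) / \<epsilon>\<rceil>)" by linarith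
  also have "\<dots> \<le> real (totient m)" using m by (simp add: tot B_def)
  finally have "2 + 2 * pi \<le> \<epsilon> * real (totient m)" using \<epsilon> by (simp add: divide_le_eq mult.commute)
  hence "(\<Sum>c\<in>totatives m. nearest g (\<psi> (int c))) \<ge> (real g / pi * sin (pi / real g) - \<epsilon>) * real (totient m)"
    using 1 by (simp add: algebra_simps)
  thus ?thesis using m odd mg \<psi>(1) neg by blast
qed

text \<open>Each reduced residue class modulo \<open>m\<close> receives at least the share
  \<open>1 / totient m\<close> of \<open>ln (ln y)\<close> up to a constant, so the average of
  \<open>nearest\<close> over the classes appears. Leaving out the primes that divide
  \<open>g\<close> costs at most \<open>g\<close>.\<close>

lemma sum_nearest_primes:
  assumes g: "g \<ge> 3" and m: "prime m" "odd m" and dc: "dirichlet_character m \<psi>"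
    and avg: "(\<Sum>c\<in>totatives m. nearest g (\<psi> (int c))) \<ge> \<alpha> * real (totient m)"
  shows "\<exists>C. \<forall>y\<ge>3. (\<Sum>p | p \<in> {1..y} \<and> prime p \<and> \<not> p dvd m * g. nearest g (\<psi> (int p)) / real p) \<ge>
    \<alpha> * ln (ln (real y)) - C"
proof -
  have m1: "m > 1" using m prime_gt_1_nat by auto
  have tot0: "totient m > 0" using m1 by simp
  have "\<exists>C. \<forall>N\<ge>2. (\<Sum>p | p \<in> {1..N} \<and> prime p \<and> [p = c] (mod m). 1 / real p) \<ge>
      ln (ln (real N)) / real (totient m) - C" if "c \<in> totatives m" for c
    using that sum_inverse_primes_progression[OF m1 m(2), of c] by (auto simp: totatives_def)
  hence "\<forall>c\<in>totatives m. \<exists>C. \<forall>N\<ge>2. (\<Sum>p | p \<in> {1..N} \<and> prime p \<and> [p = c] (mod m). 1 / real p) \<ge>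
      ln (ln (real N)) / real (totient m) - C" ..
  from bchoice[OF this] obtain Cf where Cf': "\<forall>c\<in>totatives m. \<forall>N\<ge>2.
      (\<Sum>p | p \<in> {1..N} \<and> prime p \<and> [p = c] (mod m). 1 / real p) \<ge> ln (ln (real N)) / real (totient m) - Cf c"
    ..
  note Cf = Cf'[rule_format]
  define C where "C = (\<Sum>c\<in>totatives m. \<bar>Cf c\<bar>) + real g"
  have n01: "0 \<le> nearest g (\<psi> n)" "nearest g (\<psi> n) \<le> 1" for n
    using nearest_nonneg[of g] nearest_le[of g "\<psi> n"] dc_norm_le[OF dc] g by auto
  have "(\<Sum>p | p \<in> {1..y} \<and> prime p \<and> \<not> p dvd m * g. nearest g (\<psi> (int p)) / real p) \<ge>
      \<alpha> * ln (ln (real y)) - C" if y: "y \<ge> 3" for y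
  proof -
    define A where "A = {p \<in> {1..y}. prime p \<and> \<not> p dvd m}"
    have finA: "finite A" by (simp add: A_def)
    have "exp 1 \<le> real y" using exp_le y by linarith
    hence "1 \<le> ln (real y)" using ln_ge_iff[of "real y" 1] y by simp
    hence lnln: "ln (ln (real y)) \<ge> 0" by simp
    define r where "r p = p mod m" for p
    have rt: "r p \<in> totatives m" if "p \<in> A" for p
    proof -
      have "coprime p m" using that by (simp add: A_def prime_imp_coprime_nat)
      thus ?thesis using m1 by (auto simp: totatives_def r_def coprime_mod_left_iff intro!: Nat.gr0I)
    qed
    have cls: "{p \<in> A. r p = c} = {p. p \<in> {1..y} \<and> prime p \<and> [p = c] (mod m)}" if c: "c \<in> totatives m" for c
    proof -
      have cm: "c < m" "coprime c m" using c m1 by (auto simp: totatives_def intro: order.not_eq_order_implies_strict)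
      have "\<not> p dvd m" if "prime p" "[p = c] (mod m)" for p
      proof
        assume "p dvd m"
        hence "p = m" using m that primes_dvd_imp_eq by blast
        hence "[0 = c] (mod m)" using that by (simp add: cong_def)
        hence "m dvd c" by (metis cong_0_iff cong_sym)
        thus False using cm m1 by (auto simp: coprime_absorb_right)
      qed
      thus ?thesis using cm by (auto simp: A_def r_def cong_def)
    qed
    have "(\<Sum>p\<in>A. nearest g (\<psi> (int p)) / real p) = (\<Sum>c\<in>totatives m. \<Sum>p | p \<in> A \<and> r p = c. nearest g (\<psi> (int p)) / real p)"
      using rt finA by (intro sum.group[symmetric]) auto
    also have "\<dots> = (\<Sum>c\<in>totatives m. nearest g (\<psi> (int c)) * (\<Sum>p | p \<in> {1..y} \<and> prime p \<and> [p = c] (mod m). 1 / real p))"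
    proof (intro sum.cong refl)
      fix c assume c: "c \<in> totatives m"
      have \<psi>c: "\<psi> (int p) = \<psi> (int c)" if "[p = c] (mod m)" for p
        using that by (intro dc_cong[OF dc]) (simp add: cong_int_iff)
      show "(\<Sum>p | p \<in> A \<and> r p = c. nearest g (\<psi> (int p)) / real p) =
          nearest g (\<psi> (int c)) * (\<Sum>p | p \<in> {1..y} \<and> prime p \<and> [p = c] (mod m). 1 / real p)"
        unfolding cls[OF c] sum_distrib_left
      proof (intro sum.cong refl)
        fix p assume "p \<in> {p. p \<in> {1..y} \<and> prime p \<and> [p = c] (mod m)}"
        hence "\<psi> (int p) = \<psi> (int c)" using \<psi>c by blast
        thus "nearest g (\<psi> (int p)) / real p = nearest g (\<psi> (int c)) * (1 / real p)" by simp
      qed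
    qed
    also have "\<dots> \<ge> (\<Sum>c\<in>totatives m. nearest g (\<psi> (int c)) * (ln (ln (real y)) / real (totient m)) - \<bar>Cf c\<bar>)"
    proof (intro sum_mono)
      fix c assume c: "c \<in> totatives m"
      have "nearest g (\<psi> (int c)) * (ln (ln (real y)) / real (totient m) - Cf c) \<le>
          nearest g (\<psi> (int c)) * (\<Sum>p | p \<in> {1..y} \<and> prime p \<and> [p = c] (mod m). 1 / real p)"
        using Cf[OF c, of y] y n01 by (intro mult_left_mono) auto
      moreover have "nearest g (\<psi> (int c)) * Cf c \<le> 1 * \<bar>Cf c\<bar>"
      proof -
        have "nearest g (\<psi> (int c)) * Cf c \<le> nearest g (\<psi> (int c)) * \<bar>Cf c\<bar>"
          using n01(1) by (rule mult_left_mono[OF abs_ge_self])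
        also have "\<dots> \<le> 1 * \<bar>Cf c\<bar>" using n01(2) by (rule mult_right_mono) simp
        finally show ?thesis .
      qed
      ultimately show "nearest g (\<psi> (int c)) * (ln (ln (real y)) / real (totient m)) - \<bar>Cf c\<bar> \<le>
          nearest g (\<psi> (int c)) * (\<Sum>p | p \<in> {1..y} \<and> prime p \<and> [p = c] (mod m). 1 / real p)"
        by (simp add: right_diff_distrib)
    qed
    also have "(\<Sum>c\<in>totatives m. nearest g (\<psi> (int c)) * (ln (ln (real y)) / real (totient m)) - \<bar>Cf c\<bar>) =
        (\<Sum>c\<in>totatives m. nearest g (\<psi> (int c))) * (ln (ln (real y)) / real (totient m)) - (\<Sum>c\<in>totatives m. \<bar>Cf c\<bar>)"
      by (simp only: sum_subtractf sum_distrib_right)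
    finally have "(\<Sum>p\<in>A. nearest g (\<psi> (int p)) / real p) \<ge>
        (\<Sum>c\<in>totatives m. nearest g (\<psi> (int c))) * (ln (ln (real y)) / real (totient m)) - (\<Sum>c\<in>totatives m. \<bar>Cf c\<bar>)" .
    moreover have "\<alpha> * real (totient m) * (ln (ln (real y)) / real (totient m)) \<le>
        (\<Sum>c\<in>totatives m. nearest g (\<psi> (int c))) * (ln (ln (real y)) / real (totient m))"
      using avg lnln by (intro mult_right_mono) auto
    ultimately have 1: "(\<Sum>p\<in>A. nearest g (\<psi> (int p)) / real p) \<ge> \<alpha> * ln (ln (real y)) - (\<Sum>c\<in>totatives m. \<bar>Cf c\<bar>)"
      using tot0 by simp
    have "(\<Sum>p\<in>A. nearest g (\<psi> (int p)) / real p) \<le>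
        (\<Sum>p\<in>{p. p \<in> {1..y} \<and> prime p \<and> \<not> p dvd m * g} \<union> {1..g}. nearest g (\<psi> (int p)) / real p)"
    proof (intro sum_mono2)
      show "A \<subseteq> {p. p \<in> {1..y} \<and> prime p \<and> \<not> p dvd m * g} \<union> {1..g}"
        using g dvd_imp_le[of _ g] by (auto simp: A_def prime_dvd_mult_iff)
    qed (auto simp: n01)
    also have "\<dots> \<le> (\<Sum>p | p \<in> {1..y} \<and> prime p \<and> \<not> p dvd m * g. nearest g (\<psi> (int p)) / real p) +
        (\<Sum>p\<in>{1..g}. nearest g (\<psi> (int p)) / real p)"
      by (subst sum.union_inter[symmetric]) (auto intro!: sum_nonneg simp: n01)
    also have "(\<Sum>p\<in>{1..g}. nearest g (\<psi> (int p)) / real p) \<le> (\<Sum>p\<in>{1..g}. 1)"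
    proof (intro sum_mono)
      fix p assume "p \<in> {1..g}"
      hence "nearest g (\<psi> (int p)) / real p \<le> 1 / 1" using n01 by (intro frac_le) auto
      thus "nearest g (\<psi> (int p)) / real p \<le> 1" by simp
    qed
    finally show ?thesis using 1 by (simp add: C_def)
  qed
  thus ?thesis by blast
qed

section \<open>Smooth numbers\<close>

lemma powr_prod_powers:
  fixes A :: "nat set"
  assumes "finite A" "\<And>p. p \<in> A \<Longrightarrow> p > 0"
  shows "real (\<Prod>p\<in>A. p ^ k p) powr e = (\<Prod>p\<in>A. (real p powr e) ^ k p)"
  using assms
proof (induction A rule: finite_induct)
  case (insert p A)
  have "real (p ^ k p) powr e = (real p powr e) ^ k p"
    using insert.prems[of p] by (simp add: powr_realpow[symmetric] powr_powr mult.commute)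
  thus ?case using insert by (simp add: powr_mult)
qed simp

lemma sum_inverse_squares_le: "(\<Sum>n=Suc y..N. 1 / real n ^ 2) \<le> 1 / real y" if "y > 0"
proof (cases "y \<le> N")
  case True
  have "(\<Sum>n=Suc y..N. 1 / real n ^ 2) \<le> 1 / real y - 1 / real N"
    using True
  proof (induction N rule: dec_induct)
    case (step N)
    have "1 / real (Suc N) ^ 2 \<le> 1 / (real N * real (Suc N))"
      using step that by (intro divide_left_mono) (auto simp: power2_eq_square)
    also have "\<dots> = 1 / real N - 1 / real (Suc N)" using step that by (simp add: field_simps)
    finally show ?case using step by simp
  qed simp
  thus ?thesis using that by (smt (verit) divide_nonneg_nonneg of_nat_0_le_iff)
qed simp

lemma sum_inverse_le_ln: "N > 0 \<Longrightarrow> (\<Sum>j=1..N. 1 / real j) \<le> 1 + ln (real N)"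
proof (induction N rule: nat_induct_non_zero)
  case (Suc N)
  have "ln (real N / real (Suc N)) \<le> real N / real (Suc N) - 1" using Suc by (intro ln_le_minus_one) auto
  also have "\<dots> = - 1 / real (Suc N)" by (simp add: field_simps)
  finally have "1 / real (Suc N) \<le> ln (real (Suc N)) - ln (real N)" using Suc by (simp add: ln_div)
  thus ?case using Suc by simp
qed simp

lemma norm_one_minus_le: "norm (1 - u) \<le> exp (- Re u + norm u ^ 2 / 2)" for u :: complex
proof -
  have "norm (1 - u) ^ 2 = 1 + (- 2 * Re u + norm u ^ 2)"
    unfolding cmod_power2 by (simp add: power2_eq_square algebra_simps)
  also have "\<dots> \<le> exp (- 2 * Re u + norm u ^ 2)" by (rule exp_ge_add_one_self)
  also have "\<dots> = exp (- Re u + norm u ^ 2 / 2) ^ 2" by (simp add: exp_double[symmetric] algebra_simps)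
  finally show ?thesis by (rule power2_le_imp_le) simp
qed

lemma one_minus_ge_exp: "0 \<le> x \<Longrightarrow> x \<le> 1 / 2 \<Longrightarrow> 1 - x \<ge> exp (- 2 * x)" for x :: real
proof -
  assume x: "0 \<le> x" "x \<le> 1 / 2"
  have "1 \<le> (1 - x) * (1 + 2 * x)" using x mult_left_mono[of "2 * x" 1 x] by (simp add: algebra_simps)
  also have "\<dots> \<le> (1 - x) * exp (2 * x)" using x by (intro mult_left_mono exp_ge_add_one_self) auto
  finally show ?thesis by (simp add: exp_minus field_simps)
qed

text \<open>Of the correction \<open>3 / p ^ 2\<close>, the part \<open>2 / p ^ 2\<close> covers the
  truncation \<open>u ^ Suc K\<close> and \<open>1 / p ^ 2\<close> the second-order term of
  \<open>1 - u\<close>.\<close>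

lemma norm_geometric_ge:
  assumes u: "norm u \<le> 1 / real p" and p: "p \<ge> 2" and K: "K \<ge> 1"
  shows "norm (\<Sum>k\<le>K. u ^ k) \<ge> exp (Re u - 3 / real p ^ 2)"
proof -
  have u2: "norm u \<le> 1 / 2" using u p by (intro order.trans[OF u] frac_le) auto
  hence u1: "u \<noteq> 1" by auto
  have "norm u ^ 2 \<le> (1 / real p) ^ 2" by (intro power_mono u) auto
  hence usq: "norm u ^ 2 \<le> 1 / real p ^ 2" by (simp add: power_divide)
  have "(\<Sum>k\<le>K. u ^ k) = (1 - u ^ Suc K) / (1 - u)" using u1 by (simp add: sum_gp0)
  hence eq: "norm (\<Sum>k\<le>K. u ^ k) = norm (1 - u ^ Suc K) / norm (1 - u)" by (simp only: norm_divide)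
  have "norm (u ^ Suc K) \<le> norm u ^ 2"
    unfolding norm_power using u2 K by (intro power_decreasing) auto
  hence uK: "norm (u ^ Suc K) \<le> 1 / real p ^ 2" using usq by linarith
  have p4: "1 / real p ^ 2 \<le> 1 / 2"
  proof -
    have "2 ^ 2 \<le> real p ^ 2" using p by (intro power_mono) auto
    hence "1 / real p ^ 2 \<le> 1 / 2 ^ 2" using p by (intro divide_left_mono) auto
    thus ?thesis by simp
  qed
  have "exp (- 2 * (1 / real p ^ 2)) \<le> 1 - 1 / real p ^ 2" using p4 by (intro one_minus_ge_exp) auto
  also have "\<dots> \<le> norm (1 - u ^ Suc K)" using uK norm_triangle_ineq2[of 1 "u ^ Suc K"] by simp
  finally have 1: "exp (- 2 / real p ^ 2) \<le> norm (1 - u ^ Suc K)" by simp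
  have 2: "norm (1 - u) \<le> exp (- Re u + 1 / real p ^ 2)"
  proof -
    have "norm u ^ 2 / 2 \<le> 1 / real p ^ 2" using usq zero_le_power2[of "norm u"] by linarith
    hence "exp (- Re u + norm u ^ 2 / 2) \<le> exp (- Re u + 1 / real p ^ 2)" by simp
    thus ?thesis using norm_one_minus_le[of u] by linarith
  qed
  have "exp (Re u - 3 / real p ^ 2) = exp (- 2 / real p ^ 2) / exp (- Re u + 1 / real p ^ 2)"
    by (simp add: exp_diff[symmetric] diff_divide_distrib[symmetric] algebra_simps)
  also have "\<dots> \<le> norm (1 - u ^ Suc K) / norm (1 - u)"
    using 1 2 u1 by (intro frac_le) auto
  finally show ?thesis using eq by simp
qed

text \<open>Sums over \<open>y\<close>-smooth numbers are compared with finite Euler products; the discrepancy is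
  estimated by Rankin's trick.\<close>

locale smooth_sum =
  fixes f :: "nat \<Rightarrow> complex" and y N :: nat
  assumes f_mult: "m > 0 \<Longrightarrow> n > 0 \<Longrightarrow> f (m * n) = f m * f n" and f_1: "f 1 = 1" and f_norm: "norm (f n) \<le> 1"
    and N_pos: "N > 0"
begin

definition P where "P = {p. prime p \<and> p \<le> y}"
text \<open>Exponent vectors of \<open>y\<close>-smooth numbers. The bound \<open>N\<close> is
  generous, since the exponents in an integer below \<open>N\<close> are smaller; it only makes the
  Euler product finite.\<close>

definition Box where "Box = PiE P (\<lambda>_. {..N})"
definition nn :: "(nat \<Rightarrow> nat) \<Rightarrow> nat" where "nn k = (\<Prod>p\<in>P. p ^ k p)"
definition smooth where "smooth = {n \<in> {1..<N}. \<forall>p. prime p \<longrightarrow> p dvd n \<longrightarrow> p \<le> y}"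

lemma finite_P [simp]: "finite P" by (simp add: P_def)
lemma finite_Box [simp]: "finite Box" by (simp add: Box_def finite_PiE)
lemma P_ge: "p \<in> P \<Longrightarrow> p \<ge> 2" by (simp add: P_def prime_ge_2_nat)
lemma P_pos: "p \<in> P \<Longrightarrow> p > 0" using P_ge[of p] by linarith
lemma nn_pos: "nn k > 0" unfolding nn_def using P_pos by (intro prod_pos) auto

lemma f_power: "n > 0 \<Longrightarrow> f (n ^ k) = f n ^ k"
  by (induction k) (use f_1 f_mult in auto)

lemma f_nn: "f (nn k) = (\<Prod>p\<in>P. f p ^ k p)"
proof -
  have "f (\<Prod>p\<in>A. p ^ k p) = (\<Prod>p\<in>A. f p ^ k p) \<and> (\<Prod>p\<in>A. p ^ k p) > 0" if "finite A" "A \<subseteq> P" for A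
    using that
  proof (induction A rule: finite_induct)
    case (insert p A)
    thus ?case using P_pos[of p] f_mult f_power by auto
  qed (use f_1 in auto)
  thus ?thesis by (simp add: nn_def)
qed

lemma multiplicity_nn: "p \<in> P \<Longrightarrow> multiplicity p (nn k) = k p"
  unfolding nn_def by (subst multiplicity_prod_prime_powers) (auto simp: P_def)

lemma inj_nn: "inj_on nn Box"
proof (rule inj_onI)
  fix k k' assume k: "k \<in> Box" "k' \<in> Box" "nn k = nn k'"
  have "k p = k' p" if "p \<in> P" for p
    using multiplicity_nn[OF that, of k] multiplicity_nn[OF that, of k'] k(3) by simp
  thus "k = k'" using k unfolding Box_def by (rule_tac PiE_ext)
qed

lemma smooth_subset: "smooth \<subseteq> nn ` Box"
proof
  fix n assume n: "n \<in> smooth"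
  hence n0: "n > 0" "n < N" by (auto simp: smooth_def)
  define k where "k = (\<lambda>p\<in>P. multiplicity p n)"
  have "prime_factors n \<subseteq> P" using n by (auto simp: smooth_def P_def)
  have "n = (\<Prod>p\<in>prime_factors n. p ^ multiplicity p n)" using n0 by (intro prime_factorization_nat) auto
  also have "\<dots> = (\<Prod>p\<in>P. p ^ multiplicity p n)"
    using \<open>prime_factors n \<subseteq> P\<close>
    by (intro prod.mono_neutral_left) (auto simp: prime_factors_multiplicity P_def)
  also have "\<dots> = nn k" by (simp add: nn_def k_def)
  finally have "n = nn k" .
  moreover have "k \<in> Box" unfolding Box_def k_def
  proof (intro PiE_I)
    fix p assume p: "p \<in> P"
    have "multiplicity p n \<le> N" 
    proof -
      have "multiplicity p n < p ^ multiplicity p n" using P_ge[OF p] by (intro power_gt_expt) auto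
      also have "p ^ multiplicity p n \<le> n" using n0 by (intro dvd_imp_le multiplicity_dvd) auto
      finally show ?thesis using n0 by simp
    qed
    thus "(\<lambda>p\<in>P. multiplicity p n) p \<in> {..N}" using p by simp
  qed simp
  ultimately show "n \<in> nn ` Box" by blast
qed

lemma euler_product: "(\<Prod>p\<in>P. \<Sum>k\<le>N. (f p / of_nat p) ^ k) = (\<Sum>k\<in>Box. f (nn k) / of_nat (nn k))"
proof -
  have "(\<Prod>p\<in>P. \<Sum>k\<le>N. (f p / of_nat p) ^ k) = (\<Sum>k\<in>Box. \<Prod>p\<in>P. (f p / of_nat p) ^ k p)"
    unfolding Box_def by (rule prod_sum_PiE) auto
  also have "\<dots> = (\<Sum>k\<in>Box. f (nn k) / of_nat (nn k))"
    unfolding f_nn unfolding nn_def by (simp add: power_divide prod_dividef)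
  finally show ?thesis .
qed

definition w :: "nat \<Rightarrow> real" where "w n = (if n < N then 1 - real n / real N else 0)"

lemma weighted_sum: "(\<Sum>n\<in>smooth. of_real (1 - real n / real N) * f n / of_nat n) =
    (\<Sum>k\<in>Box. of_real (w (nn k)) * (f (nn k) / of_nat (nn k)))"
proof -
  have "(\<Sum>k\<in>Box. of_real (w (nn k)) * (f (nn k) / of_nat (nn k))) =
      (\<Sum>n\<in>nn ` Box. of_real (w n) * (f n / of_nat n))"
    by (subst sum.reindex[OF inj_nn]) simp
  also have "\<dots> = (\<Sum>n\<in>smooth. of_real (1 - real n / real N) * f n / of_nat n)"
  proof (rule sum.mono_neutral_cong_right)
    show "\<forall>n\<in>nn ` Box - smooth. of_real (w n) * (f n / of_nat n) = 0"
    proof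
      fix n assume n: "n \<in> nn ` Box - smooth"
      then obtain k where k: "n = nn k" by blast
      have "p \<le> y" if "prime p" "p dvd n" for p
      proof -
        have "\<exists>q\<in>P. p dvd q ^ k q" using that prime_dvd_prod_iff[of P p "\<lambda>q. q ^ k q"] by (simp add: k nn_def)
        then obtain q where q: "q \<in> P" "p dvd q ^ k q" by blast
        hence "p dvd q" using prime_dvd_power[OF that(1)] by blast
        thus ?thesis using q that(1) primes_dvd_imp_eq[of p q] by (auto simp: P_def)
      qed
      hence "\<not> n < N" using n nn_pos[of k] by (auto simp: smooth_def k)
      thus "of_real (w n) * (f n / of_nat n) = 0" by (simp add: w_def)
    qed
  qed (use smooth_subset in \<open>auto simp: w_def smooth_def\<close>)
  finally show ?thesis ..
qed

text \<open>The deficit \<open>1 - w n\<close> is \<open>n / N\<close> below \<open>N\<close> and 1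
  from \<open>N\<close> on, hence at most \<open>(n / N) powr \<delta>\<close> in either case; the
  sum of this majorant factors into an Euler product.\<close>

lemma rankin:
  assumes \<delta>: "0 \<le> \<delta>" "\<delta> \<le> 1"
  shows "norm ((\<Sum>k\<in>Box. f (nn k) / of_nat (nn k)) - (\<Sum>k\<in>Box. of_real (w (nn k)) * (f (nn k) / of_nat (nn k)))) \<le>
    real N powr (- \<delta>) * (\<Prod>p\<in>P. \<Sum>k\<le>N. (real p powr (\<delta> - 1)) ^ k)"
proof -
  have "(\<Sum>k\<in>Box. f (nn k) / of_nat (nn k)) - (\<Sum>k\<in>Box. of_real (w (nn k)) * (f (nn k) / of_nat (nn k))) =
      (\<Sum>k\<in>Box. of_real (1 - w (nn k)) * (f (nn k) / of_nat (nn k)))"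
    by (simp add: sum_subtractf[symmetric] algebra_simps diff_divide_distrib)
  also have "norm \<dots> \<le> (\<Sum>k\<in>Box. real N powr (- \<delta>) * real (nn k) powr (\<delta> - 1))"
  proof (rule sum_norm_le)
    fix k
    define n where "n = nn k"
    have n: "n > 0" by (simp add: n_def nn_pos)
    have w: "\<bar>1 - w n\<bar> \<le> (real n / real N) powr \<delta>"
    proof (cases "n < N")
      case True
      have "(real n / real N) powr 1 \<le> (real n / real N) powr \<delta>"
        using True n \<delta> by (intro powr_mono') auto
      thus ?thesis using True n by (simp add: w_def)
    next
      case False
      hence "1 \<le> (real n / real N) powr \<delta>" using N_pos \<delta> by (intro ge_one_powr_ge_zero) auto
      thus ?thesis using False by (simp add: w_def)
    qed
    have "norm (of_real (1 - w n) * (f n / of_nat n)) = \<bar>1 - w n\<bar> * (norm (f n) / real n)"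
      by (simp only: norm_mult norm_of_real norm_divide norm_of_nat)
    also have "\<dots> \<le> (real n / real N) powr \<delta> * (1 / real n)"
      using w f_norm by (intro mult_mono divide_right_mono) auto
    also have "\<dots> = real N powr (- \<delta>) * real n powr (\<delta> - 1)"
      using n N_pos by (simp add: powr_divide powr_minus powr_diff field_simps)
    finally show "norm (of_real (1 - w (nn k)) * (f (nn k) / of_nat (nn k))) \<le> real N powr (- \<delta>) * real (nn k) powr (\<delta> - 1)"
      by (simp add: n_def)
  qed
  also have "\<dots> = real N powr (- \<delta>) * (\<Sum>k\<in>Box. \<Prod>p\<in>P. (real p powr (\<delta> - 1)) ^ k p)"
    unfolding sum_distrib_left[symmetric] nn_def using P_pos by (subst powr_prod_powers) auto
  also have "(\<Sum>k\<in>Box. \<Prod>p\<in>P. (real p powr (\<delta> - 1)) ^ k p) = (\<Prod>p\<in>P. \<Sum>k\<le>N. (real p powr (\<delta> - 1)) ^ k)"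
    unfolding Box_def by (rule prod_sum_PiE[symmetric]) auto
  finally show ?thesis .
qed

text \<open>The 6 is three times the bound 2 for the sum of \<open>1 / p ^ 2\<close>.\<close>

lemma euler_product_ge:
  "norm (\<Prod>p\<in>P. \<Sum>k\<le>N. (f p / of_nat p) ^ k) \<ge> exp ((\<Sum>p\<in>P. Re (f p) / real p) - 6)"
proof -
  have "(\<Sum>p\<in>P. 1 / real p ^ 2) \<le> (\<Sum>n\<in>insert 1 {Suc 1..y}. 1 / real n ^ 2)"
    by (intro sum_mono2) (auto simp: P_def dest: prime_ge_2_nat)
  also have "\<dots> = 1 + (\<Sum>n=Suc 1..y. 1 / real n ^ 2)" by simp
  also have "(\<Sum>n=Suc 1..y. 1 / real n ^ 2) \<le> 1" using sum_inverse_squares_le[of 1 y] by simp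
  finally have "(\<Sum>p\<in>P. 3 / real p ^ 2) \<le> 6"
    using sum_distrib_left[of 3 "\<lambda>p. 1 / real p ^ 2" P] by simp
  hence "exp ((\<Sum>p\<in>P. Re (f p) / real p) - 6) \<le> exp (\<Sum>p\<in>P. Re (f p / of_nat p) - 3 / real p ^ 2)"
    by (simp add: sum_subtractf)
  also have "\<dots> = (\<Prod>p\<in>P. exp (Re (f p / of_nat p) - 3 / real p ^ 2))" by (simp add: exp_sum)
  also have "\<dots> \<le> (\<Prod>p\<in>P. norm (\<Sum>k\<le>N. (f p / of_nat p) ^ k))"
    using f_norm N_pos P_ge
    by (intro prod_mono conjI norm_geometric_ge) (auto simp: norm_divide divide_right_mono)
  finally show ?thesis by (simp add: prod_norm)
qed

text \<open>For \<open>\<delta> = 1 / ln y\<close> and \<open>p \<le> y\<close> the factor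
  \<open>p powr \<delta>\<close> is at most \<open>exp 1 \<le> 3\<close>, so
  \<open>x = p powr (\<delta> - 1)\<close> is at most \<open>3 / p\<close>; with
  \<open>1 / (1 - x) \<le> exp (4 * x)\<close> this gives \<open>exp (12 / p)\<close> for each
  prime. The product is of order \<open>ln y powr 12\<close>, which
  \<open>N powr (- \<delta>)\<close> cancels precisely because of the factor 12 in the hypothesis on
  \<open>N\<close>.\<close>

lemma rankin_product_le:
  assumes y: "y \<ge> 8" and C: "(\<Sum>p\<in>P. 1 / real p) \<le> ln (ln (real y)) + C" and C0: "C \<ge> 0"
    and N: "ln (real N) \<ge> 12 * ln (real y) * ln (ln (real y))"
  defines "\<delta> \<equiv> 1 / ln (real y)"
  shows "\<delta> \<le> 1" "real N powr (- \<delta>) * (\<Prod>p\<in>P. \<Sum>k\<le>N. (real p powr (\<delta> - 1)) ^ k) \<le> exp (12 * C)"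
proof -
  have "exp (2::real) = exp 1 ^ 2" using exp_double[of "1::real"] by simp
  also have "\<dots> \<le> 2.75 ^ 2" using e_less_272 by (intro power_mono) auto
  also have "\<dots> \<le> real y" using y by (simp add: power2_eq_square)
  finally have ly: "ln (real y) \<ge> 2" using y by (subst ln_ge_iff) auto
  have \<delta>: "0 < \<delta>" "\<delta> \<le> 1 / 2" unfolding \<delta>_def using ly by (auto simp: divide_le_eq)
  thus "\<delta> \<le> 1" by simp
  have lnln: "ln (ln (real y)) \<ge> 0" using ly by simp
  have factor: "(\<Sum>k\<le>N. (real p powr (\<delta> - 1)) ^ k) \<le> exp (12 * (1 / real p))" if p: "p \<in> P" for p
  proof -
    define x where "x = real p powr (\<delta> - 1)"
    have p2: "real p \<ge> 2" using P_ge[OF p] by simp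
    have "x \<le> 2 powr (\<delta> - 1)" unfolding x_def using p2 \<delta>(2) by (intro powr_mono2') simp_all
    also have "\<dots> \<le> 2 powr (- (1 / 2))" using \<delta> by (intro powr_mono) auto
    also have "\<dots> = 1 / sqrt 2" by (simp only: powr_minus powr_half_sqrt inverse_eq_divide)
    also have "\<dots> \<le> 3 / 4"
    proof -
      have "4 / 3 \<le> sqrt 2" by (rule real_le_rsqrt) (simp add: power2_eq_square)
      thus ?thesis by (simp add: divide_le_eq)
    qed
    finally have x: "x \<le> 3 / 4" .
    have x0: "x > 0" using p2 by (simp add: x_def)
    have "(\<Sum>k\<le>N. x ^ k) = (1 - x ^ Suc N) / (1 - x)" using x by (simp add: sum_gp0)
    also have "\<dots> \<le> 1 / (1 - x)" using x x0 by (intro divide_right_mono) auto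
    also have "\<dots> \<le> exp (4 * x)"
    proof -
      have "1 \<le> (1 - x) * (1 + 4 * x)" using x x0 by (simp add: algebra_simps)
      also have "\<dots> \<le> (1 - x) * exp (4 * x)" using x by (intro mult_left_mono exp_ge_add_one_self) auto
      finally show ?thesis using x by (simp add: divide_le_eq mult.commute)
    qed
    also have "\<dots> \<le> exp (12 * (1 / real p))"
    proof -
      have "real p powr \<delta> \<le> real y powr \<delta>" using p \<delta> by (intro powr_mono2) (auto simp: P_def)
      also have "\<dots> = exp 1" using y ly by (simp add: powr_def \<delta>_def)
      also have "\<dots> \<le> 3" by (rule exp_le)
      finally have "x \<le> 3 / real p" using p2 by (simp add: x_def powr_diff divide_right_mono)
      thus ?thesis by simp
    qed
    finally show ?thesis by (simp add: x_def)
  qed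
  have "(\<Prod>p\<in>P. \<Sum>k\<le>N. (real p powr (\<delta> - 1)) ^ k) \<le> (\<Prod>p\<in>P. exp (12 * (1 / real p)))"
    using factor by (intro prod_mono conjI sum_nonneg) auto
  also have "\<dots> = exp (12 * (\<Sum>p\<in>P. 1 / real p))" by (simp add: exp_sum sum_distrib_left)
  also have "\<dots> \<le> exp (12 * (ln (ln (real y)) + C))" using C by simp
  finally have 1: "(\<Prod>p\<in>P. \<Sum>k\<le>N. (real p powr (\<delta> - 1)) ^ k) \<le> exp (12 * (ln (ln (real y)) + C))" .
  have "real N powr (- \<delta>) = exp (- (ln (real N) / ln (real y)))" using N_pos by (simp add: powr_def \<delta>_def)
  also have "\<dots> \<le> exp (- (12 * ln (ln (real y))))"
    using N ly by (simp add: pos_le_divide_eq mult_ac)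
  finally have 2: "real N powr (- \<delta>) \<le> exp (- (12 * ln (ln (real y))))" .
  have "real N powr (- \<delta>) * (\<Prod>p\<in>P. \<Sum>k\<le>N. (real p powr (\<delta> - 1)) ^ k) \<le>
      exp (- (12 * ln (ln (real y)))) * exp (12 * (ln (ln (real y)) + C))"
    using 1 2 by (intro mult_mono prod_nonneg sum_nonneg) auto
  also have "\<dots> = exp (12 * C)" by (simp add: exp_add[symmetric] algebra_simps)
  finally show "real N powr (- \<delta>) * (\<Prod>p\<in>P. \<Sum>k\<le>N. (real p powr (\<delta> - 1)) ^ k) \<le> exp (12 * C)" .
qed

theorem smooth_sum_ge:
  assumes y: "y \<ge> 8" and C: "(\<Sum>p\<in>P. 1 / real p) \<le> ln (ln (real y)) + C" and C0: "C \<ge> 0"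
    and N: "ln (real N) \<ge> 12 * ln (real y) * ln (ln (real y))"
  shows "norm (\<Sum>n\<in>smooth. of_real (1 - real n / real N) * f n / of_nat n) \<ge>
    exp ((\<Sum>p\<in>P. Re (f p) / real p) - 6) - exp (12 * C)"
proof -
  note R = rankin_product_le[OF assms]
  have "0 \<le> 1 / ln (real y)" using y by simp
  from rankin[OF this R(1)] R(2) have
    "norm ((\<Sum>k\<in>Box. f (nn k) / of_nat (nn k)) - (\<Sum>k\<in>Box. of_real (w (nn k)) * (f (nn k) / of_nat (nn k)))) \<le> exp (12 * C)"
    by linarith
  moreover have "norm (\<Sum>k\<in>Box. f (nn k) / of_nat (nn k)) \<ge> exp ((\<Sum>p\<in>P. Re (f p) / real p) - 6)"
    using euler_product_ge unfolding euler_product .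
  ultimately show ?thesis unfolding weighted_sum
    using norm_triangle_ineq3[of "\<Sum>k\<in>Box. f (nn k) / of_nat (nn k)" "\<Sum>k\<in>Box. of_real (w (nn k)) * (f (nn k) / of_nat (nn k))"]
    by linarith
qed

end

lemma finite_primes_le [simp]: "finite {p::nat. prime p \<and> p \<le> N}"
  by (rule finite_subset[of _ "{..N}"]) auto

section \<open>Resonating characters\<close>

text \<open>For \<open>0 < n \<le> N\<close> this is the completely multiplicative extension of
  \<open>z\<close>; the cutoff keeps the product finite and preserves multiplicativity.\<close>

definition prime_mult :: "nat \<Rightarrow> (nat \<Rightarrow> complex) \<Rightarrow> nat \<Rightarrow> complex" where
  "prime_mult N z n = (\<Prod>p | prime p \<and> p \<le> N. z p ^ multiplicity p n)"

lemma prime_mult_mult: "m > 0 \<Longrightarrow> n > 0 \<Longrightarrow> prime_mult N z (m * n) = prime_mult N z m * prime_mult N z n"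
  unfolding prime_mult_def prod.distrib[symmetric]
  by (intro prod.cong refl) (simp add: prime_elem_multiplicity_mult_distrib power_add)

lemma prime_mult_1 [simp]: "prime_mult N z (Suc 0) = 1"
  unfolding prime_mult_def by (intro prod.neutral) auto

lemma prime_mult_prime:
  assumes "prime p" "p \<le> N"
  shows "prime_mult N z p = z p"
proof -
  have "z r ^ multiplicity r p = (if r = p then z p else 1)" if "prime r" for r
    using that assms prime_multiplicity_other[of r p] not_prime_unit[of p] by (auto simp: multiplicity_self)
  hence "prime_mult N z p = (\<Prod>r | prime r \<and> r \<le> N. if r = p then z p else 1)"
    unfolding prime_mult_def by (intro prod.cong) auto
  also have "\<dots> = z p" using assms by (subst prod.delta) auto
  finally show ?thesis .
qed

lemma norm_prime_mult: "(\<And>p. norm (z p) = 1) \<Longrightarrow> norm (prime_mult N z n) = 1"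
  unfolding prime_mult_def by (simp add: prod_norm[symmetric] norm_power)

lemma norm_1_if_power_eq_1:
  assumes "z ^ g = 1" "g > 0"
  shows "norm (z :: complex) = 1"
proof -
  have "norm z ^ g = 1" using assms(1) by (simp flip: norm_power)
  thus ?thesis using assms(2) power_eq_1_iff[of "norm z" g] by simp
qed

lemma cis_root_power:
  assumes "g > 0"
  shows "cis (2 * pi * real i / real g) ^ g = 1"
proof -
  have "cis (2 * pi * real i / real g) ^ g = cis (2 * pi * real i)" using assms by (simp add: Complex.DeMoivre)
  thus ?thesis by (metis cis_multiple_2pi Ints_of_nat mult.assoc)
qed

lemma sum_root_of_unity_powers:
  assumes "g > 0"
  shows "(\<Sum>i<g. cis (2 * pi * real i / real g) ^ k) = (if g dvd k then of_nat g else 0)"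
proof -
  define u where "u = cis (2 * pi * real k / real g)"
  have "cis (2 * pi * real i / real g) ^ k = u ^ i" for i
    by (simp add: u_def Complex.DeMoivre mult_ac)
  hence eq: "(\<Sum>i<g. cis (2 * pi * real i / real g) ^ k) = (\<Sum>i<g. u ^ i)" by simp
  have u1: "u = 1 \<longleftrightarrow> g dvd k" unfolding u_def by (rule cis_2pi_div_eq_1_iff[OF assms])
  have ug: "u ^ g = 1" unfolding u_def by (rule cis_root_power[OF assms])
  show ?thesis
  proof (cases "u = 1")
    case False
    hence "(\<Sum>i<g. u ^ i) = (u ^ g - 1) / (u - 1)" by (rule geometric_sum)
    thus ?thesis using False u1 ug eq by simp
  qed (use u1 eq in simp)
qed

text \<open>Averaging over \<open>g\<close>-th roots of unity at a prime keeps only exponents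
  divisible by \<open>g\<close>; as \<open>g \<ge> 3\<close>, a surviving \<open>n\<close> with a
  prime factor \<open>p\<close> above \<open>y\<close> is divisible by \<open>p ^ 3\<close>. Such
  \<open>n\<close> contribute at most 1 once \<open>1 + ln N \<le> y\<close>.\<close>

lemma sum_inverse_cube_multiples_le:
  assumes y: "y > 0" and N: "N > 0"
  shows "(\<Sum>n | n \<in> {1..<N} \<and> (\<exists>p\<in>{Suc y..N}. p ^ 3 dvd n). 1 / real n) \<le> (1 + ln (real N)) / real y"
proof -
  have "(\<Sum>n | n \<in> {1..<N} \<and> (\<exists>p\<in>{Suc y..N}. p ^ 3 dvd n). 1 / real n) \<le>
      (\<Sum>n\<in>(\<lambda>(p, j). p ^ 3 * j) ` ({Suc y..N} \<times> {1..N}). 1 / real n)"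
  proof (intro sum_mono2 subsetI)
    fix n assume "n \<in> {n. n \<in> {1..<N} \<and> (\<exists>p\<in>{Suc y..N}. p ^ 3 dvd n)}"
    then obtain p j where n: "1 \<le> n" "n < N" "p \<in> {Suc y..N}" "n = p ^ 3 * j" by (auto elim: dvdE)
    have "j > 0" using n by (intro Nat.gr0I) auto
    moreover have "j \<le> p ^ 3 * j" using n(3) by simp
    hence "j \<le> N" using n(2) unfolding n(4) by linarith
    ultimately have "j \<in> {1..N}" by simp
    thus "n \<in> (\<lambda>(p, j). p ^ 3 * j) ` ({Suc y..N} \<times> {1..N})" using n by (intro image_eqI[of _ _ "(p, j)"]) auto
  qed auto
  also have "\<dots> \<le> (\<Sum>(p, j)\<in>{Suc y..N} \<times> {1..N}. 1 / real (p ^ 3 * j))"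
    by (rule order.trans[OF sum_image_le]) (auto simp: o_def case_prod_unfold)
  also have "\<dots> = (\<Sum>p=Suc y..N. \<Sum>j=1..N. 1 / real p ^ 3 * (1 / real j))"
    by (simp add: sum.cartesian_product)
  also have "\<dots> = (\<Sum>p=Suc y..N. 1 / real p ^ 3) * (\<Sum>j=1..N. 1 / real j)"
    by (rule sum_product[symmetric])
  also have "\<dots> \<le> (1 / real y) * (1 + ln (real N))"
  proof (intro mult_mono sum_inverse_le_ln N)
    have "(\<Sum>p=Suc y..N. 1 / real p ^ 3) \<le> (\<Sum>p=Suc y..N. 1 / real p ^ 2)"
      by (intro sum_mono frac_le power_increasing) auto
    also have "\<dots> \<le> 1 / real y" using y by (rule sum_inverse_squares_le)
    finally show "(\<Sum>p=Suc y..N. 1 / real p ^ 3) \<le> 1 / real y" .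
  qed (auto intro!: sum_nonneg)
  finally show ?thesis by simp
qed

text \<open>Averaging over all choices of \<open>g\<close>-th roots of unity at the primes above \<open>y\<close> kills every
  \<open>n\<close> divisible by such a prime, unless all exponents of these primes are multiples of \<open>g\<close>.\<close>

lemma exists_extension_beyond_smooth:
  fixes a :: "nat \<Rightarrow> complex"
  assumes g: "g \<ge> 3" and y: "y > 0" and N: "N > 0" and a: "\<And>n. norm (a n) \<le> 1"
    and z0: "\<And>p. z0 p ^ g = 1"
  shows "\<exists>z. (\<forall>p\<le>y. z p = z0 p) \<and> (\<forall>p. z p ^ g = 1) \<and>
    norm (\<Sum>k=1..<N. of_real (1 - real k / real N) * a k * cnj (prime_mult N z k) / of_nat k) \<ge>
    norm (\<Sum>n | n \<in> {1..<N} \<and> (\<forall>p. prime p \<longrightarrow> p dvd n \<longrightarrow> p \<le> y).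
      of_real (1 - real n / real N) * (a n * cnj (prime_mult N z0 n)) / of_nat n) - (1 + ln (real N)) / real y"
proof -
  define P where "P = {p. prime p \<and> y < p \<and> p \<le> N}"
  define Q where "Q = {p. prime p \<and> p \<le> y \<and> p \<le> N}"
  have fin: "finite P" "finite Q" unfolding P_def Q_def by (rule finite_subset[of _ "{..N}"]; auto)+
  have PQ: "{p. prime p \<and> p \<le> N} = Q \<union> P" "Q \<inter> P = {}" by (auto simp: P_def Q_def)
  define J where "J = PiE P (\<lambda>_. {..<g})"
  have finJ: "finite J" unfolding J_def using fin by (intro finite_PiE) auto
  have cardJ: "card J = g ^ card P" unfolding J_def using fin by (simp add: card_PiE)
  have J0: "card J > 0" unfolding cardJ using g by simp
  define zz where "zz j p = (if p \<in> P then cis (2 * pi * real (j p) / real g) else z0 p)" for j :: "nat \<Rightarrow> nat" and p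
  have zzg: "zz j p ^ g = 1" for j p using cis_root_power[of g] g z0 by (simp add: zz_def)
  have norm1: "norm u = 1" if "u ^ g = 1" for u :: complex using norm_1_if_power_eq_1[OF that] g by simp
  define c0 where "c0 n = (\<Prod>p\<in>Q. z0 p ^ multiplicity p n)" for n
  define T where "T n = (\<Sum>j\<in>J. cnj (prime_mult N (zz j) n))" for n
  define bad where "bad = {n. n \<in> {1..<N} \<and> (\<exists>p\<in>{Suc y..N}. p ^ 3 dvd n)}"
  define sm where "sm = {n. n \<in> {1..<N} \<and> (\<forall>p. prime p \<longrightarrow> p dvd n \<longrightarrow> p \<le> y)}"
  have split: "prime_mult N z n = (\<Prod>p\<in>Q. z p ^ multiplicity p n) * (\<Prod>p\<in>P. z p ^ multiplicity p n)" for z n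
    unfolding prime_mult_def PQ(1) using fin PQ(2) by (rule_tac prod.union_disjoint)
  have zz: "prime_mult N (zz j) n = c0 n * (\<Prod>p\<in>P. cis (2 * pi * real (j p) / real g) ^ multiplicity p n)" for j n
  proof -
    have "(\<Prod>p\<in>Q. zz j p ^ multiplicity p n) = c0 n"
      unfolding c0_def using PQ(2) by (intro prod.cong) (auto simp: zz_def)
    moreover have "(\<Prod>p\<in>P. zz j p ^ multiplicity p n) = (\<Prod>p\<in>P. cis (2 * pi * real (j p) / real g) ^ multiplicity p n)"
      by (intro prod.cong) (auto simp: zz_def)
    ultimately show ?thesis unfolding split by simp
  qed
  have sumzz: "(\<Sum>j\<in>J. prime_mult N (zz j) n) = c0 n * (\<Prod>p\<in>P. if g dvd multiplicity p n then of_nat g else 0)" for n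
  proof -
    have "(\<Prod>p\<in>P. if g dvd multiplicity p n then of_nat g else 0 :: complex) =
        (\<Prod>p\<in>P. \<Sum>i<g. cis (2 * pi * real i / real g) ^ multiplicity p n)"
      using g by (subst sum_root_of_unity_powers) auto
    also have "\<dots> = (\<Sum>j\<in>J. \<Prod>p\<in>P. cis (2 * pi * real (j p) / real g) ^ multiplicity p n)"
      unfolding J_def using fin by (intro prod_sum_PiE) auto
    finally show ?thesis unfolding zz by (simp add: sum_distrib_left)
  qed
  have T: "T n = cnj (\<Sum>j\<in>J. prime_mult N (zz j) n)" for n by (simp add: T_def)
  have T_smooth: "T n = of_nat (card J) * cnj (prime_mult N z0 n)" if n: "n \<in> sm" for n
  proof -
    have 0: "multiplicity p n = 0" if "p \<in> P" for p
      using that n by (intro not_dvd_imp_multiplicity_0) (auto simp: sm_def P_def)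
    have "prime_mult N z0 n = c0 n" unfolding split c0_def using 0 by simp
    moreover have "(\<Sum>j\<in>J. prime_mult N (zz j) n) = c0 n * of_nat (card J)" unfolding sumzz using 0 by (simp add: cardJ)
    ultimately show ?thesis unfolding T by simp
  qed
  have T_norm: "norm (T n) \<le> real (card J)" for n
  proof -
    have "norm (T n) \<le> (\<Sum>j\<in>J. norm (cnj (prime_mult N (zz j) n)))" unfolding T_def by (rule norm_sum)
    thus ?thesis using norm_prime_mult[of "zz _"] zzg norm1 by simp
  qed
  have T_zero: "T n = 0" if n: "n \<in> {1..<N} - sm - bad" for n
  proof -
    from n obtain p where p: "prime p" "p dvd n" "y < p" by (auto simp: sm_def not_le)
    have "p \<le> n" using p n by (intro dvd_imp_le) auto
    hence pP: "p \<in> P" and p2: "p \<in> {Suc y..N}" using p n by (auto simp: P_def)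
    have "multiplicity p n \<noteq> 0" using p n by (simp add: multiplicity_eq_zero_iff prime_elem_multiplicity_eq_zero_iff)
    moreover have "\<not> 3 \<le> multiplicity p n"
    proof
      assume "3 \<le> multiplicity p n"
      hence "p ^ 3 dvd n" by (rule multiplicity_dvd')
      thus False using n p2 by (auto simp: bad_def)
    qed
    ultimately have "\<not> g dvd multiplicity p n" using g by (auto dest!: dvd_imp_le)
    hence "(\<Prod>p\<in>P. if g dvd multiplicity p n then of_nat g else 0 :: complex) = 0"
      using fin pP by (intro prod_zero) auto
    thus ?thesis unfolding T sumzz by simp
  qed
  define b where "b n = of_real (1 - real n / real N) * a n / of_nat n" for n
  define S where "S z = (\<Sum>k=1..<N. of_real (1 - real k / real N) * a k * cnj (prime_mult N z k) / of_nat k)" for z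
  define S0 where "S0 = (\<Sum>n\<in>sm. of_real (1 - real n / real N) * (a n * cnj (prime_mult N z0 n)) / of_nat n)"
  have b: "norm (b n) \<le> 1 / real n" if "n < N" for n
  proof -
    have "norm (b n) = \<bar>1 - real n / real N\<bar> * norm (a n) / real n"
      unfolding b_def norm_divide norm_mult norm_of_real norm_of_nat ..
    also have "\<dots> \<le> 1 * 1 / real n" using a that by (intro divide_right_mono mult_mono) auto
    finally show ?thesis by simp
  qed
  have "(\<Sum>j\<in>J. S (zz j)) = (\<Sum>j\<in>J. \<Sum>k=1..<N. b k * cnj (prime_mult N (zz j) k))"
    by (simp add: S_def b_def)
  also have "\<dots> = (\<Sum>k=1..<N. b k * T k)"
    unfolding T_def sum_distrib_left by (rule sum.swap)
  also have "\<dots> = (\<Sum>k\<in>sm. b k * T k) + (\<Sum>k\<in>{1..<N} - sm. b k * T k)"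
    by (subst add.commute, rule sum.subset_diff) (auto simp: sm_def)
  also have "(\<Sum>k\<in>sm. b k * T k) = of_nat (card J) * S0"
    unfolding S0_def sum_distrib_left by (intro sum.cong refl) (simp add: T_smooth b_def)
  finally have eq: "(\<Sum>j\<in>J. S (zz j)) = of_nat (card J) * S0 + (\<Sum>k\<in>{1..<N} - sm. b k * T k)" .
  have "norm (\<Sum>k\<in>{1..<N} - sm. b k * T k) \<le> (\<Sum>k\<in>{1..<N} - sm. norm (b k * T k))" by (rule norm_sum)
  also have "\<dots> = (\<Sum>k\<in>({1..<N} - sm) \<inter> bad. norm (b k * T k))"
  proof (rule sum.mono_neutral_right)
    show "\<forall>k\<in>({1..<N} - sm) - ({1..<N} - sm) \<inter> bad. norm (b k * T k) = 0"
    proof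
      fix k assume "k \<in> ({1..<N} - sm) - ({1..<N} - sm) \<inter> bad"
      hence "T k = 0" by (intro T_zero) blast
      thus "norm (b k * T k) = 0" by simp
    qed
  qed auto
  also have "\<dots> \<le> (\<Sum>k\<in>({1..<N} - sm) \<inter> bad. 1 / real k * real (card J))"
    unfolding norm_mult using b T_norm by (intro sum_mono mult_mono) auto
  also have "\<dots> \<le> (\<Sum>k\<in>bad. 1 / real k * real (card J))"
    by (intro sum_mono2) (auto simp: bad_def)
  also have "\<dots> = real (card J) * (\<Sum>k\<in>bad. 1 / real k)" by (simp add: sum_distrib_left)
  also have "\<dots> \<le> real (card J) * ((1 + ln (real N)) / real y)"
    using sum_inverse_cube_multiples_le[OF y N] unfolding bad_def by (intro mult_left_mono) auto
  finally have R: "norm (\<Sum>k\<in>{1..<N} - sm. b k * T k) \<le> real (card J) * ((1 + ln (real N)) / real y)" .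
  have "norm (of_nat (card J) * S0) \<le> norm (\<Sum>j\<in>J. S (zz j)) + norm (\<Sum>k\<in>{1..<N} - sm. b k * T k)"
    using norm_triangle_ineq4[of "\<Sum>j\<in>J. S (zz j)" "\<Sum>k\<in>{1..<N} - sm. b k * T k"] unfolding eq by simp
  hence lower: "real (card J) * (norm S0 - (1 + ln (real N)) / real y) \<le> norm (\<Sum>j\<in>J. S (zz j))"
    using R by (simp add: norm_mult right_diff_distrib)
  have "\<exists>j\<in>J. norm S0 - (1 + ln (real N)) / real y \<le> norm (S (zz j))"
  proof (rule ccontr)
    assume "\<not> ?thesis"
    hence "norm (S (zz j)) < norm S0 - (1 + ln (real N)) / real y" if "j \<in> J" for j using that by auto
    hence "(\<Sum>j\<in>J. norm (S (zz j))) < (\<Sum>j\<in>J. norm S0 - (1 + ln (real N)) / real y)"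
      using J0 finJ by (intro sum_strict_mono) auto
    also have "\<dots> = real (card J) * (norm S0 - (1 + ln (real N)) / real y)" by simp
    finally show False using lower norm_sum[of "\<lambda>j. S (zz j)" J] by linarith
  qed
  then obtain j where "norm S0 - (1 + ln (real N)) / real y \<le> norm (S (zz j))" by blast
  moreover have "\<forall>p\<le>y. zz j p = z0 p" by (auto simp: zz_def P_def)
  ultimately show ?thesis using zzg unfolding S_def S0_def sm_def by (intro exI[of _ "zz j"]) auto
qed

lemma dc_int_prod:
  assumes "dirichlet_character q \<psi>"
  shows "finite A \<Longrightarrow> \<psi> (int (\<Prod>x\<in>A. h x)) = (\<Prod>x\<in>A. \<psi> (int (h x)))"
  by (induction A rule: finite_induct) (simp_all add: dc_mult[OF assms] dc_1[OF assms])

lemma prod_primes_le_multiplicity: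
  fixes n N :: nat
  assumes "n > 0" "n \<le> N"
  shows "n = (\<Prod>p | prime p \<and> p \<le> N. p ^ multiplicity p n)"
proof -
  have le: "p \<le> N" if "0 < multiplicity p n" for p
    using that assms dvd_imp_le[of p n] not_dvd_imp_multiplicity_0[of p n] by fastforce
  have "n = (\<Prod>p\<in>prime_factors n. p ^ multiplicity p n)" using assms by (intro prime_factorization_nat) auto
  also have "\<dots> = (\<Prod>p | prime p \<and> p \<le> N. p ^ multiplicity p n)"
    using le by (intro prod.mono_neutral_left) (auto simp: prime_factors_multiplicity)
  finally show ?thesis .
qed

lemma dc_eq_prime_mult:
  assumes \<eta>: "dirichlet_character q \<eta>" and z: "\<And>p. prime p \<Longrightarrow> p \<le> N \<Longrightarrow> \<not> p dvd g \<Longrightarrow> \<eta> (int p) = z p"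
    and n: "0 < n" "n \<le> N" "coprime n g"
  shows "\<eta> (int n) = prime_mult N z n"
proof -
  have "\<eta> (int n) = \<eta> (int (\<Prod>p | prime p \<and> p \<le> N. p ^ multiplicity p n))"
    using prod_primes_le_multiplicity[OF n(1,2)] by simp
  also have "\<dots> = (\<Prod>p | prime p \<and> p \<le> N. \<eta> (int (p ^ multiplicity p n)))" by (rule dc_int_prod[OF \<eta>]) simp
  also have "\<dots> = prime_mult N z n" unfolding prime_mult_def
  proof (rule prod.cong[OF refl])
    fix p assume p: "p \<in> {p. prime p \<and> p \<le> N}"
    have pow: "\<eta> (int (p ^ multiplicity p n)) = \<eta> (int p) ^ multiplicity p n" using dc_power[OF \<eta>] by simp
    show "\<eta> (int (p ^ multiplicity p n)) = z p ^ multiplicity p n"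
    proof (cases "p dvd g")
      case True
      have "\<not> p dvd n"
      proof
        assume "p dvd n"
        hence "p dvd 1" using True n(3) by (metis coprime_common_divisor)
        thus False using p by auto
      qed
      thus ?thesis unfolding pow by (simp add: not_dvd_imp_multiplicity_0)
    qed (use p z pow in simp)
  qed
  finally show ?thesis .
qed

text \<open>The value at \<open>m\<close> of the character is irrelevant for the sum since \<open>\<psi> m = 0\<close>; it is used to make
  the order exactly \<open>g\<close>.\<close>

lemma exists_resonating_values:
  assumes g: "g \<ge> 3" and m: "prime m" "m > g" and dc: "dirichlet_character m \<psi>"
    and y: "y \<ge> 8" "m \<le> y" "y \<le> N" "ln (real N) \<ge> 12 * ln (real y) * ln (ln (real y))" "1 + ln (real N) \<le> real y"
    and s: "(\<Sum>p | p \<in> {1..y} \<and> prime p \<and> \<not> p dvd m * g. nearest g (\<psi> (int p)) / real p) \<ge> s"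
  defines "a \<equiv> \<lambda>n. \<psi> n * principal_character (m * g) n"
  shows "\<exists>z. (\<forall>p. z p ^ g = 1) \<and> z m = cis (2 * pi / real g) \<and>
    norm (\<Sum>k=1..<N. of_real (1 - real k / real N) * a (int k) * cnj (prime_mult N z k) / of_nat k) \<ge>
    exp (s - 6) - exp (12 * (1 + 4 / ln 2 - ln (ln 2))) - 1"
proof -
  have M0: "m * g > 0" using m g by auto
  have a: "dirichlet_character (m * g) a" unfolding a_def using dc M0 by (intro dc_lift) auto
  have "\<exists>i. \<forall>w. i w < g \<and> nearest g w = Re (w * cnj (cis (2 * pi * real (i w) / real g)))"
    using nearest_attained[of g] g by (intro choice) auto
  then obtain i where i: "\<And>w. nearest g w = Re (w * cnj (cis (2 * pi * real (i w) / real g)))" by blast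
  define z0 where "z0 p = (if p = m then cis (2 * pi / real g) else cis (2 * pi * real (i (\<psi> (int p))) / real g))" for p
  have z0g: "z0 p ^ g = 1" for p
    using cis_root_power[of g 1] cis_root_power[of g "i (\<psi> (int p))"] g by (simp add: z0_def)
  have z0n: "norm (z0 p) = 1" for p using z0g g by (intro norm_1_if_power_eq_1[of _ g]) auto
  define f where "f n = a (int n) * cnj (prime_mult N z0 n)" for n
  interpret smooth_sum f y N
  proof
    show "f (u * v) = f u * f v" if "u > 0" "v > 0" for u v
      using that by (simp add: f_def prime_mult_mult dc_mult[OF a])
    show "f 1 = 1" using dc_1[OF a] by (simp add: f_def)
    show "norm (f n) \<le> 1" for n
      using dc_norm_le[OF a] norm_prime_mult[of z0] z0n by (simp add: f_def norm_mult)
    show "N > 0" using y by simp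
  qed
  have Peq: "P = {p. p \<in> {1..y} \<and> prime p}" by (auto simp: P_def dest: prime_gt_0_nat)
  have Ref: "Re (f p) / real p = (if p dvd m * g then 0 else nearest g (\<psi> (int p)) / real p)" if p: "p \<in> P" for p
  proof (cases "p dvd m * g")
    case True
    have "\<not> coprime p (m * g)"
    proof
      assume "coprime p (m * g)"
      from coprime_common_divisor[OF this dvd_refl True] show False using p by (auto simp: P_def)
    qed
    hence "\<not> coprime (int p) (int (m * g))" by (simp only: coprime_int_iff not_False_eq_True)
    hence "a (int p) = 0" by (auto simp: a_def principal_character_def)
    thus ?thesis using True by (simp add: f_def)
  next
    case False
    hence "coprime (int p) (int (m * g))" using p False prime_imp_coprime_nat[of p "m * g"] by (simp only: coprime_int_iff) (simp add: P_def)
    moreover have "p \<noteq> m" using False by auto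
    ultimately have "f p = \<psi> (int p) * cnj (cis (2 * pi * real (i (\<psi> (int p))) / real g))"
      using p y by (simp add: f_def a_def principal_character_def prime_mult_prime P_def z0_def)
    thus ?thesis using False i[of "\<psi> (int p)"] by simp
  qed
  have "(\<Sum>p\<in>P. Re (f p) / real p) = (\<Sum>p | p \<in> {1..y} \<and> prime p \<and> \<not> p dvd m * g. nearest g (\<psi> (int p)) / real p)"
    using finite_P by (intro sum.mono_neutral_cong_right) (auto simp: Ref Peq)
  hence sP: "s \<le> (\<Sum>p\<in>P. Re (f p) / real p)" using s by simp
  define C2 where "C2 = 1 + 4 / ln 2 - ln (ln (2::real))"
  have "ln (ln (2::real)) \<le> 0" using ln_2_less_1 by simp
  moreover have "4 / ln (2::real) \<ge> 0" by simp
  ultimately have "C2 \<ge> 0" unfolding C2_def by linarith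
  have "(\<Sum>p\<in>P. 1 / real p) \<le> ln (ln (real y)) + C2"
    using sum_inverse_primes_le[of y] y unfolding Peq C2_def by simp
  note smooth_sum_ge[OF y(1) this \<open>C2 \<ge> 0\<close> y(4)]
  moreover have "exp (s - 6) \<le> exp ((\<Sum>p\<in>P. Re (f p) / real p) - 6)" using sP by simp
  ultimately have 1: "norm (\<Sum>n\<in>smooth. of_real (1 - real n / real N) * f n / of_nat n) \<ge> exp (s - 6) - exp (12 * C2)"
    by linarith
  have y0: "y > 0" using y by simp
  obtain z where z: "\<forall>p\<le>y. z p = z0 p" "\<forall>p. z p ^ g = 1"
    "norm (\<Sum>k=1..<N. of_real (1 - real k / real N) * a (int k) * cnj (prime_mult N z k) / of_nat k) \<ge>
     norm (\<Sum>n\<in>smooth. of_real (1 - real n / real N) * f n / of_nat n) - (1 + ln (real N)) / real y"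
    using exists_extension_beyond_smooth[OF g y0 N_pos, of "\<lambda>n. a (int n)" z0] dc_norm_le[OF a] z0g
    unfolding f_def smooth_def by blast
  have "(1 + ln (real N)) / real y \<le> 1" using y by simp
  hence "norm (\<Sum>k=1..<N. of_real (1 - real k / real N) * a (int k) * cnj (prime_mult N z k) / of_nat k) \<ge>
    exp (s - 6) - exp (12 * C2) - 1" using z(3) 1 by linarith
  moreover have "z m = cis (2 * pi / real g)" using z(1) y(2) by (simp add: z0_def)
  ultimately show ?thesis using z(2) unfolding C2_def by blast
qed

text \<open>The function \<open>a\<close>, which is \<open>\<psi>\<close> restricted to integers
  coprime to \<open>m * g\<close>, has the three properties that matter for
  \<open>max_sum_lower_bound\<close>: it is odd, it has period \<open>m * g\<close>, and it vanishes
  at multiples of primes dividing \<open>g\<close>, where the values of \<open>\<eta>\<close> are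
  not prescribed.\<close>

lemma resonating_character:
  assumes g: "g \<ge> 3" "odd g" and m: "prime m" "m > g" and dc: "dirichlet_character m \<psi>" "\<psi> (- 1) = - 1"
  shows "\<exists>C\<ge>1. \<forall>y N s. 8 \<le> y \<longrightarrow> m \<le> y \<longrightarrow> y \<le> N \<longrightarrow> ln (real N) \<ge> 12 * ln (real y) * ln (ln (real y)) \<longrightarrow>
    1 + ln (real N) \<le> real y \<longrightarrow>
    (\<Sum>p | p \<in> {1..y} \<and> prime p \<and> \<not> p dvd m * g. nearest g (\<psi> (int p)) / real p) \<ge> s \<longrightarrow>
    (\<exists>q \<eta>. dirichlet_character q \<eta> \<and> character_order q \<eta> = g \<and> N < q \<and> ln (real q) \<le> C * real N ^ 3 \<and>
      real (m * g) * max_character_sum q \<eta> \<ge>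
        sqrt (real q) * ((exp (s - 6) - exp (12 * (1 + 4 / ln 2 - ln (ln 2))) - 1) / pi - pi))"
proof -
  define D where "D = exp (12 * (1 + 4 / ln 2 - ln (ln (2::real)))) + 1"
  define a where "a n = \<psi> n * principal_character (m * g) n" for n
  have M0: "m * g > 0" using m g by auto
  have a: "dirichlet_character (m * g) a" unfolding a_def using dc M0 by (intro dc_lift) auto
  have "a (- 1) = - 1" using dc by (simp add: a_def principal_character_def)
  hence a_odd: "a (- n) = - a n" for n using dc_mult[OF a, of "- 1" n] by simp
  have a_per: "a (n + int (m * g)) = a n" for n using a by (simp add: dirichlet_character_def)
  obtain C where C: "C \<ge> 1" and pc: "\<And>N z. N > 0 \<Longrightarrow> (\<forall>p. z p ^ g = 1) \<Longrightarrow>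
     (\<exists>p. prime p \<and> p \<le> N \<and> \<not> p dvd g \<and> z p = cis (2 * pi / real g)) \<Longrightarrow>
     (\<exists>q \<eta>. dirichlet_character q \<eta> \<and> character_order q \<eta> = g \<and> separates q \<eta> \<and> N < q \<and>
        ln (real q) \<le> C * real N ^ 3 \<and> (\<forall>n. \<eta> n ^ g = principal_character q n) \<and>
        (\<forall>p. prime p \<longrightarrow> p \<le> N \<longrightarrow> \<not> p dvd g \<longrightarrow> \<eta> (int p) = z p))"
    using prescribed_character[OF g] by blast
  have "\<exists>q \<eta>. dirichlet_character q \<eta> \<and> character_order q \<eta> = g \<and> N < q \<and> ln (real q) \<le> 64 * C * real N ^ 3 \<and>
      real (m * g) * max_character_sum q \<eta> \<ge> sqrt (real q) * ((exp (s - 6) - D) / pi - pi)"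
    if y: "8 \<le> y" "m \<le> y" "y \<le> N" "ln (real N) \<ge> 12 * ln (real y) * ln (ln (real y))" "1 + ln (real N) \<le> real y"
    and s: "(\<Sum>p | p \<in> {1..y} \<and> prime p \<and> \<not> p dvd m * g. nearest g (\<psi> (int p)) / real p) \<ge> s" for y N s
  proof -
    obtain z where z: "\<forall>p. z p ^ g = 1" "z m = cis (2 * pi / real g)"
      "norm (\<Sum>k=1..<N. of_real (1 - real k / real N) * a (int k) * cnj (prime_mult N z k) / of_nat k) \<ge>
        exp (s - 6) - D"
      using exists_resonating_values[OF g(1) m dc(1) y s] unfolding a_def D_def by (auto simp: algebra_simps)
    have N0: "N > 0" using y by simp
    have mg: "\<not> m dvd g" using m(2) g by (auto dest: dvd_imp_le)
    \<comment> \<open>Values are prescribed up to \<open>4 * N\<close> so that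
      \<open>4 * N < q\<close>, as \<open>max_sum_lower_bound\<close> demands; the cube turns
      \<open>C\<close> into \<open>64 * C\<close>.\<close>
    have "\<exists>p. prime p \<and> p \<le> 4 * N \<and> \<not> p dvd g \<and> z p = cis (2 * pi / real g)"
      using m y mg z(2) by (intro exI[of _ m]) auto
    from pc[OF _ z(1) this] N0 obtain q \<eta> where \<eta>: "dirichlet_character q \<eta>" "character_order q \<eta> = g"
      "separates q \<eta>" "4 * N < q" "ln (real q) \<le> C * real (4 * N) ^ 3" "\<And>n. \<eta> n ^ g = principal_character q n"
      "\<And>p. prime p \<Longrightarrow> p \<le> 4 * N \<Longrightarrow> \<not> p dvd g \<Longrightarrow> \<eta> (int p) = z p"
      by auto
    have "\<eta> (int m) = cis (2 * pi / real g)" using \<eta>(7)[of m] m y mg z(2) by simp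
    moreover have "cis (2 * pi / real g) \<noteq> 1" using cis_2pi_div_eq_1_iff[of g 1] g by auto
    ultimately have np: "\<eta> \<noteq> principal_character q" by (metis cis_neq_zero principal_character_def)
    \<comment> \<open>The value is 1 or -1 and, \<open>g\<close> being odd, equals its own
      \<open>g\<close>-th power.\<close>
    have even: "\<eta> (- 1) = 1"
    proof -
      obtain k where k: "g = 2 * k + 1" using g(2) by (auto elim: oddE)
      have "\<eta> (- 1) ^ 2 = 1" using dc_power[OF \<eta>(1), of "- 1" 2] dc_1[OF \<eta>(1)] by simp
      hence "\<eta> (- 1) ^ g = \<eta> (- 1)" by (simp add: k power_mult)
      thus ?thesis using \<eta>(6)[of "- 1"] by (simp add: principal_character_def)
    qed
    interpret separating_char q \<eta>
      by standard (use \<eta> np even in auto)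
    have "a (int k) * cnj (\<eta> (int k)) = a (int k) * cnj (prime_mult N z k)" if k: "k \<in> {1..<N}" for k
    proof (cases "coprime k (m * g)")
      case True
      hence "coprime k g" by simp
      thus ?thesis using dc_eq_prime_mult[OF \<eta>(1), of N g z k] \<eta>(7) k by simp
    next
      case False
      hence "\<not> coprime (int k) (int (m * g))" by (simp only: coprime_int_iff) simp
      hence "a (int k) = 0" by (auto simp: a_def principal_character_def)
      thus ?thesis by simp
    qed
    hence eq: "(\<Sum>k=1..<N. of_real (1 - real k / real N) * a (int k) * cnj (\<eta> (int k)) / of_nat k) =
        (\<Sum>k=1..<N. of_real (1 - real k / real N) * a (int k) * cnj (prime_mult N z k) / of_nat k)"
      by (intro sum.cong refl) (simp add: mult.assoc)
    have "sqrt (real q) * ((exp (s - 6) - D) / pi - pi) \<le> sqrt (real q) *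
        (norm (\<Sum>k=1..<N. of_real (1 - real k / real N) * a (int k) * cnj (\<eta> (int k)) / of_nat k) / pi - pi)"
      unfolding eq using z(3) by (intro mult_left_mono diff_right_mono divide_right_mono) auto
    also have "\<dots> \<le> real (m * g) * max_character_sum q \<eta>"
      using \<eta>(4) by (intro max_sum_lower_bound M0 a_per dc_norm_le[OF a] a_odd N0) auto
    finally show ?thesis using \<eta>(1,2,4,5)
      by (intro exI[of _ q] exI[of _ \<eta>]) (auto simp: power_mult_distrib)
  qed
  thus ?thesis using C unfolding D_def by (intro exI[of _ "64 * C"]) (auto simp: diff_diff_eq)
qed

text \<open>\<open>L\<close> stands for \<open>ln y\<close>. The left side bounds the target power
  of \<open>ln (ln q)\<close>, with 36 as the product of the 12 from Rankin's trick and the exponent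
  3 of \<open>N\<close> in \<open>ln q\<close>. As \<open>\<beta> < \<alpha>\<close>, the power of
  \<open>L\<close> on the right beats the factor \<open>ln L\<close> and all constants.\<close>

lemma growth_comparison:
  fixes \<alpha> \<beta> A B D E K :: real
  assumes "K > 0" "0 \<le> \<beta>" "\<beta> < \<alpha>" "A > 0" "B > 0"
  shows "eventually (\<lambda>L. (A + 36 * (L * ln L)) powr \<beta> \<le> (K * L powr \<alpha> - D) / B - E) at_top"
proof -
  define t where "t = \<alpha> - \<beta>"
  have t: "t > 0" and \<alpha>: "\<alpha> > 0" using assms by (auto simp: t_def)
  have "eventually (\<lambda>L. (37 * (L * ln L)) powr \<beta> \<le> (K * L powr \<alpha> - D) / B - E) at_top"
  proof -
    have "((\<lambda>L::real. 37 powr \<beta> * (ln L powr \<beta> / L powr t)) \<longlongrightarrow> 0) at_top" using t by real_asymp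
    moreover have "((\<lambda>L::real. K / B - (D / B + E) / L powr \<alpha>) \<longlongrightarrow> K / B) at_top" using \<alpha> by real_asymp
    ultimately have "((\<lambda>L. K / B - (D / B + E) / L powr \<alpha> - 37 powr \<beta> * (ln L powr \<beta> / L powr t)) \<longlongrightarrow> K / B - 0) at_top"
      by (intro tendsto_diff)
    moreover have "0 < K / B - 0" using assms by simp
    ultimately have "eventually (\<lambda>L. 0 < K / B - (D / B + E) / L powr \<alpha> - 37 powr \<beta> * (ln L powr \<beta> / L powr t)) at_top"
      by (rule order_tendstoD)
    thus ?thesis using eventually_gt_at_top[of 1]
    proof eventually_elim
      case (elim L)
      have "(37 * (L * ln L)) powr \<beta> = L powr \<alpha> * (37 powr \<beta> * (ln L powr \<beta> / L powr t))"
        using elim by (simp add: powr_mult t_def powr_diff)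
      also have "\<dots> \<le> L powr \<alpha> * (K / B - (D / B + E) / L powr \<alpha>)" using elim by (intro mult_left_mono) auto
      also have "\<dots> = (K * L powr \<alpha> - D) / B - E" using elim assms by (simp add: field_simps)
      finally show ?case .
    qed
  qed
  moreover have "eventually (\<lambda>L::real. A \<le> L * ln L) at_top"
  proof -
    have "filterlim (\<lambda>L::real. L * ln L) at_top at_top" by real_asymp
    thus ?thesis by (simp add: filterlim_at_top)
  qed
  ultimately show ?thesis using eventually_gt_at_top[of 1]
  proof eventually_elim
    case (elim L)
    have "(A + 36 * (L * ln L)) powr \<beta> \<le> (37 * (L * ln L)) powr \<beta>"
      using elim assms by (intro powr_mono2) auto
    thus ?case using elim by linarith
  qed
qed

text \<open>At most half of \<open>\<epsilon>\<close> is spent on the equidistribution of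
  \<open>\<psi>\<close>; the remaining gap between exponents goes to
  \<open>growth_comparison\<close>. This leaves the leading constant 1 and a free lower bound
  \<open>N0\<close> for the modulus.\<close>

lemma exists_large_character_sum:
  assumes g: "g \<ge> 3" "odd g" and \<epsilon>: "\<epsilon> > 0"
  shows "\<exists>q \<eta>. N0 < q \<and> dirichlet_character q \<eta> \<and> character_order q \<eta> = g \<and>
    max_character_sum q \<eta> \<ge> sqrt (real q) * ln (ln (real q)) powr (1 - delta g - \<epsilon>)"
proof -
  define \<alpha>0 where "\<alpha>0 = real g / pi * sin (pi / real g)"
  have "sin (pi / real g) > 0" using g by (intro sin_gt_zero) (auto simp: divide_less_eq)
  hence \<alpha>0: "\<alpha>0 > 0" using g by (simp add: \<alpha>0_def)
  have del: "1 - delta g = \<alpha>0" by (simp add: delta_def \<alpha>0_def)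
  \<comment> \<open>The second bound keeps \<open>\<alpha>\<close> positive, so that it exceeds
    \<open>\<beta>\<close>, the target exponent cut off at 0; the cutoff makes \<open>powr\<close>
    monotone in its base when \<open>ln (ln q)\<close> is replaced by an upper bound.\<close>
  define \<epsilon>' where "\<epsilon>' = min (\<epsilon> / 2) (\<alpha>0 / 2)"
  define \<alpha> where "\<alpha> = \<alpha>0 - \<epsilon>'"
  define \<beta> where "\<beta> = max 0 (\<alpha>0 - \<epsilon>)"
  have \<epsilon>': "\<epsilon>' > 0" using \<epsilon> \<alpha>0 by (simp add: \<epsilon>'_def)
  have \<beta>: "0 \<le> \<beta>" "\<beta> < \<alpha>" "\<alpha>0 - \<epsilon> \<le> \<beta>" using \<epsilon> \<alpha>0 by (auto simp: \<alpha>_def \<beta>_def \<epsilon>'_def min_def max_def)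
  obtain m \<psi> where m: "prime m" "odd m" "m > g" and \<psi>: "dirichlet_character m \<psi>" "\<psi> (- 1) = - 1"
    and avg: "(\<Sum>c\<in>totatives m. nearest g (\<psi> (int c))) \<ge> \<alpha> * real (totient m)"
    using exists_equidistributed_character[OF g(1) \<epsilon>'] unfolding \<alpha>_def \<alpha>0_def by blast
  obtain C1 where C1: "\<And>y. y \<ge> 3 \<Longrightarrow> (\<Sum>p | p \<in> {1..y} \<and> prime p \<and> \<not> p dvd m * g. nearest g (\<psi> (int p)) / real p) \<ge>
      \<alpha> * ln (ln (real y)) - C1"
    using sum_nearest_primes[OF g(1) m(1,2) \<psi>(1) avg] by blast
  define D where "D = exp (12 * (1 + 4 / ln 2 - ln (ln (2::real)))) + 1"
  obtain C where C: "C \<ge> 1" and res: "\<And>y N s. 8 \<le> y \<Longrightarrow> m \<le> y \<Longrightarrow> y \<le> N \<Longrightarrow> ln (real N) \<ge> 12 * ln (real y) * ln (ln (real y)) \<Longrightarrow>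
    1 + ln (real N) \<le> real y \<Longrightarrow>
    (\<Sum>p | p \<in> {1..y} \<and> prime p \<and> \<not> p dvd m * g. nearest g (\<psi> (int p)) / real p) \<ge> s \<Longrightarrow>
    (\<exists>q \<eta>. dirichlet_character q \<eta> \<and> character_order q \<eta> = g \<and> N < q \<and> ln (real q) \<le> C * real N ^ 3 \<and>
      real (m * g) * max_character_sum q \<eta> \<ge> sqrt (real q) * ((exp (s - 6) - D) / pi - pi))"
    using resonating_character[OF g m(1,3) \<psi>] unfolding D_def by (auto simp: diff_diff_eq)
  define M where "M = real (m * g)"
  have M: "M > 0" using m g by (simp add: M_def)
  define K where "K = exp (- C1 - 6)"
  define A where "A = ln (8 * C)"
  have A: "A > 0" using C by (simp add: A_def)
  have lim: "filterlim (\<lambda>y::nat. ln (real y)) at_top sequentially" by real_asymp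
  have "eventually (\<lambda>L. (A + 36 * (L * ln L)) powr \<beta> \<le> (K * L powr \<alpha> - D) / (pi * M) - pi / M) at_top"
    using \<beta> A M by (intro growth_comparison) (auto simp: K_def)
  \<comment> \<open>With \<open>X = 12 * (L * ln L)\<close>, the three side conditions yield in turn
    \<open>y \<le> N\<close>, \<open>ln (ln q) \<ge> 1\<close> and
    \<open>1 + ln N \<le> y\<close>.\<close>
  moreover have "eventually (\<lambda>L::real. L \<le> 12 * (L * ln L)) at_top" by real_asymp
  moreover have "eventually (\<lambda>L::real. 3 \<le> 12 * (L * ln L)) at_top" by real_asymp
  moreover have "eventually (\<lambda>L::real. 2 + 12 * (L * ln L) \<le> exp L) at_top" by real_asymp
  ultimately have "eventually (\<lambda>L. (A + 36 * (L * ln L)) powr \<beta> \<le> (K * L powr \<alpha> - D) / (pi * M) - pi / M \<and>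
      L \<le> 12 * (L * ln L) \<and> 3 \<le> 12 * (L * ln L) \<and> 2 + 12 * (L * ln L) \<le> exp L \<and> 1 < L) at_top"
    using eventually_gt_at_top[of 1] by eventually_elim blast
  from eventually_compose_filterlim[OF this lim] eventually_ge_at_top[of "max 8 (max m N0)"]
  have "eventually (\<lambda>y::nat. ((A + 36 * (ln (real y) * ln (ln (real y)))) powr \<beta> \<le> (K * ln (real y) powr \<alpha> - D) / (pi * M) - pi / M \<and>
      ln (real y) \<le> 12 * (ln (real y) * ln (ln (real y))) \<and> 3 \<le> 12 * (ln (real y) * ln (ln (real y))) \<and>
      2 + 12 * (ln (real y) * ln (ln (real y))) \<le> exp (ln (real y)) \<and> 1 < ln (real y)) \<and> max 8 (max m N0) \<le> y) sequentially"
    by eventually_elim blast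
  then obtain y :: nat where y': "(A + 36 * (ln (real y) * ln (ln (real y)))) powr \<beta> \<le> (K * ln (real y) powr \<alpha> - D) / (pi * M) - pi / M"
      "ln (real y) \<le> 12 * (ln (real y) * ln (ln (real y)))" "3 \<le> 12 * (ln (real y) * ln (ln (real y)))"
      "2 + 12 * (ln (real y) * ln (ln (real y))) \<le> exp (ln (real y))" "1 < ln (real y)" "max 8 (max m N0) \<le> y"
    unfolding eventually_sequentially by blast
  define L where "L = ln (real y)"
  define X where "X = 12 * (L * ln L)"
  have y: "(A + 3 * X) powr \<beta> \<le> (K * L powr \<alpha> - D) / (pi * M) - pi / M" "L \<le> X" "3 \<le> X" "2 + X \<le> real y" "1 < L"
      "8 \<le> y" "m \<le> y" "N0 \<le> y"
    using y' by (auto simp: L_def X_def)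
  define N where "N = nat \<lceil>exp X\<rceil>"
  have N1: "exp X \<le> real N" unfolding N_def by linarith
  have N2: "real N \<le> 2 * exp X"
  proof -
    have "1 \<le> exp X" using y(3) by simp
    moreover have "real N \<le> exp X + 1"
    proof -
      have "- 1 < exp X" using exp_gt_zero[of X] by linarith
      hence "real N = of_int \<lceil>exp X\<rceil>" unfolding N_def by (intro of_nat_nat) simp
      thus ?thesis using of_int_ceiling_le_add_one[of "exp X"] by simp
    qed
    ultimately show ?thesis by linarith
  qed
  have N0: "real N > 0" using N1 less_le_trans[OF exp_gt_zero] by blast
  have lnN1: "X \<le> ln (real N)" using N1 N0 by (simp add: ln_ge_iff)
  have "ln (real N) \<le> ln (2 * exp X)" using N2 N0 by simp
  also have "\<dots> = ln 2 + X" by (simp add: ln_mult)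
  finally have lnN2: "1 + ln (real N) \<le> real y" using y(4) ln_2_less_1 by linarith
  have "exp L = real y" using y(6) by (simp add: L_def)
  moreover have "exp L \<le> exp X" using y(2) by simp
  ultimately have "real y \<le> real N" using N1 by linarith
  hence yN: "y \<le> N" by simp
  have "ln (real N) \<ge> 12 * ln (real y) * ln (ln (real y))" using lnN1 by (simp add: X_def L_def mult.assoc)
  from res[OF y(6,7) yN this lnN2 C1] y(6) obtain q \<eta> where \<eta>: "dirichlet_character q \<eta>" "character_order q \<eta> = g"
      "N < q" "ln (real q) \<le> C * real N ^ 3"
      "M * max_character_sum q \<eta> \<ge> sqrt (real q) * ((exp (\<alpha> * ln (ln (real y)) - C1 - 6) - D) / pi - pi)"
    unfolding M_def by auto
  have "X \<le> ln (real q)" using lnN1 \<eta>(3) N0 by (smt (verit) ln_le_cancel_iff of_nat_less_iff)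
  hence "exp 1 \<le> ln (real q)" using y(3) exp_le by linarith
  hence lnlnq: "1 \<le> ln (ln (real q))" by (subst ln_ge_iff) (auto intro: less_le_trans[OF exp_gt_zero])
  have "ln (real q) \<le> C * (2 * exp X) ^ 3"
    using \<eta>(4) N2 C by (rule_tac order.trans[OF \<eta>(4)]) (intro mult_left_mono power_mono, auto)
  also have "\<dots> = 8 * C * exp (3 * X)" by (simp add: power_mult_distrib exp_of_nat_mult[of 3 X, symmetric])
  finally have "ln (ln (real q)) \<le> ln (8 * C * exp (3 * X))"
    using \<open>exp 1 \<le> ln (real q)\<close> C by (subst ln_le_cancel_iff) (auto intro: less_le_trans[OF exp_gt_zero])
  also have "\<dots> = A + 3 * X" using C by (simp add: A_def ln_mult)
  finally have up: "ln (ln (real q)) \<le> A + 3 * X" .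
  have "ln (ln (real q)) powr (\<alpha>0 - \<epsilon>) \<le> ln (ln (real q)) powr \<beta>" using lnlnq \<beta> by (intro powr_mono) auto
  also have "\<dots> \<le> (A + 3 * X) powr \<beta>" using lnlnq up \<beta> by (intro powr_mono2) auto
  also have "\<dots> \<le> (K * L powr \<alpha> - D) / (pi * M) - pi / M" by (rule y(1))
  also have "K * L powr \<alpha> = exp (\<alpha> * ln (ln (real y)) - C1 - 6)"
    using y(5) by (simp add: K_def powr_def L_def exp_add[symmetric] algebra_simps)
  also have "(exp (\<alpha> * ln (ln (real y)) - C1 - 6) - D) / (pi * M) - pi / M =
      ((exp (\<alpha> * ln (ln (real y)) - C1 - 6) - D) / pi - pi) / M" by (simp add: diff_divide_distrib)
  finally have "sqrt (real q) * ln (ln (real q)) powr (\<alpha>0 - \<epsilon>) \<le>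
      sqrt (real q) * (((exp (\<alpha> * ln (ln (real y)) - C1 - 6) - D) / pi - pi) / M)" by (intro mult_left_mono) auto
  also have "\<dots> \<le> max_character_sum q \<eta>" using \<eta>(5) M by (simp add: divide_le_eq mult.commute)
  finally have "max_character_sum q \<eta> \<ge> sqrt (real q) * ln (ln (real q)) powr (1 - delta g - \<epsilon>)" unfolding del .
  moreover have "N0 < q" using y(8) yN \<eta>(3) by simp
  ultimately show ?thesis using \<eta>(1,2) by blast
qed

theorem theorem3:
  fixes g :: nat and \<epsilon> :: real
  assumes "GRH" and "g \<ge> 3" and "odd g" and "\<epsilon> > 0"
  shows "\<exists>c>0. \<exists>F :: (nat \<times> (int \<Rightarrow> complex)) set.
           infinite F \<and> (\<forall>N. \<exists>(q, \<psi>)\<in>F. q > N) \<and>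
           (\<forall>(q, \<psi>)\<in>F. dirichlet_character q \<psi> \<and> character_order q \<psi> = g \<and>
              max_character_sum q \<psi> \<ge> c * sqrt (real q) * ln (ln (real q)) powr (1 - delta g - \<epsilon>))"
proof -
  define F where "F = {(q, \<psi>). dirichlet_character q \<psi> \<and> character_order q \<psi> = g \<and>
      max_character_sum q \<psi> \<ge> sqrt (real q) * ln (ln (real q)) powr (1 - delta g - \<epsilon>)}"
  have unb: "\<exists>(q, \<psi>)\<in>F. q > N" for N
    using exists_large_character_sum[OF assms(2-4), of N] unfolding F_def by blast
  have "infinite F"
  proof
    assume "finite F"
    hence "finite (fst ` F)" by simp
    then obtain B where "\<forall>q\<in>fst ` F. q \<le> B" using finite_nat_set_iff_bounded_le by blast
    thus False using unb[of B] by force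
  qed
  \<comment> \<open>The constant 1 suffices, since all constants were absorbed by the strict
    inequality between the exponents.\<close>
  thus ?thesis using unb by (intro exI[of _ 1] conjI exI[of _ F]) (auto simp: F_def)
qed

end
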